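(* Let $\rho\colon\mathbb{S}^1\to\mathrm{U}(V)$ be a unitary representation of the circle on a finite-dimensional hermitian vector space $V$, with weight vector $\mathbf{a}=(a_1,\ldots,a_n)\in\mathbb{Z}^n$, and let $\Gamma$ be a finitely presented discrete group. Suppose $X\subset V$ is an $\mathbb{S}^1$-invariant definable subset with the following property. For each $I=\{i_1,\ldots,i_k\}\subseteq\{1,\ldots,n\}$ with $k\geq2$ and $\mathbf{a}_I\neq\{0\}$ such that $V_I\cap X\neq\emptyset$: (1) if the set $\{a_i:i\in I\}$ has more than one element, then $X\cap V_I$ is invariant under the circle action by scalar multiplication; and (2) if the set $\{a_i:i\in I\}$ is a singleton, then $X\cap V_I$ is invariant under a circle action with weight $(\pm1,\ldots,\pm1)$ where each sign occurs at least once. Then $$\chi_\Gamma(\mathbb{S}^1\ltimes X)=\chi\big(\mathrm{Hom}(\Gamma,\mathbb{S}^1)\big)\,\chi\big(X\cap V^{\mathbb{S}^1}\big)+\sum_{\substack{i=1\\ a_i\neq0}}^n\chi\big(\mathbb{S}^1\backslash(X\cap V_{\{i\}})\big)\,\chi\big(\mathrm{Hom}(\Gamma,\mathbb{Z}/a_i\mathbb{Z})\big).$$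
   Context: Weight vector: in suitable complex coordinates $(x_1,\ldots,x_n)$ on $V$ (with $n=\dim_{\mathbb{C}}V$), the action is $z(x_1,\ldots,x_n)=(z^{a_1}x_1,\ldots,z^{a_n}x_n)$ for $z\in\mathbb{S}^1$. For $I\subseteq\{1,\ldots,n\}$, $V_I=\{(x_1,\ldots,x_n)\in V: x_i\neq0\ \forall i\in I\text{ and }x_i=0\ \forall i\notin I\}$, and $\mathbf{a}_I=\{a_i:i\in I\}$ as a set of integers, with $\mathbf{a}_\emptyset=\{0\}$. $V^{\mathbb{S}^1}$ is the subspace of fixed points. The circle action with weight $(\varepsilon_1,\ldots,\varepsilon_k)$, $\varepsilon_j\in\{\pm1\}$, on $V_I$ with $I=\{i_1,\ldots,i_k\}$ is $w\cdot(x_{i_1},\ldots,x_{i_k})=(w^{\varepsilon_1}x_{i_1},\ldots,w^{\varepsilon_k}x_{i_k})$ for $w\in\mathbb{S}^1$, the other coordinates remaining zero. Definability and Euler characteristic: fix an o-minimal structure on $\mathbb{R}$ containing the semialgebraic sets; "definable" means belonging to it (with $V\cong\mathbb{R}^{2n}$). For a definable set $A$, $\chi(A)$ is the finitely additive Euler characteristic $\sum_C(-1)^{\dim C}$ over the cells $C$ of any finite cell decomposition of $A$ (so an open $k$-cell has Euler characteristic $(-1)^k$). It depends only on the homeomorphism type of $A$. If a compact Lie group $G$ (with its unique structure of a linear semialgebraic group) acts definably and continuously on a definable set $X$, the orbit space $G\backslash X$ has a structure of definable set, unique up to definable homeomorphism, for which the orbit map is continuous and definable; $\chi$ of orbit spaces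 is taken with respect to this structure. $\Gamma$-Euler characteristic: for a finitely presented group $\Gamma$ and a compact Lie group $H$, $\mathrm{Hom}(\Gamma,H)$ is the space of group homomorphisms with the compact-open topology (a real algebraic subset of a finite power of $H$, via a finite generating set of $\Gamma$), on which $H$ acts by pointwise conjugation, with orbit space $H\backslash\mathrm{Hom}(\Gamma,H)$. For a compact Lie group $G$ acting linearly on a finite-dimensional vector space and a $G$-invariant definable subset $X$, let $G\backslash X=X_1\sqcup\cdots\sqcup X_s$ be any finite partition into definable subsets such that within each $X_i$ all points of the corresponding orbits have isomorphic isotropy groups, and let $G_i$ be the isotropy group of a point whose orbit lies in $X_i$. Then the $\Gamma$-Euler characteristic of the translation groupoid $G\ltimes X$ is $$\chi_\Gamma(G\ltimes X)=\sum_{i=1}^s\chi(X_i)\,\chi\big(G_i\backslash\mathrm{Hom}(\Gamma,G_i)\big),$$ which is independent of the partition. *)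

theory Defs
  imports "HOL-Algebra.Elementary_Groups" "HOL-Library.Extended_Real" "HOL-Analysis.Analysis"
begin

section \<open>O-minimal structures on the real field\<close>

text \<open>
  Since the dimension varies inside the definitions, \<open>\<real>\<^sup>m\<close> is rendered as the set of real sequences
  vanishing from index \<open>m\<close> on. Its topology is the subspace topology of the product topology on
  functions, which is the Euclidean topology.
\<close>

definition Rn :: "nat \<Rightarrow> (nat \<Rightarrow> real) set" where
  "Rn m = {x. \<forall>i\<ge>m. x i = 0}"

definition trunc :: "nat \<Rightarrow> (nat \<Rightarrow> real) \<Rightarrow> nat \<Rightarrow> real" where
  "trunc m x = (\<lambda>i. if i < m then x i else 0)"

definition join :: "nat \<Rightarrow> (nat \<Rightarrow> real) \<Rightarrow> (nat \<Rightarrow> real) \<Rightarrow> nat \<Rightarrow> real" where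
  "join m x y = (\<lambda>i. if i < m then x i else y (i - m))"

inductive polynomial_map :: "nat \<Rightarrow> ((nat \<Rightarrow> real) \<Rightarrow> real) \<Rightarrow> bool" for m where
  const: "polynomial_map m (\<lambda>x. c)"
| coord: "i < m \<Longrightarrow> polynomial_map m (\<lambda>x. x i)"
| add: "polynomial_map m p \<Longrightarrow> polynomial_map m q \<Longrightarrow> polynomial_map m (\<lambda>x. p x + q x)"
| mult: "polynomial_map m p \<Longrightarrow> polynomial_map m q \<Longrightarrow> polynomial_map m (\<lambda>x. p x * q x)"

inductive_set semialgebraic :: "nat \<Rightarrow> (nat \<Rightarrow> real) set set" for m where
  pos: "polynomial_map m p \<Longrightarrow> {x \<in> Rn m. p x > 0} \<in> semialgebraic m"
| union: "A \<in> semialgebraic m \<Longrightarrow> B \<in> semialgebraic m \<Longrightarrow> A \<union> B \<in> semialgebraic m"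
| compl: "A \<in> semialgebraic m \<Longrightarrow> Rn m - A \<in> semialgebraic m"

text \<open>\<open>S m\<close> is the collection of definable subsets of \<open>\<real>\<^sup>m\<close>.\<close>

locale o_minimal_structure =
  fixes S :: "nat \<Rightarrow> (nat \<Rightarrow> real) set set"
  assumes definable_subset: "A \<in> S m \<Longrightarrow> A \<subseteq> Rn m"
    and definable_empty: "{} \<in> S m"
    and definable_union: "A \<in> S m \<Longrightarrow> B \<in> S m \<Longrightarrow> A \<union> B \<in> S m"
    and definable_compl: "A \<in> S m \<Longrightarrow> Rn m - A \<in> S m"
    and definable_times_R: "A \<in> S m \<Longrightarrow> {x \<in> Rn (Suc m). trunc m x \<in> A} \<in> S (Suc m)"
    and definable_R_times: "A \<in> S m \<Longrightarrow> {x \<in> Rn (Suc m). (\<lambda>i. x (Suc i)) \<in> A} \<in> S (Suc m)"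
    and definable_diagonal: "{x \<in> Rn (Suc m). x 0 = x m} \<in> S (Suc m)"
    and definable_projection: "A \<in> S (Suc m) \<Longrightarrow> trunc m ` A \<in> S m"
    and definable_less: "{x \<in> Rn 2. x 0 < x 1} \<in> S 2"
    and definable_semialgebraic: "semialgebraic m \<subseteq> S m"
    and o_minimal: "A \<in> S 1 \<Longrightarrow>
      \<exists>F. finite F \<and> (\<forall>J\<in>F. is_interval J) \<and> \<Union>F = (\<lambda>x. x 0) ` A"

section \<open>Cells and the Euler characteristic\<close>

definition definable_fun ::
    "(nat \<Rightarrow> (nat \<Rightarrow> real) set set) \<Rightarrow> nat \<Rightarrow> (nat \<Rightarrow> real) set \<Rightarrow> ((nat \<Rightarrow> real) \<Rightarrow> real) \<Rightarrow> bool" where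
  "definable_fun S m C f \<longleftrightarrow> (\<lambda>x. x(m := f x)) ` C \<in> S (Suc m)"

text \<open>The bounds of a band: continuous definable functions and the constants \<open>-\<infinity>\<close>, \<open>\<infinity>\<close>.\<close>

definition cell_bound ::
    "(nat \<Rightarrow> (nat \<Rightarrow> real) set set) \<Rightarrow> nat \<Rightarrow> (nat \<Rightarrow> real) set \<Rightarrow> ((nat \<Rightarrow> real) \<Rightarrow> ereal) \<Rightarrow> bool" where
  "cell_bound S m C f \<longleftrightarrow>
     (\<forall>x\<in>C. f x = - \<infinity>) \<or> (\<forall>x\<in>C. f x = \<infinity>) \<or>
     (\<exists>h. definable_fun S m C h \<and> continuous_on C h \<and> (\<forall>x\<in>C. f x = ereal (h x)))"

text \<open>\<open>cell S m d C\<close>: \<open>C\<close> is a cell of dimension \<open>d\<close> in \<open>\<real>\<^sup>m\<close>.\<close>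

inductive cell ::
    "(nat \<Rightarrow> (nat \<Rightarrow> real) set set) \<Rightarrow> nat \<Rightarrow> nat \<Rightarrow> (nat \<Rightarrow> real) set \<Rightarrow> bool" for S where
  point: "cell S 0 0 (Rn 0)"
| graph: "cell S m d C \<Longrightarrow> definable_fun S m C f \<Longrightarrow> continuous_on C f \<Longrightarrow>
    cell S (Suc m) d {x(m := f x) | x. x \<in> C}"
| band: "cell S m d C \<Longrightarrow> cell_bound S m C f \<Longrightarrow> cell_bound S m C g \<Longrightarrow> (\<And>x. x \<in> C \<Longrightarrow> f x < g x) \<Longrightarrow>
    cell S (Suc m) (Suc d) {x(m := t) | x t. x \<in> C \<and> f x < ereal t \<and> ereal t < g x}"

definition euler_char :: "(nat \<Rightarrow> (nat \<Rightarrow> real) set set) \<Rightarrow> nat \<Rightarrow> (nat \<Rightarrow> real) set \<Rightarrow> int" where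
  "euler_char S m A = (THE c. \<exists>P d. finite P \<and> partition_on A P \<and> (\<forall>C\<in>P. cell S m (d C) C) \<and>
     c = (\<Sum>C\<in>P. (- 1) ^ d C))"

section \<open>Charts and orbit spaces\<close>

text \<open>
  A chart \<open>(m, \<iota>)\<close> realizes a set \<open>A\<close> outside \<open>\<real>\<^sup>m\<close> (in a vector space, a group, a set of
  homomorphisms) as the subset \<open>\<iota> ` A\<close> of \<open>\<real>\<^sup>m\<close>; \<open>\<iota>\<close> has to be injective on \<open>A\<close>.
\<close>

type_synonym 'a chart = "nat \<times> ('a \<Rightarrow> nat \<Rightarrow> real)"

definition definable :: "(nat \<Rightarrow> (nat \<Rightarrow> real) set set) \<Rightarrow> 'a chart \<Rightarrow> 'a set \<Rightarrow> bool" where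
  "definable S c A \<longleftrightarrow> inj_on (snd c) A \<and> snd c ` A \<in> S (fst c)"

definition chi :: "(nat \<Rightarrow> (nat \<Rightarrow> real) set set) \<Rightarrow> 'a chart \<Rightarrow> 'a set \<Rightarrow> int" where
  "chi S c A = euler_char S (fst c) (snd c ` A)"

definition chart_topology :: "'a chart \<Rightarrow> 'a set \<Rightarrow> 'a topology" where
  "chart_topology c A = pullback_topology A (snd c) euclidean"

text \<open>
  \<open>orbit_model S c A G act k Y p\<close>: the definable set \<open>Y \<subseteq> \<real>\<^sup>k\<close> with the definable map \<open>p\<close> is a
  realization of the orbit space \<open>G \ A\<close>, i.e. \<open>p\<close> induces a homeomorphism from the topological
  quotient onto \<open>Y\<close>.
\<close>

definition orbit_model ::
    "(nat \<Rightarrow> (nat \<Rightarrow> real) set set) \<Rightarrow> 'a chart \<Rightarrow> 'a set \<Rightarrow> 'h monoid \<Rightarrow> ('h \<Rightarrow> 'a \<Rightarrow> 'a) \<Rightarrow>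
     nat \<Rightarrow> (nat \<Rightarrow> real) set \<Rightarrow> ('a \<Rightarrow> nat \<Rightarrow> real) \<Rightarrow> bool" where
  "orbit_model S c A G act k Y p \<longleftrightarrow>
     Y \<in> S k \<and>
     (\<lambda>x. join (fst c) (snd c x) (p x)) ` A \<in> S (fst c + k) \<and>
     quotient_map (chart_topology c A) (top_of_set Y) p \<and>
     (\<forall>x\<in>A. \<forall>y\<in>A. p x = p y \<longleftrightarrow> (\<exists>g\<in>carrier G. act g x = y))"

definition chi_orbits ::
    "(nat \<Rightarrow> (nat \<Rightarrow> real) set set) \<Rightarrow> 'a chart \<Rightarrow> 'a set \<Rightarrow> 'h monoid \<Rightarrow> ('h \<Rightarrow> 'a \<Rightarrow> 'a) \<Rightarrow> int" where
  "chi_orbits S c A G act =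
     (THE e. \<exists>k Y p. orbit_model S c A G act k Y p \<and> e = euler_char S k Y)"

section \<open>Finitely presented groups and spaces of homomorphisms\<close>

text \<open>The letter \<open>(x, True)\<close> stands for \<open>x\<close>, the letter \<open>(x, False)\<close> for its formal inverse.\<close>

primrec word_value :: "('g, 'b) monoid_scheme \<Rightarrow> ('g \<times> bool) list \<Rightarrow> 'g" where
  "word_value \<Gamma> [] = \<one>\<^bsub>\<Gamma>\<^esub>"
| "word_value \<Gamma> (l # w) =
     (if snd l then fst l else inv\<^bsub>\<Gamma>\<^esub> (fst l)) \<otimes>\<^bsub>\<Gamma>\<^esub> word_value \<Gamma> w"

text \<open>Equality of words over \<open>B\<close> in the group presented by generators \<open>B\<close> and relators \<open>R\<close>.\<close>

inductive word_eq ::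
    "'g set \<Rightarrow> ('g \<times> bool) list set \<Rightarrow> ('g \<times> bool) list \<Rightarrow> ('g \<times> bool) list \<Rightarrow> bool" for B R where
  refl: "w \<in> lists (B \<times> UNIV) \<Longrightarrow> word_eq B R w w"
| sym: "word_eq B R v w \<Longrightarrow> word_eq B R w v"
| trans: "word_eq B R u v \<Longrightarrow> word_eq B R v w \<Longrightarrow> word_eq B R u w"
| cancel: "u \<in> lists (B \<times> UNIV) \<Longrightarrow> v \<in> lists (B \<times> UNIV) \<Longrightarrow> x \<in> B \<Longrightarrow>
    word_eq B R (u @ [(x, b), (x, \<not> b)] @ v) (u @ v)"
| relator: "u \<in> lists (B \<times> UNIV) \<Longrightarrow> v \<in> lists (B \<times> UNIV) \<Longrightarrow> r \<in> R \<Longrightarrow>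
    word_eq B R (u @ r @ v) (u @ v)"

definition finitely_presented :: "('g, 'b) monoid_scheme \<Rightarrow> bool" where
  "finitely_presented \<Gamma> \<longleftrightarrow>
     (\<exists>B R. finite B \<and> B \<subseteq> carrier \<Gamma> \<and> generate \<Gamma> B = carrier \<Gamma> \<and>
        finite R \<and> R \<subseteq> lists (B \<times> UNIV) \<and> (\<forall>r\<in>R. word_value \<Gamma> r = \<one>\<^bsub>\<Gamma>\<^esub>) \<and>
        (\<forall>w\<in>lists (B \<times> UNIV). word_value \<Gamma> w = \<one>\<^bsub>\<Gamma>\<^esub> \<longrightarrow> word_eq B R w []))"

definition Hom :: "('g, 'b) monoid_scheme \<Rightarrow> 'h monoid \<Rightarrow> ('g \<Rightarrow> 'h) set" where
  "Hom \<Gamma> H = hom \<Gamma> H \<inter> extensional (carrier \<Gamma>)"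

definition conj_act ::
    "('g, 'b) monoid_scheme \<Rightarrow> 'h monoid \<Rightarrow> 'h \<Rightarrow> ('g \<Rightarrow> 'h) \<Rightarrow> ('g \<Rightarrow> 'h)" where
  "conj_act \<Gamma> H h \<phi> = restrict (\<lambda>\<gamma>. h \<otimes>\<^bsub>H\<^esub> \<phi> \<gamma> \<otimes>\<^bsub>H\<^esub> inv\<^bsub>H\<^esub> h) (carrier \<Gamma>)"

definition generating_list :: "('g, 'b) monoid_scheme \<Rightarrow> 'g list \<Rightarrow> bool" where
  "generating_list \<Gamma> gs \<longleftrightarrow> set gs \<subseteq> carrier \<Gamma> \<and> generate \<Gamma> (set gs) = carrier \<Gamma>"

text \<open>
  The chart \<open>\<phi> \<mapsto> (\<phi> \<gamma>\<^sub>0, \<dots>, \<phi> \<gamma>\<^sub>r)\<close> attached to a generating list \<open>gs = [\<gamma>\<^sub>0, \<dots>, \<gamma>\<^sub>r]\<close> and a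
  chart \<open>c\<close> of the target group. As \<open>\<Gamma>\<close> is discrete, its topology is the compact-open one.
\<close>

definition hom_chart :: "'h chart \<Rightarrow> 'g list \<Rightarrow> ('g \<Rightarrow> 'h) chart" where
  "hom_chart c gs = (length gs * fst c,
     \<lambda>\<phi> i. if i < length gs * fst c then snd c (\<phi> (gs ! (i div fst c))) (i mod fst c) else 0)"

definition chi_Hom ::
    "(nat \<Rightarrow> (nat \<Rightarrow> real) set set) \<Rightarrow> ('g, 'b) monoid_scheme \<Rightarrow> 'h monoid \<Rightarrow> 'h chart \<Rightarrow> int" where
  "chi_Hom S \<Gamma> H c =
     (THE e. \<exists>gs. generating_list \<Gamma> gs \<and> e = chi S (hom_chart c gs) (Hom \<Gamma> H))"

definition chi_Hom_orbits ::
    "(nat \<Rightarrow> (nat \<Rightarrow> real) set set) \<Rightarrow> ('g, 'b) monoid_scheme \<Rightarrow> 'h monoid \<Rightarrow> 'h chart \<Rightarrow> int" where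
  "chi_Hom_orbits S \<Gamma> H c =
     (THE e. \<exists>gs. generating_list \<Gamma> gs \<and>
        e = chi_orbits S (hom_chart c gs) (Hom \<Gamma> H) H (conj_act \<Gamma> H))"

section \<open>The \<open>\<Gamma>\<close>-Euler characteristic of a translation groupoid\<close>

definition isotropy :: "'h monoid \<Rightarrow> ('h \<Rightarrow> 'a \<Rightarrow> 'a) \<Rightarrow> 'a \<Rightarrow> 'h monoid" where
  "isotropy G act x = G\<lparr>carrier := {g \<in> carrier G. act g x = x}\<rparr>"

text \<open>Isomorphism of subgroups of a group with chart \<open>c\<close>, as topological (hence Lie) groups.\<close>

definition top_group_iso :: "'h chart \<Rightarrow> 'h monoid \<Rightarrow> 'h monoid \<Rightarrow> bool" where
  "top_group_iso c H K \<longleftrightarrow>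
     (\<exists>f\<in>iso H K. homeomorphic_map (chart_topology c (carrier H)) (chart_topology c (carrier K)) f)"

text \<open>
  The group \<open>G\<close> has chart \<open>cG\<close>, the \<open>G\<close>-space \<open>X\<close> has chart \<open>cX\<close>. The family \<open>P\<close> is the partition
  of the orbit space, and \<open>r C\<close> is a point of \<open>X\<close> whose orbit lies in the block \<open>C\<close>.
\<close>

definition chi_Gamma ::
    "(nat \<Rightarrow> (nat \<Rightarrow> real) set set) \<Rightarrow> ('g, 'b) monoid_scheme \<Rightarrow> 'h monoid \<Rightarrow> 'h chart \<Rightarrow>
     ('h \<Rightarrow> 'a \<Rightarrow> 'a) \<Rightarrow> 'a chart \<Rightarrow> 'a set \<Rightarrow> int" where
  "chi_Gamma S \<Gamma> G cG act cX X =
     (THE e. \<exists>k Y p P r. orbit_model S cX X G act k Y p \<and>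
        finite P \<and> partition_on Y P \<and> P \<subseteq> S k \<and>
        (\<forall>C\<in>P. \<forall>x\<in>X. \<forall>y\<in>X. p x \<in> C \<longrightarrow> p y \<in> C \<longrightarrow>
           top_group_iso cG (isotropy G act x) (isotropy G act y)) \<and>
        (\<forall>C\<in>P. r C \<in> X \<and> p (r C) \<in> C) \<and>
        e = (\<Sum>C\<in>P. euler_char S k C * chi_Hom_orbits S \<Gamma> (isotropy G act (r C)) cG))"

section \<open>The circle and its unitary representations\<close>

definition circle_group :: "complex monoid" where
  "circle_group = \<lparr>carrier = sphere 0 1, monoid.mult = (*), one = 1\<rparr>"

definition circle_chart :: "complex chart" where
  "circle_chart = (2, \<lambda>z i. if i = 0 then Re z else if i = 1 then Im z else 0)"

text \<open>The linear structure of the finite group \<open>\<int>/m\<int>\<close> (\<open>m > 0\<close>), via the \<open>m\<close>-th roots of unity.\<close>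

definition cyclic_chart :: "nat \<Rightarrow> int chart" where
  "cyclic_chart m = (2, \<lambda>k. snd circle_chart (cis (2 * pi * of_int k / of_nat m)))"

locale hermitian_space = vector_space sc
  for sc :: "complex \<Rightarrow> 'v::ab_group_add \<Rightarrow> 'v" +
  fixes herm :: "'v \<Rightarrow> 'v \<Rightarrow> complex"
  assumes herm_add_left: "herm (x + y) z = herm x z + herm y z"
    and herm_scale_left: "herm (sc c x) z = c * herm x z"
    and herm_commute: "herm y x = cnj (herm x y)"
    and herm_pos: "x \<noteq> 0 \<Longrightarrow> Re (herm x x) > 0"

locale unitary_circle_rep = hermitian_space sc herm
  for sc :: "complex \<Rightarrow> 'v::ab_group_add \<Rightarrow> 'v" and herm :: "'v \<Rightarrow> 'v \<Rightarrow> complex" +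
  fixes \<rho> :: "complex \<Rightarrow> 'v \<Rightarrow> 'v"
  assumes rho_linear: "z \<in> sphere 0 1 \<Longrightarrow> Vector_Spaces.linear sc sc (\<rho> z)"
    and rho_bij: "z \<in> sphere 0 1 \<Longrightarrow> bij (\<rho> z)"
    and rho_herm: "z \<in> sphere 0 1 \<Longrightarrow> herm (\<rho> z x) (\<rho> z y) = herm x y"
    and rho_mult: "z \<in> sphere 0 1 \<Longrightarrow> w \<in> sphere 0 1 \<Longrightarrow> \<rho> (z * w) = \<rho> z \<circ> \<rho> w"
    and rho_continuous: "continuous_on (sphere 0 1) (\<lambda>z. herm (\<rho> z x) y)"

text \<open>
  The coordinate system given by the basis \<open>e 0, \<dots>, e (n - 1)\<close>, in which the circle acts diagonally
  with weight vector \<open>(a 0, \<dots>, a (n - 1))\<close>.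
\<close>

definition weight_basis ::
    "(complex \<Rightarrow> 'v::ab_group_add \<Rightarrow> 'v) \<Rightarrow> (complex \<Rightarrow> 'v \<Rightarrow> 'v) \<Rightarrow> nat \<Rightarrow> (nat \<Rightarrow> 'v) \<Rightarrow> (nat \<Rightarrow> int) \<Rightarrow> bool"
  where
  "weight_basis sc \<rho> n e a \<longleftrightarrow>
     inj_on e {..<n} \<and> \<not> module.dependent sc (e ` {..<n}) \<and>
     module.span sc (e ` {..<n}) = UNIV \<and>
     (\<forall>z\<in>sphere 0 1. \<forall>i<n. \<rho> z (e i) = sc (z powi a i) (e i))"

definition coord ::
    "(complex \<Rightarrow> 'v::ab_group_add \<Rightarrow> 'v) \<Rightarrow> nat \<Rightarrow> (nat \<Rightarrow> 'v) \<Rightarrow> 'v \<Rightarrow> nat \<Rightarrow> complex" where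
  "coord sc n e x i = module.representation sc (e ` {..<n}) x (e i)"

text \<open>The identification of \<open>V\<close> with \<open>\<real>\<^sup>2\<^sup>n\<close>: \<open>(Re x\<^sub>0, Im x\<^sub>0, Re x\<^sub>1, Im x\<^sub>1, \<dots>)\<close>.\<close>

definition vector_chart ::
    "(complex \<Rightarrow> 'v::ab_group_add \<Rightarrow> 'v) \<Rightarrow> nat \<Rightarrow> (nat \<Rightarrow> 'v) \<Rightarrow> 'v chart" where
  "vector_chart sc n e = (2 * n, \<lambda>x k. if k < 2 * n
     then (if even k then Re else Im) (coord sc n e x (k div 2)) else 0)"

definition stratum ::
    "(complex \<Rightarrow> 'v::ab_group_add \<Rightarrow> 'v) \<Rightarrow> nat \<Rightarrow> (nat \<Rightarrow> 'v) \<Rightarrow> nat set \<Rightarrow> 'v set" where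
  "stratum sc n e I =
     {x. (\<forall>i\<in>I. coord sc n e x i \<noteq> 0) \<and> (\<forall>i\<in>{..<n} - I. coord sc n e x i = 0)}"

definition fixed_points :: "(complex \<Rightarrow> 'v \<Rightarrow> 'v) \<Rightarrow> 'v set" where
  "fixed_points \<rho> = {x. \<forall>z\<in>sphere 0 1. \<rho> z x = x}"

definition weighted_act ::
    "(complex \<Rightarrow> 'v::ab_group_add \<Rightarrow> 'v) \<Rightarrow> nat \<Rightarrow> (nat \<Rightarrow> 'v) \<Rightarrow> nat set \<Rightarrow> (nat \<Rightarrow> int) \<Rightarrow>
     complex \<Rightarrow> 'v \<Rightarrow> 'v" where
  "weighted_act sc n e I \<epsilon> w x = (\<Sum>i\<in>I. sc (w powi \<epsilon> i * coord sc n e x i) (e i))"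

definition circle_invariant :: "(complex \<Rightarrow> 'v \<Rightarrow> 'v) \<Rightarrow> 'v set \<Rightarrow> bool" where
  "circle_invariant act A \<longleftrightarrow> (\<forall>w\<in>sphere 0 1. \<forall>x\<in>A. act w x \<in> A)"

end

theory Submission
  imports Defs
begin

text \<open>
  The Euler characteristic is identified with an iterated integral over the coordinates; the cell
  decomposition theorem makes the integral agree with alternating sums over cells, and commuting
  two coordinates gives a Fubini theorem, hence invariance under definable bijections and
  multiplicativity along definable maps with fibres of constant Euler characteristic.

  The orbit space is realized by invariant polynomials, and the isotropy group is constant on each
  stratum \<open>V\<^sub>I\<close>. The group is abelian, so conjugation acts trivially on the homomorphisms and the
  formula is a sum over \<open>I\<close>. The strata with \<open>a ` I \<subseteq> {0}\<close> assemble to the fixed points, and the strata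
  of the coordinate axes give the second sum. On any other stratum a second circle acts on the quotient,
  without fixed points there: some invariant coordinate \<open>h\<close> is multiplied by a nonconstant character, so the
  quotient fibres over the values of \<open>|h|\<close> with fibres that in turn fibre over a circle, which has
  Euler characteristic zero.
\<close>

text \<open>Every quantity in the statement is a definite description, so existence and independence
  of choices must be proved each time: of the cell partition for \<open>euler_char\<close>, of the
  orbit model for \<open>chi_orbits\<close>, of the generating list for \<open>chi_Hom\<close>, of
  partition and representatives for \<open>chi_Gamma\<close>. The integral settles the first, since
  it mentions no cells; the price is that the order of integration has to be shown irrelevant. This
  replaces triangulation and definable trivialization. The other obstacle is generic continuity on
  cells, needed inside the induction for cell decomposition. As the structure lives on the real
  line, a countability argument replaces dimension theory: a tame property of a variable that holds
  infinitely often holds on an interval with rational end points, these are countably many, and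
  countably many finite sets do not cover an interval. Multiplicativity is used only for maps all of
  whose fibres have the same Euler characteristic; on the strata that must vanish this equality
  comes from rotating one fibre onto another, so local triviality never enters.\<close>

lemma trunc_in_Rn [simp]: "trunc m x \<in> Rn m"
  by (simp add: trunc_def Rn_def)

lemma trunc_Rn: "x \<in> Rn m \<Longrightarrow> trunc m x = x"
  by (auto simp: trunc_def Rn_def fun_eq_iff)

lemma trunc_nth [simp]: "i < m \<Longrightarrow> trunc m x i = x i"
  by (simp add: trunc_def)

lemma trunc_trunc [simp]: "trunc m (trunc k x) = trunc (min m k) x"
  by (auto simp: trunc_def fun_eq_iff)

lemma Rn_eqI: "x \<in> Rn m \<Longrightarrow> y \<in> Rn m \<Longrightarrow> (\<And>i. i < m \<Longrightarrow> x i = y i) \<Longrightarrow> x = y"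
  by (rule ext, rename_tac i, case_tac "i < m") (auto simp: Rn_def)

lemma Rn_upd [simp]: "x \<in> Rn m \<Longrightarrow> x(m := t) \<in> Rn (Suc m)"
  by (auto simp: Rn_def)

lemma trunc_upd [simp]: "trunc m (x(m := t)) = trunc m x"
  by (auto simp: trunc_def)

lemma trunc_Suc_upd: "trunc (Suc m) (x(m := t)) = (trunc m x)(m := t)"
  by (auto simp: trunc_def)

lemma Rn_Suc_upd_trunc: "x \<in> Rn (Suc m) \<Longrightarrow> (trunc m x)(m := x m) = x"
  by (auto simp: trunc_def Rn_def fun_eq_iff less_Suc_eq)

lemma Rn_0: "Rn 0 = {\<lambda>_. 0}"
  by (auto simp: Rn_def)

lemma trunc_cong: "(\<And>i. i < m \<Longrightarrow> x i = y i) \<Longrightarrow> trunc m x = trunc m y"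
  by (auto simp: trunc_def)

lemma polynomial_map_trunc: "polynomial_map m p \<Longrightarrow> p (trunc m x) = p x"
  by (induction rule: polynomial_map.induct) auto

lemma polynomial_map_diff:
  "polynomial_map m p \<Longrightarrow> polynomial_map m q \<Longrightarrow> polynomial_map m (\<lambda>x. p x - q x)"
  using polynomial_map.add[of m p "\<lambda>x. (-1) * q x"] polynomial_map.mult[OF polynomial_map.const[of m "-1"], of q]
  by simp

section \<open>Definable predicates and functions\<close>

context o_minimal_structure
begin

text \<open>Working with predicates on infinite sequences, instead of sets in varying dimensions,
  lets logical connectives act without padding; invariance under \<open>trunc m\<close> is what
  makes such a predicate a subset of dimension \<open>m\<close>.\<close>

definition DefN :: "nat \<Rightarrow> ((nat \<Rightarrow> real) \<Rightarrow> bool) \<Rightarrow> bool" where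
  "DefN m P \<longleftrightarrow> (\<forall>x. P (trunc m x) = P x) \<and> {x \<in> Rn m. P x} \<in> S m"

definition Def :: "((nat \<Rightarrow> real) \<Rightarrow> bool) \<Rightarrow> bool" where
  "Def P \<longleftrightarrow> (\<exists>m. DefN m P)"

text \<open>The value sits in coordinate 0 and the arguments are shifted up by one, as for a bound
  variable in de Bruijn notation; the quantifier rules below bind coordinate 0 in the same
  manner.\<close>

definition DefT :: "((nat \<Rightarrow> real) \<Rightarrow> real) \<Rightarrow> bool" where
  "DefT f \<longleftrightarrow> Def (\<lambda>x. x 0 = f (\<lambda>i. x (Suc i)))"

lemma DefN_Suc: assumes "DefN m P" shows "DefN (Suc m) P"
proof -
  have inv: "\<And>x. P (trunc m x) = P x" and d: "{x \<in> Rn m. P x} \<in> S m" using assms by (auto simp: DefN_def)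
  have "P (trunc (Suc m) x) = P x" for x
    using inv[of "trunc (Suc m) x"] inv[of x] by simp
  moreover have "{x \<in> Rn (Suc m). P x} = {x \<in> Rn (Suc m). trunc m x \<in> {x \<in> Rn m. P x}}"
    using inv by auto
  ultimately show ?thesis using definable_times_R[OF d] by (auto simp: DefN_def)
qed

lemma DefN_mono: "DefN m P \<Longrightarrow> m \<le> k \<Longrightarrow> DefN k P"
  by (induction k) (auto simp: le_Suc_eq DefN_Suc)

lemma DefN_not: "DefN m P \<Longrightarrow> DefN m (\<lambda>x. \<not> P x)"
proof -
  assume a: "DefN m P"
  have "{x \<in> Rn m. \<not> P x} = Rn m - {x \<in> Rn m. P x}" by auto
  then show ?thesis using a definable_compl[of "{x \<in> Rn m. P x}" m] by (auto simp: DefN_def)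
qed

lemma DefN_disj: "DefN m P \<Longrightarrow> DefN m Q \<Longrightarrow> DefN m (\<lambda>x. P x \<or> Q x)"
proof -
  assume a: "DefN m P" "DefN m Q"
  have "{x \<in> Rn m. P x \<or> Q x} = {x \<in> Rn m. P x} \<union> {x \<in> Rn m. Q x}" by auto
  then show ?thesis using a definable_union[of "{x \<in> Rn m. P x}" m] by (auto simp: DefN_def)
qed

lemma DefN_conj: "DefN m P \<Longrightarrow> DefN m Q \<Longrightarrow> DefN m (\<lambda>x. P x \<and> Q x)"
  using DefN_not[OF DefN_disj[OF DefN_not[of m P] DefN_not[of m Q]]] by simp

lemma DefN_const: "DefN m (\<lambda>x. b)"
proof -
  have "Rn m \<in> S m" using definable_compl[OF definable_empty] by simp
  then show ?thesis using definable_empty by (cases b) (auto simp: DefN_def)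
qed

lemma DefN_poly: assumes "polynomial_map m p" shows "DefN m (\<lambda>x. p x > 0)"
  using assms definable_semialgebraic semialgebraic.pos[OF assms]
  by (auto simp: DefN_def polynomial_map_trunc)

lemma DefN_ball: "(\<And>i. i < k \<Longrightarrow> DefN m (P i)) \<Longrightarrow> DefN m (\<lambda>x. \<forall>i<k. P i x)" for k :: nat
proof (induction k)
  case 0 then show ?case by (simp add: DefN_const)
next
  case (Suc k)
  then have "DefN m (\<lambda>x. (\<forall>i<k. P i x) \<and> P k x)" by (intro DefN_conj) auto
  moreover have "(\<lambda>x. (\<forall>i<k. P i x) \<and> P k x) = (\<lambda>x. \<forall>i<Suc k. P i x)"
    by (auto simp: less_Suc_eq)
  ultimately show ?case by simp
qed

lemma DefN_eq: assumes "i < m" "j < m" shows "DefN m (\<lambda>x. x i = x j)"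
proof -
  have c: "polynomial_map m (\<lambda>x. x i - x j)" "polynomial_map m (\<lambda>x. x j - x i)"
    using assms by (auto intro!: polynomial_map_diff polynomial_map.coord)
  have "DefN m (\<lambda>x. \<not> (x i - x j > 0 \<or> x j - x i > 0))"
    by (intro DefN_not DefN_disj DefN_poly c)
  moreover have "(\<lambda>x. \<not> (x i - x j > 0 \<or> x j - x i > 0)) = (\<lambda>x::nat \<Rightarrow> real. x i = x j)" by auto
  ultimately show ?thesis by simp
qed

text \<open>Iterates \<open>definable_R_times\<close>; it places the variables of \<open>P\<close>
  in a fresh block behind \<open>k\<close> others, which is the first half of a substitution of
  variables.\<close>

lemma DefN_shift: assumes "DefN m P" shows "DefN (k + m) (\<lambda>x. P (\<lambda>i. x (k + i)))"
proof (induction k)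
  case 0 then show ?case using assms by simp
next
  case (Suc k)
  let ?P = "\<lambda>x. P (\<lambda>i. x (k + i))"
  have inv: "\<And>x. ?P (trunc (k + m) x) = ?P x" and d: "{x \<in> Rn (k + m). ?P x} \<in> S (k + m)"
    using Suc by (auto simp: DefN_def)
  have "P (\<lambda>i. trunc (Suc k + m) x (Suc k + i)) = P (\<lambda>i. x (Suc k + i))" for x
    using inv[of "\<lambda>i. x (Suc i)"] by (simp add: trunc_def)
  moreover have "{x \<in> Rn (Suc k + m). P (\<lambda>i. x (Suc k + i))} =
     {x \<in> Rn (Suc (k + m)). (\<lambda>i. x (Suc i)) \<in> {x \<in> Rn (k + m). ?P x}}"
    by (auto simp: Rn_def)
  ultimately show ?case using definable_R_times[OF d] by (auto simp: DefN_def)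
qed

lemma DefN_ex_last: assumes "DefN (Suc m) P" shows "DefN m (\<lambda>x. \<exists>t. P (x(m := t)))"
proof -
  have inv: "\<And>x. P (trunc (Suc m) x) = P x" and d: "{x \<in> Rn (Suc m). P x} \<in> S (Suc m)"
    using assms by (auto simp: DefN_def)
  have "P ((trunc m x)(m := t)) = P (x(m := t))" for x t
    using inv[of "x(m := t)"] by (simp add: trunc_Suc_upd)
  moreover have "{x \<in> Rn m. \<exists>t. P (x(m := t))} = trunc m ` {x \<in> Rn (Suc m). P x}"
  proof (intro equalityI subsetI)
    fix x assume "x \<in> {x \<in> Rn m. \<exists>t. P (x(m := t))}"
    then obtain t where "x \<in> Rn m" "P (x(m := t))" by auto
    then show "x \<in> trunc m ` {x \<in> Rn (Suc m). P x}"
      by (intro image_eqI[of _ _ "x(m := t)"]) (auto simp: trunc_Rn)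
  next
    fix x assume "x \<in> trunc m ` {x \<in> Rn (Suc m). P x}"
    then obtain y where "y \<in> Rn (Suc m)" "P y" "x = trunc m y" by auto
    then show "x \<in> {x \<in> Rn m. \<exists>t. P (x(m := t))}"
      using Rn_Suc_upd_trunc[of y m] by (auto intro!: exI[of _ "y m"])
  qed
  ultimately show ?thesis using definable_projection[OF d] by (simp add: DefN_def)
qed

text \<open>Projection removes one last coordinate at a time, so the block is taken down from the
  top. Quantifying over a whole sequence \<open>y\<close> is harmless, because \<open>P\<close>
  reads nothing from index \<open>k + m\<close> on.\<close>

lemma DefN_ex_block:
  "DefN (k + m) P \<Longrightarrow> DefN k (\<lambda>x. \<exists>y. P (\<lambda>i. if i < k then x i else y i))"
proof (induction m arbitrary: P)
  case 0
  have "P (\<lambda>i. if i < k then x i else y i) = P x" for x y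
  proof -
    have "trunc k (\<lambda>i. if i < k then x i else y i) = trunc k x" by (intro trunc_cong) auto
    then show ?thesis using 0 unfolding DefN_def by (metis add_0_right)
  qed
  then show ?case using 0 by simp
next
  case (Suc m)
  have "DefN k (\<lambda>x. \<exists>y. \<exists>t. P ((\<lambda>i. if i < k then x i else y i)(k + m := t)))"
    using Suc.IH[of "\<lambda>z. \<exists>t. P (z(k + m := t))"] DefN_ex_last[of "k + m" P] Suc.prems by simp
  moreover have "(\<lambda>x. \<exists>y t. P ((\<lambda>i. if i < k then x i else y i)(k + m := t))) =
     (\<lambda>x. \<exists>y. P (\<lambda>i. if i < k then x i else y i))"
  proof (intro ext iffI)
    fix x assume "\<exists>y t. P ((\<lambda>i. if i < k then x i else y i)(k + m := t))"
    then obtain y t where "P ((\<lambda>i. if i < k then x i else y i)(k + m := t))" by auto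
    moreover have "(\<lambda>i. if i < k then x i else y i)(k + m := t) = (\<lambda>i. if i < k then x i else (y(k + m := t)) i)"
      by (auto simp: fun_eq_iff)
    ultimately show "\<exists>y. P (\<lambda>i. if i < k then x i else y i)" by metis
  next
    fix x assume "\<exists>y. P (\<lambda>i. if i < k then x i else y i)"
    then obtain y where "P (\<lambda>i. if i < k then x i else y i)" by auto
    moreover have "(\<lambda>i. if i < k then x i else y i)(k + m := y (k + m)) = (\<lambda>i. if i < k then x i else y i)"
      by (auto simp: fun_eq_iff)
    ultimately show "\<exists>y t. P ((\<lambda>i. if i < k then x i else y i)(k + m := t))" by metis
  qed
  ultimately show ?case by simp
qed

text \<open>The axioms contain no permutation of coordinates. A copy of the variables of
  \<open>P\<close> is placed in a block behind position \<open>K\<close>, equated with the wanted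
  coordinates, and projected away; so \<open>\<sigma>\<close> may also identify or drop
  variables.\<close>

lemma Def_perm: assumes "Def P" shows "Def (\<lambda>x. P (\<lambda>i. x (\<sigma> i)))"
proof -
  obtain m where P: "DefN m P" using assms by (auto simp: Def_def)
  obtain K where K: "\<And>i. i < m \<Longrightarrow> \<sigma> i < K"
    using finite_nat_set_iff_bounded[of "\<sigma> ` {..<m}"] by auto
  have "DefN (K + m) (\<lambda>x. P (\<lambda>i. x (K + i)) \<and> (\<forall>i<m. x (K + i) = x (\<sigma> i)))"
    using K by (intro DefN_conj DefN_shift P DefN_ball DefN_eq) (auto intro: trans_less_add1)
  note * = DefN_ex_block[OF this]
  have "(\<lambda>x. \<exists>y. P (\<lambda>i. if K + i < K then x (K + i) else y (K + i)) \<and>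
           (\<forall>i<m. (if K + i < K then x (K + i) else y (K + i)) = (if \<sigma> i < K then x (\<sigma> i) else y (\<sigma> i))))
      = (\<lambda>x. P (\<lambda>i. x (\<sigma> i)))"
  proof (intro ext iffI)
    fix x assume "\<exists>y. P (\<lambda>i. if K + i < K then x (K + i) else y (K + i)) \<and>
           (\<forall>i<m. (if K + i < K then x (K + i) else y (K + i)) = (if \<sigma> i < K then x (\<sigma> i) else y (\<sigma> i)))"
    then obtain y where y: "P (\<lambda>i. y (K + i))" "\<forall>i<m. y (K + i) = x (\<sigma> i)" using K by auto
    then have "trunc m (\<lambda>i. y (K + i)) = trunc m (\<lambda>i. x (\<sigma> i))" by (intro trunc_cong) auto
    moreover have "P (trunc m z) = P z" for z using P by (auto simp: DefN_def)
    ultimately show "P (\<lambda>i. x (\<sigma> i))" using y(1) by metis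
  next
    fix x assume "P (\<lambda>i. x (\<sigma> i))"
    then show "\<exists>y. P (\<lambda>i. if K + i < K then x (K + i) else y (K + i)) \<and>
           (\<forall>i<m. (if K + i < K then x (K + i) else y (K + i)) = (if \<sigma> i < K then x (\<sigma> i) else y (\<sigma> i)))"
      using K by (intro exI[of _ "\<lambda>i. x (\<sigma> (i - K))"]) auto
  qed
  then show ?thesis using * by (auto simp: Def_def)
qed

section \<open>Closure of definability under logic, arithmetic and substitution\<close>

named_theorems defi

lemma Def_const [defi]: "Def (\<lambda>x. b)"
  using DefN_const by (auto simp: Def_def)

lemma Def_not [defi]: "Def P \<Longrightarrow> Def (\<lambda>x. \<not> P x)"
  using DefN_not by (auto simp: Def_def)

lemma Def_disj [defi]: "Def P \<Longrightarrow> Def Q \<Longrightarrow> Def (\<lambda>x. P x \<or> Q x)"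
proof -
  assume "Def P" "Def Q"
  then obtain m k where "DefN m P" "DefN k Q" by (auto simp: Def_def)
  then have "DefN (max m k) P" "DefN (max m k) Q" by (auto intro: DefN_mono)
  then show ?thesis unfolding Def_def by (intro exI[of _ "max m k"] DefN_disj)
qed

lemma Def_conj [defi]: "Def P \<Longrightarrow> Def Q \<Longrightarrow> Def (\<lambda>x. P x \<and> Q x)"
proof -
  assume "Def P" "Def Q"
  then obtain m k where "DefN m P" "DefN k Q" by (auto simp: Def_def)
  then have "DefN (max m k) P" "DefN (max m k) Q" by (auto intro: DefN_mono)
  then show ?thesis unfolding Def_def by (intro exI[of _ "max m k"] DefN_conj)
qed

lemma Def_imp [defi]: "Def P \<Longrightarrow> Def Q \<Longrightarrow> Def (\<lambda>x. P x \<longrightarrow> Q x)"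
  using Def_disj[OF Def_not[of P], of Q] by simp

lemma Def_iff [defi]: "Def P \<Longrightarrow> Def Q \<Longrightarrow> Def (\<lambda>x. P x = Q x)"
proof -
  assume "Def P" "Def Q"
  then have "Def (\<lambda>x. (P x \<longrightarrow> Q x) \<and> (Q x \<longrightarrow> P x))" by (intro defi)
  moreover have "(\<lambda>x. (P x \<longrightarrow> Q x) \<and> (Q x \<longrightarrow> P x)) = (\<lambda>x. P x = Q x)" by auto
  ultimately show ?thesis by simp
qed

text \<open>The bound variable sits in coordinate 0, while projection removes the last one;
  \<open>\<sigma>\<close> moves it to position \<open>m\<close>, which \<open>P\<close> does not
  read as a parameter.\<close>

lemma Def_ex [defi]: assumes "Def (\<lambda>x. P (\<lambda>i. x (Suc i)) (x 0))" shows "Def (\<lambda>x. \<exists>t. P x t)"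
proof -
  obtain k where Q: "DefN k (\<lambda>x. P (\<lambda>i. x (Suc i)) (x 0))" using assms by (auto simp: Def_def)
  \<comment> \<open>The extra dimension counts coordinate 0 even if \<open>k = 0\<close>, so that
    \<open>P\<close> is known to read at most \<open>k\<close> parameters besides the bound
    variable.\<close>
  define m where "m = Suc k"
  have Q: "DefN m (\<lambda>x. P (\<lambda>i. x (Suc i)) (x 0))" using Q by (simp add: m_def DefN_Suc)
  have inv: "P (trunc k x) t = P x t" for x t
  proof -
    have "trunc m (case_nat t x) = case_nat t (trunc k x)"
      by (auto simp: trunc_def fun_eq_iff m_def split: nat.split)
    then show ?thesis using Q[unfolded DefN_def, THEN conjunct1, rule_format, of "case_nat t x"] by simp
  qed
  define \<sigma> where "\<sigma> = case_nat m (\<lambda>i. i)"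
  have "Def (\<lambda>x. P (\<lambda>i. x (\<sigma> (Suc i))) (x (\<sigma> 0)))"
    using Def_perm[OF assms, of \<sigma>] .
  then obtain K where K: "DefN K (\<lambda>x. P (\<lambda>i. x i) (x m))" by (auto simp: \<sigma>_def Def_def)
  have "DefN (Suc m) (\<lambda>x. P x (x m))"
  proof (cases "K \<le> Suc m")
    case True then show ?thesis using K DefN_mono by auto
  next
    case False
    then obtain j where j: "K = Suc m + j" using le_Suc_ex by (meson nat_le_linear)
    have "DefN (Suc m) (\<lambda>x. \<exists>y. P (\<lambda>i. if i < Suc m then x i else y i) (if m < Suc m then x m else y m))"
      using DefN_ex_block[OF K[unfolded j]] by simp
    moreover have "P (\<lambda>i. if i < Suc m then x i else y i) (x m) = P x (x m)" for x y
    proof -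
      have "trunc k (\<lambda>i. if i < Suc m then x i else y i) = trunc k x" by (intro trunc_cong) (auto simp: m_def)
      then show ?thesis using inv by metis
    qed
    ultimately show ?thesis by simp
  qed
  from DefN_ex_last[OF this] have "DefN m (\<lambda>x. \<exists>t. P (x(m := t)) t)" by simp
  moreover have "P (x(m := t)) t = P x t" for x t
  proof -
    have "trunc k (x(m := t)) = trunc k x" by (intro trunc_cong) (auto simp: m_def)
    then show ?thesis using inv by metis
  qed
  ultimately show ?thesis by (auto simp: Def_def)
qed

lemma Def_all [defi]: assumes "Def (\<lambda>x. P (\<lambda>i. x (Suc i)) (x 0))" shows "Def (\<lambda>x. \<forall>t. P x t)"
proof -
  have "Def (\<lambda>x. \<not> (\<exists>t. \<not> P x t))" by (intro Def_not Def_ex assms)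
  then show ?thesis by simp
qed

lemma Def_ball_less [defi]: "(\<And>i. i < k \<Longrightarrow> Def (\<lambda>x. P x i)) \<Longrightarrow> Def (\<lambda>x. \<forall>i<k. P x i)" for k :: nat
proof (induction k)
  case 0 then show ?case by (simp add: Def_const)
next
  case (Suc k)
  have "Def (\<lambda>x. (\<forall>i<k. P x i) \<and> P x k)" using Suc by (intro defi) auto
  moreover have "(\<lambda>x. (\<forall>i<k. P x i) \<and> P x k) = (\<lambda>x. \<forall>i<Suc k. P x i)"
    by (auto simp: less_Suc_eq)
  ultimately show ?case by simp
qed

lemma Def_bex_less [defi]: "(\<And>i. i < k \<Longrightarrow> Def (\<lambda>x. P x i)) \<Longrightarrow> Def (\<lambda>x. \<exists>i<k. P x i)" for k :: nat
  using Def_not[OF Def_ball_less[of k "\<lambda>x i. \<not> P x i", OF Def_not]] by simp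

lemma Def_finite_bex: "finite I \<Longrightarrow> (\<And>i. i \<in> I \<Longrightarrow> Def (\<lambda>x. P x i)) \<Longrightarrow> Def (\<lambda>x. \<exists>i\<in>I. P x i)"
proof (induction rule: finite_induct)
  case empty then show ?case by (simp add: Def_const)
next
  case (insert i I)
  then have "Def (\<lambda>x. P x i \<or> (\<exists>i\<in>I. P x i))" by (intro Def_disj) auto
  then show ?case by simp
qed

lemma Def_finite_ball: "finite I \<Longrightarrow> (\<And>i. i \<in> I \<Longrightarrow> Def (\<lambda>x. P x i)) \<Longrightarrow> Def (\<lambda>x. \<forall>i\<in>I. P x i)"
  using Def_not[OF Def_finite_bex[of I "\<lambda>x i. \<not> P x i", OF _ Def_not]] by simp

lemma DefT_perm: "DefT f \<Longrightarrow> DefT (\<lambda>x. f (\<lambda>i. x (\<sigma> i)))"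
  using Def_perm[of "\<lambda>x. x 0 = f (\<lambda>i. x (Suc i))" "case_nat 0 (\<lambda>i. Suc (\<sigma> i))"]
  by (simp add: DefT_def)

lemma DefT_poly: assumes "polynomial_map m p" shows "DefT p"
proof -
  let ?p = "\<lambda>x. p (\<lambda>i. x (Suc i))"
  have q: "polynomial_map (Suc m) (\<lambda>x. p (\<lambda>i. x (Suc i)))" using assms
    by (induction) (auto intro: polynomial_map.intros)
  have "Def (\<lambda>x. \<not> (x 0 - ?p x > 0) \<and> \<not> (?p x - x 0 > 0))"
    unfolding Def_def by (intro exI[of _ "Suc m"] DefN_conj DefN_not DefN_poly polynomial_map_diff q polynomial_map.coord) auto
  moreover have "(\<lambda>x. \<not> (x 0 - ?p x > 0) \<and> \<not> (?p x - x 0 > 0)) = (\<lambda>x. x 0 = ?p x)" by auto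
  ultimately show ?thesis by (simp add: DefT_def)
qed

lemma DefT_var [defi]: "DefT (\<lambda>x. x i)"
  by (rule DefT_poly[of "Suc i"]) (auto intro: polynomial_map.intros)

lemma DefT_const [defi]: "DefT (\<lambda>x. c)"
  by (rule DefT_poly[of 0]) (auto intro: polynomial_map.intros)

lemma Def_eq [defi]: assumes "DefT f" "DefT g" shows "Def (\<lambda>x. f x = g x)"
proof -
  have "Def (\<lambda>x. \<exists>t. t = f x \<and> t = g x)"
    using assms by (intro Def_ex Def_conj) (auto simp: DefT_def)
  then show ?thesis by simp
qed

lemma Def_less [defi]: assumes "DefT f" "DefT g" shows "Def (\<lambda>x. f x < g x)"
proof -
  have "Def (\<lambda>x. x 0 - x 1 > 0)"
    unfolding Def_def by (intro exI[of _ 2] DefN_poly polynomial_map_diff polynomial_map.coord) auto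
  then have "Def (\<lambda>x. x (Suc 0) < x 0)" by simp
  from Def_perm[OF this, of "case_nat 0 (\<lambda>_. 1)"] have *: "Def (\<lambda>x. x 1 < x 0)" by simp
  then have *: "Def (\<lambda>x. x (Suc 0) < x 0)" by simp
  \<comment> \<open>Under two binders the inner variable \<open>t\<close> is coordinate 0 and
    \<open>s\<close> is coordinate 1, which explains the orientation of \<open>*\<close>.\<close>
  have "Def (\<lambda>x. \<exists>s t. s = f x \<and> t = g x \<and> s < t)"
    by (intro Def_ex Def_conj Def_eq DefT_var * DefT_perm[OF assms(1)] DefT_perm[OF assms(2)])
  then show ?thesis by simp
qed

lemma Def_le [defi]: "DefT f \<Longrightarrow> DefT g \<Longrightarrow> Def (\<lambda>x. f x \<le> g x)"
  using Def_not[OF Def_less[of g f]] by (simp add: not_less)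

lemma DefT_add [defi]: assumes "DefT f" "DefT g" shows "DefT (\<lambda>x. f x + g x)"
proof -
  have "DefT (\<lambda>x. x 0 + x 1)" by (rule DefT_poly[of 2], intro polynomial_map.intros) auto
  then have "Def (\<lambda>x. x 0 = x 1 + x 2)" by (simp add: DefT_def numeral_2_eq_2)
  from Def_perm[OF this, of "case_nat 2 (case_nat 1 (\<lambda>_. 0))"]
  have *: "Def (\<lambda>x. x (Suc (Suc 0)) = x (Suc 0) + x 0)" by (simp add: numeral_2_eq_2)
  have "Def (\<lambda>x. \<exists>s t. s = f (\<lambda>i. x (Suc i)) \<and> t = g (\<lambda>i. x (Suc i)) \<and> x 0 = s + t)"
    by (intro Def_ex Def_conj Def_eq DefT_var * DefT_perm[OF assms(1)] DefT_perm[OF assms(2)])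
  then show ?thesis by (simp add: DefT_def)
qed

lemma DefT_mult [defi]: assumes "DefT f" "DefT g" shows "DefT (\<lambda>x. f x * g x)"
proof -
  have "DefT (\<lambda>x. x 0 * x 1)" by (rule DefT_poly[of 2], intro polynomial_map.intros) auto
  then have "Def (\<lambda>x. x 0 = x 1 * x 2)" by (simp add: DefT_def numeral_2_eq_2)
  from Def_perm[OF this, of "case_nat 2 (case_nat 1 (\<lambda>_. 0))"]
  have *: "Def (\<lambda>x. x (Suc (Suc 0)) = x (Suc 0) * x 0)" by (simp add: numeral_2_eq_2)
  have "Def (\<lambda>x. \<exists>s t. s = f (\<lambda>i. x (Suc i)) \<and> t = g (\<lambda>i. x (Suc i)) \<and> x 0 = s * t)"
    by (intro Def_ex Def_conj Def_eq DefT_var * DefT_perm[OF assms(1)] DefT_perm[OF assms(2)])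
  then show ?thesis by (simp add: DefT_def)
qed

lemma DefT_minus [defi]: "DefT f \<Longrightarrow> DefT (\<lambda>x. - f x)"
  using DefT_mult[OF DefT_const[of "-1"], of f] by simp

lemma DefT_diff [defi]: "DefT f \<Longrightarrow> DefT g \<Longrightarrow> DefT (\<lambda>x. f x - g x)"
  using DefT_add[OF _ DefT_minus, of f g] by simp

lemma DefT_if [defi]: assumes "Def P" "DefT f" "DefT g" shows "DefT (\<lambda>x. if P x then f x else g x)"
proof -
  have "Def (\<lambda>x. (P (\<lambda>i. x (Suc i)) \<longrightarrow> x 0 = f (\<lambda>i. x (Suc i))) \<and> (\<not> P (\<lambda>i. x (Suc i)) \<longrightarrow> x 0 = g (\<lambda>i. x (Suc i))))"
    by (intro Def_conj Def_imp Def_not Def_perm[OF assms(1)] Def_eq DefT_var DefT_perm[OF assms(2)] DefT_perm[OF assms(3)])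
  then show ?thesis unfolding DefT_def by (rule back_subst[of Def]) (auto simp: fun_eq_iff)
qed

lemma DefT_abs [defi]: "DefT f \<Longrightarrow> DefT (\<lambda>x. \<bar>f x\<bar>)"
  unfolding abs_if by (intro defi)

text \<open>Turns a first-order description of a value into a term; needed where a function arises
  from an enumeration or a choice and not from a formula.\<close>

lemma DefT_unique:
  assumes "Def (\<lambda>x. P (\<lambda>i. x (Suc i)) (x 0))" "\<And>x t. P x t \<Longrightarrow> t = f x" "\<And>x. P x (f x)"
  shows "DefT f"
  using assms(1) unfolding DefT_def by (rule back_subst[of Def]) (use assms in \<open>auto simp: fun_eq_iff\<close>)

text \<open>A bound vector occupies the coordinates below \<open>m\<close> and shifts the parameters
  by \<open>m\<close>, exactly as \<open>m\<close> nested single binders with the outermost one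
  holding the last entry.\<close>

lemma Def_ex_Rn [defi]:
  "Def (\<lambda>x. P (\<lambda>i. x (i + m)) (trunc m x)) \<Longrightarrow> Def (\<lambda>x. \<exists>y\<in>Rn m. P x y)"
proof (induction m arbitrary: P)
  case 0
  have "trunc 0 x = (\<lambda>_. 0)" for x by (auto simp: trunc_def)
  then show ?case using 0 by (simp add: Rn_0)
next
  case (Suc m)
  have "(trunc m x)(m := x m) = trunc (Suc m) x" for x by (auto simp: trunc_def)
  then have "Def (\<lambda>x. \<exists>t. \<exists>y\<in>Rn m. P x (y(m := t)))"
    using Suc.prems by (intro Def_ex Suc.IH) simp
  moreover have "(\<exists>t. \<exists>y\<in>Rn m. P x (y(m := t))) \<longleftrightarrow> (\<exists>y\<in>Rn (Suc m). P x y)" for x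
  proof
    assume "\<exists>y\<in>Rn (Suc m). P x y"
    then obtain y where "y \<in> Rn (Suc m)" "P x y" by auto
    then show "\<exists>t. \<exists>y\<in>Rn m. P x (y(m := t))"
      using Rn_Suc_upd_trunc[of y m] by (intro exI[of _ "y m"] bexI[of _ "trunc m y"]) auto
  qed auto
  ultimately show ?case by simp
qed

lemma Def_all_Rn [defi]:
  "Def (\<lambda>x. P (\<lambda>i. x (i + m)) (trunc m x)) \<Longrightarrow> Def (\<lambda>x. \<forall>y\<in>Rn m. P x y)"
  using Def_not[OF Def_ex_Rn[of "\<lambda>x y. \<not> P x y" m]] Def_not by simp

text \<open>\<open>T\<close> supplies infinitely many coordinates, but \<open>P\<close> reads
  finitely many of them, so the substitution costs one quantifier over \<open>Rn m\<close>.\<close>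

lemma Def_comp: assumes "Def P" "\<And>i. DefT (\<lambda>x. T x i)" shows "Def (\<lambda>x. P (T x))"
proof -
  obtain m where P: "DefN m P" using assms by (auto simp: Def_def)
  then have inv: "P (trunc m x) = P x" for x by (auto simp: DefN_def)
  have "Def (\<lambda>x. x i = T (\<lambda>j. x (j + m)) i)" for i
    using Def_perm[OF assms(2)[of i, unfolded DefT_def], of "case_nat i (\<lambda>j. j + m)"] by simp
  then have "Def (\<lambda>x. \<exists>y\<in>Rn m. P y \<and> (\<forall>i<m. y i = T x i))"
    by (intro Def_ex_Rn Def_conj Def_ball_less) (use assms(1) inv in auto)
  moreover have "(\<exists>y\<in>Rn m. P y \<and> (\<forall>i<m. y i = T x i)) \<longleftrightarrow> P (T x)" for x
  proof
    assume "\<exists>y\<in>Rn m. P y \<and> (\<forall>i<m. y i = T x i)"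
    then obtain y where "y \<in> Rn m" "P y" "\<forall>i<m. y i = T x i" by auto
    then show "P (T x)" using inv trunc_cong[of m y "T x"] by metis
  next
    assume "P (T x)" then show "\<exists>y\<in>Rn m. P y \<and> (\<forall>i<m. y i = T x i)"
      using inv by (intro bexI[of _ "trunc m (T x)"]) auto
  qed
  ultimately show ?thesis by simp
qed

lemma DefT_comp: assumes "DefT f" "\<And>i. DefT (\<lambda>x. T x i)" shows "DefT (\<lambda>x. f (T x))"
proof -
  have "DefT (\<lambda>x. T (\<lambda>j. x (Suc j)) i)" for i using DefT_perm[OF assms(2)[of i]] .
  then have "DefT (\<lambda>x. case_nat (x 0) (T (\<lambda>i. x (Suc i))) i)" for i
    by (cases i) (auto intro: DefT_var)
  from Def_comp[OF assms(1)[unfolded DefT_def], of "\<lambda>x. case_nat (x 0) (T (\<lambda>i. x (Suc i)))", OF this]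
  show ?thesis by (simp add: DefT_def)
qed

lemma DefT_trunc [defi]: "(i < m \<Longrightarrow> DefT (\<lambda>x. T x i)) \<Longrightarrow> DefT (\<lambda>x. trunc m (T x) i)"
proof (cases "i < m")
  case False
  then have "(\<lambda>x. trunc m (T x) i) = (\<lambda>x. 0)" by (simp add: trunc_def)
  then show ?thesis by (simp only: DefT_const)
qed simp

lemma DefT_upd [defi]: "DefT f \<Longrightarrow> DefT (\<lambda>x. T x i) \<Longrightarrow> DefT (\<lambda>x. ((T x)(j := f x)) i)"
  by (cases "i = j") simp_all

lemma Def_set: assumes "Def P" shows "{x \<in> Rn m. P x} \<in> S m"
proof -
  let ?Q = "\<lambda>x. P (trunc m x)"
  have "Def ?Q" by (rule Def_comp[OF assms]) (intro defi)
  then obtain K where "DefN K ?Q" by (auto simp: Def_def)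
  then have K: "DefN (m + K) ?Q" by (auto intro: DefN_mono)
  have "trunc m (\<lambda>i. if i < m then x i else y i) = trunc m x" for x y by (auto simp: trunc_def)
  then have "DefN m ?Q" using DefN_ex_block[OF K] by simp
  then have "{x \<in> Rn m. ?Q x} \<in> S m" by (auto simp: DefN_def)
  moreover have "{x \<in> Rn m. ?Q x} = {x \<in> Rn m. P x}" by (auto simp: trunc_Rn)
  ultimately show ?thesis by simp
qed

lemma Def_in: assumes "A \<in> S m" shows "Def (\<lambda>x. trunc m x \<in> A)"
proof -
  have "{x \<in> Rn m. trunc m x \<in> A} = A" using definable_subset[OF assms] by (auto simp: trunc_Rn)
  then have "DefN m (\<lambda>x. trunc m x \<in> A)" using assms by (simp add: DefN_def)
  then show ?thesis unfolding Def_def by blast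
qed

lemma S_iff: "A \<in> S m \<longleftrightarrow> A \<subseteq> Rn m \<and> Def (\<lambda>x. trunc m x \<in> A)"
proof
  assume "A \<subseteq> Rn m \<and> Def (\<lambda>x. trunc m x \<in> A)"
  moreover then have "{x \<in> Rn m. trunc m x \<in> A} = A" by (auto simp: trunc_Rn)
  ultimately show "A \<in> S m" using Def_set[of "\<lambda>x. trunc m x \<in> A" m] by simp
qed (use Def_in definable_subset in auto)

lemma Def_mem [defi]: assumes "A \<in> S m" "\<And>i. i < m \<Longrightarrow> DefT (\<lambda>x. T x i)" "\<And>x. T x \<in> Rn m"
  shows "Def (\<lambda>x. T x \<in> A)"
proof -
  have "Def (\<lambda>x. trunc m (trunc m (T x)) \<in> A)"
    by (rule Def_comp[OF Def_in[OF assms(1)]]) (intro defi assms)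
  then show ?thesis using assms(3) by (simp add: trunc_Rn)
qed

lemma Def_mem_trunc [defi]: assumes "A \<in> S m" "\<And>i. i < m \<Longrightarrow> DefT (\<lambda>x. T x i)"
  shows "Def (\<lambda>x. trunc m (T x) \<in> A)"
  by (rule Def_mem[OF assms(1)]) (use assms in \<open>auto\<close>)

lemma definable_Int: "A \<in> S m \<Longrightarrow> B \<in> S m \<Longrightarrow> A \<inter> B \<in> S m"
  using Def_conj[OF Def_in Def_in, of A m B m] by (auto simp: S_iff)

lemma definable_Union: "finite F \<Longrightarrow> F \<subseteq> S m \<Longrightarrow> \<Union>F \<in> S m"
  by (induction rule: finite_induct) (auto intro: definable_empty definable_union)

lemma definable_Collect: "A \<in> S m \<Longrightarrow> Def P \<Longrightarrow> {x \<in> A. P x} \<in> S m"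
proof -
  assume a: "A \<in> S m" "Def P"
  have "{x \<in> A. P x} = A \<inter> {x \<in> Rn m. P x}" using definable_subset[OF a(1)] by auto
  then show ?thesis using definable_Int[OF a(1) Def_set[OF a(2)]] by simp
qed

end

section \<open>Tame functions of one variable\<close>

text \<open>Constancy off finitely many points, with the values at those points left free. Any type
  of values is allowed, so the same notion serves for predicates, integer functions and tuples of
  properties that are to be constant simultaneously.\<close>

definition tame :: "(real \<Rightarrow> 'a) \<Rightarrow> bool" where
  "tame f \<longleftrightarrow> (\<exists>F. finite F \<and> (\<forall>a b. a < b \<longrightarrow> {a..b} \<inter> F = {} \<longrightarrow> f a = f b))"

text \<open>An interval can be entered or left only at \<open>Inf J\<close> or \<open>Sup J\<close>.
  For unbounded intervals these are arbitrary numbers, but a change of membership between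
  \<open>a\<close> and \<open>b\<close> makes the relevant one a true bound.\<close>

lemma intervals_tame:
  assumes "finite F" "\<forall>J\<in>F. is_interval J"
  shows "tame (\<lambda>t. t \<in> \<Union>F)"
  unfolding tame_def
proof (intro exI[of _ "Inf ` F \<union> Sup ` F"] conjI allI impI)
  fix a b :: real assume ab: "a < b" and E: "{a..b} \<inter> (Inf ` F \<union> Sup ` F) = {}"
  have "a \<in> J \<longleftrightarrow> b \<in> J" if J: "J \<in> F" for J
  proof (rule ccontr)
    assume "\<not> (a \<in> J \<longleftrightarrow> b \<in> J)"
    then consider "a \<in> J" "b \<notin> J" | "a \<notin> J" "b \<in> J" by blast
    then show False
    proof cases
      case 1
      have *: "x \<le> b" if "x \<in> J" for x
        using 1 that assms(2) J ab unfolding is_interval_1 by (meson less_imp_le not_le)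
      have "a \<le> Sup J" using 1 * by (intro cSup_upper) (auto simp: bdd_above_def)
      moreover have "Sup J \<le> b" using 1 * by (intro cSup_least) auto
      ultimately show False using E J by auto
    next
      case 2
      have *: "x \<ge> a" if "x \<in> J" for x
        using 2 that assms(2) J ab unfolding is_interval_1 by (meson less_imp_le not_le)
      have "Inf J \<le> b" using 2 * by (intro cInf_lower) (auto simp: bdd_below_def)
      moreover have "a \<le> Inf J" using 2 * by (intro cInf_greatest) auto
      ultimately show False using E J by auto
    qed
  qed
  then show "(a \<in> \<Union>F) = (b \<in> \<Union>F)" by auto
qed (use assms in auto)

lemma finite_gap_right:
  fixes x :: real assumes "finite F" shows "\<exists>\<delta>>0. \<forall>t. x < t \<and> t < x + \<delta> \<longrightarrow> t \<notin> F"
proof (cases "{y \<in> F. y > x} = {}")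
  case True then show ?thesis by (intro exI[of _ 1]) auto
next
  case False
  let ?m = "Min {y \<in> F. y > x}"
  have "?m \<in> {y \<in> F. y > x}" using assms False by (intro Min_in) auto
  moreover have "t \<ge> ?m" if "t \<in> F" "t > x" for t using assms that by (intro Min_le) auto
  ultimately show ?thesis by (intro exI[of _ "?m - x"]) fastforce
qed

lemma tame_right:
  assumes "tame f" shows "\<exists>c. \<exists>\<delta>>0. \<forall>t. x < t \<and> t < x + \<delta> \<longrightarrow> f t = c"
proof -
  obtain F where F: "finite F" "\<And>a b. a < b \<Longrightarrow> {a..b} \<inter> F = {} \<Longrightarrow> f a = f b"
    using assms by (auto simp: tame_def)
  obtain \<delta> where \<delta>: "\<delta> > 0" "\<And>t. x < t \<and> t < x + \<delta> \<Longrightarrow> t \<notin> F" using finite_gap_right[OF F(1)] by blast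
  have "f t = f (x + \<delta> / 2)" if "x < t" "t < x + \<delta>" for t
  proof (cases t "x + \<delta> / 2" rule: linorder_cases)
    case less
    then have "{t..x + \<delta> / 2} \<inter> F = {}" using \<delta> that by (auto simp: disjoint_iff)
    then show ?thesis using F(2) less by blast
  next
    case greater
    then have "{x + \<delta> / 2..t} \<inter> F = {}" using \<delta> that by (auto simp: disjoint_iff)
    then show ?thesis using F(2) greater by metis
  qed auto
  then show ?thesis using \<delta>(1) by blast
qed

text \<open>An infinite set is not contained in the finite exceptional set, and next to a
  nonexceptional point the property persists. Rational end points keep the number of candidate
  intervals countable, for the pigeonhole arguments below.\<close>

lemma tame_infinite:
  assumes "tame P" "infinite {t. p < t \<and> t < q \<and> P t}"
  shows "\<exists>r s. p < r \<and> r < s \<and> s < q \<and> r \<in> \<rat> \<and> s \<in> \<rat> \<and> (\<forall>t. r < t \<and> t < s \<longrightarrow> P t)"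
proof -
  obtain F where F: "finite F" "\<And>a b. a < b \<Longrightarrow> {a..b} \<inter> F = {} \<Longrightarrow> P a = P b"
    using assms by (auto simp: tame_def)
  have "infinite ({t. p < t \<and> t < q \<and> P t} - F)" using assms(2) F(1) by simp
  then obtain t where t: "p < t" "t < q" "P t" "t \<notin> F" by (metis (mono_tags, lifting) DiffE finite.emptyI ex_in_conv mem_Collect_eq)
  obtain \<delta> where \<delta>: "\<delta> > 0" "\<And>u. t < u \<and> u < t + \<delta> \<Longrightarrow> u \<notin> F" using finite_gap_right[OF F(1)] by blast
  have "t < min q (t + \<delta>)" using t \<delta> by auto
  then obtain s where s: "s \<in> \<rat>" "t < s" "s < min q (t + \<delta>)" using Rats_dense_in_real by blast
  then obtain r where r: "r \<in> \<rat>" "t < r" "r < s" using Rats_dense_in_real by blast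
  have "P u" if "r < u" "u < s" for u
  proof -
    have "v \<notin> F" if v: "t \<le> v" "v \<le> u" for v
      using t(4) \<delta>(2)[of v] s r \<open>u < s\<close> v by (cases "v = t") auto
    then have "{t..u} \<inter> F = {}" by auto
    then show ?thesis using F(2)[of t u] t r that by auto
  qed
  then show ?thesis using r s t by (intro exI[of _ r] exI[of _ s]) auto
qed

text \<open>Otherwise the interval would be a countable union of finite sets. Infinitely many points
  is all that \<open>tame_infinite\<close> asks for.\<close>

lemma uncountable_cover:
  fixes A :: "'k::countable \<Rightarrow> real set"
  assumes "p < q" "\<And>t. p < t \<Longrightarrow> t < q \<Longrightarrow> \<exists>k. t \<in> A k"
  shows "\<exists>k. infinite {t. p < t \<and> t < q \<and> t \<in> A k}"
proof (rule ccontr)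
  assume "\<not> (\<exists>k. infinite {t. p < t \<and> t < q \<and> t \<in> A k})"
  then have "countable (\<Union>k. {t. p < t \<and> t < q \<and> t \<in> A k})"
    by (intro countable_UN) (auto intro: countable_finite)
  moreover have "{p<..<q} = (\<Union>k. {t. p < t \<and> t < q \<and> t \<in> A k})" using assms(2) by auto
  ultimately show False using uncountable_open_interval[of p q] assms(1) by metis
qed

section \<open>Continuity expressed through coordinates\<close>

definition near :: "nat \<Rightarrow> real \<Rightarrow> (nat \<Rightarrow> real) \<Rightarrow> (nat \<Rightarrow> real) \<Rightarrow> bool" where
  "near m \<delta> x y \<longleftrightarrow> (\<forall>i<m. \<bar>y i - x i\<bar> < \<delta>)"

text \<open>The epsilon-delta form with boxes is first-order, so the continuity points of a
  definable function form a definable set.\<close>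

definition cont_at :: "nat \<Rightarrow> (nat \<Rightarrow> real) set \<Rightarrow> ((nat \<Rightarrow> real) \<Rightarrow> real) \<Rightarrow> (nat \<Rightarrow> real) \<Rightarrow> bool" where
  "cont_at m C f x \<longleftrightarrow> (\<forall>\<epsilon>>0. \<exists>\<delta>>0. \<forall>y\<in>C. near m \<delta> x y \<longrightarrow> \<bar>f y - f x\<bar> < \<epsilon>)"

lemma near_refl [simp]: "\<delta> > 0 \<Longrightarrow> near m \<delta> x x"
  by (simp add: near_def)

lemma near_mono: "near m \<delta> x y \<Longrightarrow> \<delta> \<le> \<delta>' \<Longrightarrow> near m \<delta>' x y"
  by (auto simp: near_def intro: less_le_trans)

lemma near_Suc_upd: "near (Suc m) \<delta> (x(m := s)) (y(m := t)) \<longleftrightarrow> near m \<delta> x y \<and> \<bar>t - s\<bar> < \<delta>"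
  by (auto simp: near_def less_Suc_eq)

text \<open>A basic open set of the product topology may restrict coordinates from \<open>m\<close>
  on, but inside \<open>Rn m\<close> these are all 0; so finitely many radii and their minimum
  suffice.\<close>

lemma open_contains_near:
  assumes "open U" "x \<in> U" "x \<in> Rn m"
  shows "\<exists>\<delta>>0. \<forall>y\<in>Rn m. near m \<delta> x y \<longrightarrow> y \<in> U"
proof -
  obtain X where X: "x \<in> (\<Pi>\<^sub>E i\<in>UNIV. X i)" "\<And>i. open (X i)" "(\<Pi>\<^sub>E i\<in>UNIV. X i) \<subseteq> U"
    using product_topology_open_contains_basis[of "\<lambda>_. euclidean" UNIV U x] assms
    by (auto simp: open_fun_def)
  have "\<exists>d>0. \<forall>t. \<bar>t - x i\<bar> < d \<longrightarrow> t \<in> X i" for i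
    using X(1) X(2)[of i] unfolding open_dist by (auto simp: dist_real_def PiE_def)
  then obtain d where d: "\<And>i. d i > 0" "\<And>i t. \<bar>t - x i\<bar> < d i \<Longrightarrow> t \<in> X i" by metis
  define \<delta> where "\<delta> = Min (insert 1 (d ` {..<m}))"
  have \<delta>: "\<delta> > 0" using d(1) by (auto simp: \<delta>_def)
  have \<delta>i: "\<delta> \<le> d i" if "i < m" for i unfolding \<delta>_def using that by (intro Min_le) auto
  have "y \<in> U" if "y \<in> Rn m" "near m \<delta> x y" for y
  proof -
    have "y i \<in> X i" for i
    proof (cases "i < m")
      case True then show ?thesis using d(2) \<delta>i[OF True] that by (force simp: near_def)
    next
      case False then have "y i = x i" using assms(3) that by (simp add: Rn_def)
      then show ?thesis using d by auto
    qed
    then show ?thesis using X(3) by auto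
  qed
  then show ?thesis using \<delta> by blast
qed

lemma open_near: "open {y. near m \<delta> x y}"
proof -
  have "{y. near m \<delta> x y} = (\<Inter>i\<in>{..<m}. {y. \<bar>y i - x i\<bar> < \<delta>})" by (auto simp: near_def)
  moreover have "open {y. \<bar>y i - x i\<bar> < \<delta>}" for i
    by (intro open_Collect_less continuous_intros continuous_on_product_coordinates)
  ultimately show ?thesis by auto
qed

lemma continuous_on_iff_cont_at:
  assumes "C \<subseteq> Rn m" shows "continuous_on C f \<longleftrightarrow> (\<forall>x\<in>C. cont_at m C f x)"
proof
  assume c: "continuous_on C f"
  show "\<forall>x\<in>C. cont_at m C f x" unfolding cont_at_def
  proof (intro ballI allI impI)
    fix x \<epsilon> assume x: "x \<in> C" and "(0::real) < \<epsilon>"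
    then obtain A where A: "open A" "x \<in> A" "\<And>y. y \<in> C \<Longrightarrow> y \<in> A \<Longrightarrow> f y \<in> ball (f x) \<epsilon>"
      using c[unfolded continuous_on_topological, rule_format, of x "ball (f x) \<epsilon>"] by auto
    obtain \<delta> where "\<delta> > 0" "\<And>y. y \<in> Rn m \<Longrightarrow> near m \<delta> x y \<Longrightarrow> y \<in> A"
      using open_contains_near[OF A(1,2)] x assms by blast
    then show "\<exists>\<delta>>0. \<forall>y\<in>C. near m \<delta> x y \<longrightarrow> \<bar>f y - f x\<bar> < \<epsilon>"
      using A(3) assms by (intro exI[of _ \<delta>]) (auto simp: dist_real_def abs_minus_commute)
  qed
next
  assume c: "\<forall>x\<in>C. cont_at m C f x"
  show "continuous_on C f" unfolding continuous_on_topological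
  proof (intro ballI allI impI)
    fix x B assume x: "x \<in> C" and B: "open B" "f x \<in> B"
    then obtain \<epsilon> where \<epsilon>: "\<epsilon> > 0" "\<And>t. \<bar>t - f x\<bar> < \<epsilon> \<Longrightarrow> t \<in> B"
      unfolding open_dist by (auto simp: dist_real_def)
    obtain \<delta> where \<delta>: "\<delta> > 0" "\<And>y. y \<in> C \<Longrightarrow> near m \<delta> x y \<Longrightarrow> \<bar>f y - f x\<bar> < \<epsilon>"
      using c x \<epsilon>(1) unfolding cont_at_def by blast
    then show "\<exists>A. open A \<and> x \<in> A \<and> (\<forall>y\<in>C. y \<in> A \<longrightarrow> f y \<in> B)"
      using \<epsilon>(2) open_near by (intro exI[of _ "{y. near m \<delta> x y}"]) auto
  qed
qed

context o_minimal_structure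
begin

lemma Def_near [defi]:
  "DefT d \<Longrightarrow> (\<And>i. i < m \<Longrightarrow> DefT (\<lambda>x. T x i)) \<Longrightarrow> (\<And>i. i < m \<Longrightarrow> DefT (\<lambda>x. U x i)) \<Longrightarrow>
   Def (\<lambda>x. near m (d x) (T x) (U x))"
  unfolding near_def by (intro defi)

lemma Def_ex_S [defi]: assumes "A \<in> S m" "Def (\<lambda>x. P (\<lambda>i. x (i + m)) (trunc m x))"
  shows "Def (\<lambda>x. \<exists>y\<in>A. P x y)"
proof -
  have "Def (\<lambda>x. \<exists>y\<in>Rn m. trunc m y \<in> A \<and> P x y)"
    by (rule Def_ex_Rn) (use Def_conj[OF Def_in[OF assms(1)] assms(2)] in simp)
  moreover have "(\<exists>y\<in>Rn m. trunc m y \<in> A \<and> P x y) \<longleftrightarrow> (\<exists>y\<in>A. P x y)" for x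
    using definable_subset[OF assms(1)] by (auto simp: trunc_Rn)
  ultimately show ?thesis by simp
qed

lemma Def_all_S [defi]: "A \<in> S m \<Longrightarrow> Def (\<lambda>x. P (\<lambda>i. x (i + m)) (trunc m x)) \<Longrightarrow> Def (\<lambda>x. \<forall>y\<in>A. P x y)"
  using Def_not[OF Def_ex_S[of A m "\<lambda>x y. \<not> P x y"]] Def_not by simp

lemma DefT_perm1: "DefT (\<lambda>x. \<phi> (x 0)) \<Longrightarrow> DefT (\<lambda>x. \<phi> (x i))"
  by (rule DefT_perm[of "\<lambda>x. \<phi> (x 0)" "\<lambda>_. i"])

text \<open>All variables but one are frozen, so that the axiom on definable subsets of the line
  applies; this is how o-minimality enters the argument.\<close>

lemma Def_tame: assumes "Def P" shows "tame (\<lambda>t. P (x(i := t)))"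
proof -
  have "Def (\<lambda>y. P (x(i := y 0)))"
    by (rule Def_comp[OF assms]) (intro defi)
  note A = Def_set[OF this, of 1]
  obtain F where F: "finite F" "\<forall>J\<in>F. is_interval J" "\<Union>F = (\<lambda>x. x 0) ` {y \<in> Rn 1. P (x(i := y 0))}"
    using o_minimal[OF A] by blast
  have "(\<lambda>x. x 0) ` {y \<in> Rn 1. P (x(i := y 0))} = {t. P (x(i := t))}"
  proof (intro equalityI subsetI)
    fix t assume "t \<in> {t. P (x(i := t))}"
    then show "t \<in> (\<lambda>x. x 0) ` {y \<in> Rn 1. P (x(i := y 0))}"
      by (intro image_eqI[of _ _ "(\<lambda>_. 0)(0 := t)"]) (auto simp: Rn_def)
  qed auto
  then have "(\<lambda>t. t \<in> \<Union>F) = (\<lambda>t. P (x(i := t)))" using F(3) by auto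
  then show ?thesis using intervals_tame[OF F(1,2)] by simp
qed

lemma Def_tame1: assumes "Def (\<lambda>x. P (x 0))" shows "tame P"
  using Def_tame[OF assms, of _ 0] by simp

text \<open>
  A definable function has a right type (larger, equal or smaller just to the right) at every point,
  valid up to distance \<open>1/k\<close>; one pair of type and \<open>k\<close> occurs on a whole interval.
\<close>

lemma monotone_subinterval:
  assumes \<phi>: "DefT (\<lambda>x. \<phi> (x 0))" and pq: "p < q"
  shows "\<exists>r s. p < r \<and> r < s \<and> s < q \<and> r \<in> \<rat> \<and> s \<in> \<rat> \<and>
    ((\<forall>t u. r < t \<and> t \<le> u \<and> u < s \<longrightarrow> \<phi> t \<le> \<phi> u) \<or> (\<forall>t u. r < t \<and> t \<le> u \<and> u < s \<longrightarrow> \<phi> u \<le> \<phi> t)) \<and>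
    (\<forall>t. r < t \<and> t < s \<longrightarrow> (\<forall>\<epsilon>>0. \<exists>\<delta>>0. \<forall>u. \<bar>u - t\<bar> < \<delta> \<longrightarrow> \<bar>\<phi> u - \<phi> t\<bar> < \<epsilon>))"
proof -
  note \<phi>' = DefT_perm1[OF \<phi>]
  \<comment> \<open>The codes 0, 1 and 2 stand for larger, equal and smaller to the right.\<close>
  define R where "R c = (if c = (0::nat) then (<) else if c = 1 then (=) else (\<lambda>x y :: real. y < x))" for c
  define A where "A = (\<lambda>(c, k). {t. \<forall>u. t < u \<and> u < t + 1 / Suc k \<longrightarrow> R c (\<phi> t) (\<phi> u)})"
  have DA: "Def (\<lambda>x. x 0 \<in> A (c, k))" for c k
    unfolding A_def R_def by (cases "c = 0"; cases "c = 1") (simp_all, (intro defi \<phi>')+)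
  have "\<exists>ck. t \<in> A ck" for t
  proof -
    have "Def (\<lambda>x. \<phi> t < \<phi> (x 0))" "Def (\<lambda>x. \<phi> t = \<phi> (x 0))" by (intro defi \<phi>')+
    then have "tame (\<lambda>u. \<phi> t < \<phi> u)" "tame (\<lambda>u. \<phi> t = \<phi> u)" by (auto intro: Def_tame1)
    then obtain b1 b2 \<delta>1 \<delta>2 where b: "\<delta>1 > 0" "\<delta>2 > 0" "\<And>u. t < u \<and> u < t + \<delta>1 \<Longrightarrow> (\<phi> t < \<phi> u) = b1"
      "\<And>u. t < u \<and> u < t + \<delta>2 \<Longrightarrow> (\<phi> t = \<phi> u) = b2"
      using tame_right[of "\<lambda>u. \<phi> t < \<phi> u" t] tame_right[of "\<lambda>u. \<phi> t = \<phi> u" t] by metis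
    obtain k where k: "1 / Suc k < min \<delta>1 \<delta>2" using b(1,2) nat_approx_posE[of "min \<delta>1 \<delta>2"] by auto
    have "R (if b1 then 0 else if b2 then 1 else 2) (\<phi> t) (\<phi> u)" if "t < u" "u < t + 1 / Suc k" for u
      using b(3)[of u] b(4)[of u] that k by (auto simp: R_def)
    then show ?thesis by (intro exI[of _ "(if b1 then 0 else if b2 then 1 else 2, k)"]) (auto simp: A_def)
  qed
  then obtain c k where ck: "infinite {t. p < t \<and> t < q \<and> t \<in> A (c, k)}"
    using uncountable_cover[OF pq, of A] by auto
  obtain r s where rs: "p < r" "r < s" "s < q" "\<And>t. r < t \<and> t < s \<Longrightarrow> t \<in> A (c, k)"
    using tame_infinite[OF Def_tame1[OF DA] ck] by blast
  \<comment> \<open>On an interval no longer than \<open>1 / Suc k\<close> the right type of a point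
    compares it with every later point.\<close>
  define s' where "s' = min s (r + 1 / Suc k)"
  have s': "r < s'" "s' \<le> s" using rs by (auto simp: s'_def)
  have R: "R c (\<phi> t) (\<phi> u)" if "r < t" "t < u" "u < s'" for t u
  proof -
    have "t \<in> A (c, k)" using rs(4) that s' by auto
    moreover have "u < t + 1 / Suc k" using that by (auto simp: s'_def)
    ultimately show ?thesis using that by (auto simp: A_def)
  qed
  have mono: "(\<forall>t u. r < t \<and> t \<le> u \<and> u < s' \<longrightarrow> \<phi> t \<le> \<phi> u) \<or> (\<forall>t u. r < t \<and> t \<le> u \<and> u < s' \<longrightarrow> \<phi> u \<le> \<phi> t)"
  proof (cases "c \<le> 1")
    case True
    have "\<phi> t \<le> \<phi> u" if "r < t" "t \<le> u" "u < s'" for t u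
      using R[of t u] that True by (cases "t = u") (auto simp: R_def split: if_splits)
    then show ?thesis by blast
  next
    case False
    have "\<phi> u \<le> \<phi> t" if "r < t" "t \<le> u" "u < s'" for t u
      using R[of t u] that False by (cases "t = u") (auto simp: R_def split: if_splits)
    then show ?thesis by blast
  qed
  \<comment> \<open>A monotone function has countably many discontinuities, so continuity holds at
    infinitely many points and, being a definable condition, on a whole subinterval.\<close>
  have cnt: "countable {t \<in> {r<..<s'}. \<not> isCont \<phi> t}" using mono
  proof
    assume "\<forall>t u. r < t \<and> t \<le> u \<and> u < s' \<longrightarrow> \<phi> t \<le> \<phi> u"
    then have "mono_on {r<..<s'} \<phi>" by (auto simp: mono_on_def)
    then show ?thesis using mono_on_ctble_discont_open[of "{r<..<s'}" \<phi>] by auto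
  next
    assume "\<forall>t u. r < t \<and> t \<le> u \<and> u < s' \<longrightarrow> \<phi> u \<le> \<phi> t"
    then have "mono_on {r<..<s'} (\<lambda>t. - \<phi> t)" by (auto simp: mono_on_def)
    then have "countable {t \<in> {r<..<s'}. \<not> isCont (\<lambda>t. - \<phi> t) t}"
      using mono_on_ctble_discont_open[of "{r<..<s'}" "\<lambda>t. - \<phi> t"] by auto
    moreover have "isCont (\<lambda>t. - \<phi> t) t = isCont \<phi> t" for t
      using continuous_minus[of "at t" "\<lambda>t. - \<phi> t"] continuous_minus[of "at t" \<phi>] by auto
    ultimately show ?thesis by simp
  qed
  let ?C = "\<lambda>t. \<forall>\<epsilon>>0. \<exists>\<delta>>0. \<forall>u. \<bar>u - t\<bar> < \<delta> \<longrightarrow> \<bar>\<phi> u - \<phi> t\<bar> < \<epsilon>"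
  have isC: "?C t = isCont \<phi> t" for t
    unfolding continuous_at_eps_delta by (simp add: dist_real_def)
  have "uncountable ({r<..<s'} - {t \<in> {r<..<s'}. \<not> isCont \<phi> t})"
    using uncountable_minus_countable[OF _ cnt] uncountable_open_interval s'(1) by blast
  moreover have "{r<..<s'} - {t \<in> {r<..<s'}. \<not> isCont \<phi> t} = {t. r < t \<and> t < s' \<and> ?C t}"
    using isC by auto
  ultimately have inf: "infinite {t. r < t \<and> t < s' \<and> ?C t}" using countable_finite by metis
  have "Def (\<lambda>x. ?C (x 0))" by (intro defi \<phi>')
  from tame_infinite[OF Def_tame1[of ?C, OF this] inf]
  obtain a b where ab: "r < a" "a < b" "b < s'" "a \<in> \<rat>" "b \<in> \<rat>" "\<And>t. a < t \<and> t < b \<Longrightarrow> ?C t" by blast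
  have "(\<forall>t u. a < t \<and> t \<le> u \<and> u < b \<longrightarrow> \<phi> t \<le> \<phi> u) \<or> (\<forall>t u. a < t \<and> t \<le> u \<and> u < b \<longrightarrow> \<phi> u \<le> \<phi> t)"
    using mono ab by (smt (verit))
  then show ?thesis using ab rs s' by (intro exI[of _ a] exI[of _ b]) auto
qed

section \<open>Cells\<close>

text \<open>The value 0 outside \<open>C\<close> makes a function on a cell total, as the term
  calculus \<open>DefT\<close> requires.\<close>

definition extend0 :: "nat \<Rightarrow> (nat \<Rightarrow> real) set \<Rightarrow> ((nat \<Rightarrow> real) \<Rightarrow> real) \<Rightarrow> (nat \<Rightarrow> real) \<Rightarrow> real" where
  "extend0 m C h x = (if trunc m x \<in> C then h (trunc m x) else 0)"

lemma extend0_eq: "C \<subseteq> Rn m \<Longrightarrow> x \<in> C \<Longrightarrow> extend0 m C h x = h x"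
  using trunc_Rn[of x m] by (auto simp: extend0_def)

lemma DefT_extend0:
  assumes "C \<in> S m" "definable_fun S m C h" shows "DefT (extend0 m C h)"
proof -
  have C: "C \<subseteq> Rn m" using definable_subset[OF assms(1)] .
  let ?G = "(\<lambda>x. x(m := h x)) ` C"
  have G: "?G \<in> S (Suc m)" using assms(2) by (simp add: definable_fun_def)
  have *: "(trunc m x)(m := t) \<in> ?G \<longleftrightarrow> trunc m x \<in> C \<and> t = h (trunc m x)" for x t
  proof
    assume "(trunc m x)(m := t) \<in> ?G"
    then obtain y where y: "y \<in> C" "(trunc m x)(m := t) = y(m := h y)" by auto
    then have "trunc m ((trunc m x)(m := t)) = trunc m (y(m := h y))" by metis
    then have "trunc m x = y" using y(1) C trunc_Rn[of y m] by auto
    moreover have "t = h y" using fun_cong[OF y(2), of m] by simp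
    ultimately show "trunc m x \<in> C \<and> t = h (trunc m x)" using y by auto
  qed auto
  have d: "Def (\<lambda>x. (trunc m (\<lambda>i. x (Suc i)))(m := x 0) \<in> ?G)"
    by (rule Def_mem[OF G]) (intro defi, simp)
  have d2: "Def (\<lambda>x. trunc m (\<lambda>i. x (Suc i)) \<in> C)"
    by (rule Def_mem_trunc[OF assms(1)]) (intro defi)
  have "Def (\<lambda>x. (trunc m (\<lambda>i. x (Suc i)))(m := x 0) \<in> ?G \<or> \<not> trunc m (\<lambda>i. x (Suc i)) \<in> C \<and> x 0 = 0)"
    by (intro Def_disj Def_conj Def_not Def_eq DefT_var DefT_const d d2)
  then show ?thesis unfolding DefT_def
    by (rule back_subst[of Def]) (unfold *, auto simp: extend0_def)
qed

text \<open>Bridge between functions given by a definable graph over \<open>C\<close> and total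
  terms; later arguments compute with terms only.\<close>

lemma definable_fun_iff:
  assumes "C \<in> S m" shows "definable_fun S m C h \<longleftrightarrow> (\<exists>h'. DefT h' \<and> (\<forall>x\<in>C. h x = h' x))"
proof
  assume "definable_fun S m C h"
  then show "\<exists>h'. DefT h' \<and> (\<forall>x\<in>C. h x = h' x)"
    using DefT_extend0[OF assms] extend0_eq[OF definable_subset[OF assms]] by metis
next
  assume "\<exists>h'. DefT h' \<and> (\<forall>x\<in>C. h x = h' x)"
  then obtain h' where h': "DefT h'" "\<And>x. x \<in> C \<Longrightarrow> h x = h' x" by blast
  have C: "C \<subseteq> Rn m" using definable_subset[OF assms] .
  have "DefT (\<lambda>x. h' (trunc m x))" by (rule DefT_comp[OF h'(1)]) (intro defi)
  then have "Def (\<lambda>x. trunc m x \<in> C \<and> x m = h' (trunc m x))"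
    by (intro Def_conj Def_in assms Def_eq DefT_var)
  from Def_set[OF this, of "Suc m"]
  have "{x \<in> Rn (Suc m). trunc m x \<in> C \<and> x m = h' (trunc m x)} \<in> S (Suc m)" .
  moreover have "(\<lambda>x. x(m := h x)) ` C = {x \<in> Rn (Suc m). trunc m x \<in> C \<and> x m = h' (trunc m x)}"
  proof (intro equalityI subsetI)
    fix z assume "z \<in> {x \<in> Rn (Suc m). trunc m x \<in> C \<and> x m = h' (trunc m x)}"
    then show "z \<in> (\<lambda>x. x(m := h x)) ` C" using h' Rn_Suc_upd_trunc[of z m]
      by (intro image_eqI[of _ _ "trunc m z"]) auto
  qed (use C h' in \<open>auto simp: trunc_Rn subset_iff\<close>)
  ultimately show "definable_fun S m C h" by (simp add: definable_fun_def)
qed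

text \<open>Isolates what a band needs from its floor: definability of the region above it, and
  upper semicontinuity with a uniform margin. In this form infinite bounds and continuous functions
  are treated alike; \<open>upper_bound\<close> is the mirror image for the ceiling.\<close>

definition lower_bound :: "nat \<Rightarrow> (nat \<Rightarrow> real) set \<Rightarrow> ((nat \<Rightarrow> real) \<Rightarrow> ereal) \<Rightarrow> bool" where
  "lower_bound m C f \<longleftrightarrow> Def (\<lambda>z. trunc m z \<in> C \<and> f (trunc m z) < ereal (z m)) \<and>
     (\<forall>x\<in>C. \<forall>t. f x < ereal t \<longrightarrow> (\<exists>s<t. \<exists>\<delta>>0. \<forall>y\<in>C. near m \<delta> x y \<longrightarrow> f y < ereal s))"

definition upper_bound :: "nat \<Rightarrow> (nat \<Rightarrow> real) set \<Rightarrow> ((nat \<Rightarrow> real) \<Rightarrow> ereal) \<Rightarrow> bool" where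
  "upper_bound m C f \<longleftrightarrow> Def (\<lambda>z. trunc m z \<in> C \<and> ereal (z m) < f (trunc m z)) \<and>
     (\<forall>x\<in>C. \<forall>t. ereal t < f x \<longrightarrow> (\<exists>s>t. \<exists>\<delta>>0. \<forall>y\<in>C. near m \<delta> x y \<longrightarrow> ereal s < f y))"

lemma cell_bound_cases:
  assumes "cell_bound S m C f" "C \<in> S m"
  obtains "\<And>x. x \<in> C \<Longrightarrow> f x = - \<infinity>" | "\<And>x. x \<in> C \<Longrightarrow> f x = \<infinity>"
  | h where "DefT h" "\<And>x. x \<in> C \<Longrightarrow> cont_at m C h x" "\<And>x. x \<in> C \<Longrightarrow> f x = ereal (h x)"
proof -
  have C: "C \<subseteq> Rn m" using definable_subset[OF assms(2)] .
  have "\<exists>h'. DefT h' \<and> (\<forall>x\<in>C. cont_at m C h' x) \<and> (\<forall>x\<in>C. f x = ereal (h' x))"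
    if h: "definable_fun S m C h" "continuous_on C h" "\<forall>x\<in>C. f x = ereal (h x)" for h
  proof -
    obtain h' where h': "DefT h'" "\<forall>x\<in>C. h x = h' x" using definable_fun_iff[OF assms(2)] h(1) by blast
    then have "continuous_on C h'" using h(2) by (metis continuous_on_cong)
    then show ?thesis using h' h(3) continuous_on_iff_cont_at[OF C] by auto
  qed
  then show ?thesis using assms(1) that unfolding cell_bound_def by metis
qed

lemma cell_bound_bounds:
  assumes "cell_bound S m C f" "C \<in> S m" shows "lower_bound m C f" "upper_bound m C f"
proof -
  have "lower_bound m C f \<and> upper_bound m C f"
    using assms
  proof (cases rule: cell_bound_cases)
    case 1
    have "(\<lambda>z. trunc m z \<in> C \<and> f (trunc m z) < ereal (z m)) = (\<lambda>z. trunc m z \<in> C)"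
      "(\<lambda>z. trunc m z \<in> C \<and> ereal (z m) < f (trunc m z)) = (\<lambda>z. False)" using 1 by auto
    then show ?thesis unfolding lower_bound_def upper_bound_def using 1 Def_in[OF assms(2)] Def_const
      by (auto simp: lt_ex gt_ex intro: exI[of _ "1::real"])
  next
    case 2
    have "(\<lambda>z. trunc m z \<in> C \<and> f (trunc m z) < ereal (z m)) = (\<lambda>z. False)"
      "(\<lambda>z. trunc m z \<in> C \<and> ereal (z m) < f (trunc m z)) = (\<lambda>z. trunc m z \<in> C)" using 2 by auto
    then show ?thesis unfolding lower_bound_def upper_bound_def using 2 Def_in[OF assms(2)] Def_const
      by (auto simp: lt_ex gt_ex intro: exI[of _ "1::real"])
  next
    case (3 h)
    have h: "DefT (\<lambda>x. h (trunc m x))" by (rule DefT_comp[OF 3(1)]) (intro defi)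
    have "Def (\<lambda>z. trunc m z \<in> C \<and> h (trunc m z) < z m)" "Def (\<lambda>z. trunc m z \<in> C \<and> z m < h (trunc m z))"
      by (intro Def_conj Def_in assms Def_less DefT_var h)+
    moreover have "(\<lambda>z. trunc m z \<in> C \<and> h (trunc m z) < z m) = (\<lambda>z. trunc m z \<in> C \<and> f (trunc m z) < ereal (z m))"
      "(\<lambda>z. trunc m z \<in> C \<and> z m < h (trunc m z)) = (\<lambda>z. trunc m z \<in> C \<and> ereal (z m) < f (trunc m z))"
      using 3(3) by auto
    moreover have "\<exists>s<t. \<exists>\<delta>>0. \<forall>y\<in>C. near m \<delta> x y \<longrightarrow> f y < ereal s" if x: "x \<in> C" "f x < ereal t" for x t
    proof -
      have "h x < t" using x 3(3) by auto
      then obtain \<delta> where \<delta>: "\<delta> > 0" "\<And>y. y \<in> C \<Longrightarrow> near m \<delta> x y \<Longrightarrow> \<bar>h y - h x\<bar> < (t - h x) / 2"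
        using 3(2)[OF x(1)] unfolding cont_at_def by (metis diff_gt_0_iff_gt half_gt_zero)
      have "f y < ereal ((t + h x) / 2)" if "y \<in> C" "near m \<delta> x y" for y
      proof -
        have "h y < (t + h x) / 2" using \<delta>(2)[OF that, unfolded abs_less_iff] by argo
        then show ?thesis using 3(3)[OF that(1)] by simp
      qed
      moreover have "(t + h x) / 2 < t" using \<open>h x < t\<close> by simp
      ultimately show ?thesis using \<delta>(1) by blast
    qed
    moreover have "\<exists>s>t. \<exists>\<delta>>0. \<forall>y\<in>C. near m \<delta> x y \<longrightarrow> ereal s < f y" if x: "x \<in> C" "ereal t < f x" for x t
    proof -
      have "t < h x" using x 3(3) by auto
      then obtain \<delta> where \<delta>: "\<delta> > 0" "\<And>y. y \<in> C \<Longrightarrow> near m \<delta> x y \<Longrightarrow> \<bar>h y - h x\<bar> < (h x - t) / 2"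
        using 3(2)[OF x(1)] unfolding cont_at_def by (metis diff_gt_0_iff_gt half_gt_zero)
      have "ereal ((t + h x) / 2) < f y" if "y \<in> C" "near m \<delta> x y" for y
      proof -
        have "(t + h x) / 2 < h y" using \<delta>(2)[OF that, unfolded abs_less_iff] by argo
        then show ?thesis using 3(3)[OF that(1)] by simp
      qed
      moreover have "t < (t + h x) / 2" using \<open>t < h x\<close> by simp
      ultimately show ?thesis using \<delta>(1) by blast
    qed
    ultimately show ?thesis unfolding lower_bound_def upper_bound_def by auto
  qed
  then show "lower_bound m C f" "upper_bound m C f" by auto
qed

lemma graph_set_eq:
  assumes "C \<subseteq> Rn m"
  shows "{x(m := f x) | x. x \<in> C} = {z \<in> Rn (Suc m). trunc m z \<in> C \<and> z m = f (trunc m z)}"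
proof (intro equalityI subsetI)
  fix z assume "z \<in> {z \<in> Rn (Suc m). trunc m z \<in> C \<and> z m = f (trunc m z)}"
  then show "z \<in> {x(m := f x) | x. x \<in> C}"
    using Rn_Suc_upd_trunc[of z m] by (intro CollectI exI[of _ "trunc m z"]) simp
qed (use assms in \<open>auto simp: trunc_Rn subset_iff\<close>)

lemma band_set_eq:
  assumes "C \<subseteq> Rn m"
  shows "{x(m := t) | x t. x \<in> C \<and> f x < ereal t \<and> ereal t < g x} =
     {z \<in> Rn (Suc m). (trunc m z \<in> C \<and> f (trunc m z) < ereal (z m)) \<and> (trunc m z \<in> C \<and> ereal (z m) < g (trunc m z))}"
proof (intro equalityI subsetI)
  fix z assume "z \<in> {z \<in> Rn (Suc m). (trunc m z \<in> C \<and> f (trunc m z) < ereal (z m)) \<and> (trunc m z \<in> C \<and> ereal (z m) < g (trunc m z))}"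
  then show "z \<in> {x(m := t) | x t. x \<in> C \<and> f x < ereal t \<and> ereal t < g x}"
    using Rn_Suc_upd_trunc[of z m, symmetric] by (intro CollectI exI[of _ "trunc m z"] exI[of _ "z m"]) blast
qed (use assms in \<open>auto simp: trunc_Rn subset_iff\<close>)

lemma cell_facts: "cell S m d C \<Longrightarrow> C \<in> S m \<and> C \<noteq> {}"
proof (induction rule: cell.induct)
  case point
  then show ?case using DefN_const[of 0 True] by (auto simp: DefN_def Rn_0)
next
  case (graph m d C f)
  then show ?case by (auto simp: definable_fun_def image_def Setcompr_eq_image)
next
  case (band m d C f g)
  then have C: "C \<in> S m" "C \<subseteq> Rn m" using definable_subset by auto
  have "{x(m := t) | x t. x \<in> C \<and> f x < ereal t \<and> ereal t < g x} \<in> S (Suc m)"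
    unfolding band_set_eq[OF C(2)]
    using cell_bound_bounds[OF band(2) C(1)] cell_bound_bounds[OF band(3) C(1)]
    by (intro Def_set Def_conj[of "\<lambda>z. trunc m z \<in> C \<and> f (trunc m z) < ereal (z m)"]) (auto simp: lower_bound_def upper_bound_def)
  moreover obtain x where "x \<in> C" "f x < g x" using band by auto
  then obtain t where "f x < ereal t" "ereal t < g x" using ereal_dense2 by blast
  ultimately show ?case using \<open>x \<in> C\<close> by blast
qed

lemma cell_definable: "cell S m d C \<Longrightarrow> C \<in> S m" using cell_facts by blast
lemma cell_nonempty: "cell S m d C \<Longrightarrow> C \<noteq> {}" using cell_facts by blast
lemma cell_subset: "cell S m d C \<Longrightarrow> C \<subseteq> Rn m" using cell_facts definable_subset by blast

text \<open>Restates the induction over cells with total continuous terms for graphs and with the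
  semicontinuity properties for bands, which hides the three cases of
  \<open>cell_bound\<close>.\<close>

lemma cell_induct [consumes 1, case_names point graph band]:
  assumes "cell S m d C"
    and "P 0 0 (Rn 0)"
    and "\<And>m d C f. cell S m d C \<Longrightarrow> P m d C \<Longrightarrow> C \<subseteq> Rn m \<Longrightarrow> DefT f \<Longrightarrow> (\<And>x. x \<in> C \<Longrightarrow> cont_at m C f x) \<Longrightarrow>
      P (Suc m) d {x(m := f x) | x. x \<in> C}"
    and "\<And>m d C f g. cell S m d C \<Longrightarrow> P m d C \<Longrightarrow> C \<subseteq> Rn m \<Longrightarrow> cell_bound S m C f \<Longrightarrow> cell_bound S m C g \<Longrightarrow>
      lower_bound m C f \<Longrightarrow> upper_bound m C g \<Longrightarrow> (\<And>x. x \<in> C \<Longrightarrow> f x < g x) \<Longrightarrow>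
      P (Suc m) (Suc d) {x(m := t) | x t. x \<in> C \<and> f x < ereal t \<and> ereal t < g x}"
  shows "P m d C"
  using assms(1)
proof (induction rule: cell.induct)
  case (graph m d C f)
  have C: "C \<in> S m" "C \<subseteq> Rn m" using graph cell_definable cell_subset by auto
  obtain h where h: "DefT h" "\<forall>x\<in>C. f x = h x" using definable_fun_iff[OF C(1)] graph by blast
  then have "continuous_on C h" using graph by (metis continuous_on_cong)
  then have c: "cont_at m C h x" if "x \<in> C" for x using continuous_on_iff_cont_at[OF C(2)] that by blast
  have "{x(m := f x) | x. x \<in> C} = {x(m := h x) | x. x \<in> C}" using h by force
  then show ?case using assms(3)[OF graph(1) graph.IH C(2) h(1) c] by simp
next
  case (band m d C f g)
  have C: "C \<in> S m" "C \<subseteq> Rn m" using band cell_definable cell_subset by auto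
  show ?case by (rule assms(4)) (use band C cell_bound_bounds in auto)
qed (rule assms(2))

lemma cell_graph:
  assumes "cell S m d C" "DefT f" "\<And>x. x \<in> C \<Longrightarrow> cont_at m C f x"
  shows "cell S (Suc m) d {x(m := f x) | x. x \<in> C}"
  using assms(2,3) definable_fun_iff[OF cell_definable[OF assms(1)]] continuous_on_iff_cont_at[OF cell_subset[OF assms(1)]]
  by (intro cell.graph[OF assms(1)]) auto

end

section \<open>Neighbourhoods inside cells\<close>

definition nb :: "nat \<Rightarrow> (nat \<Rightarrow> real) set \<Rightarrow> (nat \<Rightarrow> real) \<Rightarrow> real \<Rightarrow> (nat \<Rightarrow> real) set" where
  "nb m C x \<delta> = {y \<in> C. near m \<delta> x y}"

text \<open>Product neighbourhoods: the form in which an induction hypothesis on the base is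
  combined with the behaviour along the fibre.\<close>

definition slab :: "nat \<Rightarrow> (nat \<Rightarrow> real) set \<Rightarrow> (nat \<Rightarrow> real) \<Rightarrow> real \<Rightarrow> real \<Rightarrow> real \<Rightarrow> (nat \<Rightarrow> real) set" where
  "slab m C x \<delta> p q = {y(m := u) | y u. y \<in> nb m C x \<delta> \<and> p < u \<and> u < q}"

lemma nb_center: "x \<in> C \<Longrightarrow> \<delta> > 0 \<Longrightarrow> x \<in> nb m C x \<delta>"
  by (simp add: nb_def)

lemma nb_open: assumes "y \<in> nb m C x \<delta>" shows "\<exists>\<delta>'>0. nb m C y \<delta>' \<subseteq> nb m C x \<delta>"
proof -
  define d where "d = Min (insert 1 ((\<lambda>i. \<delta> - \<bar>y i - x i\<bar>) ` {..<m}))"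
  have "d > 0" using assms by (auto simp: d_def nb_def near_def)
  moreover have "d \<le> \<delta> - \<bar>y i - x i\<bar>" if "i < m" for i
    unfolding d_def using that by (intro Min_le) auto
  then have "nb m C y d \<subseteq> nb m C x \<delta>" by (fastforce simp: nb_def near_def)
  ultimately show ?thesis by blast
qed

lemma upd_inj: "x \<in> Rn m \<Longrightarrow> y \<in> Rn m \<Longrightarrow> x(m := s) = y(m := t) \<Longrightarrow> x = y \<and> s = t"
  by (metis fun_upd_same trunc_Rn trunc_upd)

lemma graph_nb:
  assumes "C \<subseteq> Rn m" "cont_at m C f x" "\<delta> > 0" "x \<in> C"
  shows "\<exists>\<delta>'>0. \<forall>y\<in>nb m C x \<delta>'. y(m := f y) \<in> nb (Suc m) {x(m := f x) | x. x \<in> C} (x(m := f x)) \<delta>"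
proof -
  obtain d where "d > 0" "\<And>y. y \<in> C \<Longrightarrow> near m d x y \<Longrightarrow> \<bar>f y - f x\<bar> < \<delta>"
    using assms(2,3) unfolding cont_at_def by blast
  moreover have "near m d x y \<and> near m \<delta> x y" if "near m (min d \<delta>) x y" for y
    using that by (auto intro: near_mono)
  ultimately show ?thesis using assms(3)
    by (intro exI[of _ "min d \<delta>"]) (auto simp: nb_def near_Suc_upd)
qed

lemma graph_nb':
  assumes "C \<subseteq> Rn m" "x \<in> C"
  shows "nb (Suc m) {x(m := f x) | x. x \<in> C} (x(m := f x)) \<delta> \<subseteq> (\<lambda>y. y(m := f y)) ` nb m C x \<delta>"
  by (auto simp: nb_def near_Suc_upd)

lemma abs_half_add: fixes a b c e :: real shows "\<bar>a - b\<bar> < e / 2 \<Longrightarrow> \<bar>b - c\<bar> < e / 2 \<Longrightarrow> \<bar>a - c\<bar> < e"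
  by (smt (verit) field_sum_of_halves)

lemma abs_between:
  fixes a b c e :: real
  shows "a \<le> x \<and> x \<le> c \<or> c \<le> x \<and> x \<le> a \<Longrightarrow> \<bar>a - z\<bar> < e \<Longrightarrow> \<bar>c - z\<bar> < e \<Longrightarrow> \<bar>x - z\<bar> < e"
  by (smt (verit))

lemma cont_atD: "cont_at m C f x \<Longrightarrow> \<epsilon> > 0 \<Longrightarrow> \<exists>\<delta>>0. \<forall>y\<in>C. near m \<delta> x y \<longrightarrow> \<bar>f y - f x\<bar> < \<epsilon>"
  by (simp add: cont_at_def)

context o_minimal_structure
begin

text \<open>Semicontinuity keeps both bounds away from \<open>t\<close> over a whole neighbourhood
  of \<open>x\<close>, so a full box fits between them.\<close>

lemma band_slab:
  assumes C: "C \<subseteq> Rn m" and b: "lower_bound m C f" "upper_bound m C g"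
    and x: "x \<in> C" "f x < ereal t" "ereal t < g x" and "\<delta> > 0"
  shows "\<exists>\<delta>'>0. \<exists>p q. p < t \<and> t < q \<and>
    slab m C x \<delta>' p q \<subseteq> nb (Suc m) {x(m := t) | x t. x \<in> C \<and> f x < ereal t \<and> ereal t < g x} (x(m := t)) \<delta>"
proof -
  obtain s1 d1 where 1: "s1 < t" "d1 > 0" "\<And>y. y \<in> C \<Longrightarrow> near m d1 x y \<Longrightarrow> f y < ereal s1"
    using b(1) x unfolding lower_bound_def by blast
  obtain s2 d2 where 2: "s2 > t" "d2 > 0" "\<And>y. y \<in> C \<Longrightarrow> near m d2 x y \<Longrightarrow> ereal s2 < g y"
    using b(2) x unfolding upper_bound_def by blast
  let ?d = "min \<delta> (min d1 d2)" and ?p = "max s1 (t - \<delta>)" and ?q = "min s2 (t + \<delta>)"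
  have "y(m := u) \<in> nb (Suc m) {x(m := t) | x t. x \<in> C \<and> f x < ereal t \<and> ereal t < g x} (x(m := t)) \<delta>"
    if y: "y \<in> nb m C x ?d" "?p < u" "u < ?q" for y u
  proof -
    have n: "y \<in> C" "near m \<delta> x y" "near m d1 x y" "near m d2 x y"
      using y(1) by (auto simp: nb_def intro: near_mono)
    have "f y < ereal u" using 1(3)[OF n(1,3)] y(2) by (metis dual_order.strict_trans ereal_less(2) max_less_iff_conj less_ereal.simps(1))
    moreover have "ereal u < g y" using 2(3)[OF n(1,4)] y(3) by (metis dual_order.strict_trans min_less_iff_conj less_ereal.simps(1))
    ultimately show ?thesis using n y by (auto simp: nb_def near_Suc_upd)
  qed
  then have "slab m C x ?d ?p ?q \<subseteq> nb (Suc m) {x(m := t) | x t. x \<in> C \<and> f x < ereal t \<and> ereal t < g x} (x(m := t)) \<delta>"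
    unfolding slab_def by blast
  moreover have "?p < t" "t < ?q" "?d > 0" using 1 2 \<open>\<delta> > 0\<close> by auto
  ultimately show ?thesis by blast
qed

text \<open>Converse of \<open>band_slab\<close>: a radius of at most half the width keeps the last
  coordinate, centred at the midpoint, between \<open>p\<close> and \<open>q\<close>.\<close>

lemma band_nb:
  assumes "C \<subseteq> Rn m" "p < q"
  shows "nb (Suc m) {x(m := t) | x t. x \<in> C \<and> f x < ereal t \<and> ereal t < g x} (x(m := (p + q) / 2)) (min \<delta> ((q - p) / 2))
     \<subseteq> slab m C x \<delta> p q"
proof
  fix z assume "z \<in> nb (Suc m) {x(m := t) | x t. x \<in> C \<and> f x < ereal t \<and> ereal t < g x} (x(m := (p + q) / 2)) (min \<delta> ((q - p) / 2))"
  then obtain y u where z: "z = y(m := u)" "y \<in> C" "near m (min \<delta> ((q - p) / 2)) x y" "\<bar>u - (p + q) / 2\<bar> < min \<delta> ((q - p) / 2)"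
    by (auto simp: nb_def near_Suc_upd)
  then have "y \<in> nb m C x \<delta>" by (auto simp: nb_def intro: near_mono)
  moreover have "p < u" "u < q" using z(4) by (auto simp: abs_less_iff field_simps)
  ultimately show "z \<in> slab m C x \<delta> p q" using z(1) by (auto simp: slab_def)
qed

lemma slab_center:
  assumes "p < q" "x \<in> C" "\<delta> > 0" shows "x(m := (p + q) / 2) \<in> slab m C x \<delta> p q"
  unfolding slab_def using assms by (intro CollectI exI[of _ x] exI[of _ "(p + q) / 2"]) (auto simp: nb_def)

text \<open>
  The analogue for cells of the countable additivity of null sets: a definable set without interior
  points is negligible. On a band the inner step is the uncountability of the line.
\<close>

lemma cell_sigma:
  assumes "cell S m d C" "\<And>k::nat. Def (A k)" "x \<in> C" "\<delta> > 0" "\<And>y. y \<in> nb m C x \<delta> \<Longrightarrow> \<exists>k. A k y"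
  shows "\<exists>k. \<exists>x'\<in>C. \<exists>\<delta>'>0. nb m C x' \<delta>' \<subseteq> {y \<in> nb m C x \<delta>. A k y}"
  using assms
proof (induction arbitrary: A x \<delta> rule: cell_induct)
  case point
  obtain k where "A k x" using point(4)[of x] point(2,3) nb_center by blast
  then show ?case using point(2,3) by (intro exI[of _ k] bexI[of _ x] exI[of _ \<delta>]) (auto simp: nb_def Rn_0)
next
  case (graph m d C f)
  obtain x0 where x0: "x0 \<in> C" "x = x0(m := f x0)" using graph by auto
  let ?C = "{x(m := f x) | x. x \<in> C}"
  obtain \<delta>0 where \<delta>0: "\<delta>0 > 0" "\<And>y. y \<in> nb m C x0 \<delta>0 \<Longrightarrow> y(m := f y) \<in> nb (Suc m) ?C x \<delta>"
    using graph_nb[OF graph(2) graph(4)[OF x0(1)] \<open>\<delta> > 0\<close> x0(1)] x0 by blast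
  have D: "Def (\<lambda>y. A k (y(m := f y)))" for k
    by (rule Def_comp[OF graph.prems(1)]) (intro defi graph(3))
  obtain k x1 \<delta>1 where 1: "x1 \<in> C" "\<delta>1 > 0" "nb m C x1 \<delta>1 \<subseteq> {y \<in> nb m C x0 \<delta>0. A k (y(m := f y))}"
    using graph.IH[of "\<lambda>k y. A k (y(m := f y))" x0 \<delta>0, OF D x0(1) \<delta>0(1)] graph.prems(4) \<delta>0(2) by blast
  have "nb (Suc m) ?C (x1(m := f x1)) \<delta>1 \<subseteq> {y \<in> nb (Suc m) ?C x \<delta>. A k y}"
    using graph_nb'[OF graph(2) 1(1), of f \<delta>1] 1(3) \<delta>0(2) by blast
  then show ?case using 1 by blast
next
  case (band m d C f g)
  let ?C = "{x(m := t) | x t. x \<in> C \<and> f x < ereal t \<and> ereal t < g x}"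
  obtain x0 t0 where x0: "x0 \<in> C" "x = x0(m := t0)" "f x0 < ereal t0" "ereal t0 < g x0" using band.prems(2) by blast
  obtain \<delta>0 p q where \<delta>0: "\<delta>0 > 0" "p < t0" "t0 < q" "slab m C x0 \<delta>0 p q \<subseteq> nb (Suc m) ?C x \<delta>"
    using band_slab[OF band(2,5,6) x0(1,3,4) \<open>\<delta> > 0\<close>] x0(2) by blast
  have bx: "y(m := u) \<in> nb (Suc m) ?C x \<delta>" if "y \<in> nb m C x0 \<delta>0" "p < u" "u < q" for y u
    using \<delta>0(4) that by (auto simp: slab_def)
  \<comment> \<open>A code \<open>j\<close> names an index \<open>k\<close> together with a rational
    interval of the fibre on which \<open>A k\<close> holds; as there are countably many codes, the
    induction hypothesis applies to them on the base.\<close>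
  define B where "B j y = (case from_nat j :: nat \<times> rat \<times> rat of (k, r, s) \<Rightarrow>
     p < of_rat r \<and> (of_rat r :: real) < of_rat s \<and> of_rat s < q \<and> (\<forall>t. of_rat r < t \<and> t < of_rat s \<longrightarrow> A k (y(m := t))))" for j y
  have DA: "Def (\<lambda>x. A k ((\<lambda>i. x (Suc i))(m := x 0)))" for k
    by (rule Def_comp[OF band.prems(1)]) (intro defi)
  have D: "Def (B j)" for j
    unfolding B_def by (cases "from_nat j :: nat \<times> rat \<times> rat") (simp, intro defi DA)
  have cov: "\<exists>j. B j y" if y: "y \<in> nb m C x0 \<delta>0" for y
  proof -
    have "\<exists>k. t \<in> {t. A k (y(m := t))}" if "p < t" "t < q" for t
      using band.prems(4)[OF bx[OF y that]] by blast
    then obtain k where "infinite {t. p < t \<and> t < q \<and> A k (y(m := t))}"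
      using uncountable_cover[of p q "\<lambda>k. {t. A k (y(m := t))}"] \<delta>0 by auto
    from tame_infinite[OF Def_tame[OF band.prems(1)] this]
    obtain r s where "p < r" "r < s" "s < q" "r \<in> \<rat>" "s \<in> \<rat>" "\<And>t. r < t \<and> t < s \<Longrightarrow> A k (y(m := t))" by blast
    then obtain r' s' where "r = of_rat r'" "s = of_rat s'" by (auto elim!: Rats_cases)
    then have "B (to_nat (k, r', s')) y" using \<open>p < r\<close> \<open>r < s\<close> \<open>s < q\<close> \<open>\<And>t. r < t \<and> t < s \<Longrightarrow> A k (y(m := t))\<close>
      by (simp add: B_def)
    then show ?thesis by blast
  qed
  obtain j x1 \<delta>1 where 1: "x1 \<in> C" "\<delta>1 > 0" "nb m C x1 \<delta>1 \<subseteq> {y \<in> nb m C x0 \<delta>0. B j y}"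
    using band.IH[of B x0 \<delta>0, OF D x0(1) \<delta>0(1) cov] by blast
  obtain k :: nat and r s :: rat where j: "from_nat j = (k, r, s)" by (metis prod_cases3)
  let ?r = "of_rat r :: real" and ?s = "of_rat s :: real"
  have Bj: "p < ?r" "?r < ?s" "?s < q" using 1(3) nb_center[OF 1(1,2), of m] j by (auto simp: B_def)
  have sub: "slab m C x1 \<delta>1 ?r ?s \<subseteq> {y \<in> nb (Suc m) ?C x \<delta>. A k y}"
  proof
    fix z assume "z \<in> slab m C x1 \<delta>1 ?r ?s"
    then obtain y u where z: "z = y(m := u)" "y \<in> nb m C x1 \<delta>1" "?r < u" "u < ?s" by (auto simp: slab_def)
    have "B j y" "y \<in> nb m C x0 \<delta>0" using z(2) 1(3) by auto
    then show "z \<in> {y \<in> nb (Suc m) ?C x \<delta>. A k y}"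
      using z j Bj bx[of y u] by (auto simp: B_def)
  qed
  let ?x = "x1(m := (?r + ?s) / 2)"
  have "?x \<in> slab m C x1 \<delta>1 ?r ?s" using slab_center Bj 1 by blast
  then have "?x \<in> ?C" using sub by (auto simp: nb_def)
  moreover have "nb (Suc m) ?C ?x (min \<delta>1 ((?s - ?r) / 2)) \<subseteq> {y \<in> nb (Suc m) ?C x \<delta>. A k y}"
    using band_nb[OF band(2) Bj(2), of f g x1 \<delta>1] sub by blast
  moreover have "min \<delta>1 ((?s - ?r) / 2) > 0" using 1 Bj by auto
  ultimately show ?case by blast
qed

lemma cell_sigma_countable:
  fixes A :: "'k::countable \<Rightarrow> _"
  assumes "cell S m d C" "\<And>k. Def (A k)" "x \<in> C" "\<delta> > 0" "\<And>y. y \<in> nb m C x \<delta> \<Longrightarrow> \<exists>k. A k y"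
  obtains k x' \<delta>' where "x' \<in> C" "\<delta>' > 0" "nb m C x' \<delta>' \<subseteq> nb m C x \<delta>" "\<And>y. y \<in> nb m C x' \<delta>' \<Longrightarrow> A k y"
proof -
  have "\<exists>n. A (from_nat n) y" if "y \<in> nb m C x \<delta>" for y
    using assms(5)[OF that] by (metis from_nat_to_nat)
  from cell_sigma[of m d C "\<lambda>n. A (from_nat n)", OF assms(1,2,3,4) this] show ?thesis using that by blast
qed

lemma Def_cont_at:
  assumes "C \<in> S m" "DefT f" shows "Def (\<lambda>x. cont_at m C (\<lambda>w. f (w(m := x m))) (trunc m x))"
proof -
  have f: "DefT (\<lambda>x. f ((T x)(m := x k)))" if "\<And>i. DefT (\<lambda>x. T x i)" for T k
    by (rule DefT_comp[OF assms(2)]) (intro defi that)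
  show ?thesis unfolding cont_at_def by (intro Def_all_S[OF assms(1)] f defi)
qed

lemma Def_cont_at': assumes "C \<in> S m" "DefT f" shows "Def (\<lambda>x. cont_at m C f (trunc m x))"
proof -
  have f: "DefT (\<lambda>x. f (trunc m (T x)))" if "\<And>i. DefT (\<lambda>x. T x i)" for T
    by (rule DefT_comp[OF assms(2)]) (intro defi that)
  show ?thesis unfolding cont_at_def by (intro Def_all_S[OF assms(1)] f defi)
qed

text \<open>
  On a band, \<open>f\<close> is monotone and continuous in the last variable on a fixed interval, and continuous in
  the others by induction; monotonicity makes it jointly continuous.
\<close>

lemma cell_cont:
  assumes "cell S m d C" "DefT f" "x \<in> C" "\<delta> > 0"
  shows "\<exists>x'\<in>C. \<exists>\<delta>'>0. nb m C x' \<delta>' \<subseteq> {y \<in> nb m C x \<delta>. cont_at m C f y}"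
  using assms
proof (induction arbitrary: f x \<delta> rule: cell_induct)
  case point
  then show ?case by (intro bexI[of _ x] exI[of _ \<delta>]) (auto simp: nb_def cont_at_def Rn_0 intro: exI[of _ 1])
next
  case (graph m d C h)
  obtain x0 where x0: "x0 \<in> C" "x = x0(m := h x0)" using graph by auto
  let ?C = "{x(m := h x) | x. x \<in> C}"
  obtain \<delta>0 where \<delta>0: "\<delta>0 > 0" "\<And>y. y \<in> nb m C x0 \<delta>0 \<Longrightarrow> y(m := h y) \<in> nb (Suc m) ?C x \<delta>"
    using graph_nb[OF graph(2) graph(4)[OF x0(1)] \<open>\<delta> > 0\<close> x0(1)] x0 by blast
  let ?f = "\<lambda>y. f (y(m := h y))"
  have "DefT ?f" by (rule DefT_comp[OF graph.prems(1)]) (intro defi graph(3))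
  from graph.IH[OF this x0(1) \<delta>0(1)]
  obtain x1 \<delta>1 where 1: "x1 \<in> C" "\<delta>1 > 0" "nb m C x1 \<delta>1 \<subseteq> {y \<in> nb m C x0 \<delta>0. cont_at m C ?f y}"
    by (elim bexE exE conjE)
  have "cont_at (Suc m) ?C f (y(m := h y))" if "cont_at m C ?f y" for y
    unfolding cont_at_def
  proof (intro allI impI)
    fix \<epsilon> :: real assume "\<epsilon> > 0"
    from cont_atD[OF that this]
    obtain \<delta>' where \<delta>': "\<delta>' > 0 \<and> (\<forall>z\<in>C. near m \<delta>' y z \<longrightarrow> \<bar>?f z - ?f y\<bar> < \<epsilon>)" by (elim exE)
    have "\<forall>z\<in>?C. near (Suc m) \<delta>' (y(m := h y)) z \<longrightarrow> \<bar>f z - f (y(m := h y))\<bar> < \<epsilon>"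
    proof (intro ballI impI)
      fix z assume z: "z \<in> ?C" "near (Suc m) \<delta>' (y(m := h y)) z"
      then obtain w where w: "z = w(m := h w)" "w \<in> C" by (elim CollectE exE conjE)
      show "\<bar>f z - f (y(m := h y))\<bar> < \<epsilon>"
        using \<delta>'[THEN conjunct2, THEN bspec, OF w(2), THEN mp] z(2) unfolding w(1) near_Suc_upd by (elim conjE)
    qed
    then show "\<exists>\<delta>>0. \<forall>z\<in>?C. near (Suc m) \<delta> (y(m := h y)) z \<longrightarrow> \<bar>f z - f (y(m := h y))\<bar> < \<epsilon>"
      using \<delta>' by blast
  qed
  then have "nb (Suc m) ?C (x1(m := h x1)) \<delta>1 \<subseteq> {y \<in> nb (Suc m) ?C x \<delta>. cont_at (Suc m) ?C f y}"
    using graph_nb'[OF graph(2) 1(1), of h \<delta>1] 1(3) \<delta>0(2) by blast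
  then show ?case using 1 by blast
next
  case (band m d C l g)
  let ?C = "{x(m := t) | x t. x \<in> C \<and> l x < ereal t \<and> ereal t < g x}"
  note f = band.prems(1)
  have CS: "C \<in> S m" using cell_definable band(1) .
  obtain x0 t0 where x0: "x0 \<in> C" "x = x0(m := t0)" "l x0 < ereal t0" "ereal t0 < g x0" using band.prems(2) by blast
  obtain \<delta>0 p q where \<delta>0: "\<delta>0 > 0" "p < t0" "t0 < q" "slab m C x0 \<delta>0 p q \<subseteq> nb (Suc m) ?C x \<delta>"
    using band_slab[OF band(2,5,6) x0(1,3,4) \<open>\<delta> > 0\<close>] x0(2) by blast
  have fd: "DefT (\<lambda>x. f ((T x)(m := h x)))" if "\<And>i. DefT (\<lambda>x. T x i)" "DefT h" for T h
    by (rule DefT_comp[OF f]) (intro defi that)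
  \<comment> \<open>The code consists of a rational interval and a direction of monotonicity, with
    continuity along the fibre as part of the condition; the codes are countable, so one of them
    holds throughout some neighbourhood.\<close>
  define B where "B = (\<lambda>(r, s, b) y. p < of_rat r \<and> (of_rat r :: real) < of_rat s \<and> of_rat s < q \<and>
     (b \<longrightarrow> (\<forall>t u. of_rat r < t \<and> t \<le> u \<and> u < of_rat s \<longrightarrow> f (y(m := t)) \<le> f (y(m := u)))) \<and>
     (\<not> b \<longrightarrow> (\<forall>t u. of_rat r < t \<and> t \<le> u \<and> u < of_rat s \<longrightarrow> f (y(m := u)) \<le> f (y(m := t)))) \<and>
     (\<forall>t. of_rat r < t \<and> t < of_rat s \<longrightarrow> (\<forall>\<epsilon>>0. \<exists>\<delta>>0. \<forall>u. \<bar>u - t\<bar> < \<delta> \<longrightarrow> \<bar>f (y(m := u)) - f (y(m := t))\<bar> < \<epsilon>)))"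
  have DB: "Def (B (r, s, b))" for r s b
    unfolding B_def by simp (intro defi fd)
  have DB': "Def (B k)" for k using DB by (cases k) simp
  have "\<exists>k. B k y" if "y \<in> nb m C x0 \<delta>0" for y
  proof -
    have DD: "DefT (\<lambda>x. f (y(m := x 0)))" by (intro fd defi)
    have pq: "p < q" using \<delta>0(2,3) by simp
    from monotone_subinterval[of "\<lambda>t. f (y(m := t))", OF DD pq] obtain r s where rs: "p < r \<and> r < s \<and> s < q \<and> r \<in> \<rat> \<and> s \<in> \<rat> \<and>
      ((\<forall>t u. r < t \<and> t \<le> u \<and> u < s \<longrightarrow> f (y(m := t)) \<le> f (y(m := u))) \<or> (\<forall>t u. r < t \<and> t \<le> u \<and> u < s \<longrightarrow> f (y(m := u)) \<le> f (y(m := t)))) \<and>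
      (\<forall>t. r < t \<and> t < s \<longrightarrow> (\<forall>\<epsilon>>0. \<exists>\<delta>>0. \<forall>u. \<bar>u - t\<bar> < \<delta> \<longrightarrow> \<bar>f (y(m := u)) - f (y(m := t))\<bar> < \<epsilon>))"
      by (elim exE)
    have rr: "r \<in> \<rat>" using rs by (elim conjE)
    have ss: "s \<in> \<rat>" using rs by (elim conjE)
    obtain r' s' where eqs: "r = of_rat r'" "s = of_rat s'" using rr ss by (elim Rats_cases)
    have split: "\<And>a b c d e M N K. a \<and> b \<and> c \<and> d \<and> e \<and> (M \<or> N) \<and> K \<Longrightarrow> a \<and> b \<and> c \<and> (M \<longrightarrow> M) \<and> (\<not> M \<longrightarrow> N) \<and> K"
      by blast
    have "B (r', s', \<forall>t u. r < t \<and> t \<le> u \<and> u < s \<longrightarrow> f (y(m := t)) \<le> f (y(m := u))) y"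
      unfolding B_def prod.case eqs by (rule split[OF rs[unfolded eqs]])
    then show ?thesis by (rule exI)
  qed
  from cell_sigma_countable[of m d C B, OF band(1) DB' x0(1) \<delta>0(1) this]
  obtain k x1 \<delta>1 where 1: "x1 \<in> C" "\<delta>1 > 0" "nb m C x1 \<delta>1 \<subseteq> nb m C x0 \<delta>0" "\<And>y. y \<in> nb m C x1 \<delta>1 \<Longrightarrow> B k y" by metis
  obtain r0 s0 b where k: "k = (r0, s0, b)" by (metis prod_cases3)
  define r s where "r = (of_rat r0 :: real)" and "s = (of_rat s0 :: real)"
  have B1: "p < r" "r < s" "s < q" using 1(4)[OF nb_center[OF 1(1,2)]] by (auto simp: B_def k r_def s_def)
  have mono: "b \<longrightarrow> f (y(m := t)) \<le> f (y(m := u))" "\<not> b \<longrightarrow> f (y(m := u)) \<le> f (y(m := t))"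
    if "y \<in> nb m C x1 \<delta>1" "r < t" "t \<le> u" "u < s" for y t u
    using 1(4)[OF that(1)] that unfolding B_def k prod.case r_def s_def by blast+
  have cont: "\<exists>\<delta>>0. \<forall>u. \<bar>u - t\<bar> < \<delta> \<longrightarrow> \<bar>f (y(m := u)) - f (y(m := t))\<bar> < \<epsilon>"
    if "y \<in> nb m C x1 \<delta>1" "r < t" "t < s" "\<epsilon> > 0" for y t \<epsilon>
    using 1(4)[OF that(1)] that unfolding B_def k prod.case r_def s_def by blast
  \<comment> \<open>Over a fixed base point, continuity in the base variables is a tame property of
    the height \<open>t\<close>; its truth value \<open>c\<close> becomes constant on a rational
    interval.\<close>
  define E where "E = (\<lambda>(r', s', c) y. r < of_rat r' \<and> (of_rat r' :: real) < of_rat s' \<and> of_rat s' < s \<and>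
     (\<forall>t. of_rat r' < t \<and> t < of_rat s' \<longrightarrow> cont_at m C (\<lambda>w. f (w(m := t))) (trunc m y) = c))"
  have Dc: "Def (\<lambda>x. cont_at m C (\<lambda>w. f (w(m := x 0))) (trunc m (\<lambda>i. x (Suc i))))"
  proof -
    have T: "DefT (\<lambda>x. ((\<lambda>i. x (Suc i))(m := x 0)) i)" for i by (intro defi)
    show ?thesis
      using Def_comp[OF Def_cont_at[OF CS f], of "\<lambda>x. (\<lambda>i. x (Suc i))(m := x 0)", OF T]
      by (simp only: fun_upd_same trunc_upd)
  qed
  have DE: "Def (E (r', s', c))" for r' s' c
    unfolding E_def by simp (intro defi Dc)
  have DE': "Def (E k)" for k using DE by (cases k) simp
  have "\<exists>k. E k y" if y: "y \<in> nb m C x1 \<delta>1" for y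
  proof -
    have ty: "trunc m y = y" using y band(2) by (auto simp: nb_def trunc_Rn subset_iff)
    let ?D = "\<lambda>t. cont_at m C (\<lambda>w. f (w(m := t))) y"
    obtain c where c: "infinite {t. r < t \<and> t < s \<and> (?D t = c)}"
      using uncountable_cover[of r s "\<lambda>c. {t. ?D t = c}"] B1 by auto
    have "Def (\<lambda>x. cont_at m C (\<lambda>w. f (w(m := x m))) (trunc m x) = c)"
      by (intro Def_iff Def_cont_at CS f defi)
    from Def_tame[OF this, of y m] have "tame (\<lambda>t. ?D t = c)" by (simp add: ty)
    from tame_infinite[OF this c]
    obtain r' s' where rs: "r < r'" "r' < s'" "s' < s" "r' \<in> \<rat>" "s' \<in> \<rat>" "\<And>t. r' < t \<and> t < s' \<Longrightarrow> ?D t = c" by blast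
    then obtain r'' s'' where "r' = of_rat r''" "s' = of_rat s''" by (auto elim!: Rats_cases)
    then have "E (r'', s'', c) y" unfolding E_def prod.case ty using rs by blast
    then show ?thesis by blast
  qed
  from cell_sigma_countable[of m d C E, OF band(1) DE' 1(1,2) this]
  obtain k x2 \<delta>2 where 2: "x2 \<in> C" "\<delta>2 > 0" "nb m C x2 \<delta>2 \<subseteq> nb m C x1 \<delta>1" "\<And>y. y \<in> nb m C x2 \<delta>2 \<Longrightarrow> E k y" by metis
  obtain r0' s0' c where k: "k = (r0', s0', c)" by (metis prod_cases3)
  define r' s' where "r' = (of_rat r0' :: real)" and "s' = (of_rat s0' :: real)"
  have E1: "r < r'" "r' < s'" "s' < s" using 2(4)[OF nb_center[OF 2(1,2)]] by (auto simp: E_def k r'_def s'_def)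
  have Ec: "cont_at m C (\<lambda>w. f (w(m := t))) y = c" if "y \<in> nb m C x2 \<delta>2" "r' < t" "t < s'" for y t
  proof -
    have "trunc m y = y" using that band(2) by (auto simp: nb_def trunc_Rn subset_iff)
    then show ?thesis using 2(4)[OF that(1)] that(2,3) by (auto simp: E_def k r'_def s'_def)
  qed
  \<comment> \<open>The induction hypothesis at a single height provides a point of continuity,
    which excludes the value \<open>False\<close>.\<close>
  have c
  proof -
    have "DefT (\<lambda>w. f (w(m := (r' + s') / 2)))" by (intro fd defi)
    from band.IH[OF this 2(1,2)] obtain x3 \<delta>3 where "x3 \<in> C" "\<delta>3 > 0"
      "nb m C x3 \<delta>3 \<subseteq> {y \<in> nb m C x2 \<delta>2. cont_at m C (\<lambda>w. f (w(m := (r' + s') / 2))) y}" by blast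
    then have "x3 \<in> nb m C x2 \<delta>2" "cont_at m C (\<lambda>w. f (w(m := (r' + s') / 2))) x3"
      using nb_center by blast+
    then show c using Ec[of x3 "(r' + s') / 2"] E1 by auto
  qed
  have cont2: "cont_at (Suc m) ?C f (y(m := t))" if y: "y \<in> nb m C x2 \<delta>2" and t: "r' < t" "t < s'" for y t
    unfolding cont_at_def
  proof (intro allI impI)
    fix \<epsilon> :: real assume \<epsilon>: "\<epsilon> > 0"
    have y1: "y \<in> nb m C x1 \<delta>1" using y 2(3) by blast
    obtain \<delta>a where a: "\<delta>a > 0" "\<And>u. \<bar>u - t\<bar> < \<delta>a \<Longrightarrow> \<bar>f (y(m := u)) - f (y(m := t))\<bar> < \<epsilon> / 2"
      using cont[OF y1, of t "\<epsilon> / 2"] t E1 \<epsilon> by auto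
    \<comment> \<open>The heights \<open>t - \<eta>\<close> and \<open>t + \<eta>\<close> are
      compared with \<open>t\<close> along the fibre and with nearby base points; monotonicity traps
      all values at heights between them.\<close>
    define \<eta> where "\<eta> = min (\<delta>a / 2) (min ((t - r') / 2) ((s' - t) / 2))"
    have \<eta>: "\<eta> > 0" "\<eta> < \<delta>a" "r' < t - \<eta>" "t + \<eta> < s'" using a t by (auto simp: \<eta>_def min_def field_simps)
    have cb: "\<exists>\<delta>>0. \<forall>w\<in>C. near m \<delta> y w \<longrightarrow> \<bar>f (w(m := u)) - f (y(m := u))\<bar> < \<epsilon> / 2" if "r' < u" "u < s'" for u
      by (rule cont_atD[OF _ half_gt_zero[OF \<epsilon>]]) (simp only: Ec[OF y that] \<open>c\<close>)
    have \<eta>': "t - \<eta> < s'" "r' < t + \<eta>" using \<eta> t by auto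
    from cb[OF \<eta>(3) \<eta>'(1)] obtain \<delta>b1 where
      b1: "\<delta>b1 > 0 \<and> (\<forall>w\<in>C. near m \<delta>b1 y w \<longrightarrow> \<bar>f (w(m := t - \<eta>)) - f (y(m := t - \<eta>))\<bar> < \<epsilon> / 2)" by (elim exE)
    from cb[OF \<eta>'(2) \<eta>(4)] obtain \<delta>b2 where
      b2: "\<delta>b2 > 0 \<and> (\<forall>w\<in>C. near m \<delta>b2 y w \<longrightarrow> \<bar>f (w(m := t + \<eta>)) - f (y(m := t + \<eta>))\<bar> < \<epsilon> / 2)" by (elim exE)
    note b = b1[THEN conjunct1] b2[THEN conjunct1] b1[THEN conjunct2, THEN bspec, THEN mp] b2[THEN conjunct2, THEN bspec, THEN mp]
    obtain \<delta>c where c: "\<delta>c > 0" "nb m C y \<delta>c \<subseteq> nb m C x1 \<delta>1" using nb_open[OF y1] by blast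
    let ?\<delta> = "min (min \<delta>b1 \<delta>b2) (min \<delta>c \<eta>)"
    have main: "\<bar>f (w(m := u)) - f (y(m := t))\<bar> < \<epsilon>" if w: "w \<in> C" "near m ?\<delta> y w" "\<bar>u - t\<bar> < ?\<delta>" for w u
    proof -
      have n: "near m \<delta>b1 y w" "near m \<delta>b2 y w" "near m \<delta>c y w" using w(2) by (auto intro: near_mono)
      have w1: "w \<in> nb m C x1 \<delta>1" using c n w by (auto simp: nb_def)
      have u: "t - \<eta> \<le> u" "u \<le> t + \<eta>" "r < t - \<eta>" "t + \<eta> < s" "r < u" "u < s" using w(3) \<eta> E1 by (auto simp: abs_less_iff)
      have 1: "\<bar>f (w(m := t - \<eta>)) - f (y(m := t))\<bar> < \<epsilon>"
        by (rule abs_half_add[OF b(3)[OF w(1) n(1)] a(2)]) (use \<eta> in simp)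
      have 2: "\<bar>f (w(m := t + \<eta>)) - f (y(m := t))\<bar> < \<epsilon>"
        by (rule abs_half_add[OF b(4)[OF w(1) n(2)] a(2)]) (use \<eta> in simp)
      show ?thesis
      proof (rule abs_between[OF _ 1 2])
        show "f (w(m := t - \<eta>)) \<le> f (w(m := u)) \<and> f (w(m := u)) \<le> f (w(m := t + \<eta>)) \<or>
          f (w(m := t + \<eta>)) \<le> f (w(m := u)) \<and> f (w(m := u)) \<le> f (w(m := t - \<eta>))"
          using mono[OF w1 u(3,1,6)] mono[OF w1 u(5,2,4)] by (cases b) simp_all
      qed
    qed
    have "\<forall>z\<in>?C. near (Suc m) ?\<delta> (y(m := t)) z \<longrightarrow> \<bar>f z - f (y(m := t))\<bar> < \<epsilon>"
    proof (intro ballI impI)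
      fix z assume z: "z \<in> ?C" "near (Suc m) ?\<delta> (y(m := t)) z"
      then obtain w u where w: "z = w(m := u)" "w \<in> C" by (elim CollectE exE conjE)
      show "\<bar>f z - f (y(m := t))\<bar> < \<epsilon>"
        using main[OF w(2), of u] z(2) unfolding w(1) near_Suc_upd by (elim conjE)
    qed
    moreover have "?\<delta> > 0" using b(1,2) c(1) \<eta>(1) by simp
    ultimately show "\<exists>\<delta>>0. \<forall>z\<in>?C. near (Suc m) \<delta> (y(m := t)) z \<longrightarrow> \<bar>f z - f (y(m := t))\<bar> < \<epsilon>"
      by blast
  qed
  have sub: "slab m C x2 \<delta>2 r' s' \<subseteq> {y \<in> nb (Suc m) ?C x \<delta>. cont_at (Suc m) ?C f y}"
  proof
    fix z assume "z \<in> slab m C x2 \<delta>2 r' s'"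
    then obtain y u where z: "z = y(m := u)" "y \<in> nb m C x2 \<delta>2" "r' < u" "u < s'" by (auto simp: slab_def)
    then have "z \<in> slab m C x0 \<delta>0 p q" using 1(3) 2(3) E1 B1
      unfolding slab_def by (intro CollectI exI[of _ y] exI[of _ u]) auto
    then show "z \<in> {y \<in> nb (Suc m) ?C x \<delta>. cont_at (Suc m) ?C f y}"
      using \<delta>0(4) cont2[OF z(2-4)] z(1) by auto
  qed
  let ?x = "x2(m := (r' + s') / 2)"
  have "?x \<in> slab m C x2 \<delta>2 r' s'" using slab_center E1 2 by blast
  then have "?x \<in> ?C" using sub by (auto simp: nb_def)
  moreover have "nb (Suc m) ?C ?x (min \<delta>2 ((s' - r') / 2)) \<subseteq> {y \<in> nb (Suc m) ?C x \<delta>. cont_at (Suc m) ?C f y}"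
    using band_nb[OF band(2) E1(2), of l g x2 \<delta>2] sub by blast
  moreover have "min \<delta>2 ((s' - r') / 2) > 0" using 2 E1 by auto
  ultimately show ?case by blast
qed

lemma cell_cont_list:
  fixes k :: nat
  assumes "cell S m d C" "\<And>i. i < k \<Longrightarrow> DefT (f i)" "x \<in> C" "\<delta> > 0"
  shows "\<exists>x'\<in>C. \<exists>\<delta>'>0. nb m C x' \<delta>' \<subseteq> {y \<in> nb m C x \<delta>. \<forall>i<k. cont_at m C (f i) y}"
  using assms(2)
proof (induction k)
  case 0 then show ?case using assms by auto
next
  case (Suc k)
  then obtain x1 \<delta>1 where 1: "x1 \<in> C" "\<delta>1 > 0" "nb m C x1 \<delta>1 \<subseteq> {y \<in> nb m C x \<delta>. \<forall>i<k. cont_at m C (f i) y}" by auto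
  obtain x2 \<delta>2 where 2: "x2 \<in> C" "\<delta>2 > 0" "nb m C x2 \<delta>2 \<subseteq> {y \<in> nb m C x1 \<delta>1. cont_at m C (f k) y}"
    using cell_cont[OF assms(1) Suc(2)[of k] 1(1,2)] by auto
  have "nb m C x2 \<delta>2 \<subseteq> {y \<in> nb m C x \<delta>. \<forall>i<Suc k. cont_at m C (f i) y}"
    using 1(3) 2(3) by (auto simp: less_Suc_eq subset_iff)
  then show ?case using 2 by blast
qed


section \<open>Connectedness and dimension of cells\<close>

lemma band_memD:
  assumes "C \<subseteq> Rn m" "w(m := t) \<in> {x(m := t) | x t. x \<in> C \<and> f x < ereal t \<and> ereal t < g x}" "w \<in> Rn m"
  shows "w \<in> C \<and> f w < ereal t \<and> ereal t < g w"
proof -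
  obtain x u where x: "w(m := t) = x(m := u)" "x \<in> C" "f x < ereal u" "ereal u < g x"
    using assms(2) by blast
  then have "w = x \<and> t = u" using assms(1,3) upd_inj[of w m x t u] by blast
  then show ?thesis using x by simp
qed

text \<open>The fibres of a band are intervals, so a locally constant function is constant on each
  of them and descends to the base along any choice \<open>\<tau>\<close> of heights;
  \<open>\<tau>\<close> itself need not be continuous.\<close>

lemma cell_connected:
  assumes "cell S m d C" "\<And>x. x \<in> C \<Longrightarrow> \<exists>\<delta>>0. \<forall>y\<in>nb m C x \<delta>. n y = n x" "x \<in> C" "y \<in> C"
  shows "n x = n y"
  using assms
proof (induction arbitrary: n x y rule: cell_induct)
  case point then show ?case by (simp add: Rn_0)
next
  case (graph m d C f)
  let ?C = "{x(m := f x) | x. x \<in> C}"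
  obtain x0 y0 where x0: "x0 \<in> C" "x = x0(m := f x0)" "y0 \<in> C" "y = y0(m := f y0)" using graph by auto
  have "\<exists>\<delta>>0. \<forall>w\<in>nb m C z \<delta>. n (w(m := f w)) = n (z(m := f z))" if z: "z \<in> C" for z
  proof -
    obtain \<delta> where "\<delta> > 0" "\<And>w. w \<in> nb (Suc m) ?C (z(m := f z)) \<delta> \<Longrightarrow> n w = n (z(m := f z))"
      using graph.prems(1)[of "z(m := f z)"] z by blast
    moreover obtain \<delta>' where "\<delta>' > 0" "\<And>y. y \<in> nb m C z \<delta>' \<Longrightarrow> y(m := f y) \<in> nb (Suc m) ?C (z(m := f z)) \<delta>"
      using graph_nb[OF graph(2) graph(4)[OF z] \<open>\<delta> > 0\<close> z] by blast
    ultimately show ?thesis by (intro exI[of _ \<delta>'] conjI ballI) simp_all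
  qed
  from graph.IH[of "\<lambda>w. n (w(m := f w))", OF this x0(1,3)] show ?case unfolding x0(2,4) .
next
  case (band m d C f g)
  let ?C = "{x(m := t) | x t. x \<in> C \<and> f x < ereal t \<and> ereal t < g x}"
  have loc: "\<exists>\<delta>>0. \<exists>p q. p < t \<and> t < q \<and> (\<forall>w\<in>slab m C z \<delta> p q. n w = n (z(m := t)))"
    if z: "z \<in> C" "f z < ereal t" "ereal t < g z" for z t
  proof -
    obtain \<delta> where "\<delta> > 0" "\<And>w. w \<in> nb (Suc m) ?C (z(m := t)) \<delta> \<Longrightarrow> n w = n (z(m := t))"
      using band.prems(1)[of "z(m := t)"] z by blast
    then show ?thesis using band_slab[OF band(2,5,6) z, of \<delta>] by (meson subset_iff)
  qed
  have fib: "n (z(m := t)) = n (z(m := u))" if z: "z \<in> C" "f z < ereal t" "ereal t < g z" "f z < ereal u" "ereal u < g z" for z t u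
  proof (rule connected_local_const[of "{t. f z < ereal t \<and> ereal t < g z}" t u "\<lambda>t. n (z(m := t))"])
    have "is_interval {t. f z < ereal t \<and> ereal t < g z}"
      unfolding is_interval_1
    proof (intro ballI allI impI)
      fix a b x assume "a \<in> {t. f z < ereal t \<and> ereal t < g z}" "b \<in> {t. f z < ereal t \<and> ereal t < g z}" "a \<le> x \<and> x \<le> b"
      then show "x \<in> {t. f z < ereal t \<and> ereal t < g z}"
        using less_le_trans[of "f z" "ereal a" "ereal x"] le_less_trans[of "ereal x" "ereal b" "g z"] by simp
    qed
    then show "connected {t. f z < ereal t \<and> ereal t < g z}" by (rule is_interval_connected)
    show "\<forall>a\<in>{t. f z < ereal t \<and> ereal t < g z}. eventually (\<lambda>b. n (z(m := a)) = n (z(m := b))) (at a within {t. f z < ereal t \<and> ereal t < g z})"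
    proof
      fix a assume "a \<in> {t. f z < ereal t \<and> ereal t < g z}"
      then obtain \<delta> p q where l: "\<delta> > 0" "p < a" "a < q" "\<forall>w\<in>slab m C z \<delta> p q. n w = n (z(m := a))" using loc[OF z(1), of a] by auto
      have "n (z(m := a)) = n (z(m := b))" if "b \<in> {p<..<q}" for b
      proof -
        have "z(m := b) \<in> slab m C z \<delta> p q" unfolding slab_def
          using that nb_center[OF z(1) l(1), of m] by (intro CollectI exI[of _ z] exI[of _ b]) simp
        then show ?thesis using l(4) by metis
      qed
      moreover have "eventually (\<lambda>b. b \<in> {p<..<q}) (at a within {t. f z < ereal t \<and> ereal t < g z})"
        unfolding eventually_at_topological using l by (intro exI[of _ "{p<..<q}"]) auto
      ultimately show "eventually (\<lambda>b. n (z(m := a)) = n (z(m := b))) (at a within {t. f z < ereal t \<and> ereal t < g z})"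
        by (auto elim: eventually_mono)
    qed
  qed (use z in auto)
  define \<tau> where "\<tau> z = (SOME t. f z < ereal t \<and> ereal t < g z)" for z
  have \<tau>: "f z < ereal (\<tau> z) \<and> ereal (\<tau> z) < g z" if "z \<in> C" for z
    unfolding \<tau>_def by (rule someI_ex) (use band(7)[OF that] ereal_dense2 in blast)
  obtain x0 t0 y0 u0 where x0: "x0 \<in> C" "x = x0(m := t0)" "f x0 < ereal t0" "ereal t0 < g x0"
    "y0 \<in> C" "y = y0(m := u0)" "f y0 < ereal u0" "ereal u0 < g y0" using band.prems(2,3) by blast
  have "\<exists>\<delta>>0. \<forall>w\<in>nb m C z \<delta>. n (w(m := \<tau> w)) = n (z(m := \<tau> z))" if z: "z \<in> C" for z
  proof -
    obtain \<delta>1 where 1: "\<delta>1 > 0" "\<And>w. w \<in> nb (Suc m) ?C (z(m := \<tau> z)) \<delta>1 \<Longrightarrow> n w = n (z(m := \<tau> z))"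
      using band.prems(1)[of "z(m := \<tau> z)"] z \<tau>[OF z] by blast
    obtain \<delta> p q where l: "\<delta> > 0" "p < \<tau> z" "\<tau> z < q" "slab m C z \<delta> p q \<subseteq> nb (Suc m) ?C (z(m := \<tau> z)) \<delta>1"
      using band_slab[OF band(2,5,6) z, of "\<tau> z" \<delta>1] \<tau>[OF z] 1(1) by blast
    have "n (w(m := \<tau> w)) = n (z(m := \<tau> z))" if w: "w \<in> nb m C z \<delta>" for w
    proof -
      have "w(m := \<tau> z) \<in> slab m C z \<delta> p q"
        unfolding slab_def using l(2,3) w by (intro CollectI exI[of _ w] exI[of _ "\<tau> z"]) simp
      then have wn: "w(m := \<tau> z) \<in> nb (Suc m) ?C (z(m := \<tau> z)) \<delta>1" using l(4) by (rule subsetD[rotated])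
      have wC: "w \<in> C" using w by (simp add: nb_def)
      have "w(m := \<tau> z) \<in> ?C" using wn by (simp only: nb_def mem_Collect_eq)
      then have wt: "w \<in> C \<and> f w < ereal (\<tau> z) \<and> ereal (\<tau> z) < g w"
        by (rule band_memD[OF band(2)]) (use band(2) wC in blast)
      have "n (w(m := \<tau> w)) = n (w(m := \<tau> z))"
        by (rule fib) (use wt \<tau>[OF wC] in simp_all)
      also have "\<dots> = n (z(m := \<tau> z))" by (rule 1(2)[OF wn])
      finally show ?thesis .
    qed
    then show ?thesis using l(1) by blast
  qed
  from band.IH[of "\<lambda>w. n (w(m := \<tau> w))", OF this x0(1,5)]
  have eq: "n (x0(m := \<tau> x0)) = n (y0(m := \<tau> y0))" .
  have "n (x0(m := t0)) = n (x0(m := \<tau> x0))" "n (y0(m := u0)) = n (y0(m := \<tau> y0))"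
    by (rule fib; use \<tau> x0 in simp)+
  then show ?case using eq unfolding x0(2,6) by (simp only:)
qed

text \<open>Induction on the larger cell: a band never fits into a graph, having two points over one
  base point, and the other cases project to the base. The relative interior in equal dimension is
  what makes the complement of a dense definable set drop in dimension.\<close>

lemma cell_dim_le:
  assumes "cell S m d C" "cell S m d' C'" "C' \<subseteq> C"
  shows "d' \<le> d \<and> (d' = d \<longrightarrow> (\<exists>x\<in>C. \<exists>\<delta>>0. nb m C x \<delta> \<subseteq> C'))"
  using assms
proof (induction arbitrary: d' C' rule: cell_induct)
  case point
  from point(1) show ?case by (cases rule: cell.cases) (auto simp: nb_def Rn_0 intro!: exI[of _ 1])
next
  case (graph m d C f)
  let ?C = "{x(m := f x) | x. x \<in> C}"
  from graph.prems(1) show ?case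
  proof (cases rule: cell.cases)
    case (graph C0 f')
    have C0: "C0 \<subseteq> Rn m" using cell_subset graph by auto
    have eq: "x \<in> C \<and> f' x = f x" if x: "x \<in> C0" for x
    proof -
      have "x(m := f' x) \<in> ?C" using graph.prems(2) x unfolding graph(1) by blast
      then obtain y where "y \<in> C" "x(m := f' x) = y(m := f y)" by blast
      then show ?thesis using upd_inj[of x m y "f' x" "f y"] C0 x \<open>C \<subseteq> Rn m\<close> by auto
    qed
    then have "d' \<le> d \<and> (d' = d \<longrightarrow> (\<exists>x\<in>C. \<exists>\<delta>>0. nb m C x \<delta> \<subseteq> C0))"
      using graph.IH[OF graph(2)] by blast
    moreover have "\<exists>x\<in>?C. \<exists>\<delta>>0. nb (Suc m) ?C x \<delta> \<subseteq> C'" if "x \<in> C" "\<delta> > 0" "nb m C x \<delta> \<subseteq> C0" for x \<delta>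
    proof -
      have "y(m := f y) \<in> C'" if "y \<in> nb m C x \<delta>" for y
      proof -
        have "y \<in> C0" using that \<open>nb m C x \<delta> \<subseteq> C0\<close> by (rule subsetD[rotated])
        then have "y(m := f' y) \<in> C'" "f' y = f y" unfolding graph(1) using eq by blast+
        then show ?thesis by (simp only:)
      qed
      then have "nb (Suc m) ?C (x(m := f x)) \<delta> \<subseteq> C'"
        using graph_nb'[OF \<open>C \<subseteq> Rn m\<close> that(1), of f \<delta>] by blast
      then show ?thesis using that(1,2) by blast
    qed
    ultimately show ?thesis by blast
  next
    case (band d0 C0 f' g')
    have C0: "C0 \<subseteq> Rn m" using cell_subset band by auto
    obtain x where x: "x \<in> C0" using cell_nonempty[OF band(3)] by blast
    obtain t where t: "f' x < ereal t" "ereal t < g' x" using band(6)[OF x] ereal_dense2 by blast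
    obtain u where u: "f' x < ereal u" "ereal u < ereal t" using t ereal_dense2 by blast
    have u2: "ereal u < g' x" using u(2) t(2) by (rule less_trans)
    have "x(m := t) \<in> C'" "x(m := u) \<in> C'" unfolding band(2) using t u u2 x by blast+
    then have "x(m := t) \<in> ?C" "x(m := u) \<in> ?C" using graph.prems(2) by blast+
    then obtain y z where "y \<in> C" "x(m := t) = y(m := f y)" "z \<in> C" "x(m := u) = z(m := f z)" by blast
    then have "t = f x" "u = f x" using upd_inj[of x m y t "f y"] upd_inj[of x m z u "f z"] C0 x \<open>C \<subseteq> Rn m\<close> by auto
    then show ?thesis using u by simp
  qed
next
  case (band m d C f g)
  note IH = band.IH and Cb = band(2) and sub = band.prems(2)
  let ?C = "{x(m := t) | x t. x \<in> C \<and> f x < ereal t \<and> ereal t < g x}"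
  from band.prems(1) show ?case
  proof (cases rule: cell.cases)
    case (graph C0 f')
    have C0: "C0 \<subseteq> Rn m" using cell_subset graph by auto
    have "C0 \<subseteq> C"
    proof
      fix x assume x: "x \<in> C0"
      obtain y t where "y \<in> C" "x(m := f' x) = y(m := t)" using sub graph(1) x by blast
      then show "x \<in> C" using upd_inj[of x m y "f' x" t] C0 x Cb by auto
    qed
    then show ?thesis using IH[OF graph(2)] by auto
  next
    case (band d0 C0 f' g')
    have C0: "C0 \<subseteq> Rn m" using cell_subset band by auto
    have "C0 \<subseteq> C"
    proof
      fix x assume x: "x \<in> C0"
      obtain t where t: "f' x < ereal t" "ereal t < g' x" using band(6)[OF x] ereal_dense2 by blast
      obtain y u where "y \<in> C" "x(m := t) = y(m := u)" using sub band(2) x t by blast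
      then show "x \<in> C" using upd_inj[of x m y t u] C0 x Cb by auto
    qed
    from IH[OF band(3) this] have 1: "d0 \<le> d" "d0 = d \<longrightarrow> (\<exists>x\<in>C. \<exists>\<delta>>0. nb m C x \<delta> \<subseteq> C0)" by auto
    have "\<exists>x\<in>?C. \<exists>\<delta>>0. nb (Suc m) ?C x \<delta> \<subseteq> C'" if x: "x \<in> C" "\<delta> > 0" "nb m C x \<delta> \<subseteq> C0" for x \<delta>
    proof -
      have x0: "x \<in> C0" using x nb_center[OF x(1,2)] by blast
      obtain t where t: "f' x < ereal t" "ereal t < g' x" using band(6)[OF x0] ereal_dense2 by blast
      note bb = cell_bound_bounds[OF band(4) cell_definable[OF band(3)]] cell_bound_bounds[OF band(5) cell_definable[OF band(3)]]
      obtain \<delta>1 p q where 2: "\<delta>1 > 0" "p < t" "t < q" "slab m C0 x \<delta>1 p q \<subseteq> nb (Suc m) C' (x(m := t)) 1"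
        using band_slab[OF C0 bb(1,4) x0 t, of 1] band(2) by auto
      have C': "x(m := t) \<in> ?C" using sub band(2) x0 t by blast
      let ?\<delta> = "min (min \<delta> \<delta>1) (min (t - p) (q - t))"
      have "nb (Suc m) ?C (x(m := t)) ?\<delta> \<subseteq> C'"
      proof
        fix z assume "z \<in> nb (Suc m) ?C (x(m := t)) ?\<delta>"
        then obtain y u where z: "z = y(m := u)" "y \<in> C" "near m ?\<delta> x y" "\<bar>u - t\<bar> < ?\<delta>"
          by (auto simp: nb_def near_Suc_upd)
        have "near m \<delta> x y" "near m \<delta>1 x y" using z(3) by (auto intro: near_mono)
        then have "y \<in> nb m C0 x \<delta>1" using x(3) z(2) by (auto simp: nb_def)
        moreover have "p < u" "u < q" using z(4) by (auto simp: abs_less_iff)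
        ultimately have "z \<in> slab m C0 x \<delta>1 p q" using z(1) by (auto simp: slab_def)
        then show "z \<in> C'" using 2(4) by (auto simp: nb_def)
      qed
      moreover have "?\<delta> > 0" using x 2 by auto
      ultimately show ?thesis using C' by blast
    qed
    then show ?thesis using 1 band(1) by blast
  qed
qed

section \<open>Cell decomposition\<close>

text \<open>The parameter \<open>Q\<close> covers plain decompositions and decompositions adapted to
  functions by one notion.\<close>

definition cellp :: "nat \<Rightarrow> ((nat \<Rightarrow> real) set \<Rightarrow> bool) \<Rightarrow> (nat \<Rightarrow> real) set \<Rightarrow> bool" where
  "cellp m Q A \<longleftrightarrow> (\<exists>P. finite P \<and> partition_on A P \<and> (\<forall>C\<in>P. (\<exists>d. cell S m d C) \<and> Q C))"

lemma cellp_UN: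
  assumes "finite I" "\<And>i j. i \<in> I \<Longrightarrow> j \<in> I \<Longrightarrow> i \<noteq> j \<Longrightarrow> A i \<inter> A j = {}" "\<And>i. i \<in> I \<Longrightarrow> cellp m Q (A i)"
  shows "cellp m Q (\<Union>i\<in>I. A i)"
proof -
  obtain P where P: "\<And>i. i \<in> I \<Longrightarrow> finite (P i) \<and> partition_on (A i) (P i) \<and> (\<forall>C\<in>P i. (\<exists>d. cell S m d C) \<and> Q C)"
    using assms(3) unfolding cellp_def by metis
  have "partition_on (\<Union>i\<in>I. A i) (\<Union>i\<in>I. P i)"
  proof (rule partition_onI)
    have "\<Union>(P i) = A i" if "i \<in> I" for i using P[OF that] by (simp add: partition_on_def)
    then show "\<Union>(\<Union>i\<in>I. P i) = (\<Union>i\<in>I. A i)" by blast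
    show "{} \<notin> (\<Union>i\<in>I. P i)" using P by (auto simp: partition_on_def)
    fix p p' assume p: "p \<in> (\<Union>i\<in>I. P i)" "p' \<in> (\<Union>i\<in>I. P i)" "p \<noteq> p'"
    then obtain i j where ij: "i \<in> I" "p \<in> P i" "j \<in> I" "p' \<in> P j" by blast
    show "disjnt p p'"
    proof (cases "i = j")
      case True then show ?thesis using P[OF ij(1)] ij p by (auto simp: partition_on_def disjoint_def disjnt_def)
    next
      case False
      then have "A i \<inter> A j = {}" using assms(2) ij by blast
      moreover have "p \<subseteq> A i" "p' \<subseteq> A j" using P ij by (auto simp: partition_on_def)
      ultimately show ?thesis by (auto simp: disjnt_def)
    qed
  qed
  then show ?thesis unfolding cellp_def using P assms(1) by (intro exI[of _ "\<Union>i\<in>I. P i"]) auto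
qed

lemma cellp_Un: "A \<inter> B = {} \<Longrightarrow> cellp m Q A \<Longrightarrow> cellp m Q B \<Longrightarrow> cellp m Q (A \<union> B)"
  using cellp_UN[of "UNIV :: bool set" "\<lambda>b. if b then A else B" m Q] by (simp add: UNIV_bool Int_commute Un_commute)

lemma cellp_cell: "cell S m d C \<Longrightarrow> Q C \<Longrightarrow> cellp m Q C"
  unfolding cellp_def using cell_nonempty[of m d C] by (intro exI[of _ "{C}"]) (auto simp: partition_on_def)

lemma cellp_empty: "cellp m Q {}"
  unfolding cellp_def by (intro exI[of _ "{}"]) (auto simp: partition_on_def)

text \<open>Induction on the dimension of a cell: the good set \<open>U\<close> is dense in
  \<open>C\<close>, so its complement contains no neighbourhood in \<open>C\<close> and, by
  \<open>cell_dim_le\<close>, splits into cells of smaller dimension. Plain decomposition in the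
  same \<open>m\<close> is presupposed, which fits the induction on \<open>m\<close> later.\<close>

lemma piecewise:
  assumes CD: "\<And>A. A \<in> S m \<Longrightarrow> cellp m (\<lambda>_. True) A"
    and U: "\<And>d C. cell S m d C \<Longrightarrow> \<exists>U. Def U \<and> (\<forall>x\<in>C. \<forall>\<delta>>0. \<exists>y\<in>nb m C x \<delta>. U y) \<and>
       (\<forall>d' C'. cell S m d' C' \<longrightarrow> C' \<subseteq> {x \<in> C. U x} \<longrightarrow> Q C')"
    and A: "A \<in> S m"
  shows "cellp m Q A"
proof -
  have refine: "cellp m Q A" if AS: "A \<in> S m" and AC: "\<And>d C. cell S m d C \<Longrightarrow> C \<subseteq> A \<Longrightarrow> cellp m Q C" for A
  proof -
    obtain P where P: "finite P" "partition_on A P" "\<And>C. C \<in> P \<Longrightarrow> \<exists>d. cell S m d C"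
      using CD[OF AS] unfolding cellp_def by blast
    have "cellp m Q (\<Union>C\<in>P. C)"
    proof (rule cellp_UN[OF P(1)])
      show "C \<inter> C' = {}" if "C \<in> P" "C' \<in> P" "C \<noteq> C'" for C C'
        using P(2) that by (auto simp: partition_on_def disjoint_def)
      show "cellp m Q C" if "C \<in> P" for C
        using P(2,3) AC that unfolding partition_on_def by blast
    qed
    then show ?thesis using P(2) by (simp add: partition_on_def)
  qed
  have "cell S m d C \<Longrightarrow> cellp m Q C" for d C
  proof (induction d arbitrary: C rule: less_induct)
    case (less d)
    obtain U where U: "Def U" "\<And>x \<delta>. x \<in> C \<Longrightarrow> \<delta> > 0 \<Longrightarrow> \<exists>y\<in>nb m C x \<delta>. U y"
       "\<And>d' C'. cell S m d' C' \<Longrightarrow> C' \<subseteq> {x \<in> C. U x} \<Longrightarrow> Q C'"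
      using U[OF less(2)] by blast
    have C: "C \<in> S m" using cell_definable less(2) .
    have "cellp m Q {x \<in> C. U x}"
      by (rule refine) (use U cellp_cell C definable_Collect in auto)
    moreover have "cellp m Q {x \<in> C. \<not> U x}"
    proof (rule refine)
      show "{x \<in> C. \<not> U x} \<in> S m" using definable_Collect[OF C Def_not[OF U(1)]] .
      fix d' C' assume C': "cell S m d' C'" "C' \<subseteq> {x \<in> C. \<not> U x}"
      then have "C' \<subseteq> C" by blast
      note * = cell_dim_le[OF less(2) C'(1) this]
      have "d' \<noteq> d"
      proof
        assume "d' = d"
        have "\<exists>x\<in>C. \<exists>\<delta>>0. nb m C x \<delta> \<subseteq> C'" by (rule conjunct2[OF *, THEN mp]) fact
        then obtain x \<delta> where "x \<in> C" "\<delta> > 0" "nb m C x \<delta> \<subseteq> C'" by blast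
        then show False using U(2)[of x \<delta>] C'(2) by auto
      qed
      then have "d' < d" using conjunct1[OF *] by simp
      then show "cellp m Q C'" using C'(1) by (rule less(1))
    qed
    ultimately have "cellp m Q ({x \<in> C. U x} \<union> {x \<in> C. \<not> U x})" by (intro cellp_Un) auto
    moreover have "{x \<in> C. U x} \<union> {x \<in> C. \<not> U x} = C" by auto
    ultimately show ?case by simp
  qed
  then show ?thesis using refine[OF A] by blast
qed

end

section \<open>Enumeration and matching of finite sets of reals\<close>

lemma card_below_Suc:
  fixes T :: "real set" assumes "finite T"
  shows "(\<exists>s. s < t \<and> s \<in> T \<and> k \<le> card {u \<in> T. u < s}) \<longleftrightarrow> Suc k \<le> card {u \<in> T. u < t}"
proof
  assume "\<exists>s. s < t \<and> s \<in> T \<and> k \<le> card {u \<in> T. u < s}"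
  then obtain s where s: "s < t" "s \<in> T" "k \<le> card {u \<in> T. u < s}" by blast
  have "card (insert s {u \<in> T. u < s}) \<le> card {u \<in> T. u < t}"
    using assms s by (intro card_mono) auto
  then show "Suc k \<le> card {u \<in> T. u < t}" using s(3) assms by simp
next
  assume a: "Suc k \<le> card {u \<in> T. u < t}"
  let ?T = "{u \<in> T. u < t}"
  have "?T \<noteq> {}" using a by fastforce
  then have m: "Max ?T \<in> ?T" using assms by (intro Max_in) auto
  have "?T \<subseteq> insert (Max ?T) {u \<in> T. u < Max ?T}" using assms by (force simp: less_le)
  then have "card ?T \<le> Suc (card {u \<in> T. u < Max ?T})"
    using card_mono[of "insert (Max ?T) {u \<in> T. u < Max ?T}" ?T] assms by simp
  then show "\<exists>s. s < t \<and> s \<in> T \<and> k \<le> card {u \<in> T. u < s}" using a m by (intro exI[of _ "Max ?T"]) auto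
qed

lemma rank_unique:
  fixes T :: "real set" assumes "finite T" "i < card T"
  shows "\<exists>!t. t \<in> T \<and> card {u \<in> T. u < t} = i"
proof -
  let ?r = "\<lambda>t. card {u \<in> T. u < t}"
  have less: "?r s < ?r t" if "s < t" "s \<in> T" for s t
    using assms(1) that by (intro psubset_card_mono) auto
  have inj: "inj_on ?r T"
    by (intro linorder_inj_onI') (use less in fastforce)+
  have "?r t < card T" if "t \<in> T" for t
    using assms(1) that by (intro psubset_card_mono) auto
  then have "?r ` T = {..<card T}"
    using card_image[OF inj] by (intro card_subset_eq) auto
  then obtain t where "t \<in> T" "?r t = i" using assms(2) by (metis (no_types, lifting) imageE lessThan_iff)
  then show ?thesis using inj by (auto simp: inj_on_def)
qed

text \<open>The default 0 beyond the cardinality makes every \<open>enum T i\<close> total in a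
  family of sets \<open>T\<close>, so that it can become a term.\<close>

definition enum :: "real set \<Rightarrow> nat \<Rightarrow> real" where
  "enum T i = (if i < card T then THE t. t \<in> T \<and> card {u \<in> T. u < t} = i else 0)"

lemma enum: 
  assumes "finite T" "i < card T" shows "enum T i \<in> T" "card {u \<in> T. u < enum T i} = i"
  using theI'[OF rank_unique[OF assms]] assms by (auto simp: enum_def)

lemma enum_unique: "finite T \<Longrightarrow> t \<in> T \<Longrightarrow> enum T (card {u \<in> T. u < t}) = t"
proof -
  assume a: "finite T" "t \<in> T"
  then have "card {u \<in> T. u < t} < card T" by (intro psubset_card_mono) auto
  then show ?thesis using enum[OF a(1)] rank_unique[OF a(1)] a(2) by blast
qed

lemma enum_less:
  assumes "finite T" "i < j" "j < card T" shows "enum T i < enum T j"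
proof (rule ccontr)
  assume "\<not> enum T i < enum T j"
  then have "card {u \<in> T. u < enum T j} \<le> card {u \<in> T. u < enum T i}"
    using assms(1) by (intro card_mono) auto
  then show False using enum(2)[of T] assms by auto
qed

text \<open>Sorts the complement of a finite set into the gaps between consecutive points, ranks 0
  and \<open>card T\<close> being the unbounded ones. The gaps become the bands of the cell
  decomposition.\<close>

lemma rank_band:
  assumes T: "finite T" and i: "i \<le> card T"
  shows "t \<notin> T \<and> card {u \<in> T. u < t} = i \<longleftrightarrow> (i = 0 \<or> enum T (i - 1) < t) \<and> (i = card T \<or> t < enum T i)"
proof
  assume t: "t \<notin> T \<and> card {u \<in> T. u < t} = i"
  have "enum T (i - 1) < t" if "i \<noteq> 0"
  proof (rule ccontr)
    assume "\<not> enum T (i - 1) < t"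
    then have "card {u \<in> T. u < t} \<le> card {u \<in> T. u < enum T (i - 1)}"
      using T by (intro card_mono) auto
    then show False using enum(2)[OF T, of "i - 1"] t i that by simp
  qed
  moreover have "t < enum T i" if "i \<noteq> card T"
  proof (rule ccontr)
    assume "\<not> t < enum T i"
    moreover have e: "enum T i \<in> T" "card {u \<in> T. u < enum T i} = i" using enum[OF T, of i] i that by auto
    moreover have "t \<noteq> enum T i" using t e(1) by blast
    ultimately have "enum T i < t" by simp
    then have "card (insert (enum T i) {u \<in> T. u < enum T i}) \<le> card {u \<in> T. u < t}"
      using T e by (intro card_mono) auto
    then show False using e t T by simp
  qed
  ultimately show "(i = 0 \<or> enum T (i - 1) < t) \<and> (i = card T \<or> t < enum T i)" by blast
next
  assume t: "(i = 0 \<or> enum T (i - 1) < t) \<and> (i = card T \<or> t < enum T i)"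
  have ge: "i \<le> card {u \<in> T. u < t}"
  proof (cases "i = 0")
    case False
    then have e: "enum T (i - 1) \<in> T" "card {u \<in> T. u < enum T (i - 1)} = i - 1" using enum[OF T, of "i - 1"] i by auto
    have "card (insert (enum T (i - 1)) {u \<in> T. u < enum T (i - 1)}) \<le> card {u \<in> T. u < t}"
      using T e t False by (intro card_mono) auto
    then show ?thesis using e T False by simp
  qed simp
  have le: "card {u \<in> T. u \<le> t} \<le> i"
  proof (cases "i = card T")
    case True then show ?thesis using T by (auto intro: card_mono)
  next
    case False
    then have "card {u \<in> T. u \<le> t} \<le> card {u \<in> T. u < enum T i}"
      using T t by (intro card_mono) auto
    then show ?thesis using enum(2)[OF T, of i] i False by simp
  qed
  have "t \<notin> T"
  proof
    assume "t \<in> T"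
    then have "card {u \<in> T. u < t} < card {u \<in> T. u \<le> t}" using T by (intro psubset_card_mono) auto
    then show False using ge le by simp
  qed
  moreover have "card {u \<in> T. u < t} \<le> card {u \<in> T. u \<le> t}" using T by (intro card_mono) auto
  ultimately show "t \<notin> T \<and> card {u \<in> T. u < t} = i" using ge le by simp
qed

definition fibre :: "((nat \<Rightarrow> real) \<Rightarrow> bool) \<Rightarrow> nat \<Rightarrow> (nat \<Rightarrow> real) \<Rightarrow> real set" where
  "fibre F m x = {t. F (x(m := t))}"

lemma fibre_upd [simp]: "fibre F m (x(m := t)) = fibre F m x"
  by (simp add: fibre_def)

text \<open>Cardinality is not first-order, but having at least \<open>k\<close> fibre points below
  a given height is, by recursion on \<open>k\<close>.\<close>

primrec card_gt :: "((nat \<Rightarrow> real) \<Rightarrow> bool) \<Rightarrow> nat \<Rightarrow> nat \<Rightarrow> (nat \<Rightarrow> real) \<Rightarrow> bool" where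
  "card_gt F m 0 = (\<lambda>z. True)"
| "card_gt F m (Suc k) = (\<lambda>z. \<exists>s. s < z m \<and> F (z(m := s)) \<and> card_gt F m k (z(m := s)))"

lemma card_gt_iff:
  assumes "finite (fibre F m z)" shows "card_gt F m k z \<longleftrightarrow> k \<le> card {u \<in> fibre F m z. u < z m}"
  using assms
proof (induction k arbitrary: z)
  case (Suc k)
  have IH: "card_gt F m k (z(m := s)) \<longleftrightarrow> k \<le> card {u \<in> fibre F m z. u < s}" for s
    using Suc.IH[of "z(m := s)"] Suc.prems by (simp only: fibre_upd fun_upd_same)
  have "F (z(m := s)) \<longleftrightarrow> s \<in> fibre F m z" for s by (simp only: fibre_def mem_Collect_eq)
  then have "card_gt F m (Suc k) z \<longleftrightarrow> (\<exists>s. s < z m \<and> s \<in> fibre F m z \<and> k \<le> card {u \<in> fibre F m z. u < s})"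
    by (simp only: card_gt.simps(2) IH)
  then show ?case using card_below_Suc[OF Suc.prems] by simp
qed simp

text \<open>A first-order way to say that two finite sets are equipotent by a small displacement. No
  cardinality occurs in it, so it can define the good set in the finiteness theorem before a bound
  on the fibres is known.\<close>

definition matched :: "real \<Rightarrow> real set \<Rightarrow> real set \<Rightarrow> bool" where
  "matched \<epsilon> A B \<longleftrightarrow> (\<forall>s\<in>A. \<exists>!t. t \<in> B \<and> \<bar>t - s\<bar> < \<epsilon>) \<and> (\<forall>t\<in>B. \<exists>!s. s \<in> A \<and> \<bar>t - s\<bar> < \<epsilon>)"

lemma matched_card: assumes "matched \<epsilon> A B" shows "card A = card B"
proof -
  have a: "\<And>s. s \<in> A \<Longrightarrow> \<exists>!t. t \<in> B \<and> \<bar>t - s\<bar> < \<epsilon>" and b: "\<And>t. t \<in> B \<Longrightarrow> \<exists>!s. s \<in> A \<and> \<bar>t - s\<bar> < \<epsilon>"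
    using assms by (auto simp: matched_def)
  have "bij_betw (\<lambda>s. THE t. t \<in> B \<and> \<bar>t - s\<bar> < \<epsilon>) A B"
    by (rule bij_betw_byWitness[where f' = "\<lambda>t. THE s. s \<in> A \<and> \<bar>t - s\<bar> < \<epsilon>"])
      (use theI'[OF a] theI'[OF b] the1_equality[OF a] the1_equality[OF b] in auto)
  then show ?thesis by (rule bij_betw_same_card)
qed

text \<open>The points of \<open>A\<close> are at least \<open>2 * \<epsilon>\<close> apart and each
  is displaced by less than \<open>\<epsilon>\<close>, so being close singles out one index.\<close>

lemma matched_enum:
  assumes fin: "finite A" "finite B" "card A = k" "card B = k"
    and gap: "\<And>i j. i < k \<Longrightarrow> j < k \<Longrightarrow> i \<noteq> j \<Longrightarrow> \<bar>enum A i - enum A j\<bar> \<ge> 2 * \<epsilon>"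
    and close: "\<And>i. i < k \<Longrightarrow> \<bar>enum B i - enum A i\<bar> < \<epsilon>"
  shows "matched \<epsilon> A B"
proof -
  have A: "A = enum A ` {..<k}" and B: "B = enum B ` {..<k}"
  proof -
    have *: "T = enum T ` {..<card T}" if "finite T" for T
    proof (intro equalityI subsetI)
      fix t assume t: "t \<in> T"
      then have "card {u \<in> T. u < t} < card T" using that by (intro psubset_card_mono) auto
      then show "t \<in> enum T ` {..<card T}" using enum_unique[OF that t] by force
    qed (use enum[OF that] in auto)
    show "A = enum A ` {..<k}" "B = enum B ` {..<k}" using *[of A] *[of B] fin by auto
  qed
  have key: "i = j" if "i < k" "j < k" "\<bar>enum B j - enum A i\<bar> < \<epsilon>" for i j
  proof (rule ccontr)
    assume "i \<noteq> j"
    then show False using gap[OF that(1,2)] close[OF that(2)] that(3) by linarith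
  qed
  have Bk: "\<exists>j<k. t = enum B j" if "t \<in> B" for t using that B by blast
  have Ak: "\<exists>j<k. s = enum A j" if "s \<in> A" for s using that A by blast
  have BA: "enum B i \<in> B" "enum A i \<in> A" if "i < k" for i using enum(1) fin that by auto
  have "\<exists>!t. t \<in> B \<and> \<bar>t - enum A i\<bar> < \<epsilon>" if "i < k" for i
  proof (rule ex1I)
    show "enum B i \<in> B \<and> \<bar>enum B i - enum A i\<bar> < \<epsilon>" using that close BA by blast
    show "t = enum B i" if t: "t \<in> B \<and> \<bar>t - enum A i\<bar> < \<epsilon>" for t
    proof -
      obtain j where "j < k" "t = enum B j" using Bk t by blast
      moreover then have "i = j" using key[of i j] \<open>i < k\<close> t by simp
      ultimately show ?thesis by simp
    qed
  qed
  moreover have "\<exists>!s. s \<in> A \<and> \<bar>enum B j - s\<bar> < \<epsilon>" if "j < k" for j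
  proof (rule ex1I)
    show "enum A j \<in> A \<and> \<bar>enum B j - enum A j\<bar> < \<epsilon>" using that close BA by blast
    show "s = enum A j" if s: "s \<in> A \<and> \<bar>enum B j - s\<bar> < \<epsilon>" for s
    proof -
      obtain i where "i < k" "s = enum A i" using Ak s by blast
      moreover then have "i = j" using key[of i j] \<open>j < k\<close> s by simp
      ultimately show ?thesis by simp
    qed
  qed
  ultimately show ?thesis unfolding matched_def
  proof (intro conjI ballI)
    fix s assume *: "\<And>i. i < k \<Longrightarrow> \<exists>!t. t \<in> B \<and> \<bar>t - enum A i\<bar> < \<epsilon>" and "s \<in> A"
    then obtain i where "i < k" "s = enum A i" using Ak by blast
    then show "\<exists>!t. t \<in> B \<and> \<bar>t - s\<bar> < \<epsilon>" using *[of i] by simp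
  next
    fix t assume *: "\<And>j. j < k \<Longrightarrow> \<exists>!s. s \<in> A \<and> \<bar>enum B j - s\<bar> < \<epsilon>" and "t \<in> B"
    then obtain j where "j < k" "t = enum B j" using Bk by blast
    then show "\<exists>!s. s \<in> A \<and> \<bar>t - s\<bar> < \<epsilon>" using *[of j] by simp
  qed
qed

lemma finite_gap: 
  fixes f :: "nat \<Rightarrow> real"
  assumes "\<And>i j. i < j \<Longrightarrow> j < k \<Longrightarrow> f i < f j"
  shows "\<exists>\<gamma>>0. \<forall>i<k. \<forall>j<k. i \<noteq> j \<longrightarrow> \<bar>f i - f j\<bar> \<ge> \<gamma>"
proof -
  \<comment> \<open>The entry 1 keeps the minimum meaningful when there is no pair of distinct
    indices.\<close>
  let ?D = "insert 1 ((\<lambda>(i, j). \<bar>f i - f j\<bar>) ` {(i, j). i < k \<and> j < k \<and> i \<noteq> j})"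
  have "finite {(i, j). i < k \<and> j < k \<and> i \<noteq> j}" by (rule finite_subset[of _ "{..<k} \<times> {..<k}"]) auto
  then have fin: "finite ?D" by simp
  have "f i \<noteq> f j" if "i < k" "j < k" "i \<noteq> j" for i j
    using assms[of i j] assms[of j i] that by (cases i j rule: linorder_cases) auto
  then have "Min ?D > 0" using fin by (subst Min_gr_iff) auto
  moreover have "Min ?D \<le> \<bar>f i - f j\<bar>" if "i < k" "j < k" "i \<noteq> j" for i j
    using that by (intro Min_le fin) auto
  ultimately show ?thesis by blast
qed

text \<open>The boundary of the fibre in the last variable alone. It contains every height at which
  membership can change, and it is finite for tame fibres.\<close>

definition boundary_pt :: "((nat \<Rightarrow> real) \<Rightarrow> bool) \<Rightarrow> nat \<Rightarrow> (nat \<Rightarrow> real) \<Rightarrow> bool" where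
  "boundary_pt A m z \<longleftrightarrow> (\<forall>\<epsilon>>0. (\<exists>u. \<bar>u - z m\<bar> < \<epsilon> \<and> A (z(m := u))) \<and> (\<exists>u. \<bar>u - z m\<bar> < \<epsilon> \<and> \<not> A (z(m := u))))"

lemma not_boundary:
  fixes p :: "real \<Rightarrow> bool"
  shows "\<not> (\<forall>\<epsilon>>0. (\<exists>u. \<bar>u - t\<bar> < \<epsilon> \<and> p u) \<and> (\<exists>u. \<bar>u - t\<bar> < \<epsilon> \<and> \<not> p u)) \<longleftrightarrow>
     (\<exists>\<epsilon>>0. \<forall>u. \<bar>u - t\<bar> < \<epsilon> \<longrightarrow> p u = p t)"
proof
  assume "\<not> (\<forall>\<epsilon>>0. (\<exists>u. \<bar>u - t\<bar> < \<epsilon> \<and> p u) \<and> (\<exists>u. \<bar>u - t\<bar> < \<epsilon> \<and> \<not> p u))"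
  then obtain \<epsilon> where e: "\<epsilon> > 0" "(\<forall>u. \<bar>u - t\<bar> < \<epsilon> \<longrightarrow> \<not> p u) \<or> (\<forall>u. \<bar>u - t\<bar> < \<epsilon> \<longrightarrow> p u)" by blast
  moreover have "\<bar>t - t\<bar> < \<epsilon>" using e by simp
  ultimately show "\<exists>\<epsilon>>0. \<forall>u. \<bar>u - t\<bar> < \<epsilon> \<longrightarrow> p u = p t" by blast
qed blast

lemma not_boundary_pt:
  "\<not> boundary_pt A m (x(m := t)) \<longleftrightarrow> (\<exists>\<epsilon>>0. \<forall>u. \<bar>u - t\<bar> < \<epsilon> \<longrightarrow> A (x(m := u)) = A (x(m := t)))"
  using not_boundary[of t "\<lambda>u. A (x(m := u))"] by (simp only: boundary_pt_def fun_upd_same fun_upd_upd)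

lemma tame_boundary:
  assumes "tame (\<lambda>t. A (x(m := t)))" shows "finite (fibre (boundary_pt A m) m x)"
proof -
  obtain E where E: "finite E" "\<And>a b. a < b \<Longrightarrow> {a..b} \<inter> E = {} \<Longrightarrow> A (x(m := a)) = A (x(m := b))"
    using assms by (auto simp: tame_def)
  have "t \<in> E" if t: "t \<in> fibre (boundary_pt A m) m x" for t
  proof (rule ccontr)
    assume "t \<notin> E"
    then obtain \<epsilon> where \<epsilon>: "\<epsilon> > 0" "ball t \<epsilon> \<subseteq> - E"
      using E(1) open_contains_ball[of "- E"] finite_imp_closed[of E] by (auto simp: open_closed)
    have "A (x(m := u)) = A (x(m := t))" if "\<bar>u - t\<bar> < \<epsilon>" for u
    proof (cases u t rule: linorder_cases)
      case less
      then have "{u..t} \<subseteq> ball t \<epsilon>" using that by (auto simp: dist_real_def)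
      then show ?thesis using E(2)[OF less] \<epsilon>(2) by blast
    next
      case greater
      then have "{t..u} \<subseteq> ball t \<epsilon>" using that by (auto simp: dist_real_def)
      then have "{t..u} \<inter> E = {}" using \<epsilon>(2) by blast
      then show ?thesis using E(2)[OF greater] by simp
    qed simp
    then have "\<not> boundary_pt A m (x(m := t))" unfolding not_boundary_pt using \<epsilon>(1) by blast
    then show False using t unfolding fibre_def by (simp only: mem_Collect_eq)
  qed
  then show ?thesis using E(1) by (auto intro: finite_subset)
qed

lemma boundary_const:
  assumes "connected J" "J \<inter> fibre (boundary_pt A m) m x = {}" "s \<in> J" "t \<in> J"
  shows "A (x(m := s)) = A (x(m := t))"
proof (rule connected_local_const[OF assms(1,3,4), of "\<lambda>t. A (x(m := t))"], intro ballI)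
  fix a assume "a \<in> J"
  then have "a \<notin> fibre (boundary_pt A m) m x" using assms(2) by blast
  then have "\<not> boundary_pt A m (x(m := a))" by (simp only: fibre_def mem_Collect_eq simp_thms)
  then obtain \<epsilon> where \<epsilon>: "\<epsilon> > 0 \<and> (\<forall>u. \<bar>u - a\<bar> < \<epsilon> \<longrightarrow> A (x(m := u)) = A (x(m := a)))"
    unfolding not_boundary_pt by (elim exE)
  then have "\<epsilon> > 0" by (rule conjunct1)
  have "A (x(m := a)) = A (x(m := b))" if "\<bar>b - a\<bar> < \<epsilon>" for b
    using \<epsilon>[THEN conjunct2, THEN spec, THEN mp, OF that] by (simp only:)
  then show "eventually (\<lambda>b. A (x(m := a)) = A (x(m := b))) (at a within J)"
    unfolding eventually_at using \<open>\<epsilon> > 0\<close> by (intro exI[of _ \<epsilon>]) (auto simp: dist_real_def)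
qed

section \<open>Definable families of finite sets and the inductive step of cell
  decomposition\<close>

context o_minimal_structure
begin

lemma Def_upd: assumes "Def F" "\<And>i. DefT (\<lambda>x. T x i)" "DefT h" shows "Def (\<lambda>x. F ((T x)(m := h x)))"
  by (rule Def_comp[OF assms(1)]) (intro defi assms)

lemma Def_card_gt: assumes "Def F" shows "Def (card_gt F m k)"
proof (induction k)
  case 0 then show ?case by (simp add: Def_const)
next
  case (Suc k)
  have "Def (\<lambda>z. \<exists>s. s < z m \<and> F (z(m := s)) \<and> card_gt F m k (z(m := s)))"
    by (intro Def_ex Def_conj Def_less Def_upd[OF assms] Def_upd[OF Suc] DefT_var)
  then show ?case by simp
qed

lemma Def_rank:
  assumes "Def F" "\<And>x. finite (fibre F m x)"
  shows "Def (\<lambda>z. card {u \<in> fibre F m z. u < z m} = i)"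
proof -
  have "Def (\<lambda>z. card_gt F m i z \<and> \<not> card_gt F m (Suc i) z)"
    by (intro Def_conj Def_not Def_card_gt assms)
  moreover have "(card_gt F m i z \<and> \<not> card_gt F m (Suc i) z) \<longleftrightarrow> card {u \<in> fibre F m z. u < z m} = i" for z
    unfolding card_gt_iff[OF assms(2)] by auto
  ultimately show ?thesis by simp
qed

lemma Def_card:
  assumes "Def F" "\<And>x. finite (fibre F m x)"
  shows "Def (\<lambda>x. card (fibre F m x) = k)"
proof -
  \<comment> \<open>The fibre lies below \<open>Max (insert 0 ?T) + 1\<close>, so it has
    \<open>k\<close> elements as soon as some height has \<open>k\<close> of them below it; 0 is
    inserted for the empty fibre.\<close>
  have *: "(\<exists>t. card_gt F m k (x(m := t))) \<longleftrightarrow> k \<le> card (fibre F m x)" for x k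
  proof -
    let ?T = "fibre F m x"
    have eq: "card_gt F m k (x(m := t)) \<longleftrightarrow> k \<le> card {u \<in> ?T. u < t}" for t
      using card_gt_iff[of F m "x(m := t)" k] assms(2)[of x] by (simp only: fibre_upd fun_upd_same)
    have "u < Max (insert 0 ?T) + 1" if "u \<in> ?T" for u
    proof -
      have "u \<le> Max (insert 0 ?T)" by (rule Max_ge) (use assms(2)[of x] that in auto)
      then show ?thesis by linarith
    qed
    then have "?T = {u \<in> ?T. u < Max (insert 0 ?T) + 1}" by blast
    then have 1: "card ?T = card {u \<in> ?T. u < Max (insert 0 ?T) + 1}" by (rule arg_cong)
    have 2: "card {u \<in> ?T. u < t} \<le> card ?T" for t using assms(2) by (intro card_mono) auto
    show ?thesis unfolding eq
    proof
      assume "\<exists>t. k \<le> card {u \<in> ?T. u < t}"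
      then show "k \<le> card ?T" using 2 by (elim exE) (rule order_trans)
    next
      assume "k \<le> card ?T"
      then have "k \<le> card {u \<in> ?T. u < Max (insert 0 ?T) + 1}" using 1 by (simp only:)
      then show "\<exists>t. k \<le> card {u \<in> ?T. u < t}" by (rule exI)
    qed
  qed
  have "Def (\<lambda>x. (\<exists>t. card_gt F m k (x(m := t))) \<and> \<not> (\<exists>t. card_gt F m (Suc k) (x(m := t))))"
    by (intro Def_conj Def_not Def_ex Def_upd[OF Def_card_gt[OF assms(1)]] DefT_var)
  then show ?thesis unfolding * by (rule back_subst[of Def]) auto
qed

lemma DefT_enum:
  assumes "Def F" "\<And>x. finite (fibre F m x)"
  shows "DefT (\<lambda>x. enum (fibre F m x) i)"
proof -
  let ?T = "fibre F m"
  define P where "P x t \<longleftrightarrow> (\<exists>k<Suc i. card (?T x) = k) \<and> t = 0 \<or> \<not> (\<exists>k<Suc i. card (?T x) = k) \<and> F (x(m := t)) \<and>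
    card {u \<in> ?T (x(m := t)). u < (x(m := t)) m} = i" for x t
  have d1: "Def (\<lambda>x. card (?T (\<lambda>i. x (Suc i))) = k)" for k
    by (rule Def_comp[OF Def_card[OF assms]]) (intro defi)
  have d2: "Def (\<lambda>x. F ((\<lambda>i. x (Suc i))(m := x 0)))"
    by (intro Def_upd[OF assms(1)] DefT_var)
  have d3: "Def (\<lambda>x. card {u \<in> ?T ((\<lambda>i. x (Suc i))(m := x 0)). u < ((\<lambda>i. x (Suc i))(m := x 0)) m} = i)"
    by (intro Def_upd[OF Def_rank[OF assms]] DefT_var)
  have "Def (\<lambda>x. P (\<lambda>i. x (Suc i)) (x 0))"
    unfolding P_def by (intro Def_disj Def_conj Def_not Def_bex_less d1 d2 d3 Def_eq DefT_var DefT_const)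
  then show ?thesis
  proof (rule DefT_unique)
    fix x t assume P: "P x t"
    show "t = enum (?T x) i"
    proof (cases "card (?T x) < Suc i")
      case True then show ?thesis using P by (auto simp: P_def enum_def)
    next
      case False
      then have "t \<in> ?T x" "card {u \<in> ?T x. u < t} = i" using P by (auto simp: P_def fibre_def)
      then show ?thesis using enum_unique[OF assms(2)] by metis
    qed
  next
    fix x
    show "P x (enum (?T x) i)"
    proof (cases "card (?T x) < Suc i")
      case True then show ?thesis by (auto simp: P_def enum_def)
    next
      case False
      then have "enum (?T x) i \<in> ?T x" "card {u \<in> ?T x. u < enum (?T x) i} = i" using enum[OF assms(2), of i x] by auto
      then show ?thesis using False by (auto simp: P_def fibre_def)
    qed
  qed
qed

text \<open>Instance of \<open>piecewise\<close>: continuity points are dense in each cell by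
  \<open>cell_cont_list\<close>, and continuity is inherited by smaller cells.\<close>

lemma piecewise_continuous:
  fixes k :: nat
  assumes CD: "\<And>A. A \<in> S m \<Longrightarrow> cellp m (\<lambda>_. True) A"
    and f: "\<And>i. i < k \<Longrightarrow> DefT (f i)" and A: "A \<in> S m"
  shows "cellp m (\<lambda>C. \<forall>i<k. \<forall>x\<in>C. cont_at m C (f i) x) A"
proof (rule piecewise[OF CD _ A])
  fix d C assume C: "cell S m d C"
  define U where "U x \<longleftrightarrow> (\<forall>i<k. cont_at m C (f i) (trunc m x))" for x
  have "Def U" unfolding U_def by (intro Def_ball_less Def_cont_at' cell_definable[OF C] f)
  moreover have tr: "trunc m x = x" if "x \<in> C" for x using cell_subset[OF C] that by (auto intro: trunc_Rn)
  have "\<exists>y\<in>nb m C x \<delta>. U y" if x: "x \<in> C" "\<delta> > 0" for x \<delta>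
  proof -
    obtain y \<delta>' where y: "y \<in> C" "\<delta>' > 0" "nb m C y \<delta>' \<subseteq> {y \<in> nb m C x \<delta>. \<forall>i<k. cont_at m C (f i) y}"
      using cell_cont_list[of m d C k f x \<delta>, OF C f x] by blast
    then have "y \<in> {y \<in> nb m C x \<delta>. \<forall>i<k. cont_at m C (f i) y}" using nb_center[OF y(1,2)] by blast
    then show ?thesis using tr[OF y(1)] by (intro bexI[of _ y]) (simp_all add: U_def)
  qed
  moreover have "cont_at m C' (f i) x" if "C' \<subseteq> {x \<in> C. U x}" "i < k" "x \<in> C'" for C' i x
  proof -
    have "x \<in> C" "U x" "C' \<subseteq> C" using that by auto
    then have "cont_at m C (f i) x" using tr that(2) by (auto simp: U_def)
    then show ?thesis using \<open>C' \<subseteq> C\<close> unfolding cont_at_def by (meson subsetD)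
  qed
  ultimately show "\<exists>U. Def U \<and> (\<forall>x\<in>C. \<forall>\<delta>>0. \<exists>y\<in>nb m C x \<delta>. U y) \<and>
      (\<forall>d' C'. cell S m d' C' \<longrightarrow> C' \<subseteq> {x \<in> C. U x} \<longrightarrow> (\<forall>i<k. \<forall>x\<in>C'. cont_at m C' (f i) x))"
    by (intro exI[of _ U] conjI ballI allI impI) simp_all
qed

text \<open>
  The points near which the fibres are matched up to \<open>\<epsilon>\<close> form a definable set, dense in each cell; the
  cardinality of the fibre is locally constant there.
\<close>

lemma uniform_finiteness:
  assumes CD: "\<And>A. A \<in> S m \<Longrightarrow> cellp m (\<lambda>_. True) A"
    and F: "Def F" "\<And>x. finite (fibre F m x)"
  shows "\<exists>N. \<forall>x\<in>Rn m. card (fibre F m x) \<le> N"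
proof -
  let ?T = "fibre F m"
  have "cellp m (\<lambda>C. \<exists>N. \<forall>x\<in>C. card (?T x) \<le> N) (Rn m)"
  proof (rule piecewise[OF CD])
    fix d C assume C: "cell S m d C"
    have CS: "C \<in> S m" using cell_definable[OF C] .
    define U where "U x \<longleftrightarrow> (\<exists>\<epsilon>>0. \<exists>\<delta>>0. \<forall>y\<in>C. near m \<delta> x y \<longrightarrow> matched \<epsilon> (?T x) (?T y))" for x
    have "Def U" unfolding U_def matched_def fibre_def Ex1_def Ball_def[of "Collect _"] mem_Collect_eq
      by (intro Def_all_S[OF CS] Def_upd[OF F(1)] defi)
    moreover have "\<exists>y\<in>nb m C x \<delta>. U y" if x: "x \<in> C" "\<delta> > 0" for x \<delta>
    proof -
      \<comment> \<open>There are countably many possible cardinalities, so one of them occurs on a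
        whole neighbourhood; within it the \<open>k\<close> enumeration functions have a common
        point of continuity.\<close>
      obtain k x1 \<delta>1 where 1: "x1 \<in> C" "\<delta>1 > 0" "nb m C x1 \<delta>1 \<subseteq> nb m C x \<delta>" "\<And>y. y \<in> nb m C x1 \<delta>1 \<Longrightarrow> card (?T y) = k"
        using cell_sigma_countable[OF C, of "\<lambda>k y. card (?T y) = k" x \<delta>, OF Def_card[OF F] x] by metis
      obtain y \<delta>2 where 2: "y \<in> C" "\<delta>2 > 0" "nb m C y \<delta>2 \<subseteq> {z \<in> nb m C x1 \<delta>1. \<forall>i<k. cont_at m C (\<lambda>x. enum (?T x) i) z}"
        using cell_cont_list[OF C, of k "\<lambda>i x. enum (?T x) i" x1 \<delta>1, OF DefT_enum[OF F] 1(1,2)] by blast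
      have y: "y \<in> nb m C x1 \<delta>1" "\<And>i. i < k \<Longrightarrow> cont_at m C (\<lambda>x. enum (?T x) i) y"
        using 2(3) nb_center[OF 2(1,2)] by blast+
      obtain \<gamma> where \<gamma>: "\<gamma> > 0" "\<forall>i<k. \<forall>j<k. i \<noteq> j \<longrightarrow> \<bar>enum (?T y) i - enum (?T y) j\<bar> \<ge> \<gamma>"
        using finite_gap[of k "enum (?T y)"] enum_less[OF F(2)[of y]] 1(4)[OF y(1)] by blast
      have "\<exists>d>0. \<forall>z\<in>C. near m d y z \<longrightarrow> \<bar>enum (?T z) i - enum (?T y) i\<bar> < \<gamma> / 2" if "i < k" for i
        by (rule cont_atD[OF y(2)[OF that]]) (use \<gamma>(1) in simp)
      then obtain d where d: "\<And>i. i < k \<Longrightarrow> d i > 0 \<and> (\<forall>z\<in>C. near m (d i) y z \<longrightarrow> \<bar>enum (?T z) i - enum (?T y) i\<bar> < \<gamma> / 2)"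
        by metis
      obtain \<delta>3 where 3: "\<delta>3 > 0" "nb m C y \<delta>3 \<subseteq> nb m C x1 \<delta>1" using nb_open[OF y(1)] by blast
      define \<delta>' where "\<delta>' = Min (insert \<delta>3 (d ` {..<k}))"
      have \<delta>': "\<delta>' > 0" "\<delta>' \<le> \<delta>3" "\<And>i. i < k \<Longrightarrow> \<delta>' \<le> d i"
        unfolding \<delta>'_def using d 3(1) by (auto intro!: Min_le)
      have "matched (\<gamma> / 2) (?T y) (?T z)" if z: "z \<in> C" "near m \<delta>' y z" for z
      proof (rule matched_enum)
        show "finite (?T y)" "finite (?T z)" using F(2) by auto
        show "card (?T y) = k" using 1(4) y(1) by auto
        have "z \<in> nb m C y \<delta>3" using z near_mono[OF z(2) \<delta>'(2)] by (simp add: nb_def)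
        then show "card (?T z) = k" using 1(4) 3(2) by auto
        show "\<bar>enum (?T y) i - enum (?T y) j\<bar> \<ge> 2 * (\<gamma> / 2)" if "i < k" "j < k" "i \<noteq> j" for i j
          using \<gamma>(2) that by simp
        show "\<bar>enum (?T z) i - enum (?T y) i\<bar> < \<gamma> / 2" if "i < k" for i
          using d[OF that] z(1) near_mono[OF z(2) \<delta>'(3)[OF that]] by blast
      qed
      then have "U y" unfolding U_def using \<gamma>(1) \<delta>'(1) by (intro exI[of _ "\<gamma> / 2"] conjI exI[of _ \<delta>']) auto
      then show ?thesis using y(1) 1(3) by blast
    qed
    moreover have "\<exists>N. \<forall>x\<in>C'. card (?T x) \<le> N" if C': "cell S m d' C'" "C' \<subseteq> {x \<in> C. U x}" for d' C'
    proof -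
      have "\<exists>\<delta>>0. \<forall>y\<in>nb m C' x \<delta>. card (?T y) = card (?T x)" if x: "x \<in> C'" for x
      proof -
        have "U x" using x C'(2) by blast
        then obtain \<epsilon> \<delta> where "\<delta> > 0" "\<forall>y\<in>C. near m \<delta> x y \<longrightarrow> matched \<epsilon> (?T x) (?T y)"
          unfolding U_def by blast
        moreover have "card (?T y) = card (?T x)" if "y \<in> nb m C' x \<delta>" for y
        proof -
          have "y \<in> C" "near m \<delta> x y" using that C'(2) by (auto simp: nb_def)
          then have "matched \<epsilon> (?T x) (?T y)" using calculation(2) by blast
          from matched_card[OF this] show ?thesis by simp
        qed
        ultimately show ?thesis by blast
      qed
      then have "card (?T x) = card (?T y)" if "x \<in> C'" "y \<in> C'" for x y
        using cell_connected[OF C'(1), of "\<lambda>x. card (?T x)" x y] that by blast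
      then show ?thesis by (metis order_refl)
    qed
    ultimately show "\<exists>U. Def U \<and> (\<forall>x\<in>C. \<forall>\<delta>>0. \<exists>y\<in>nb m C x \<delta>. U y) \<and>
      (\<forall>d' C'. cell S m d' C' \<longrightarrow> C' \<subseteq> {x \<in> C. U x} \<longrightarrow> (\<exists>N. \<forall>x\<in>C'. card (?T x) \<le> N))" by blast
  next
    show "Rn m \<in> S m" using Def_set[OF Def_const[of True], of m] by simp
  qed
  then obtain P where P: "finite P" "\<Union>P = Rn m" "\<forall>C\<in>P. \<exists>N. \<forall>x\<in>C. card (?T x) \<le> N"
    unfolding cellp_def partition_on_def by blast
  obtain N where N: "\<forall>C\<in>P. \<forall>x\<in>C. card (?T x) \<le> N C" using bchoice[OF P(3)] by (elim exE)
  have "card (?T x) \<le> Max (N ` P)" if x: "x \<in> Rn m" for x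
  proof -
    obtain C where C: "C \<in> P" "x \<in> C" using x P(2) by blast
    then have "card (?T x) \<le> N C" using N by blast
    also have "\<dots> \<le> Max (N ` P)" using C(1) P(1) by (intro Max_ge) auto
    finally show ?thesis .
  qed
  then show ?thesis by blast
qed

lemma over_eq:
  assumes "B \<subseteq> Rn m"
  shows "{x(m := t) | x t. x \<in> B \<and> R x t} = {z \<in> Rn (Suc m). trunc m z \<in> B \<and> R (trunc m z) (z m)}"
proof (intro equalityI subsetI)
  fix z assume "z \<in> {x(m := t) | x t. x \<in> B \<and> R x t}"
  then obtain x t where x: "z = x(m := t)" "x \<in> B" "R x t" by (elim CollectE exE conjE)
  have xR: "x \<in> Rn m" using x(2) assms by (rule subsetD[rotated])
  have "trunc m z = x" "z m = t" unfolding x(1) trunc_upd trunc_Rn[OF xR] by simp_all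
  then show "z \<in> {z \<in> Rn (Suc m). trunc m z \<in> B \<and> R (trunc m z) (z m)}"
    using x(2,3) Rn_upd[OF xR, of t] unfolding x(1)[symmetric] by simp
next
  fix z assume "z \<in> {z \<in> Rn (Suc m). trunc m z \<in> B \<and> R (trunc m z) (z m)}"
  then show "z \<in> {x(m := t) | x t. x \<in> B \<and> R x t}"
    using Rn_Suc_upd_trunc[of z m, symmetric] by (intro CollectI exI[of _ "trunc m z"] exI[of _ "z m"]) blast
qed

text \<open>Lifts a decomposition of the base, provided that over each base cell the relation
  \<open>R\<close> cuts out a single graph or band.\<close>

lemma cellp_over:
  assumes "cellp m Q B" "B \<subseteq> Rn m"
    and "\<And>d C. cell S m d C \<Longrightarrow> C \<subseteq> B \<Longrightarrow> Q C \<Longrightarrow> \<exists>d'. cell S (Suc m) d' {x(m := t) | x t. x \<in> C \<and> R x t}"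
  shows "cellp (Suc m) (\<lambda>_. True) {x(m := t) | x t. x \<in> B \<and> R x t}"
proof -
  obtain P where P: "finite P" "partition_on B P" "\<And>C. C \<in> P \<Longrightarrow> (\<exists>d. cell S m d C) \<and> Q C"
    using assms(1) unfolding cellp_def by blast
  have sub: "C \<subseteq> B" if "C \<in> P" for C using P(2) that by (auto simp: partition_on_def)
  have "cellp (Suc m) (\<lambda>_. True) (\<Union>C\<in>P. {x(m := t) | x t. x \<in> C \<and> R x t})"
  proof (rule cellp_UN[OF P(1)])
    fix C C' assume C: "C \<in> P" "C' \<in> P" "C \<noteq> C'"
    then have dis: "C \<inter> C' = {}" using P(2) by (auto simp: partition_on_def disjoint_def)
    show "{x(m := t) | x t. x \<in> C \<and> R x t} \<inter> {x(m := t) | x t. x \<in> C' \<and> R x t} = {}"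
    proof (rule ccontr)
      assume "\<not> ?thesis"
      then obtain z where z: "z \<in> {x(m := t) | x t. x \<in> C \<and> R x t}" "z \<in> {x(m := t) | x t. x \<in> C' \<and> R x t}"
        by blast
      obtain x t where x: "z = x(m := t)" "x \<in> C" using z(1) by (elim CollectE exE conjE)
      obtain y u where y: "z = y(m := u)" "y \<in> C'" using z(2) by (elim CollectE exE conjE)
      have "x \<in> Rn m" "y \<in> Rn m" using sub[OF C(1)] sub[OF C(2)] x(2) y(2) assms(2) by blast+
      moreover have "x(m := t) = y(m := u)" using x(1) y(1) by (simp only:)
      ultimately have "x = y" using upd_inj by blast
      then show False using x(2) y(2) dis by blast
    qed
  next
    fix C assume "C \<in> P"
    then obtain d where "cell S m d C" "Q C" using P(3) by blast
    then obtain d' where "cell S (Suc m) d' {x(m := t) | x t. x \<in> C \<and> R x t}" using assms(3) sub[OF \<open>C \<in> P\<close>] by blast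
    then show "cellp (Suc m) (\<lambda>_. True) {x(m := t) | x t. x \<in> C \<and> R x t}" by (rule cellp_cell) simp
  qed
  moreover have "(\<Union>C\<in>P. {x(m := t) | x t. x \<in> C \<and> R x t}) = {x(m := t) | x t. x \<in> B \<and> R x t}"
    unfolding partition_onD1[OF P(2)] by blast
  ultimately show ?thesis by simp
qed

text \<open>The boundary heights of the fibres of \<open>A\<close> are bounded in number, so
  finitely many functions \<open>enum\<close> list them all. Membership in \<open>A\<close> is
  constant on each gap, hence \<open>A\<close> consists of parts of the graphs of these functions
  and of full gaps over parts of the base.\<close>

lemma cell_decomposition_Suc:
  assumes CD: "\<And>A. A \<in> S m \<Longrightarrow> cellp m (\<lambda>_. True) A" and A: "A \<in> S (Suc m)"
  shows "cellp (Suc m) (\<lambda>_. True) A"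
proof -
  have AR: "A \<subseteq> Rn (Suc m)" using definable_subset[OF A] .
  define a where "a z \<longleftrightarrow> trunc (Suc m) z \<in> A" for z
  have a: "Def a" unfolding a_def by (rule Def_in[OF A])
  define F where "F = boundary_pt a m"
  have F: "Def F" unfolding F_def boundary_pt_def by (intro Def_upd[OF a] defi)
  have fin: "finite (fibre F m x)" for x unfolding F_def by (rule tame_boundary[OF Def_tame[OF a]])
  let ?T = "fibre F m"
  let ?e = "\<lambda>i x. enum (?T x) i"
  obtain N where N: "\<And>x. x \<in> Rn m \<Longrightarrow> card (?T x) \<le> N" using uniform_finiteness[OF CD F fin] by blast
  \<comment> \<open>\<open>G k i\<close> collects the points of \<open>A\<close> at boundary height
    number \<open>i\<close>, \<open>B k i\<close> those in gap number \<open>i\<close>, over base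
    points with \<open>k\<close> boundary heights; so \<open>i < k\<close> for the former and
    \<open>i \<le> k\<close> for the latter.\<close>
  define G where "G k i = {z \<in> A. card (?T z) = k \<and> z m \<in> ?T z \<and> card {u \<in> ?T z. u < z m} = i}" for k i
  define B where "B k i = {z \<in> A. card (?T z) = k \<and> z m \<notin> ?T z \<and> card {u \<in> ?T z. u < z m} = i}" for k i
  have zu: "(trunc m z)(m := z m) = z" if "z \<in> Rn (Suc m)" for z by (rule Rn_Suc_upd_trunc[OF that])
  have Tz: "?T z = ?T (trunc m z)" if "z \<in> Rn (Suc m)" for z
    using fibre_upd[of F m "trunc m z" "z m"] unfolding zu[OF that] .
  have az: "a z \<longleftrightarrow> z \<in> A" if "z \<in> Rn (Suc m)" for z by (simp only: a_def trunc_Rn[OF that])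
  have Rn: "Rn m \<in> S m" using Def_set[OF Def_const[of True], of m] by simp
  have cont: "cellp m (\<lambda>C. \<forall>i<k. \<forall>x\<in>C. cont_at m C (?e i) x) B" if "B \<in> S m" for k B
    by (rule piecewise_continuous[OF CD DefT_enum[OF F fin] that])
  have bound: "cell_bound S m C (\<lambda>x. ereal (?e i x))" if "cell S m d C" "\<forall>x\<in>C. cont_at m C (?e i) x" for d C i
    unfolding cell_bound_def
    using definable_fun_iff[OF cell_definable[OF that(1)], of "?e i"] DefT_enum[OF F fin, of i]
      continuous_on_iff_cont_at[OF cell_subset[OF that(1)], of "?e i"] that(2) by blast
  have bound_inf: "cell_bound S m C (\<lambda>x. - \<infinity>)" "cell_bound S m C (\<lambda>x. \<infinity>)" for C
    by (simp_all add: cell_bound_def)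
  have G: "cellp (Suc m) (\<lambda>_. True) (G k i)" if "i < k" for k i
  proof -
    let ?B = "{x \<in> Rn m. card (?T x) = k \<and> a (x(m := ?e i x))}"
    have "?B \<in> S m"
      by (intro Def_set Def_conj Def_card F fin Def_upd[OF a] DefT_enum DefT_var)
    then have "cellp (Suc m) (\<lambda>_. True) {x(m := t) | x t. x \<in> ?B \<and> t = ?e i x}"
    proof (rule cellp_over[OF cont[where k = k], where R = "\<lambda>x t. t = ?e i x"])
      fix d C assume C: "cell S m d C" "\<forall>i<k. \<forall>x\<in>C. cont_at m C (?e i) x"
      have "cell S (Suc m) d {x(m := ?e i x) | x. x \<in> C}"
        by (rule cell_graph[OF C(1) DefT_enum[OF F fin]]) (use C(2) that in blast)
      then show "\<exists>d'. cell S (Suc m) d' {x(m := t) | x t. x \<in> C \<and> t = ?e i x}"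
        unfolding over_eq[OF cell_subset[OF C(1)]] graph_set_eq[OF cell_subset[OF C(1)]] by (rule exI)
    qed auto
    moreover have "{x(m := t) | x t. x \<in> ?B \<and> t = ?e i x} = G k i"
    proof -
      have "?B \<subseteq> Rn m" by blast
      have "trunc m z \<in> ?B \<and> z m = ?e i (trunc m z) \<longleftrightarrow> z \<in> G k i" if z: "z \<in> Rn (Suc m)" for z
      proof -
        let ?x = "trunc m z"
        have "z m = ?e i ?x \<longleftrightarrow> z m \<in> ?T ?x \<and> card {u \<in> ?T ?x. u < z m} = i" if "card (?T ?x) = k"
          using enum[OF fin, of i ?x] enum_unique[OF fin, of "z m" ?x] \<open>i < k\<close> that by auto
        moreover have "a (?x(m := ?e i ?x)) \<longleftrightarrow> z \<in> A" if "z m = ?e i ?x"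
          unfolding that[symmetric] zu[OF z] by (rule az[OF z])
        ultimately show ?thesis unfolding G_def mem_Collect_eq Tz[OF z] using trunc_in_Rn[of m z] by blast
      qed
      then show ?thesis unfolding over_eq[OF \<open>?B \<subseteq> Rn m\<close>] using AR unfolding G_def by blast
    qed
    ultimately show ?thesis by simp
  qed
  have B: "cellp (Suc m) (\<lambda>_. True) (B k i)" if "i \<le> k" for k i
  proof -
    define L where "L x = (if i = 0 then - \<infinity> else ereal (?e (i - 1) x))" for x
    define U where "U x = (if i = k then \<infinity> else ereal (?e i x))" for x
    have LU: "t \<notin> ?T x \<and> card {u \<in> ?T x. u < t} = i \<longleftrightarrow> L x < ereal t \<and> ereal t < U x" if "card (?T x) = k" for x t
      using rank_band[OF fin[of x], of i t] \<open>i \<le> k\<close> that by (auto simp: L_def U_def)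
    let ?q = "\<lambda>x t. t \<notin> ?T x \<and> card {u \<in> ?T x. u < t} = i"
    \<comment> \<open>A gap belongs to \<open>A\<close> entirely or not at all, so one witness
      \<open>t\<close> selects the base points.\<close>
    let ?B = "{x \<in> Rn m. card (?T x) = k \<and> (\<exists>t. ((x(m := t)) m \<notin> ?T (x(m := t)) \<and> card {u \<in> ?T (x(m := t)). u < (x(m := t)) m} = i) \<and> a (x(m := t)))}"
    have d: "Def (\<lambda>z. z m \<notin> ?T z \<and> card {u \<in> ?T z. u < z m} = i)"
    proof -
      have "Def (\<lambda>z. \<not> F z)" using F by (rule Def_not)
      moreover have "(\<lambda>z. \<not> F z) = (\<lambda>z. z m \<notin> ?T z)" by (auto simp: fibre_def)
      ultimately show ?thesis using Def_rank[OF F fin] by (auto intro: Def_conj)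
    qed
    have BS: "?B \<in> S m"
      by (intro Def_set Def_conj Def_ex Def_card F fin Def_upd[OF a] Def_upd[OF d] DefT_var)
    have less: "L x < U x" if x: "x \<in> ?B" for x
    proof -
      obtain t where "?q x t" "card (?T x) = k" using x unfolding mem_Collect_eq fibre_upd fun_upd_same by blast
      then have "L x < ereal t" "ereal t < U x" using LU by blast+
      then show ?thesis by (rule less_trans)
    qed
    from BS have "cellp (Suc m) (\<lambda>_. True) {x(m := t) | x t. x \<in> ?B \<and> L x < ereal t \<and> ereal t < U x}"
    proof (rule cellp_over[OF cont[where k = k], where R = "\<lambda>x t. L x < ereal t \<and> ereal t < U x"])
      fix d C assume C: "cell S m d C" "C \<subseteq> ?B" "\<forall>i<k. \<forall>x\<in>C. cont_at m C (?e i) x"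
      have "cell_bound S m C L"
      proof (cases "i = 0")
        case True then show ?thesis using bound_inf unfolding L_def by simp
      next
        case False then show ?thesis using bound[OF C(1), of "i - 1"] C(3) \<open>i \<le> k\<close> unfolding L_def by simp
      qed
      moreover have "cell_bound S m C U"
      proof (cases "i = k")
        case True then show ?thesis using bound_inf unfolding U_def by simp
      next
        case False then show ?thesis using bound[OF C(1), of i] C(3) \<open>i \<le> k\<close> unfolding U_def by simp
      qed
      moreover have "L x < U x" if "x \<in> C" for x by (rule less) (use that C(2) in blast)
      ultimately show "\<exists>d'. cell S (Suc m) d' {x(m := t) | x t. x \<in> C \<and> L x < ereal t \<and> ereal t < U x}"
        using cell.band[OF C(1)] by blast
    qed auto
    moreover have "{x(m := t) | x t. x \<in> ?B \<and> L x < ereal t \<and> ereal t < U x} = B k i"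
    proof -
      have sub: "?B \<subseteq> Rn m" by blast
      have "trunc m z \<in> ?B \<and> L (trunc m z) < ereal (z m) \<and> ereal (z m) < U (trunc m z) \<longleftrightarrow> z \<in> B k i"
        if z: "z \<in> Rn (Suc m)" for z
      proof -
        let ?x = "trunc m z"
        have const: "a (?x(m := s)) = a (?x(m := t))" if c: "card (?T ?x) = k" and st: "?q ?x s" "?q ?x t" for s t
        proof (rule boundary_const)
          have J: "{u. ?q ?x u} = {u. L ?x < ereal u \<and> ereal u < U ?x}" using LU[OF c] by blast
          have "is_interval {u. L ?x < ereal u \<and> ereal u < U ?x}"
            unfolding is_interval_1 by (auto simp: L_def U_def split: if_splits)
          then show "connected {u. ?q ?x u}" unfolding J by (rule is_interval_connected)
          show "{u. ?q ?x u} \<inter> fibre (boundary_pt a m) m ?x = {}" unfolding F_def by blast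
        qed (use st in blast)+
        have "(\<exists>t. ?q ?x t \<and> a (?x(m := t))) \<longleftrightarrow> z \<in> A" if c: "card (?T ?x) = k" and q: "?q ?x (z m)"
        proof -
          have "(\<exists>t. ?q ?x t \<and> a (?x(m := t))) \<longleftrightarrow> a (?x(m := z m))"
          proof
            assume "\<exists>t. ?q ?x t \<and> a (?x(m := t))"
            then obtain t where t: "?q ?x t \<and> a (?x(m := t))" by (elim exE)
            show "a (?x(m := z m))" using const[OF c conjunct1[OF t] q] conjunct2[OF t] by (rule iffD1)
          next
            assume "a (?x(m := z m))"
            with q have "?q ?x (z m) \<and> a (?x(m := z m))" by (rule conjI)
            then show "\<exists>t. ?q ?x t \<and> a (?x(m := t))" by (rule exI)
          qed
          then show ?thesis unfolding zu[OF z] az[OF z] .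
        qed
        then show ?thesis
          unfolding B_def mem_Collect_eq Tz[OF z] fibre_upd fun_upd_same using LU[of ?x "z m"] trunc_in_Rn[of m z] by blast
      qed
      then show ?thesis unfolding over_eq[OF sub] using AR unfolding B_def by blast
    qed
    ultimately show ?thesis by simp
  qed
  have Gk: "cellp (Suc m) (\<lambda>_. True) (\<Union>i\<in>{..<k}. G k i)" for k
    by (rule cellp_UN) (use G in \<open>auto simp: G_def\<close>)
  have Bk: "cellp (Suc m) (\<lambda>_. True) (\<Union>i\<in>{..k}. B k i)" for k
    by (rule cellp_UN) (use B in \<open>auto simp: B_def\<close>)
  have "cellp (Suc m) (\<lambda>_. True) ((\<Union>i\<in>{..<k}. G k i) \<union> (\<Union>i\<in>{..k}. B k i))" for k
    by (rule cellp_Un[OF _ Gk Bk]) (auto simp: G_def B_def)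
  then have "cellp (Suc m) (\<lambda>_. True) (\<Union>k\<in>{..N}. (\<Union>i\<in>{..<k}. G k i) \<union> (\<Union>i\<in>{..k}. B k i))"
    by (intro cellp_UN) (auto simp: G_def B_def)
  moreover have "(\<Union>k\<in>{..N}. (\<Union>i\<in>{..<k}. G k i) \<union> (\<Union>i\<in>{..k}. B k i)) = A"
  proof (intro equalityI subsetI)
    fix z assume z: "z \<in> A"
    then have z': "z \<in> Rn (Suc m)" using AR by blast
    let ?k = "card (?T z)" and ?i = "card {u \<in> ?T z. u < z m}"
    have k: "?k \<le> N" unfolding Tz[OF z'] by (rule N) simp
    have fz: "finite (?T z)" using fin .
    show "z \<in> (\<Union>k\<in>{..N}. (\<Union>i\<in>{..<k}. G k i) \<union> (\<Union>i\<in>{..k}. B k i))"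
    proof (cases "z m \<in> ?T z")
      case True
      then have "?i < ?k" using fz by (intro psubset_card_mono) auto
      moreover have "z \<in> G ?k ?i" using True z by (simp add: G_def)
      ultimately show ?thesis using k by blast
    next
      case False
      have "?i \<le> ?k" using fz by (intro card_mono) auto
      moreover have "z \<in> B ?k ?i" using False z by (simp add: B_def)
      ultimately show ?thesis using k by blast
    qed
  qed (auto simp: G_def B_def)
  ultimately show ?thesis by simp
qed

theorem cell_decomposition: "A \<in> S m \<Longrightarrow> cellp m (\<lambda>_. True) A"
proof (induction m arbitrary: A)
  case 0
  then have "A = {} \<or> A = Rn 0" using definable_subset[OF 0] by (auto simp: Rn_0)
  then show ?case using cellp_empty cellp_cell[OF cell.point] by auto
next
  case (Suc m)
  then show ?case by (rule cell_decomposition_Suc)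
qed

end

section \<open>The Euler integral of a tame function\<close>

text \<open>Pairing each break point with the gap to its right leaves only the gap at the bottom
  unpaired; hence right limits and the value near minus infinity are all that the integral needs
  besides the values at the jumps.\<close>

definition right_val :: "(real \<Rightarrow> int) \<Rightarrow> real \<Rightarrow> int" where
  "right_val f x = (THE c. \<exists>\<delta>>0. \<forall>t. x < t \<and> t < x + \<delta> \<longrightarrow> f t = c)"

definition bot_val :: "(real \<Rightarrow> int) \<Rightarrow> int" where
  "bot_val f = (THE c. \<exists>M. \<forall>t<M. f t = c)"

text \<open>
  Normalized so that points integrate to \<open>1\<close> and open intervals to \<open>-1\<close>; being linear in \<open>f\<close>, it needs no
  decomposition of the line.
\<close>

definition euler_int :: "(real \<Rightarrow> int) \<Rightarrow> int" where
  "euler_int f = (\<Sum>x | f x \<noteq> right_val f x. f x - right_val f x) - bot_val f"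

lemma tame_map2: assumes "tame f" "tame g" shows "tame (\<lambda>x. h (f x) (g x))"
proof -
  obtain F G where "finite F" "\<And>a b. a < b \<Longrightarrow> {a..b} \<inter> F = {} \<Longrightarrow> f a = f b"
    "finite G" "\<And>a b. a < b \<Longrightarrow> {a..b} \<inter> G = {} \<Longrightarrow> g a = g b"
    using assms unfolding tame_def by blast
  then show ?thesis unfolding tame_def
    by (intro exI[of _ "F \<union> G"]) (metis Int_Un_distrib Un_empty finite_UnI)
qed

lemma tame_const: "tame (\<lambda>x. c)"
  unfolding tame_def by (intro exI[of _ "{}"]) auto

lemma tame_map: "tame f \<Longrightarrow> tame (\<lambda>x. h (f x))"
  using tame_map2[of f f "\<lambda>x _. h x"] .

lemma right_val_eq:
  assumes "\<delta> > 0" "\<And>t. x < t \<Longrightarrow> t < x + \<delta> \<Longrightarrow> f t = c" shows "right_val f x = c"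
  unfolding right_val_def
proof (rule the_equality)
  show "\<exists>\<delta>>0. \<forall>t. x < t \<and> t < x + \<delta> \<longrightarrow> f t = c" using assms by blast
  fix c' assume "\<exists>\<delta>>0. \<forall>t. x < t \<and> t < x + \<delta> \<longrightarrow> f t = c'"
  then obtain \<delta>' where "\<delta>' > 0" "\<And>t. x < t \<and> t < x + \<delta>' \<Longrightarrow> f t = c'" by blast
  then show "c' = c" using assms(2)[of "x + min \<delta> \<delta>' / 2"] assms(1) by force
qed

lemma right_val: assumes "tame f" shows "\<exists>\<delta>>0. \<forall>t. x < t \<and> t < x + \<delta> \<longrightarrow> f t = right_val f x"
proof -
  obtain c \<delta> where "\<delta> > 0" "\<And>t. x < t \<and> t < x + \<delta> \<Longrightarrow> f t = c" using tame_right[OF assms] by blast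
  then show ?thesis using right_val_eq[of \<delta> x f c] by blast
qed

lemma bot_val_eq: assumes "\<And>t. t < M \<Longrightarrow> f t = c" shows "bot_val f = c"
  unfolding bot_val_def
proof (rule the_equality)
  show "\<exists>M. \<forall>t<M. f t = c" using assms by blast
  fix c' assume "\<exists>M. \<forall>t<M. f t = c'"
  then obtain M' where "\<And>t. t < M' \<Longrightarrow> f t = c'" by blast
  then show "c' = c" using assms[of "min M M' - 1"] by force
qed

lemma bot_val: assumes "tame f" shows "\<exists>M. \<forall>t<M. f t = bot_val f"
proof -
  obtain F where F: "finite F" "\<And>a b. a < b \<Longrightarrow> {a..b} \<inter> F = {} \<Longrightarrow> f a = f b"
    using assms by (auto simp: tame_def)
  define M where "M = Min (insert 0 F)"
  have M: "x \<ge> M" if "x \<in> F" for x unfolding M_def using that F(1) by (intro Min_le) auto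
  have nF: "x \<notin> F" if "x < M" for x using M[of x] that by linarith
  have "f t = f (M - 1)" if "t < M" for t
  proof (cases t "M - 1" rule: linorder_cases)
    case less
    have "v \<notin> F" if "v \<in> {t..M - 1}" for v by (rule nF) (use that in simp)
    then have "{t..M - 1} \<inter> F = {}" by blast
    then show ?thesis using F(2)[OF less] by simp
  next
    case greater
    have "v \<notin> F" if "v \<in> {M - 1..t}" for v by (rule nF) (use that \<open>t < M\<close> in simp)
    then have "{M - 1..t} \<inter> F = {}" by blast
    then show ?thesis using F(2)[OF greater] by simp
  qed simp
  note eq = this
  have bv: "bot_val f = f (M - 1)" by (rule bot_val_eq[OF eq])
  show ?thesis unfolding bv by (intro exI[of _ M] allI impI) (rule eq)
qed

lemma jumps_finite: assumes "tame f" shows "finite {x. f x \<noteq> right_val f x}"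
proof -
  obtain F where F: "finite F" "\<And>a b. a < b \<Longrightarrow> {a..b} \<inter> F = {} \<Longrightarrow> f a = f b"
    using assms by (auto simp: tame_def)
  have "f x = right_val f x" if "x \<notin> F" for x
  proof -
    obtain \<delta> where \<delta>: "\<delta> > 0" "\<And>t. x < t \<and> t < x + \<delta> \<Longrightarrow> t \<notin> F" using finite_gap_right[OF F(1)] by blast
    have "f t = f x" if t: "x < t" "t < x + \<delta>" for t
    proof -
      have "u \<notin> F" if "x \<le> u" "u \<le> t" for u using \<delta>(2)[of u] \<open>x \<notin> F\<close> that t by (cases "u = x") auto
      then have "{x..t} \<inter> F = {}" by auto
      then show ?thesis using F(2)[OF t(1)] by simp
    qed
    then show ?thesis using right_val_eq[OF \<delta>(1), of x f "f x"] by simp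
  qed
  then have "{x. f x \<noteq> right_val f x} \<subseteq> F" by blast
  then show ?thesis using F(1) finite_subset by blast
qed

text \<open>Points without a jump contribute 0, so several functions can be summed over a common
  finite set.\<close>

lemma euler_int_eq:
  assumes "finite G" "\<And>x. f x \<noteq> right_val f x \<Longrightarrow> x \<in> G"
  shows "euler_int f = (\<Sum>x\<in>G. f x - right_val f x) - bot_val f"
  unfolding euler_int_def by (subst sum.mono_neutral_left[of G]) (use assms in auto)

lemma euler_int_add:
  assumes "tame f" "tame g" shows "euler_int (\<lambda>x. f x + g x) = euler_int f + euler_int g"
proof -
  have rv: "right_val (\<lambda>x. f x + g x) x = right_val f x + right_val g x" for x
  proof -
    obtain \<delta>1 \<delta>2 where "\<delta>1 > 0" "\<And>t. x < t \<and> t < x + \<delta>1 \<Longrightarrow> f t = right_val f x"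
      "\<delta>2 > 0" "\<And>t. x < t \<and> t < x + \<delta>2 \<Longrightarrow> g t = right_val g x" using right_val assms by meson
    then show ?thesis by (intro right_val_eq[of "min \<delta>1 \<delta>2"]) auto
  qed
  have bv: "bot_val (\<lambda>x. f x + g x) = bot_val f + bot_val g"
  proof -
    obtain M1 M2 where "\<And>t. t < M1 \<Longrightarrow> f t = bot_val f" "\<And>t. t < M2 \<Longrightarrow> g t = bot_val g" using bot_val assms by meson
    then show ?thesis by (intro bot_val_eq[of "min M1 M2"]) auto
  qed
  let ?G = "{x. f x \<noteq> right_val f x} \<union> {x. g x \<noteq> right_val g x}"
  have fin: "finite ?G" using jumps_finite assms by blast
  have "euler_int (\<lambda>x. f x + g x) = (\<Sum>x\<in>?G. f x + g x - right_val (\<lambda>x. f x + g x) x) - bot_val (\<lambda>x. f x + g x)"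
    by (rule euler_int_eq[OF fin]) (auto simp: rv)
  moreover have "euler_int f = (\<Sum>x\<in>?G. f x - right_val f x) - bot_val f" by (rule euler_int_eq[OF fin]) auto
  moreover have "euler_int g = (\<Sum>x\<in>?G. g x - right_val g x) - bot_val g" by (rule euler_int_eq[OF fin]) auto
  ultimately show ?thesis by (simp add: rv bv sum.distrib sum_subtractf)
qed

lemma euler_int_cmult: assumes "tame f" shows "euler_int (\<lambda>x. c * f x) = c * euler_int f"
proof -
  have rv: "right_val (\<lambda>x. c * f x) x = c * right_val f x" for x
    using right_val[OF assms, of x] by (auto intro: right_val_eq)
  have bv: "bot_val (\<lambda>x. c * f x) = c * bot_val f"
  proof -
    obtain M where "\<forall>t<M. f t = bot_val f" using bot_val[OF assms] by blast
    then show ?thesis by (intro bot_val_eq[of M]) simp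
  qed
  let ?G = "{x. f x \<noteq> right_val f x}"
  have "euler_int (\<lambda>x. c * f x) = (\<Sum>x\<in>?G. c * f x - right_val (\<lambda>x. c * f x) x) - bot_val (\<lambda>x. c * f x)"
    by (rule euler_int_eq[OF jumps_finite[OF assms]]) (auto simp: rv)
  then show ?thesis by (simp add: rv bv euler_int_def sum_distrib_left right_diff_distrib)
qed

lemma euler_int_0 [simp]: "euler_int (\<lambda>x. 0) = 0"
  using euler_int_cmult[OF tame_const, of 0 0] by simp

lemma euler_int_interval:
  assumes "l < u" shows "euler_int (\<lambda>t. of_bool (l < ereal t \<and> ereal t < u)) = -1"
proof -
  let ?f = "\<lambda>t. of_bool (l < ereal t \<and> ereal t < u) :: int"
  have rv: "right_val ?f x = of_bool (l \<le> ereal x \<and> ereal x < u)" for x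
  proof -
    have "\<exists>\<delta>>0. \<forall>t. x < t \<and> t < x + \<delta> \<longrightarrow> ?f t = of_bool (l \<le> ereal x \<and> ereal x < u)"
    proof (cases "ereal x < l")
      case True
      then obtain r where r: "ereal x < ereal r" "ereal r < l" using ereal_dense2 by blast
      have "\<not> l < ereal t" if "t < r" for t using r that by (meson less_ereal.simps(1) less_trans not_less_iff_gr_or_eq)
      then show ?thesis using r True by (intro exI[of _ "r - x"]) auto
    next
      case False
      then have l: "l < ereal t" if "x < t" for t using that by (meson le_less_trans less_ereal.simps(1) not_le)
      show ?thesis
      proof (cases "ereal x < u")
        case True
        then obtain r where r: "ereal x < ereal r" "ereal r < u" using ereal_dense2 by blast
        have "ereal t < u" if "t < r" for t using r that by (meson less_ereal.simps(1) less_trans)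
        then show ?thesis using r True l False by (intro exI[of _ "r - x"]) auto
      next
        case u: False
        then have "\<not> ereal t < u" if "x < t" for t using that by (meson less_ereal.simps(1) less_trans not_less_iff_gr_or_eq)
        then show ?thesis using u by (intro exI[of _ 1]) auto
      qed
    qed
    then show ?thesis by (blast intro: right_val_eq)
  qed
  \<comment> \<open>Only the left end contributes, since at \<open>u\<close> both the value and the
    right limit vanish. If \<open>l\<close> is minus infinity, \<open>bot_val\<close> takes
    over.\<close>
  have diff: "?f x - right_val ?f x = - of_bool (l = ereal x)" for x
    using assms by (auto simp: rv)
  show ?thesis
  proof (cases l)
    case (real a)
    have "bot_val ?f = 0" by (rule bot_val_eq[of a]) (auto simp: real)
    moreover have "euler_int ?f = (\<Sum>x\<in>{a}. ?f x - right_val ?f x) - bot_val ?f"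
    proof (rule euler_int_eq)
      fix x assume "?f x \<noteq> right_val ?f x"
      then have "?f x - right_val ?f x \<noteq> 0" by (simp only: right_minus_eq not_False_eq_True)
      then show "x \<in> {a}" unfolding diff by (simp add: real split: if_splits)
    qed simp
    ultimately show ?thesis unfolding diff by (simp add: real)
  next
    case PInf then show ?thesis using assms by simp
  next
    case MInf
    obtain r where r: "ereal r < u" using assms MInf ereal_dense2 by blast
    have "ereal t < u" if "t < r" for t using r that by (meson less_ereal.simps(1) less_trans)
    then have "bot_val ?f = 1" by (intro bot_val_eq[of r]) (auto simp: MInf)
    moreover have "euler_int ?f = (\<Sum>x\<in>{}. ?f x - right_val ?f x) - bot_val ?f"
    proof (rule euler_int_eq)
      fix x assume "?f x \<noteq> right_val ?f x"
      then have "?f x - right_val ?f x \<noteq> 0" by (simp only: right_minus_eq not_False_eq_True)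
      then show "x \<in> {}" unfolding diff by (simp add: MInf)
    qed simp
    ultimately show ?thesis by simp
  qed
qed

lemma euler_int_point: "euler_int (\<lambda>t. of_bool (t = a) * c) = c"
proof -
  let ?f = "\<lambda>t. of_bool (t = a) * c"
  have "right_val ?f x = 0" for x
    by (rule right_val_eq[of "if a > x then a - x else 1"]) auto
  moreover have "bot_val ?f = 0" by (rule bot_val_eq[of a]) auto
  ultimately show ?thesis using euler_int_eq[of "{a}" ?f] by (simp split: if_splits)
qed

text \<open>Such a set is the interval between its infimum and its supremum in the extended reals,
  both excluded because the set is open.\<close>

lemma euler_int_open_connected:
  assumes "open J" "connected J" "J \<noteq> {}" shows "euler_int (\<lambda>t. of_bool (t \<in> J)) = -1"
proof -
  let ?l = "INF t\<in>J. ereal t" and ?u = "SUP t\<in>J. ereal t"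
  have int: "is_interval J" using assms(2) is_interval_connected_1 by blast
  have out: "\<exists>t1\<in>J. \<exists>t2\<in>J. t1 < t \<and> t < t2" if t: "t \<in> J" for t
  proof -
    obtain e where e: "e > 0" "ball t e \<subseteq> J" using assms(1) t open_contains_ball by blast
    have "t - e / 2 \<in> ball t e" "t + e / 2 \<in> ball t e" using e(1) by (auto simp: dist_real_def)
    then show ?thesis using e by (intro bexI[of _ "t - e / 2"] bexI[of _ "t + e / 2"]) auto
  qed
  have iff: "t \<in> J \<longleftrightarrow> ?l < ereal t \<and> ereal t < ?u" for t
  proof
    assume "t \<in> J"
    then obtain t1 t2 where "t1 \<in> J" "t2 \<in> J" "t1 < t" "t < t2" using out by blast
    then show "?l < ereal t \<and> ereal t < ?u" by (auto simp: INF_less_iff less_SUP_iff)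
  next
    assume "?l < ereal t \<and> ereal t < ?u"
    then obtain t1 t2 where "t1 \<in> J" "t2 \<in> J" "t1 < t" "t < t2" by (auto simp: INF_less_iff less_SUP_iff)
    then show "t \<in> J" using int unfolding is_interval_1 by (meson less_imp_le)
  qed
  obtain t where "t \<in> J" using assms(3) by blast
  then have "?l < ?u" using iff[of t] by (meson less_trans)
  from euler_int_interval[OF this] show ?thesis unfolding iff[symmetric] .
qed

section \<open>Iterated integrals over coordinates\<close>

definition Int_at :: "nat \<Rightarrow> ((nat \<Rightarrow> real) \<Rightarrow> int) \<Rightarrow> (nat \<Rightarrow> real) \<Rightarrow> int" where
  "Int_at i f x = euler_int (\<lambda>t. f (x(i := t)))"

text \<open>The head of the list is the outermost integral, evaluated last.\<close>

primrec Int_list :: "nat list \<Rightarrow> ((nat \<Rightarrow> real) \<Rightarrow> int) \<Rightarrow> (nat \<Rightarrow> real) \<Rightarrow> int" where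
  "Int_list [] f = f"
| "Int_list (i # is) f = Int_at i (Int_list is f)"

lemma Int_list_append: "Int_list (xs @ ys) f = Int_list xs (Int_list ys f)"
  by (induction xs) auto

text \<open>Integration over \<open>is\<close> never changes the other coordinates, so agreement is
  needed only on sequences that coincide with \<open>x\<close> there.\<close>

lemma Int_list_cong:
  assumes "\<And>y. (\<And>j. j \<notin> set is \<Longrightarrow> y j = x j) \<Longrightarrow> f y = g y" shows "Int_list is f x = Int_list is g x"
  using assms
proof (induction "is" arbitrary: x)
  case (Cons i "is")
  have "Int_list is f (x(i := t)) = Int_list is g (x(i := t))" for t
    by (rule Cons.IH) (rule Cons.prems, auto)
  then show ?case by (simp only: Int_list.simps Int_at_def)
qed auto

lemma Int_list_shift:
  "Int_list (map ((+) m) is) (\<lambda>z. g (\<lambda>i. z (m + i))) = (\<lambda>z. Int_list is g (\<lambda>i. z (m + i)))"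
proof (induction "is")
  case (Cons i "is")
  have "(\<lambda>j. (z(m + i := t)) (m + j)) = (\<lambda>j. z (m + j))(i := t)" for z :: "nat \<Rightarrow> real" and t by auto
  then show ?case using Cons by (simp only: list.map Int_list.simps Int_at_def)
qed auto

lemma Int_list_point:
  assumes "y \<in> Rn k" shows "Int_list [0..<k] (\<lambda>w. of_bool (trunc k w = y)) = (\<lambda>_. 1)"
  using assms
proof (induction k arbitrary: y)
  case 0
  have "trunc 0 w = y" for w by (rule Rn_eqI[OF trunc_in_Rn 0]) simp
  then show ?case by (simp only: upt_0 Int_list.simps of_bool_eq(2) simp_thms)
next
  case (Suc k)
  have "Int_at k (\<lambda>w. of_bool (trunc (Suc k) w = y)) w = of_bool (trunc k w = trunc k y)" for w
  proof -
    have "trunc (Suc k) (w(k := t)) = y \<longleftrightarrow> t = y k \<and> trunc k w = trunc k y" for t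
    proof -
      have "(trunc k w)(k := t) = (trunc k y)(k := y k) \<longleftrightarrow> t = y k \<and> trunc k w = trunc k y"
      proof
        assume "(trunc k w)(k := t) = (trunc k y)(k := y k)"
        from upd_inj[OF trunc_in_Rn trunc_in_Rn this] show "t = y k \<and> trunc k w = trunc k y" by (simp only:)
      qed (simp only:)
      then show ?thesis unfolding trunc_Suc_upd Rn_Suc_upd_trunc[OF Suc.prems] .
    qed
    then have "Int_at k (\<lambda>w. of_bool (trunc (Suc k) w = y)) w = euler_int (\<lambda>t. of_bool (t = y k) * of_bool (trunc k w = trunc k y))"
      unfolding Int_at_def by (simp only: of_bool_conj)
    then show ?thesis unfolding euler_int_point .
  qed
  then have *: "Int_at k (\<lambda>w. of_bool (trunc (Suc k) w = y)) = (\<lambda>w. of_bool (trunc k w = trunc k y))" by (rule ext)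
  show ?case unfolding upt_Suc_append[OF le0] Int_list_append Int_list.simps *
    by (rule Suc.IH) simp
qed

text \<open>The maximum over a compact subinterval is attained, and local increase to the right
  excludes every point but the right end.\<close>

lemma strict_mono_of_right:
  fixes \<phi> :: "real \<Rightarrow> real"
  assumes J: "is_interval J" and c: "continuous_on J \<phi>"
    and r: "\<And>s. s \<in> J \<Longrightarrow> \<exists>\<delta>>0. \<forall>u. s < u \<and> u < s + \<delta> \<longrightarrow> \<phi> s < \<phi> u"
  shows "s \<in> J \<Longrightarrow> u \<in> J \<Longrightarrow> s < u \<Longrightarrow> \<phi> s < \<phi> u"
proof -
  assume a: "s \<in> J" "u \<in> J" "s < u"
  have sub: "{s..u} \<subseteq> J" using mem_is_interval_1_I[OF J a(1,2)] by (intro subsetI) simp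
  have max: "v = u" if v: "v \<in> {s..u}" "\<And>w. w \<in> {s..u} \<Longrightarrow> \<phi> w \<le> \<phi> v" for v
  proof (rule ccontr)
    assume "v \<noteq> u"
    then have "v < u" using v(1) by auto
    have "v \<in> J" using sub v(1) by blast
    then obtain \<delta> where \<delta>: "\<delta> > 0" "\<forall>w. v < w \<and> w < v + \<delta> \<longrightarrow> \<phi> v < \<phi> w" using r by meson
    obtain w where w: "v < w" "w < min u (v + \<delta>)" using dense[of v "min u (v + \<delta>)"] \<delta>(1) \<open>v < u\<close> by auto
    then have "\<phi> v < \<phi> w" using \<delta>(2)[THEN spec, of w] by simp
    moreover have "\<phi> w \<le> \<phi> v" by (rule v(2)) (use w v(1) in simp)
    ultimately show False by simp
  qed
  obtain v where v: "v \<in> {s..u}" "\<And>w. w \<in> {s..u} \<Longrightarrow> \<phi> w \<le> \<phi> v"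
    using continuous_attains_sup[of "{s..u}" \<phi>] a(3) continuous_on_subset[OF c sub] by auto
  have vu: "v = u" using v by (rule max)
  have u: "\<phi> w \<le> \<phi> u" if "w \<in> {s..u}" for w using v(2)[OF that] vu by simp
  show ?thesis
  proof (rule ccontr)
    assume "\<not> \<phi> s < \<phi> u"
    then have su: "\<phi> u \<le> \<phi> s" by simp
    have "s = u"
    proof (rule max)
      show "s \<in> {s..u}" using a(3) by simp
      show "\<phi> w \<le> \<phi> s" if "w \<in> {s..u}" for w using u[OF that] su by (rule order_trans)
    qed
    then show False using a(3) by simp
  qed
qed

text \<open>The level set of \<open>\<phi> s\<close> in \<open>{s..u}\<close> is compact, and local
  constancy to the right excludes that its largest point lies before \<open>u\<close>.\<close>

lemma const_of_right:
  fixes \<phi> :: "real \<Rightarrow> real"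
  assumes J: "is_interval J" and c: "continuous_on J \<phi>"
    and r: "\<And>s. s \<in> J \<Longrightarrow> \<exists>\<delta>>0. \<forall>u. s < u \<and> u < s + \<delta> \<longrightarrow> \<phi> s = \<phi> u"
  shows "s \<in> J \<Longrightarrow> u \<in> J \<Longrightarrow> s < u \<Longrightarrow> \<phi> s = \<phi> u"
proof -
  assume a: "s \<in> J" "u \<in> J" "s < u"
  have sub: "{s..u} \<subseteq> J" using mem_is_interval_1_I[OF J a(1,2)] by (intro subsetI) simp
  let ?K = "{x \<in> {s..u}. \<phi> x = \<phi> s}"
  have "closed ?K"
    by (rule continuous_closed_preimage_constant[OF continuous_on_subset[OF c sub]]) simp
  then have "compact ?K" by (intro compact_Int_closed[of "{s..u}", simplified] compact_eq_bounded_closed[THEN iffD2])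
      (auto intro: bounded_subset[of "{s..u}"])
  moreover have "s \<in> ?K" using a(3) by simp
  ultimately obtain v where v: "v \<in> ?K" "\<And>w. w \<in> ?K \<Longrightarrow> w \<le> v"
    using compact_attains_sup[of ?K] by blast
  have "v = u"
  proof (rule ccontr)
    assume "v \<noteq> u"
    then have "v < u" using v(1) by auto
    have "v \<in> J" using sub v(1) by blast
    then obtain \<delta> where \<delta>: "\<delta> > 0 \<and> (\<forall>w. v < w \<and> w < v + \<delta> \<longrightarrow> \<phi> v = \<phi> w)" using r[of v] by (elim exE meta_impE)
    obtain w where w: "v < w" "w < min u (v + \<delta>)" using dense[of v "min u (v + \<delta>)"] conjunct1[OF \<delta>] \<open>v < u\<close> by auto
    then have "\<phi> v = \<phi> w" using conjunct2[OF \<delta>, THEN spec, of w] by simp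
    then have "w \<in> ?K" using w v(1) by simp
    then show False using v(2)[of w] w(1) by simp
  qed
  then show ?thesis using v(1) by simp
qed

lemma open_image_strict:
  fixes \<phi> :: "real \<Rightarrow> real"
  assumes "open J" "is_interval J" "continuous_on J \<phi>"
    and "(\<forall>s\<in>J. \<forall>u\<in>J. s < u \<longrightarrow> \<phi> s < \<phi> u) \<or> (\<forall>s\<in>J. \<forall>u\<in>J. s < u \<longrightarrow> \<phi> u < \<phi> s)"
  shows "open (\<phi> ` J)"
proof -
  have "inj_on \<phi> J" using assms(4) by (intro linorder_inj_onI') force+
  then show ?thesis using invariance_of_domain[OF assms(3,1)] by blast
qed

lemma tame_sum: "finite I \<Longrightarrow> (\<And>k. k \<in> I \<Longrightarrow> tame (f k)) \<Longrightarrow> tame (\<lambda>t. \<Sum>k\<in>I. f k t :: int)"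
proof (induction rule: finite_induct)
  case empty then show ?case by (simp add: tame_const)
next
  case (insert k I)
  have "tame (\<lambda>t. f k t + (\<Sum>k\<in>I. f k t))" by (rule tame_map2) (use insert in auto)
  then show ?case unfolding sum.insert[OF insert(1,2)] .
qed

lemma euler_int_sum:
  "finite I \<Longrightarrow> (\<And>k. k \<in> I \<Longrightarrow> tame (f k)) \<Longrightarrow> euler_int (\<lambda>t. \<Sum>k\<in>I. f k t) = (\<Sum>k\<in>I. euler_int (f k))"
proof (induction rule: finite_induct)
  case (insert k I)
  have "euler_int (\<lambda>t. f k t + (\<Sum>k\<in>I. f k t)) = euler_int (f k) + euler_int (\<lambda>t. \<Sum>k\<in>I. f k t)"
    by (rule euler_int_add) (use insert tame_sum in auto)
  then show ?case using insert by simp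
qed simp

lemma of_bool_partition:
  assumes "finite P" "partition_on A P" shows "(of_bool (z \<in> A) :: int) = (\<Sum>C\<in>P. of_bool (z \<in> C))"
proof (cases "z \<in> A")
  case True
  then obtain C where C: "C \<in> P" "z \<in> C" using assms(2) by (auto simp: partition_on_def)
  have "z \<notin> C'" if "C' \<in> P - {C}" for C'
    using assms(2) C that by (auto simp: partition_on_def disjoint_def)
  then have "(\<Sum>C\<in>P - {C}. of_bool (z \<in> C) :: int) = 0" by (intro sum.neutral) auto
  then show ?thesis using sum.remove[OF assms(1) C(1), of "\<lambda>C. of_bool (z \<in> C) :: int"] C(2) True by simp
next
  case False
  then have "z \<notin> C" if "C \<in> P" for C using assms(2) that by (auto simp: partition_on_def)
  then show ?thesis using False by simp
qed

section \<open>Constructible functions and the Euler characteristic as an integral\<close>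

context o_minimal_structure
begin

text \<open>Constructible functions, the integer combinations of indicators of definable sets. Being
  generated this way, they allow statements linear in the function to be reduced to
  indicators.\<close>

inductive CF :: "((nat \<Rightarrow> real) \<Rightarrow> int) \<Rightarrow> bool" where
  CF_of_bool: "Def P \<Longrightarrow> CF (\<lambda>x. of_bool (P x))"
| CF_add: "CF f \<Longrightarrow> CF g \<Longrightarrow> CF (\<lambda>x. f x + g x)"
| CF_cmult: "CF f \<Longrightarrow> CF (\<lambda>x. c * f x)"

lemma CF_tame: "CF f \<Longrightarrow> tame (\<lambda>t. f (x(i := t)))"
proof (induction rule: CF.induct)
  case (CF_of_bool P)
  show ?case by (rule tame_map[OF Def_tame[OF CF_of_bool]])
next
  case (CF_add f g)
  show ?case by (rule tame_map2[OF CF_add.IH])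
next
  case (CF_cmult f c)
  show ?case by (rule tame_map[OF CF_cmult.IH])
qed

lemma CF_const: "CF (\<lambda>x. c)"
  using CF_cmult[OF CF_of_bool[OF Def_const[of True]], of c] by simp

lemma CF_sum: "finite I \<Longrightarrow> (\<And>k. k \<in> I \<Longrightarrow> CF (f k)) \<Longrightarrow> CF (\<lambda>x. \<Sum>k\<in>I. f k x)"
proof (induction rule: finite_induct)
  case empty then show ?case using CF_const[of 0] by simp
next
  case (insert k I)
  have "CF (\<lambda>x. f k x + (\<Sum>k\<in>I. f k x))" by (rule CF_add) (use insert in auto)
  then show ?case unfolding sum.insert[OF insert(1,2)] .
qed

lemma Int_at_add: "CF f \<Longrightarrow> CF g \<Longrightarrow> Int_at i (\<lambda>x. f x + g x) = (\<lambda>x. Int_at i f x + Int_at i g x)"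
  unfolding Int_at_def by (rule ext) (rule euler_int_add[OF CF_tame CF_tame])

lemma Int_at_cmult: "CF f \<Longrightarrow> Int_at i (\<lambda>x. c * f x) = (\<lambda>x. c * Int_at i f x)"
  unfolding Int_at_def by (rule ext) (rule euler_int_cmult[OF CF_tame])

text \<open>Integrating the last coordinate turns a graph into its base and a band into minus its
  base; the sign \<open>s\<close> matches the change of dimension.\<close>

lemma cell_slice:
  assumes "cell S (Suc m) d C"
  shows "\<exists>d0 C0 s. cell S m d0 C0 \<and> (-1) ^ d = s * (-1 :: int) ^ d0 \<and>
    (\<forall>y\<in>Rn m. euler_int (\<lambda>t. of_bool (y(m := t) \<in> C)) = s * of_bool (y \<in> C0))"
  using assms
proof (cases rule: cell.cases)
  case (graph C0 f)
  have C0: "C0 \<subseteq> Rn m" using cell_subset graph by auto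
  have "euler_int (\<lambda>t. of_bool (y(m := t) \<in> C)) = 1 * of_bool (y \<in> C0)" if y: "y \<in> Rn m" for y
  proof -
    have "y(m := t) \<in> C \<longleftrightarrow> t = f y \<and> y \<in> C0" for t
      unfolding graph(1) graph_set_eq[OF C0] mem_Collect_eq trunc_upd fun_upd_same trunc_Rn[OF y]
      using Rn_upd[OF y] by blast
    then show ?thesis using euler_int_point[of "f y" "of_bool (y \<in> C0)"] by (simp only: of_bool_conj mult_1)
  qed
  then show ?thesis using graph(2) by (intro exI[of _ d] exI[of _ C0] exI[of _ 1]) simp
next
  case (band d0 C0 f g)
  have C0: "C0 \<subseteq> Rn m" using cell_subset band by auto
  have "euler_int (\<lambda>t. of_bool (y(m := t) \<in> C)) = -1 * of_bool (y \<in> C0)" if y: "y \<in> Rn m" for y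
  proof -
    have *: "y(m := t) \<in> C \<longleftrightarrow> y \<in> C0 \<and> f y < ereal t \<and> ereal t < g y" for t
      unfolding band(2) band_set_eq[OF C0] mem_Collect_eq trunc_upd fun_upd_same trunc_Rn[OF y]
      using Rn_upd[OF y] by blast
    show ?thesis
    proof (cases "y \<in> C0")
      case True
      then show ?thesis using euler_int_interval[OF band(6)[OF True]] unfolding * by simp
    next
      case False then show ?thesis unfolding * by simp
    qed
  qed
  then show ?thesis using band(1,3) by (intro exI[of _ d0] exI[of _ C0] exI[of _ "-1"]) simp
qed

text \<open>Cells are adapted to the last coordinate, so coordinate \<open>i\<close> is moved there
  first; each cell then contributes a multiple of the indicator of its base.\<close>

lemma CF_Int_at_Def: assumes "Def P" shows "CF (Int_at i (\<lambda>x. of_bool (P x)))"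
proof -
  obtain K where K: "DefN K P" using assms by (auto simp: Def_def)
  define M where "M = max (Suc i) K"
  have M: "i < M" "K \<le> M" by (auto simp: M_def)
  \<comment> \<open>Exchanges \<open>i\<close> with a position \<open>M\<close> beyond all variables
    of \<open>P\<close>; the vacated coordinate \<open>i\<close> then holds a value that
    \<open>P\<close> does not see.\<close>
  define \<sigma> where "\<sigma> j = (if j = i then M else if j = M then i else j)" for j
  define y where "y x = trunc M (\<lambda>j. x (\<sigma> j))" for x :: "nat \<Rightarrow> real"
  define A where "A = {z \<in> Rn (Suc M). P (\<lambda>j. z (\<sigma> j))}"
  have A: "A \<in> S (Suc M)" unfolding A_def by (rule Def_set[OF Def_perm[OF assms]])
  have key: "P (x(i := t)) \<longleftrightarrow> (y x)(M := t) \<in> A" for x t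
  proof -
    have "trunc K (\<lambda>j. ((y x)(M := t)) (\<sigma> j)) = trunc K (x(i := t))"
      by (rule trunc_cong) (use M in \<open>auto simp: \<sigma>_def y_def\<close>)
    moreover have "P (trunc K z) = P z" for z using K by (simp add: DefN_def)
    ultimately have "P (\<lambda>j. ((y x)(M := t)) (\<sigma> j)) = P (x(i := t))" by metis
    moreover have "(y x)(M := t) \<in> Rn (Suc M)" by (simp add: y_def)
    ultimately show ?thesis unfolding A_def mem_Collect_eq by simp
  qed
  obtain Ps where Ps: "finite Ps" "partition_on A Ps" "\<forall>C\<in>Ps. \<exists>d. cell S (Suc M) d C"
    using cell_decomposition[OF A] unfolding cellp_def by blast
  have "\<forall>C\<in>Ps. \<exists>w. fst w \<in> S M \<and> (\<forall>y\<in>Rn M. euler_int (\<lambda>t. of_bool (y(M := t) \<in> C)) = snd w * of_bool (y \<in> fst w))"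
  proof
    fix C assume "C \<in> Ps"
    then obtain d where "cell S (Suc M) d C" using Ps(3) by blast
    from cell_slice[OF this] obtain d0 C0 s where "cell S M d0 C0"
      "\<forall>y\<in>Rn M. euler_int (\<lambda>t. of_bool (y(M := t) \<in> C)) = s * of_bool (y \<in> C0)" by blast
    then show "\<exists>w. fst w \<in> S M \<and> (\<forall>y\<in>Rn M. euler_int (\<lambda>t. of_bool (y(M := t) \<in> C)) = snd w * of_bool (y \<in> fst w))"
      using cell_definable by (intro exI[of _ "(C0, s)"]) simp
  qed
  from bchoice[OF this] obtain w where
    w: "\<forall>C\<in>Ps. fst (w C) \<in> S M \<and> (\<forall>y\<in>Rn M. euler_int (\<lambda>t. of_bool (y(M := t) \<in> C)) = snd (w C) * of_bool (y \<in> fst (w C)))"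
    by (elim exE)
  have "Int_at i (\<lambda>x. of_bool (P x)) x = (\<Sum>C\<in>Ps. snd (w C) * of_bool (y x \<in> fst (w C)))" for x
  proof -
    have yR: "y x \<in> Rn M" by (simp add: y_def)
    have "Int_at i (\<lambda>x. of_bool (P x)) x = euler_int (\<lambda>t. \<Sum>C\<in>Ps. of_bool ((y x)(M := t) \<in> C))"
      unfolding Int_at_def key of_bool_partition[OF Ps(1,2)] ..
    also have "\<dots> = (\<Sum>C\<in>Ps. euler_int (\<lambda>t. of_bool ((y x)(M := t) \<in> C)))"
    proof (rule euler_int_sum[OF Ps(1)])
      fix C assume "C \<in> Ps"
      then have "C \<in> S (Suc M)" using Ps(3) cell_definable by blast
      from CF_tame[OF CF_of_bool[OF Def_in[OF this]], of "y x" M]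
      show "tame (\<lambda>t. of_bool ((y x)(M := t) \<in> C) :: int)" unfolding trunc_Rn[OF Rn_upd[OF yR]] .
    qed
    also have "\<dots> = (\<Sum>C\<in>Ps. snd (w C) * of_bool (y x \<in> fst (w C)))"
      by (rule sum.cong[OF HOL.refl]) (use w yR in blast)
    finally show ?thesis .
  qed
  then have "Int_at i (\<lambda>x. of_bool (P x)) = (\<lambda>x. \<Sum>C\<in>Ps. snd (w C) * of_bool (y x \<in> fst (w C)))" by (rule ext)
  moreover have "CF (\<lambda>x. \<Sum>C\<in>Ps. snd (w C) * of_bool (y x \<in> fst (w C)))"
    unfolding y_def
    by (intro CF_sum Ps(1) CF_cmult CF_of_bool Def_mem_trunc DefT_var) (use w in blast)
  ultimately show ?thesis by (simp only:)
qed

lemma CF_Int_at: "CF f \<Longrightarrow> CF (Int_at i f)"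
proof (induction rule: CF.induct)
  case (CF_of_bool P) then show ?case by (rule CF_Int_at_Def)
next
  case (CF_add f g)
  show ?case unfolding Int_at_add[OF CF_add.hyps] by (rule CF.CF_add[OF CF_add.IH])
next
  case (CF_cmult f c)
  show ?case unfolding Int_at_cmult[OF CF_cmult.hyps] by (rule CF.CF_cmult[OF CF_cmult.IH])
qed

lemma CF_Int_list: "CF f \<Longrightarrow> CF (Int_list is f)"
  by (induction "is") (auto intro: CF_Int_at)

lemma Int_list_add: "CF f \<Longrightarrow> CF g \<Longrightarrow> Int_list is (\<lambda>x. f x + g x) = (\<lambda>x. Int_list is f x + Int_list is g x)"
  by (induction "is") (simp_all add: Int_at_add CF_Int_list)

lemma Int_list_cmult: "CF f \<Longrightarrow> Int_list is (\<lambda>x. c * f x) = (\<lambda>x. c * Int_list is f x)"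
  by (induction "is") (simp_all add: Int_at_cmult CF_Int_list)

lemma Int_list_0: "Int_list is (\<lambda>x. 0) = (\<lambda>x. 0)"
  using Int_list_cmult[OF CF_const[of 0], of "is" 0] by simp

lemma Int_list_sum:
  "finite I \<Longrightarrow> (\<And>k. k \<in> I \<Longrightarrow> CF (f k)) \<Longrightarrow> Int_list is (\<lambda>x. \<Sum>k\<in>I. f k x) = (\<lambda>x. \<Sum>k\<in>I. Int_list is (f k) x)"
proof (induction rule: finite_induct)
  case empty then show ?case by (simp add: Int_list_0)
next
  case (insert k I)
  have "Int_list is (\<lambda>x. f k x + (\<Sum>k\<in>I. f k x)) = (\<lambda>x. Int_list is (f k) x + Int_list is (\<lambda>x. \<Sum>k\<in>I. f k x) x)"
    by (rule Int_list_add) (use insert CF_sum in auto)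
  then show ?case using insert by simp
qed

lemma Int_list_cell: "cell S m d C \<Longrightarrow> Int_list [0..<m] (\<lambda>x. of_bool (trunc m x \<in> C)) = (\<lambda>_. (-1) ^ d)"
proof (induction m arbitrary: d C)
  case 0
  then show ?case by (cases rule: cell.cases) simp
next
  case (Suc m)
  obtain d0 C0 s where C0: "cell S m d0 C0" "(-1) ^ d = s * (-1 :: int) ^ d0"
    "\<And>y. y \<in> Rn m \<Longrightarrow> euler_int (\<lambda>t. of_bool (y(m := t) \<in> C)) = s * of_bool (y \<in> C0)"
    using cell_slice[OF Suc.prems] by blast
  have "Int_at m (\<lambda>x. of_bool (trunc (Suc m) x \<in> C)) = (\<lambda>x. s * of_bool (trunc m x \<in> C0))"
    unfolding Int_at_def trunc_Suc_upd C0(3)[OF trunc_in_Rn] ..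
  moreover have "Int_list [0..<m] (\<lambda>x. s * of_bool (trunc m x \<in> C0)) = (\<lambda>x. s * (-1) ^ d0)"
    unfolding Int_list_cmult[OF CF_of_bool[OF Def_in[OF cell_definable[OF C0(1)]]]] Suc.IH[OF C0(1)] ..
  ultimately show ?case unfolding upt_Suc_append[OF le0] Int_list_append C0(2) by simp
qed

lemma Int_list_partition:
  assumes "finite P" "partition_on A P" "\<forall>C\<in>P. cell S m (d C) C"
  shows "Int_list [0..<m] (\<lambda>x. of_bool (trunc m x \<in> A)) = (\<lambda>_. \<Sum>C\<in>P. (-1) ^ d C)"
proof -
  have "Int_list [0..<m] (\<lambda>x. of_bool (trunc m x \<in> A)) = (\<lambda>x. \<Sum>C\<in>P. Int_list [0..<m] (\<lambda>x. of_bool (trunc m x \<in> C)) x)"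
    unfolding of_bool_partition[OF assms(1,2)]
  proof (rule Int_list_sum[OF assms(1)])
    fix C assume "C \<in> P"
    then have "C \<in> S m" using assms(3) cell_definable by blast
    then show "CF (\<lambda>x. of_bool (trunc m x \<in> C))" by (intro CF_of_bool Def_in)
  qed
  also have "\<dots> = (\<lambda>_. \<Sum>C\<in>P. (-1) ^ d C)"
    using Int_list_cell assms(3) by (intro ext sum.cong HOL.refl) metis
  finally show ?thesis .
qed

text \<open>Every partition into cells evaluates the same integral, in which the partition does not
  occur; so a unique number meets the description of \<open>euler_char\<close>.\<close>

lemma euler_char_Int:
  assumes "A \<in> S m" shows "Int_list [0..<m] (\<lambda>x. of_bool (trunc m x \<in> A)) = (\<lambda>_. euler_char S m A)"
proof -
  obtain P where P: "finite P" "partition_on A P" "\<forall>C\<in>P. \<exists>d. cell S m d C"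
    using cell_decomposition[OF assms] unfolding cellp_def by blast
  obtain d where d: "\<forall>C\<in>P. cell S m (d C) C" using bchoice[OF P(3)] by blast
  have "euler_char S m A = (\<Sum>C\<in>P. (-1) ^ d C)"
    unfolding euler_char_def
  proof (rule the_equality)
    show "\<exists>P' d'. finite P' \<and> partition_on A P' \<and> (\<forall>C\<in>P'. cell S m (d' C) C) \<and> (\<Sum>C\<in>P. (-1) ^ d C) = (\<Sum>C\<in>P'. (- 1) ^ d' C)"
      using P d by blast
    fix c :: int assume "\<exists>P' d'. finite P' \<and> partition_on A P' \<and> (\<forall>C\<in>P'. cell S m (d' C) C) \<and> c = (\<Sum>C\<in>P'. (- 1) ^ d' C)"
    then obtain P' d' where P': "finite P'" "partition_on A P'" "\<forall>C\<in>P'. cell S m (d' C) C" "c = (\<Sum>C\<in>P'. (- 1) ^ d' C)" by blast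
    have "(\<lambda>_::nat \<Rightarrow> real. \<Sum>C\<in>P'. (-1) ^ d' C) = (\<lambda>_. \<Sum>C\<in>P. (-1) ^ d C :: int)"
      using Int_list_partition[OF P'(1-3)] Int_list_partition[OF P(1,2) d] by (rule HOL.trans[OF HOL.sym])
    then show "c = (\<Sum>C\<in>P. (-1) ^ d C)" unfolding P'(4) by (rule fun_cong)
  qed
  then show ?thesis using Int_list_partition[OF P(1,2) d] by simp
qed

lemma euler_char_Un:
  assumes "A \<in> S m" "B \<in> S m" "A \<inter> B = {}"
  shows "euler_char S m (A \<union> B) = euler_char S m A + euler_char S m B"
proof -
  have "(of_bool (trunc m x \<in> A \<union> B) :: int) = of_bool (trunc m x \<in> A) + of_bool (trunc m x \<in> B)" for x
    using assms(3) by auto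
  then have "Int_list [0..<m] (\<lambda>x. of_bool (trunc m x \<in> A \<union> B)) =
      (\<lambda>x. Int_list [0..<m] (\<lambda>x. of_bool (trunc m x \<in> A)) x + Int_list [0..<m] (\<lambda>x. of_bool (trunc m x \<in> B)) x)"
    using Int_list_add[OF CF_of_bool[OF Def_in[OF assms(1)]] CF_of_bool[OF Def_in[OF assms(2)]]] by simp
  then have "(\<lambda>_::nat \<Rightarrow> real. euler_char S m (A \<union> B)) = (\<lambda>_. euler_char S m A + euler_char S m B)"
    unfolding euler_char_Int[OF assms(1)] euler_char_Int[OF assms(2)] euler_char_Int[OF definable_union[OF assms(1,2)]] .
  then show ?thesis by (rule fun_cong)
qed

lemma euler_char_empty: "euler_char S m {} = 0"
  using euler_char_Un[OF definable_empty definable_empty, of m] by simp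

lemma euler_char_UN:
  "finite I \<Longrightarrow> (\<And>i. i \<in> I \<Longrightarrow> A i \<in> S m) \<Longrightarrow> (\<And>i j. i \<in> I \<Longrightarrow> j \<in> I \<Longrightarrow> i \<noteq> j \<Longrightarrow> A i \<inter> A j = {}) \<Longrightarrow>
   euler_char S m (\<Union>i\<in>I. A i) = (\<Sum>i\<in>I. euler_char S m (A i))"
proof (induction rule: finite_induct)
  case (insert i I)
  have "A i \<inter> A j = {}" if "j \<in> I" for j by (rule insert.prems(2)) (use that insert.hyps in auto)
  then have "A i \<inter> (\<Union>i\<in>I. A i) = {}" by blast
  moreover have "(\<Union>i\<in>I. A i) \<in> S m" using insert.hyps(1) insert.prems(1) by (intro definable_Union) auto
  moreover have "A i \<in> S m" using insert.prems(1) by blast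
  ultimately have "euler_char S m (A i \<union> (\<Union>i\<in>I. A i)) = euler_char S m (A i) + euler_char S m (\<Union>i\<in>I. A i)"
    by (intro euler_char_Un)
  moreover have "euler_char S m (\<Union>i\<in>I. A i) = (\<Sum>i\<in>I. euler_char S m (A i))"
    by (rule insert.IH) (use insert.prems in blast)+
  ultimately show ?case using insert.hyps by simp
qed (simp add: euler_char_empty)

end

section \<open>Fubini for two coordinates\<close>

definition fubini :: "(real \<Rightarrow> real \<Rightarrow> int) \<Rightarrow> bool" where
  "fubini F \<longleftrightarrow> euler_int (\<lambda>s. euler_int (\<lambda>t. F s t)) = euler_int (\<lambda>t. euler_int (\<lambda>s. F s t))"

lemma euler_int_const: "euler_int (\<lambda>t. c) = - c"
  using euler_int_interval[of "-\<infinity>" \<infinity>] euler_int_cmult[OF tame_const, of c 1] by simp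

lemma euler_int_ereal_less: "l < ereal a \<Longrightarrow> euler_int (\<lambda>t. of_bool (t < a)) = -1"
  using euler_int_interval[of "-\<infinity>" "ereal a"] by simp

text \<open>Integrating \<open>t\<close> first gives -1 over each point of \<open>J\<close>;
  integrating \<open>s\<close> first gives -1 over each level \<open>t\<close> exceeded by
  \<open>\<phi>\<close>, where connected superlevel sets are needed. Both index sets are open
  intervals, so both double integrals are 1.\<close>

lemma fubini_subgraph:
  assumes J: "open J" "J \<noteq> {}" "is_interval J" "continuous_on J \<phi>"
    and conn: "\<And>t. connected {s \<in> J. t < \<phi> s}"
  shows "fubini (\<lambda>s t. of_bool (s \<in> J \<and> t < \<phi> s))"
proof -
  have J1: "euler_int (\<lambda>s. of_bool (s \<in> J)) = -1"
    by (rule euler_int_open_connected) (use J is_interval_connected in auto)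
  have in1: "euler_int (\<lambda>t. of_bool (s \<in> J \<and> t < \<phi> s)) = -1 * of_bool (s \<in> J)" for s
    using euler_int_ereal_less[of "-\<infinity>" "\<phi> s"] by (cases "s \<in> J") auto
  have tJ: "tame (\<lambda>s. of_bool (s \<in> J) :: int)"
  proof (rule tame_map[where h = of_bool and f = "\<lambda>s. s \<in> J"])
    have "tame (\<lambda>s. s \<in> \<Union>{J})" by (rule intervals_tame) (use J(3) in auto)
    then show "tame (\<lambda>s. s \<in> J)" by simp
  qed
  have lhs: "euler_int (\<lambda>s. euler_int (\<lambda>t. of_bool (s \<in> J \<and> t < \<phi> s))) = 1"
    unfolding in1 euler_int_cmult[OF tJ] J1 by simp
  define T where "T = {t. \<exists>s\<in>J. t < \<phi> s}"
  have in2: "euler_int (\<lambda>s. of_bool (s \<in> J \<and> t < \<phi> s)) = -1 * of_bool (t \<in> T)" for t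
  proof (cases "t \<in> T")
    case True
    have "open {s \<in> J. t < \<phi> s}"
    proof -
      have "open (J \<inter> \<phi> -` {t<..})" by (rule continuous_open_preimage[OF J(4,1)]) simp
      moreover have "J \<inter> \<phi> -` {t<..} = {s \<in> J. t < \<phi> s}" by auto
      ultimately show ?thesis by simp
    qed
    then have "euler_int (\<lambda>s. of_bool (s \<in> {s \<in> J. t < \<phi> s})) = -1"
      by (rule euler_int_open_connected[OF _ conn]) (use True in \<open>auto simp: T_def\<close>)
    then show ?thesis using True by simp
  next
    case False
    then have no: "(s \<in> J \<and> t < \<phi> s) = False" for s by (auto simp: T_def)
    show ?thesis unfolding no using False by simp
  qed
  have T: "open T" "T \<noteq> {}" "is_interval T"
  proof -
    have "T = (\<Union>s\<in>J. {..<\<phi> s})" by (auto simp: T_def)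
    then show "open T" by auto
    obtain s where "s \<in> J" using J(2) by blast
    then have "\<phi> s - 1 \<in> T" unfolding T_def by force
    then show "T \<noteq> {}" by blast
    show "is_interval T" unfolding is_interval_1 T_def by (auto intro: le_less_trans)
  qed
  have tT: "tame (\<lambda>s. of_bool (s \<in> T) :: int)"
  proof (rule tame_map[where h = of_bool and f = "\<lambda>s. s \<in> T"])
    have "tame (\<lambda>s. s \<in> \<Union>{T})" by (rule intervals_tame) (use T(3) in auto)
    then show "tame (\<lambda>s. s \<in> T)" by simp
  qed
  have T1: "euler_int (\<lambda>t. of_bool (t \<in> T)) = -1"
    by (rule euler_int_open_connected) (use T is_interval_connected in auto)
  show ?thesis unfolding fubini_def lhs in2 euler_int_cmult[OF tT] T1 by simp
qed

text \<open>Both double integrals are -1. For constant \<open>\<phi>\<close> the inner integral over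
  \<open>s\<close> is concentrated on one level; for strictly monotone \<open>\<phi>\<close> it is
  the indicator of the image of \<open>J\<close>, an open interval.\<close>

lemma fubini_graph:
  assumes J: "open J" "J \<noteq> {}" "is_interval J" "continuous_on J \<phi>"
    and mono: "(\<forall>s\<in>J. \<forall>u\<in>J. s < u \<longrightarrow> \<phi> s < \<phi> u) \<or> (\<forall>s\<in>J. \<forall>u\<in>J. s < u \<longrightarrow> \<phi> u < \<phi> s) \<or> (\<exists>c. \<forall>s\<in>J. \<phi> s = c)"
  shows "fubini (\<lambda>s t. of_bool (s \<in> J \<and> t = \<phi> s))"
proof -
  have J1: "euler_int (\<lambda>s. of_bool (s \<in> J)) = -1"
    by (rule euler_int_open_connected) (use J is_interval_connected in auto)
  have in1: "euler_int (\<lambda>t. of_bool (s \<in> J \<and> t = \<phi> s)) = of_bool (s \<in> J)" for s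
  proof -
    have "euler_int (\<lambda>t. of_bool (s \<in> J \<and> t = \<phi> s)) = euler_int (\<lambda>t. of_bool (t = \<phi> s) * of_bool (s \<in> J))"
      unfolding of_bool_conj[symmetric] conj_commute[of "s \<in> J"] ..
    then show ?thesis unfolding euler_int_point .
  qed
  have lhs: "euler_int (\<lambda>s. euler_int (\<lambda>t. of_bool (s \<in> J \<and> t = \<phi> s))) = -1" unfolding in1 J1 ..
  have "euler_int (\<lambda>t. euler_int (\<lambda>s. of_bool (s \<in> J \<and> t = \<phi> s))) = -1"
  proof (cases "\<exists>c. \<forall>s\<in>J. \<phi> s = c")
    case True
    then obtain c where c: "\<And>s. s \<in> J \<Longrightarrow> \<phi> s = c" by blast
    have "euler_int (\<lambda>s. of_bool (s \<in> J \<and> t = \<phi> s)) = of_bool (t = c) * -1" for t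
    proof (cases "t = c")
      case True
      then have "(s \<in> J \<and> t = \<phi> s) = (s \<in> J)" for s using c by auto
      then show ?thesis using J1 True by simp
    next
      case False
      then have no: "(s \<in> J \<and> t = \<phi> s) = False" for s using c by auto
      show ?thesis unfolding no using False by simp
    qed
    then show ?thesis using euler_int_point[of c "-1"] by simp
  next
    case False
    then have mono: "(\<forall>s\<in>J. \<forall>u\<in>J. s < u \<longrightarrow> \<phi> s < \<phi> u) \<or> (\<forall>s\<in>J. \<forall>u\<in>J. s < u \<longrightarrow> \<phi> u < \<phi> s)" using mono by blast
    have inj: "s = u" if "s \<in> J" "u \<in> J" "\<phi> s = \<phi> u" for s u
      using mono that by (cases s u rule: linorder_cases) force+
    have "euler_int (\<lambda>s. of_bool (s \<in> J \<and> t = \<phi> s)) = of_bool (t \<in> \<phi> ` J)" for t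
    proof (cases "t \<in> \<phi> ` J")
      case True
      then obtain s0 where s0: "s0 \<in> J" "t = \<phi> s0" by blast
      then have "(s \<in> J \<and> t = \<phi> s) = (s = s0)" for s using inj[OF s0(1)] by auto
      then show ?thesis using euler_int_point[of s0 1] True by simp
    next
      case False
      then have no: "(s \<in> J \<and> t = \<phi> s) = False" for s by blast
      show ?thesis unfolding no using False by simp
    qed
    moreover have "euler_int (\<lambda>t. of_bool (t \<in> \<phi> ` J)) = -1"
    proof (rule euler_int_open_connected)
      show "open (\<phi> ` J)" by (rule open_image_strict[OF J(1,3,4) mono])
      show "connected (\<phi> ` J)" using connected_continuous_image[OF J(4)] J(3) is_interval_connected by blast
    qed (use J(2) in blast)
    ultimately show ?thesis by simp
  qed
  then show ?thesis unfolding fubini_def lhs by simp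
qed

lemma fubini_point: "fubini (\<lambda>s t. of_bool (s = a) * G s t)"
proof -
  have 1: "euler_int (\<lambda>s. of_bool (s = a) * H s) = H a" for H :: "real \<Rightarrow> int"
  proof -
    have "(\<lambda>s. of_bool (s = a) * H s) = (\<lambda>s. of_bool (s = a) * H a)" by auto
    then show ?thesis using euler_int_point[of a "H a"] by (simp only:)
  qed
  have 2: "euler_int (\<lambda>t. of_bool (s = a) * G s t) = of_bool (s = a) * euler_int (\<lambda>t. G s t)" for s
    by (cases "s = a") auto
  show ?thesis unfolding fubini_def 2 1 ..
qed

context o_minimal_structure
begin

lemma Def_ereal_less: "DefT f \<Longrightarrow> Def (\<lambda>x. l < ereal (f x))" "DefT f \<Longrightarrow> Def (\<lambda>x. ereal (f x) < l)"
  by (cases l; simp add: Def_less DefT_const Def_const)+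

definition CF2 :: "(real \<Rightarrow> real \<Rightarrow> int) \<Rightarrow> bool" where
  "CF2 F \<longleftrightarrow> CF (\<lambda>z. F (z 0) (z (Suc 0)))"

lemma CF2_tame:
  assumes "CF2 F"
  shows "tame (\<lambda>t. F s t)" "tame (\<lambda>s. F s t)" "tame (\<lambda>s. euler_int (\<lambda>t. F s t))" "tame (\<lambda>t. euler_int (\<lambda>s. F s t))"
proof -
  let ?f = "\<lambda>z. F (z 0) (z (Suc 0))"
  have f: "CF ?f" using assms by (simp add: CF2_def)
  show "tame (\<lambda>t. F s t)" using CF_tame[OF f, of "(\<lambda>_. 0)(0 := s)" "Suc 0"] by simp
  show "tame (\<lambda>s. F s t)" using CF_tame[OF f, of "(\<lambda>_. t)" 0] by simp
  show "tame (\<lambda>s. euler_int (\<lambda>t. F s t))"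
    using CF_tame[OF CF_Int_at[OF f, of "Suc 0"], of "\<lambda>_. 0" 0] by (simp add: Int_at_def)
  show "tame (\<lambda>t. euler_int (\<lambda>s. F s t))"
    using CF_tame[OF CF_Int_at[OF f, of 0], of "\<lambda>_. 0" "Suc 0"] by (simp add: Int_at_def)
qed

lemma CF2_fubini_add:
  assumes "CF2 F" "CF2 G" "fubini F" "fubini G" shows "CF2 (\<lambda>s t. F s t + G s t)" "fubini (\<lambda>s t. F s t + G s t)"
proof -
  show "CF2 (\<lambda>s t. F s t + G s t)" using assms(1,2) unfolding CF2_def by (rule CF_add)
  note F = CF2_tame[OF assms(1)] and G = CF2_tame[OF assms(2)]
  show "fubini (\<lambda>s t. F s t + G s t)" using assms(3,4)
    unfolding fubini_def euler_int_add[OF F(1) G(1)] euler_int_add[OF F(2) G(2)] euler_int_add[OF F(3) G(3)] euler_int_add[OF F(4) G(4)]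
    by (simp only:)
qed

lemma CF2_fubini_cmult:
  assumes "CF2 F" "fubini F" shows "CF2 (\<lambda>s t. c * F s t)" "fubini (\<lambda>s t. c * F s t)"
proof -
  show "CF2 (\<lambda>s t. c * F s t)" using assms(1) unfolding CF2_def by (rule CF_cmult)
  note F = CF2_tame[OF assms(1)]
  show "fubini (\<lambda>s t. c * F s t)" using assms(2)
    unfolding fubini_def euler_int_cmult[OF F(1)] euler_int_cmult[OF F(2)] euler_int_cmult[OF F(3)] euler_int_cmult[OF F(4)]
    by (simp only:)
qed

lemma fubini_sum:
  "finite I \<Longrightarrow> (\<And>k. k \<in> I \<Longrightarrow> CF2 (F k) \<and> fubini (F k)) \<Longrightarrow> CF2 (\<lambda>s t. \<Sum>k\<in>I. F k s t) \<and> fubini (\<lambda>s t. \<Sum>k\<in>I. F k s t)"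
proof (induction rule: finite_induct)
  case empty
  show ?case using CF_const[of 0] by (simp add: CF2_def fubini_def)
next
  case (insert k I)
  have "CF2 (F k) \<and> fubini (F k)" "CF2 (\<lambda>s t. \<Sum>k\<in>I. F k s t) \<and> fubini (\<lambda>s t. \<Sum>k\<in>I. F k s t)"
    using insert by auto
  then show ?case unfolding sum.insert[OF insert(1,2)] using CF2_fubini_add by blast
qed

text \<open>If \<open>D\<close> holds on the interval, constancy of the other three properties makes
  \<open>\<phi>\<close> continuous and either strictly monotone or constant, and the two
  computations above apply. The properties are named by equivalences to keep their formulas
  opaque.\<close>

lemma fubini_base:
  assumes dec: "DefT (\<lambda>x. \<phi> (x 0))" and J: "J = {s. l < ereal s \<and> ereal s < u}"
    and C: "\<And>s. C s \<longleftrightarrow> (\<forall>\<epsilon>>0. \<exists>\<delta>>0. \<forall>v. \<bar>v - s\<bar> < \<delta> \<longrightarrow> \<bar>\<phi> v - \<phi> s\<bar> < \<epsilon>)"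
    and c1: "\<And>s. c1 s \<longleftrightarrow> (\<exists>\<delta>>0. \<forall>v. s < v \<and> v < s + \<delta> \<longrightarrow> \<phi> s < \<phi> v)"
    and c2: "\<And>s. c2 s \<longleftrightarrow> (\<exists>\<delta>>0. \<forall>v. s < v \<and> v < s + \<delta> \<longrightarrow> \<phi> s = \<phi> v)"
    and loc: "\<And>s s'. s \<in> J \<Longrightarrow> s' \<in> J \<Longrightarrow> s < s' \<Longrightarrow> D s = D s' \<and> C s = C s' \<and> c1 s = c1 s' \<and> c2 s = c2 s'"
  shows "fubini (\<lambda>s t. of_bool (s \<in> J \<and> D s \<and> t < \<phi> s)) \<and> fubini (\<lambda>s t. of_bool (s \<in> J \<and> D s \<and> t = \<phi> s))"
proof (cases "\<exists>s\<in>J. D s")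
  case False
  then have no: "(s \<in> J \<and> D s \<and> R) = False" for s R by blast
  show ?thesis unfolding fubini_def no by simp
next
  case True
  then obtain s0 where s0: "s0 \<in> J" "D s0" by blast
  define c3 where "c3 s \<longleftrightarrow> (\<exists>\<delta>>0. \<forall>v. s < v \<and> v < s + \<delta> \<longrightarrow> \<phi> v < \<phi> s)" for s
  have loc': "D s = D s0 \<and> C s = C s0 \<and> c1 s = c1 s0 \<and> c2 s = c2 s0" if s: "s \<in> J" for s
  proof (cases s s0 rule: linorder_cases)
    case less then show ?thesis by (rule loc[OF s s0(1)])
  next
    case equal then show ?thesis by (simp only: simp_thms)
  next
    case greater
    from loc[OF s0(1) s this] show ?thesis by (elim conjE) (simp only: simp_thms)
  qed
  note D_eq = loc'[THEN conjunct1] and C_eq = loc'[THEN conjunct2, THEN conjunct1]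
    and c1_eq = loc'[THEN conjunct2, THEN conjunct2, THEN conjunct1] and c2_eq = loc'[THEN conjunct2, THEN conjunct2, THEN conjunct2]
  have DJ: "(s \<in> J \<and> D s \<and> R) = (s \<in> J \<and> R)" for s R
    by (cases "s \<in> J") (simp_all only: D_eq s0(2) simp_thms)
  have Jopen: "open J"
  proof -
    have "J = ereal -` {l<..<u}" unfolding J by auto
    then show ?thesis using open_ereal_vimage[of "{l<..<u}"] by simp
  qed
  have Jint: "is_interval J" unfolding is_interval_1
  proof (intro ballI allI impI)
    fix a b x assume "a \<in> J" "b \<in> J" "a \<le> x \<and> x \<le> b"
    then show "x \<in> J" unfolding J
      using less_le_trans[of l "ereal a" "ereal x"] le_less_trans[of "ereal x" "ereal b" u] by simp
  qed
  \<comment> \<open>\<open>monotone_subinterval\<close> yields a point of continuity close to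
    \<open>s0\<close>; constancy of \<open>C\<close> then spreads it over \<open>J\<close>.\<close>
  have "\<exists>s\<in>J. C s"
  proof -
    obtain e where e: "e > 0" "ball s0 e \<subseteq> J" using Jopen s0(1) open_contains_ball by blast
    have "s0 < s0 + e" using e(1) by simp
    from monotone_subinterval[OF dec this] obtain r s where rs: "s0 < r \<and> r < s \<and> s < s0 + e"
      "\<forall>t. r < t \<and> t < s \<longrightarrow> C t" unfolding C[symmetric] by (elim exE conjE) (rule that, simp_all only: simp_thms)
    obtain t where t: "r < t" "t < s" using rs(1) dense by blast
    then have "t \<in> ball s0 e" using rs(1) by (simp add: dist_real_def)
    then show ?thesis using e(2) rs(2) t by blast
  qed
  then have "C s0" using C_eq by (elim bexE) simp
  then have "C s" if "s \<in> J" for s using C_eq[OF that] by (simp only:)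
  then have cont: "continuous_on J \<phi>"
    unfolding C using Jopen by (intro continuous_at_imp_continuous_on ballI) (simp add: continuous_at_eps_delta dist_real_def)
  \<comment> \<open>Tameness to the right of \<open>s\<close> leaves three right types, so the
    decreasing type \<open>c3\<close> follows by exclusion and does not have to appear among the
    constant properties.\<close>
  have tri: "c1 s \<or> c2 s \<or> c3 s" for s
  proof -
    note \<phi>' = DefT_perm1[OF dec]
    have "Def (\<lambda>x. \<phi> s < \<phi> (x 0))" "Def (\<lambda>x. \<phi> s = \<phi> (x 0))" by (intro defi \<phi>')+
    then have "tame (\<lambda>u. \<phi> s < \<phi> u)" "tame (\<lambda>u. \<phi> s = \<phi> u)" by (auto intro: Def_tame1)
    then obtain b1 b2 \<delta>1 \<delta>2 where b: "\<delta>1 > 0" "\<delta>2 > 0" "\<And>u. s < u \<and> u < s + \<delta>1 \<Longrightarrow> (\<phi> s < \<phi> u) = b1"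
      "\<And>u. s < u \<and> u < s + \<delta>2 \<Longrightarrow> (\<phi> s = \<phi> u) = b2"
      using tame_right[of "\<lambda>u. \<phi> s < \<phi> u" s] tame_right[of "\<lambda>u. \<phi> s = \<phi> u" s] by metis
    consider b1 | "\<not> b1" b2 | "\<not> b1" "\<not> b2" by blast
    then show ?thesis
    proof cases
      case 1 then have "c1 s" unfolding c1 using b(1,3) by (intro exI[of _ \<delta>1]) simp
      then show ?thesis by blast
    next
      case 2 then have "c2 s" unfolding c2 using b(2,4) by (intro exI[of _ \<delta>2]) simp
      then show ?thesis by blast
    next
      case 3
      have "\<phi> u < \<phi> s" if "s < u \<and> u < s + min \<delta>1 \<delta>2" for u
      proof -
        have "s < u \<and> u < s + \<delta>1" "s < u \<and> u < s + \<delta>2" using that by linarith+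
        then have "\<not> \<phi> s < \<phi> u" "\<phi> s \<noteq> \<phi> u" using b(3,4) 3 by blast+
        then show ?thesis by simp
      qed
      then have "c3 s" unfolding c3_def using b(1,2) by (intro exI[of _ "min \<delta>1 \<delta>2"]) simp
      then show ?thesis by blast
    qed
  qed
  have inc: "\<forall>s\<in>J. \<forall>u\<in>J. s < u \<longrightarrow> \<phi> s < \<phi> u" if "c1 s0"
  proof -
    have "c1 s" if "s \<in> J" for s using c1_eq[OF that] \<open>c1 s0\<close> by (simp only:)
    from strict_mono_of_right[OF Jint cont this[unfolded c1]] show ?thesis by blast
  qed
  have const: "\<exists>c. \<forall>s\<in>J. \<phi> s = c" if "c2 s0"
  proof -
    have "c2 s" if "s \<in> J" for s using c2_eq[OF that] \<open>c2 s0\<close> by (simp only:)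
    note c2J = this[unfolded c2]
    have eq: "\<phi> s = \<phi> u" if "s \<in> J" "u \<in> J" "s < u" for s u
      by (rule const_of_right[OF Jint cont c2J that])
    have "\<phi> s = \<phi> s0" if "s \<in> J" for s
    proof (cases s s0 rule: linorder_cases)
      case less then show ?thesis by (rule eq[OF that s0(1)])
    next
      case greater then show ?thesis using eq[OF s0(1) that] by simp
    qed simp
    then show ?thesis by (intro exI ballI)
  qed
  have dec: "\<forall>s\<in>J. \<forall>u\<in>J. s < u \<longrightarrow> \<phi> u < \<phi> s" if "\<not> c1 s0" "\<not> c2 s0"
  proof -
    have "\<exists>\<delta>>0. \<forall>v. s < v \<and> v < s + \<delta> \<longrightarrow> - \<phi> s < - \<phi> v" if "s \<in> J" for s
      using tri[of s] c1_eq[OF that] c2_eq[OF that] \<open>\<not> c1 s0\<close> \<open>\<not> c2 s0\<close> unfolding c3_def by simp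
    from strict_mono_of_right[OF Jint continuous_on_minus[OF cont] this] show ?thesis by simp
  qed
  have mono: "(\<forall>s\<in>J. \<forall>u\<in>J. s < u \<longrightarrow> \<phi> s < \<phi> u) \<or> (\<forall>s\<in>J. \<forall>u\<in>J. s < u \<longrightarrow> \<phi> u < \<phi> s) \<or> (\<exists>c. \<forall>s\<in>J. \<phi> s = c)"
    using inc const dec by blast
  have conn: "connected {s \<in> J. t < \<phi> s}" for t
  proof (rule is_interval_connected, unfold is_interval_1, intro ballI allI impI)
    fix a b x assume a: "a \<in> {s \<in> J. t < \<phi> s}" "b \<in> {s \<in> J. t < \<phi> s}" "a \<le> x \<and> x \<le> b"
    then have x: "x \<in> J" using mem_is_interval_1_I[OF Jint, of a b x] by simp
    have "\<phi> a \<le> \<phi> x \<or> \<phi> b \<le> \<phi> x"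
      using mono
    proof (elim disjE)
      assume m: "\<forall>s\<in>J. \<forall>u\<in>J. s < u \<longrightarrow> \<phi> s < \<phi> u"
      show ?thesis using a x m by (cases "a = x") (auto simp: less_le)
    next
      assume m: "\<forall>s\<in>J. \<forall>u\<in>J. s < u \<longrightarrow> \<phi> u < \<phi> s"
      show ?thesis using a x m by (cases "b = x") (auto simp: less_le)
    next
      assume "\<exists>c. \<forall>s\<in>J. \<phi> s = c"
      then show ?thesis using a(1) x by auto
    qed
    then show "x \<in> {s \<in> J. t < \<phi> s}" using a x by auto
  qed
  have "J \<noteq> {}" using s0 by blast
  then show ?thesis unfolding DJ
    using fubini_subgraph[OF Jopen _ Jint cont conn] fubini_graph[OF Jopen _ Jint cont mono] by blast
qed

text \<open>
  Outside a finite set of abscissae the predicate, continuity and right type of \<open>\<phi>\<close> are locally constant;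
  the induction splits the line at these points.
\<close>

lemma fubini_split:
  assumes D: "Def (\<lambda>x. D (x 0))" and \<phi>: "DefT (\<lambda>x. \<phi> (x 0))"
  shows "fubini (\<lambda>s t. of_bool (D s \<and> t < \<phi> s)) \<and> fubini (\<lambda>s t. of_bool (D s \<and> t = \<phi> s))"
proof -
  note \<phi>' = DefT_perm1[OF \<phi>]
  have D': "Def (\<lambda>x. D (x i))" for i using Def_perm[OF D, of "\<lambda>_. i"] .
  let ?C = "\<lambda>s. \<forall>\<epsilon>>0. \<exists>\<delta>>0. \<forall>v. \<bar>v - s\<bar> < \<delta> \<longrightarrow> \<bar>\<phi> v - \<phi> s\<bar> < \<epsilon>"
  let ?c1 = "\<lambda>s. \<exists>\<delta>>0. \<forall>v. s < v \<and> v < s + \<delta> \<longrightarrow> \<phi> s < \<phi> v"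
  let ?c2 = "\<lambda>s. \<exists>\<delta>>0. \<forall>v. s < v \<and> v < s + \<delta> \<longrightarrow> \<phi> s = \<phi> v"
  have dC: "Def (\<lambda>x. ?C (x 0))" and d1: "Def (\<lambda>x. ?c1 (x 0))" and d2: "Def (\<lambda>x. ?c2 (x 0))" by (intro defi \<phi>')+
  note t = Def_tame1[of D, OF D] Def_tame1[of ?C, OF dC] Def_tame1[of ?c1, OF d1] Def_tame1[of ?c2, OF d2]
  from tame_map2[OF tame_map2[OF t(1,2), of Pair] tame_map2[OF t(3,4), of Pair], of Pair, unfolded tame_def]
  obtain F where F': "finite F \<and> (\<forall>a b. a < b \<longrightarrow> {a..b} \<inter> F = {} \<longrightarrow> ((D a, ?C a), (?c1 a, ?c2 a)) = ((D b, ?C b), (?c1 b, ?c2 b)))"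
    by (elim exE)
  note F = F'[THEN conjunct1] F'[THEN conjunct2, THEN spec, THEN spec, THEN mp, THEN mp]
  have "fubini (\<lambda>s t. of_bool (s \<in> {s. l < ereal s \<and> ereal s < u} \<and> D s \<and> t < \<phi> s)) \<and>
    fubini (\<lambda>s t. of_bool (s \<in> {s. l < ereal s \<and> ereal s < u} \<and> D s \<and> t = \<phi> s))" for l u
  proof (induction "card (F \<inter> {s. l < ereal s \<and> ereal s < u})" arbitrary: l u rule: less_induct)
    case less
    let ?J = "\<lambda>l u. {s. l < ereal s \<and> ereal s < u}"
    show ?case
    proof (cases "F \<inter> ?J l u = {}")
      case True
      show ?thesis
      proof (rule fubini_base[OF \<phi> HOL.refl HOL.refl HOL.refl HOL.refl])
        fix s s' assume s: "s \<in> ?J l u" "s' \<in> ?J l u" "s < s'"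
        have "v \<in> ?J l u" if "v \<in> {s..s'}" for v
          using s that less_le_trans[of l "ereal s" "ereal v"] le_less_trans[of "ereal v" "ereal s'" u] by simp
        then have "{s..s'} \<inter> F = {}" using True by blast
        from F(2)[OF s(3) this] show "D s = D s' \<and> ?C s = ?C s' \<and> ?c1 s = ?c1 s' \<and> ?c2 s = ?c2 s'"
          by (simp only: prod.inject)
      qed
    next
      case False
      then obtain a where a: "a \<in> F" "l < ereal a" "ereal a < u" by blast
      have sm: "F \<inter> ?J l (ereal a) \<subset> F \<inter> ?J l u" "F \<inter> ?J (ereal a) u \<subset> F \<inter> ?J l u"
        using a less_trans[of _ "ereal a" u] less_trans[of l "ereal a"] by auto
      \<comment> \<open>The interval is cut at \<open>a\<close>: the point itself falls under
        \<open>fubini_point\<close>, and both halves contain fewer exceptional abscissae.\<close>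
      have split: "(of_bool (s \<in> ?J l u \<and> R) :: int) = of_bool (s \<in> ?J l (ereal a) \<and> R) + (of_bool (s = a) * of_bool R + of_bool (s \<in> ?J (ereal a) u \<and> R))" for s R
        using a less_trans[of "ereal s" "ereal a" u] less_trans[of l "ereal a" "ereal s"] by (cases s a rule: linorder_cases) auto
      have J1: "fubini (\<lambda>s t. of_bool (s \<in> ?J l (ereal a) \<and> D s \<and> t < \<phi> s)) \<and> fubini (\<lambda>s t. of_bool (s \<in> ?J l (ereal a) \<and> D s \<and> t = \<phi> s))"
        by (rule less) (use sm F(1) in \<open>auto intro: psubset_card_mono\<close>)
      have J2: "fubini (\<lambda>s t. of_bool (s \<in> ?J (ereal a) u \<and> D s \<and> t < \<phi> s)) \<and> fubini (\<lambda>s t. of_bool (s \<in> ?J (ereal a) u \<and> D s \<and> t = \<phi> s))"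
        by (rule less) (use sm F(1) in \<open>auto intro: psubset_card_mono\<close>)
      have CJ: "CF2 (\<lambda>s t. of_bool (s \<in> ?J l u \<and> D s \<and> t < \<phi> s))" "CF2 (\<lambda>s t. of_bool (s \<in> ?J l u \<and> D s \<and> t = \<phi> s))" for l u
        unfolding CF2_def mem_Collect_eq by (intro CF_of_bool Def_conj Def_ereal_less D' defi \<phi>')+
      have Ca: "CF2 (\<lambda>s t. of_bool (s = a) * of_bool (D s \<and> t < \<phi> s))" "CF2 (\<lambda>s t. of_bool (s = a) * of_bool (D s \<and> t = \<phi> s))"
        unfolding CF2_def of_bool_conj[symmetric] by (intro CF_of_bool Def_conj D' defi \<phi>')+
      show ?thesis unfolding split
        by (intro conjI CF2_fubini_add CJ Ca fubini_point J1[THEN conjunct1] J1[THEN conjunct2] J2[THEN conjunct1] J2[THEN conjunct2])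
    qed
  qed
  from this[of "-\<infinity>" \<infinity>] show ?thesis by simp
qed

text \<open>A band is the region below \<open>g\<close> minus the part not above \<open>f\<close>,
  and the latter is the region below \<open>f\<close> plus its graph; so subgraphs and graphs
  suffice. Infinite bounds give a full cylinder or the empty set.\<close>

lemma fubini_cell:
  assumes "cell S (Suc (Suc 0)) d C"
  shows "fubini (\<lambda>s t. of_bool (((\<lambda>_. 0)(0 := s))(Suc 0 := t) \<in> C))"
proof -
  let ?p = "\<lambda>s::real. (\<lambda>_::nat. 0::real)(0 := s)"
  have p: "?p s \<in> Rn (Suc 0)" for s by (simp add: Rn_def)
  have pT: "DefT (\<lambda>x. (?p (x 0)) i)" for i by (intro defi)
  have Dd: "Def (\<lambda>x. ?p (x 0) \<in> C0)" if "C0 \<in> S (Suc 0)" for C0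
    by (rule Def_mem[OF that pT p])
  have mem: "(?p s)(Suc 0 := t) \<in> Rn (Suc (Suc 0))" for s t using Rn_upd[OF p] .
  have V: "fubini (\<lambda>s t. of_bool (?p s \<in> C0))" if C0: "C0 \<in> S (Suc 0)" for C0
  proof -
    have "tame (\<lambda>s. of_bool (?p s \<in> C0) :: int)" by (rule tame_map[OF Def_tame1[OF Dd[OF C0]]])
    from euler_int_cmult[OF this, of "-1"] show ?thesis unfolding fubini_def euler_int_const by simp
  qed
  have CV: "CF2 (\<lambda>s t. of_bool (?p s \<in> C0))" if C0: "C0 \<in> S (Suc 0)" for C0
    unfolding CF2_def by (rule CF_of_bool[OF Dd[OF C0]])
  have HG: "fubini (\<lambda>s t. of_bool (?p s \<in> C0 \<and> t < h (?p s))) \<and> fubini (\<lambda>s t. of_bool (?p s \<in> C0 \<and> t = h (?p s)))"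
    "CF2 (\<lambda>s t. of_bool (?p s \<in> C0 \<and> t < h (?p s)))" "CF2 (\<lambda>s t. of_bool (?p s \<in> C0 \<and> t = h (?p s)))"
    if C0: "C0 \<in> S (Suc 0)" and h: "DefT h" for C0 h
  proof -
    have h': "DefT (\<lambda>x. h (?p (x 0)))" by (rule DefT_comp[OF h pT])
    show "fubini (\<lambda>s t. of_bool (?p s \<in> C0 \<and> t < h (?p s))) \<and> fubini (\<lambda>s t. of_bool (?p s \<in> C0 \<and> t = h (?p s)))"
      by (rule fubini_split[OF Dd[OF C0] h'])
    show "CF2 (\<lambda>s t. of_bool (?p s \<in> C0 \<and> t < h (?p s)))" "CF2 (\<lambda>s t. of_bool (?p s \<in> C0 \<and> t = h (?p s)))"
      unfolding CF2_def by (intro CF_of_bool Def_conj Def_less Def_eq DefT_var Dd[OF C0] h')+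
  qed
  from assms show ?thesis
  proof (cases rule: cell.cases)
    case (graph C0 f)
    have C0: "C0 \<in> S (Suc 0)" "C0 \<subseteq> Rn (Suc 0)" using cell_definable cell_subset graph by auto
    obtain h where h: "DefT h" "\<forall>x\<in>C0. f x = h x" using definable_fun_iff[OF C0(1)] graph(3) by blast
    have "(?p s)(Suc 0 := t) \<in> C \<longleftrightarrow> ?p s \<in> C0 \<and> t = h (?p s)" for s t
    proof (cases "?p s \<in> C0")
      case True
      then have f: "f (?p s) = h (?p s)" by (rule bspec[OF h(2)])
      show ?thesis unfolding graph(1) graph_set_eq[OF C0(2)] mem_Collect_eq trunc_upd fun_upd_same trunc_Rn[OF p] f
        using True mem by (simp only: simp_thms)
    next
      case False
      then show ?thesis unfolding graph(1) graph_set_eq[OF C0(2)] mem_Collect_eq trunc_upd fun_upd_same trunc_Rn[OF p]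
        by (simp only: simp_thms)
    qed
    then show ?thesis using HG(1)[OF C0(1) h(1)] by (simp only:)
  next
    case (band d0 C0 f g)
    have C0: "C0 \<in> S (Suc 0)" "C0 \<subseteq> Rn (Suc 0)" using cell_definable cell_subset band by auto
    have C: "(?p s)(Suc 0 := t) \<in> C \<longleftrightarrow> ?p s \<in> C0 \<and> f (?p s) < ereal t \<and> ereal t < g (?p s)" for s t
      unfolding band(2) band_set_eq[OF C0(2)] mem_Collect_eq trunc_upd fun_upd_same trunc_Rn[OF p]
      using mem[of s t] by (cases "?p s \<in> C0") (simp_all only: simp_thms)
    have fg: "f (?p s) < g (?p s)" if "?p s \<in> C0" for s by (rule band(6)[OF that])
    obtain A where A: "CF2 A \<and> fubini A" "\<And>s t. of_bool (?p s \<in> C0 \<and> ereal t < g (?p s)) = A s t"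
      using band(5) C0(1)
    proof (cases rule: cell_bound_cases)
      case 1
      then have "\<not> (?p s \<in> C0 \<and> ereal t < g (?p s))" for s t by auto
      then show ?thesis using CF_const[of 0] by (intro that[of "\<lambda>_ _. 0"]) (simp_all add: fubini_def CF2_def)
    next
      case 2
      then have "(?p s \<in> C0 \<and> ereal t < g (?p s)) = (?p s \<in> C0)" for s t by auto
      then show ?thesis using V CV C0(1) by (intro that[of "\<lambda>s t. of_bool (?p s \<in> C0)"]) simp_all
    next
      case (3 h)
      then have "(?p s \<in> C0 \<and> ereal t < g (?p s)) = (?p s \<in> C0 \<and> t < h (?p s))" for s t by auto
      then show ?thesis using HG[OF C0(1) 3(1)] by (intro that[of "\<lambda>s t. of_bool (?p s \<in> C0 \<and> t < h (?p s))"]) simp_all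
    qed
    obtain B where B: "CF2 B \<and> fubini B" "\<And>s t. of_bool (?p s \<in> C0 \<and> \<not> f (?p s) < ereal t) = B s t"
      using band(4) C0(1)
    proof (cases rule: cell_bound_cases)
      case 1
      then have "\<not> (?p s \<in> C0 \<and> \<not> f (?p s) < ereal t)" for s t by auto
      then show ?thesis using CF_const[of 0] by (intro that[of "\<lambda>_ _. 0"]) (simp_all add: fubini_def CF2_def)
    next
      case 2
      then have "(?p s \<in> C0 \<and> \<not> f (?p s) < ereal t) = (?p s \<in> C0)" for s t by auto
      then show ?thesis using V CV C0(1) by (intro that[of "\<lambda>s t. of_bool (?p s \<in> C0)"]) simp_all
    next
      case (3 h)
      have "(of_bool (?p s \<in> C0 \<and> \<not> f (?p s) < ereal t) :: int) =
          of_bool (?p s \<in> C0 \<and> t < h (?p s)) + of_bool (?p s \<in> C0 \<and> t = h (?p s))" for s t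
        using 3(3)[of "?p s"] by auto
      then show ?thesis using HG[OF C0(1) 3(1)] CF2_fubini_add[OF HG(2,3)[OF C0(1) 3(1)]]
        by (intro that[of "\<lambda>s t. of_bool (?p s \<in> C0 \<and> t < h (?p s)) + of_bool (?p s \<in> C0 \<and> t = h (?p s))"]) simp_all
    qed
    have "(of_bool ((?p s)(Suc 0 := t) \<in> C) :: int) = A s t + (-1) * B s t" for s t
    proof -
      have "ereal t < g (?p s)" if "?p s \<in> C0" "\<not> f (?p s) < ereal t"
        using fg[OF that(1)] that(2) by (meson le_less_trans not_less)
      then show ?thesis unfolding C A(2)[symmetric] B(2)[symmetric]
        by (cases "?p s \<in> C0"; cases "f (?p s) < ereal t"; cases "ereal t < g (?p s)") simp_all
    qed
    moreover have "fubini (\<lambda>s t. A s t + (-1) * B s t)"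
      by (intro CF2_fubini_add CF2_fubini_cmult) (use A(1) B(1) in simp_all)
    ultimately show ?thesis by (simp only:)
  qed
qed

lemma fubini_Def:
  assumes "Def (\<lambda>z. Q (z 0) (z (Suc 0)))" shows "fubini (\<lambda>s t. of_bool (Q s t))"
proof -
  let ?p = "\<lambda>s t::real. ((\<lambda>_::nat. 0::real)(0 := s))(Suc 0 := t)"
  define A where "A = {z \<in> Rn (Suc (Suc 0)). Q (z 0) (z (Suc 0))}"
  have mem: "?p s t \<in> Rn (Suc (Suc 0))" for s t by (simp add: Rn_def)
  have Q: "Q s t \<longleftrightarrow> ?p s t \<in> A" for s t unfolding A_def using mem by simp
  have T: "DefT (\<lambda>z. (?p (z 0) (z (Suc 0))) k)" for k
    by (rule DefT_upd[OF DefT_var], rule DefT_upd[OF DefT_var], rule DefT_const)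
  have A: "A \<in> S (Suc (Suc 0))" unfolding A_def by (rule Def_set[OF assms])
  obtain Ps where Ps: "finite Ps" "partition_on A Ps" "\<forall>C\<in>Ps. \<exists>d. cell S (Suc (Suc 0)) d C"
    using cell_decomposition[OF A] unfolding cellp_def by blast
  have "CF2 (\<lambda>s t. of_bool (?p s t \<in> C)) \<and> fubini (\<lambda>s t. of_bool (?p s t \<in> C))" if CP: "C \<in> Ps" for C
  proof
    obtain d where d: "cell S (Suc (Suc 0)) d C" using Ps(3) CP by blast
    show "fubini (\<lambda>s t. of_bool (?p s t \<in> C))" by (rule fubini_cell[OF d])
    show "CF2 (\<lambda>s t. of_bool (?p s t \<in> C))" unfolding CF2_def
      by (rule CF_of_bool, rule Def_mem[where T = "\<lambda>z. ?p (z 0) (z (Suc 0))", OF cell_definable[OF d] T mem])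
  qed
  then have "fubini (\<lambda>s t. \<Sum>C\<in>Ps. of_bool (?p s t \<in> C))"
    by (rule conjunct2[OF fubini_sum[where F = "\<lambda>C s t. of_bool (?p s t \<in> C)", OF Ps(1)]])
  then show ?thesis unfolding Q of_bool_partition[OF Ps(1,2)] .
qed

text \<open>For an indicator all coordinates other than \<open>i\<close> and \<open>j\<close> are
  frozen in \<open>x\<close>, which leaves a definable subset of the plane.\<close>

theorem Int_at_commute: "CF f \<Longrightarrow> i \<noteq> j \<Longrightarrow> Int_at i (Int_at j f) = Int_at j (Int_at i f)"
proof (induction rule: CF.induct)
  case (CF_of_bool P)
  have "Int_at i (Int_at j (\<lambda>x. of_bool (P x))) x = Int_at j (Int_at i (\<lambda>x. of_bool (P x))) x" for x
  proof -
    have T: "DefT (\<lambda>z. (x(i := z 0, j := z (Suc 0))) k)" for k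
      by (rule DefT_upd[OF DefT_var], rule DefT_upd[OF DefT_var], rule DefT_const)
    have *: "Def (\<lambda>z. P (x(i := z 0, j := z (Suc 0))))" by (rule Def_comp[OF CF_of_bool(1) T])
    have tw: "P (x(j := t, i := s)) = P (x(i := s, j := t))" for s t
      by (rule arg_cong[where f = P]) (rule fun_upd_twist[OF not_sym[OF CF_of_bool(2)]])
    show ?thesis unfolding Int_at_def tw
      by (rule fubini_Def[of "\<lambda>s t. P (x(i := s, j := t))", OF *, unfolded fubini_def])
  qed
  then show ?case by (rule ext)
next
  case (CF_add f g)
  note c = CF_Int_at[OF CF_add.hyps(1)] CF_Int_at[OF CF_add.hyps(2)]
  show ?case unfolding Int_at_add[OF CF_add.hyps] Int_at_add[OF c] CF_add.IH(1)[OF CF_add.prems] CF_add.IH(2)[OF CF_add.prems]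
    by (rule HOL.refl)
next
  case (CF_cmult f c)
  show ?case unfolding Int_at_cmult[OF CF_cmult.hyps] Int_at_cmult[OF CF_Int_at[OF CF_cmult.hyps]] CF_cmult.IH[OF CF_cmult.prems]
    by (rule HOL.refl)
qed

lemma Int_list_commute1: "CF f \<Longrightarrow> i \<notin> set js \<Longrightarrow> Int_at i (Int_list js f) = Int_list js (Int_at i f)"
proof (induction js)
  case (Cons j js)
  have ij: "i \<noteq> j" and ijs: "i \<notin> set js" using Cons.prems(2) by auto
  show ?case unfolding Int_list.simps Int_at_commute[OF CF_Int_list[OF Cons.prems(1)] ij] Cons.IH[OF Cons.prems(1) ijs]
    by (rule HOL.refl)
qed simp

lemma Int_list_commute:
  "CF f \<Longrightarrow> set is \<inter> set js = {} \<Longrightarrow> Int_list is (Int_list js f) = Int_list js (Int_list is f)"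
proof (induction "is")
  case (Cons i "is")
  have d: "i \<notin> set js" "set is \<inter> set js = {}" using Cons.prems(2) by auto
  show ?case unfolding Int_list.simps Cons.IH[OF Cons.prems(1) d(2)] Int_list_commute1[OF CF_Int_list[OF Cons.prems(1)] d(1)]
    by (rule HOL.refl)
qed simp

text \<open>
  Computing the Euler characteristic of the graph by integrating over the target first gives
  \<open>euler_char S m A\<close>; integrating over the source first gives the right-hand side.
\<close>

theorem euler_char_fibres:
  assumes A: "A \<in> S m" and B: "B \<in> S k" and G: "(\<lambda>x. join m x (g x)) ` A \<in> S (m + k)"
    and g: "\<And>x. x \<in> A \<Longrightarrow> g x \<in> B" and fib: "\<And>y. y \<in> B \<Longrightarrow> euler_char S m {x \<in> A. g x = y} = c"
  shows "euler_char S m A = c * euler_char S k B"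
proof -
  have AR: "A \<subseteq> Rn m" and BR: "B \<subseteq> Rn k" using definable_subset A B by auto
  let ?G = "(\<lambda>x. join m x (g x)) ` A"
  let ?sh = "\<lambda>z::nat \<Rightarrow> real. \<lambda>i. z (m + i)"
  let ?f = "\<lambda>z. of_bool (trunc (m + k) z \<in> ?G) :: int"
  have G_iff: "trunc (m + k) z \<in> ?G \<longleftrightarrow> trunc m z \<in> A \<and> trunc k (?sh z) = g (trunc m z)" for z
  proof
    assume "trunc (m + k) z \<in> ?G"
    then obtain x where x: "x \<in> A" "trunc (m + k) z = join m x (g x)" by blast
    have xR: "x \<in> Rn m" "g x \<in> Rn k" using x(1) AR BR g by blast+
    have "trunc m z = x"
    proof (rule Rn_eqI[OF trunc_in_Rn xR(1)])
      fix i assume i: "i < m"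
      have "trunc (m + k) z i = join m x (g x) i" unfolding x(2) ..
      then show "trunc m z i = x i" using i by (simp add: join_def)
    qed
    moreover have "trunc k (?sh z) = g x"
    proof (rule Rn_eqI[OF trunc_in_Rn xR(2)])
      fix i assume i: "i < k"
      have "trunc (m + k) z (m + i) = join m x (g x) (m + i)" unfolding x(2) ..
      then show "trunc k (?sh z) i = g x i" using i by (simp add: join_def)
    qed
    ultimately show "trunc m z \<in> A \<and> trunc k (?sh z) = g (trunc m z)" using x(1) by simp
  next
    assume a: "trunc m z \<in> A \<and> trunc k (?sh z) = g (trunc m z)"
    have "trunc (m + k) z = join m (trunc m z) (g (trunc m z))"
      unfolding conjunct2[OF a, symmetric] by (rule ext) (auto simp: join_def trunc_def)
    then show "trunc (m + k) z \<in> ?G" using a by blast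
  qed
  have CFf: "CF ?f" by (rule CF_of_bool[OF Def_in[OF G]])
  have set_sh: "[m..<m + k] = map ((+) m) [0..<k]" by (rule nth_equalityI) simp_all
  have inner1: "Int_list [m..<m + k] ?f z = of_bool (trunc m z \<in> A)" for z
  proof -
    let ?y = "g (trunc m z)"
    let ?h = "\<lambda>w. of_bool (trunc k w = ?y) :: int"
    have "Int_list [m..<m + k] ?f z = Int_list [m..<m + k] (\<lambda>w. of_bool (trunc m z \<in> A) * ?h (?sh w)) z"
    proof (rule Int_list_cong)
      fix w assume "\<And>j. j \<notin> set [m..<m + k] \<Longrightarrow> w j = z j"
      then have "trunc m w = trunc m z" by (intro trunc_cong) simp
      then show "?f w = of_bool (trunc m z \<in> A) * ?h (?sh w)" unfolding G_iff of_bool_conj by (simp only:)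
    qed
    also have "\<dots> = of_bool (trunc m z \<in> A)"
    proof (cases "trunc m z \<in> A")
      case True
      then have "?y \<in> Rn k" using g BR by blast
      from Int_list_point[OF this]
      have "Int_list [m..<m + k] (\<lambda>w. ?h (?sh w)) = (\<lambda>_. 1)" unfolding set_sh Int_list_shift[where g = ?h] by (simp only:)
      then show ?thesis using True by simp
    next
      case False
      then show ?thesis by (simp add: Int_list_0)
    qed
    finally show ?thesis .
  qed
  have inner2: "Int_list [0..<m] ?f z = c * of_bool (trunc k (?sh z) \<in> B)" for z
  proof -
    let ?y = "trunc k (?sh z)"
    have "Int_list [0..<m] ?f z = Int_list [0..<m] (\<lambda>w. of_bool (trunc m w \<in> {x \<in> A. g x = ?y})) z"
    proof (rule Int_list_cong)
      fix w assume w: "\<And>j. j \<notin> set [0..<m] \<Longrightarrow> w j = z j"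
      have "trunc k (?sh w) = trunc k (?sh z)" by (rule trunc_cong, rule w) simp
      then show "?f w = of_bool (trunc m w \<in> {x \<in> A. g x = ?y})" unfolding G_iff mem_Collect_eq by (auto simp del: trunc_nth)
    qed
    also have "\<dots> = c * of_bool (trunc k (?sh z) \<in> B)"
    proof (cases "?y \<in> B")
      case True
      \<comment> \<open>Only the graph of \<open>g\<close> is known to be definable, so the fibre is
        cut out by membership in \<open>?G\<close>.\<close>
      have "{x \<in> A. g x = ?y} \<in> S m"
      proof -
        have jT: "DefT (\<lambda>x. join m (trunc m x) ?y i)" for i
          by (cases "i < m") (simp_all add: join_def DefT_var DefT_const)
        have jR: "join m (trunc m x) ?y \<in> Rn (m + k)" for x by (auto simp: join_def Rn_def trunc_def)
        have "Def (\<lambda>x. join m (trunc m x) ?y \<in> ?G)" by (rule Def_mem[OF G jT jR])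
        from definable_Collect[OF A this] have S1: "{x \<in> A. join m (trunc m x) ?y \<in> ?G} \<in> S m" .
        have S2: "join m (trunc m x) ?y \<in> ?G \<longleftrightarrow> g x = ?y" if x: "x \<in> A" for x
        proof -
          let ?z = "join m (trunc m x) ?y"
          have tx: "trunc m x = x" using x AR by (auto intro: trunc_Rn)
          have 1: "trunc (m + k) ?z = ?z" by (rule trunc_Rn[OF jR])
          have "trunc m ?z = trunc m x" by (rule trunc_cong) (simp add: join_def)
          then have 2: "trunc m ?z = x" using tx by (simp only:)
          have 3: "?sh ?z = ?y" by (auto simp: join_def)
          show ?thesis using G_iff[of ?z] x unfolding 1 2 3 by (simp only: simp_thms eq_commute trunc_trunc min.idem)
        qed
        have "{x \<in> A. g x = ?y} = {x \<in> A. join m (trunc m x) ?y \<in> ?G}"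
          by (intro Collect_cong conj_cong HOL.refl) (rule S2[symmetric])
        then show ?thesis using S1 by (rule ssubst)
      qed
      from euler_char_Int[OF this] fib[OF True] show ?thesis using True by simp
    next
      case False
      have no: "(trunc m w \<in> {x \<in> A. g x = ?y}) = False" for w using g[of "trunc m w"] False by auto
      show ?thesis unfolding no using False by (simp add: Int_list_0)
    qed
    finally show ?thesis .
  qed
  have "Int_list [0..<m] (Int_list [m..<m + k] ?f) = Int_list [m..<m + k] (Int_list [0..<m] ?f)"
    by (rule Int_list_commute[OF CFf]) auto
  moreover have "Int_list [m..<m + k] ?f = (\<lambda>z. of_bool (trunc m z \<in> A))" by (rule ext) (rule inner1)
  moreover have "Int_list [0..<m] ?f = (\<lambda>z. c * of_bool (trunc k (?sh z) \<in> B))" by (rule ext) (rule inner2)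
  moreover have "Int_list [m..<m + k] (\<lambda>z. c * of_bool (trunc k (?sh z) \<in> B)) = (\<lambda>_. c * euler_char S k B)"
    unfolding set_sh Int_list_shift[where g = "\<lambda>w. c * of_bool (trunc k w \<in> B)"]
      Int_list_cmult[OF CF_of_bool[OF Def_in[OF B]]] euler_char_Int[OF B] ..
  ultimately have "(\<lambda>_::nat \<Rightarrow> real. euler_char S m A) = (\<lambda>_. c * euler_char S k B)"
    unfolding euler_char_Int[OF A, symmetric] by (simp only:)
  then show ?thesis by (rule fun_cong)
qed


section \<open>Definable maps and invariance of the Euler characteristic\<close>

definition Dmap :: "((nat \<Rightarrow> real) \<Rightarrow> nat \<Rightarrow> real) \<Rightarrow> bool" where
  "Dmap P \<longleftrightarrow> (\<forall>i. DefT (\<lambda>z. P z i))"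

lemma Dmap_comp: "Dmap P \<Longrightarrow> Dmap Q \<Longrightarrow> Dmap (\<lambda>z. P (Q z))"
proof -
  assume P: "Dmap P" and Q: "Dmap Q"
  have "DefT (\<lambda>z. P (Q z) i)" for i
    by (rule DefT_comp[where f = "\<lambda>z. P z i" and T = Q]) (use P Q in \<open>simp_all add: Dmap_def\<close>)
  then show ?thesis by (simp add: Dmap_def)
qed

lemma Dmap_id: "Dmap (\<lambda>z. z)" by (simp add: Dmap_def DefT_var)

lemma Dmap_trunc: "Dmap P \<Longrightarrow> Dmap (\<lambda>z. trunc m (P z))"
  unfolding Dmap_def by (intro allI DefT_trunc) simp

lemma Dmap_join: assumes "Dmap P" "Dmap Q" shows "Dmap (\<lambda>z. join k (P z) (Q z))"
  unfolding Dmap_def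
proof
  fix i show "DefT (\<lambda>z. join k (P z) (Q z) i)"
    using assms by (cases "i < k") (simp_all add: join_def Dmap_def)
qed

lemma image_definable:
  assumes "B \<in> S m" "Dmap P" "\<And>z. z \<in> B \<Longrightarrow> P z \<in> Rn k" shows "P ` B \<in> S k"
proof -
  have BR: "B \<subseteq> Rn m" using definable_subset[OF assms(1)] .
  have "DefT (\<lambda>x. P (trunc m x) i)" for i
    using Dmap_comp[OF assms(2) Dmap_trunc[OF Dmap_id, of m]] by (simp add: Dmap_def)
  then have "Def (\<lambda>y. \<exists>z\<in>B. \<forall>i<k. y i = P z i)"
    by (intro Def_ex_S[OF assms(1)] Def_ball_less Def_eq DefT_var) 
  from Def_set[OF this, of k] have "{y \<in> Rn k. \<exists>z\<in>B. \<forall>i<k. y i = P z i} \<in> S k" .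
  moreover have "{y \<in> Rn k. \<exists>z\<in>B. \<forall>i<k. y i = P z i} = P ` B"
  proof (intro equalityI subsetI)
    fix y assume "y \<in> {y \<in> Rn k. \<exists>z\<in>B. \<forall>i<k. y i = P z i}"
    then obtain z where z: "y \<in> Rn k" "z \<in> B" "\<forall>i<k. y i = P z i" by blast
    have "y = P z" by (rule Rn_eqI[OF z(1) assms(3)[OF z(2)]]) (use z(3) in blast)
    then show "y \<in> P ` B" using z(2) by blast
  qed (use assms(3) in auto)
  ultimately show ?thesis by simp
qed

lemma join_Rn: "x \<in> Rn m \<Longrightarrow> y \<in> Rn k \<Longrightarrow> join m x y \<in> Rn (m + k)"
  by (auto simp: join_def Rn_def)

lemma join_inject: assumes "x \<in> Rn m" "x' \<in> Rn m" "join m x y = join m x' y'" shows "x = x' \<and> y = y'"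
proof
  show "x = x'"
  proof (rule Rn_eqI[OF assms(1,2)])
    fix i assume "i < m" then show "x i = x' i" using fun_cong[OF assms(3), of i] by (simp add: join_def)
  qed
  show "y = y'" using fun_cong[OF assms(3), of "m + _"] by (auto simp: join_def)
qed

text \<open>The fibre theorem for a map given by total terms, where definability of the graph is
  automatic.\<close>

lemma euler_char_map:
  assumes B: "B \<in> S m" and P: "Dmap P" and C: "C \<in> S k" and PC: "\<And>z. z \<in> B \<Longrightarrow> P z \<in> C"
    and fib: "\<And>y. y \<in> C \<Longrightarrow> euler_char S m {z \<in> B. P z = y} = c"
  shows "euler_char S m B = c * euler_char S k C"
proof -
  have BR: "B \<subseteq> Rn m" and CR: "C \<subseteq> Rn k" using definable_subset B C by auto
  have "(\<lambda>z. join m z (P z)) ` B \<in> S (m + k)"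
    by (rule image_definable[OF B Dmap_join[OF Dmap_id P]]) (use BR CR PC join_Rn in blast)
  from euler_char_fibres[OF B C this PC fib] show ?thesis .
qed

lemma single_definable: assumes "z \<in> Rn m" shows "{z} \<in> S m"
proof -
  have "{x \<in> Rn m. \<forall>i<m. x i = z i} \<in> S m" by (intro Def_set defi)
  moreover have "{x \<in> Rn m. \<forall>i<m. x i = z i} = {z}" using assms Rn_eqI by blast
  ultimately show ?thesis by simp
qed

lemma euler_char_single: assumes "z \<in> Rn m" shows "euler_char S m {z} = 1"
proof -
  have "(\<lambda>_::nat \<Rightarrow> real. euler_char S m {z}) = (\<lambda>_. 1)"
    unfolding euler_char_Int[OF single_definable[OF assms], symmetric] singleton_iff by (rule Int_list_point[OF assms])
  then show ?thesis by (rule fun_cong)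
qed

lemma euler_char_inj:
  assumes B: "B \<in> S m" and P: "Dmap P" and PR: "\<And>z. z \<in> B \<Longrightarrow> P z \<in> Rn k" and inj: "inj_on P B"
  shows "euler_char S k (P ` B) = euler_char S m B"
proof -
  have "euler_char S m B = 1 * euler_char S k (P ` B)"
  proof (rule euler_char_map[OF B P image_definable[OF B P PR]])
    fix y assume "y \<in> P ` B"
    then obtain z where z: "z \<in> B" "y = P z" by blast
    have "{w \<in> B. P w = y} = {z}" using z inj by (auto simp: inj_on_def)
    then show "euler_char S m {w \<in> B. P w = y} = 1"
      using euler_char_single[of z m] definable_subset[OF B] z(1) by auto
  qed auto
  then show ?thesis by simp
qed

text \<open>Both images are projections of the image of the joint map, and equality of the fibres
  makes each projection injective. This compares two models of one quotient without constructing a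
  map between them.\<close>

lemma euler_char_equiv:
  assumes B: "B \<in> S m" and P: "Dmap P" "\<And>z. z \<in> B \<Longrightarrow> P z \<in> Rn k" and Q: "Dmap Q" "\<And>z. z \<in> B \<Longrightarrow> Q z \<in> Rn l"
    and PQ: "\<And>z w. z \<in> B \<Longrightarrow> w \<in> B \<Longrightarrow> P z = P w \<longleftrightarrow> Q z = Q w"
  shows "euler_char S k (P ` B) = euler_char S l (Q ` B)"
proof -
  let ?T = "\<lambda>z. join k (P z) (Q z)"
  let ?C = "?T ` B"
  have T: "?T z \<in> Rn (k + l)" if "z \<in> B" for z using join_Rn[OF P(2)[OF that] Q(2)[OF that]] .
  have C: "?C \<in> S (k + l)" by (rule image_definable[OF B Dmap_join[OF P(1) Q(1)] T])
  have t1: "trunc k (?T z) = P z" if "z \<in> B" for z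
    by (rule Rn_eqI[OF trunc_in_Rn P(2)[OF that]]) (simp add: join_def)
  let ?sh = "\<lambda>v. trunc l (\<lambda>i. v (k + i))"
  have t2: "?sh (?T z) = Q z" if "z \<in> B" for z
    by (rule Rn_eqI[OF trunc_in_Rn Q(2)[OF that]]) (simp add: join_def)
  have "trunc k ` ?C = P ` B" using t1 by (force simp: image_iff)
  moreover have "inj_on (trunc k) ?C"
  proof (rule inj_onI)
    fix v w assume "v \<in> ?C" "w \<in> ?C" "trunc k v = trunc k w"
    then obtain z y where z: "z \<in> B" "v = ?T z" "y \<in> B" "w = ?T y" "trunc k (?T z) = trunc k (?T y)" by blast
    then have "P z = P y" using t1 by simp
    then show "v = w" using z PQ[OF z(1,3)] by simp
  qed
  ultimately have 1: "euler_char S k (P ` B) = euler_char S (k + l) ?C"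
    using euler_char_inj[OF C Dmap_trunc[OF Dmap_id, of k], of k] by simp
  have "?sh ` ?C = Q ` B" using t2 by (force simp: image_iff)
  moreover have "inj_on ?sh ?C"
  proof (rule inj_onI)
    fix v w assume "v \<in> ?C" "w \<in> ?C" "?sh v = ?sh w"
    then obtain z y where z: "z \<in> B" "v = ?T z" "y \<in> B" "w = ?T y" "?sh (?T z) = ?sh (?T y)" by blast
    then have "Q z = Q y" using t2 by simp
    then show "v = w" using z PQ[OF z(1,3)] by simp
  qed
  moreover have "Dmap ?sh" by (rule Dmap_trunc) (simp add: Dmap_def DefT_var)
  ultimately have 2: "euler_char S l (Q ` B) = euler_char S (k + l) ?C"
    using euler_char_inj[OF C, of ?sh l] by simp
  show ?thesis unfolding 1 2 ..
qed

text \<open>A map known only through a definable graph over the chart image is extended by 0, so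
  that abstract orbit maps can be treated as maps of coordinates. Injectivity of
  \<open>\<iota>\<close> makes the value at a chart point well defined.\<close>

lemma graph_Dmap:
  assumes G: "(\<lambda>x. join m (\<iota> x) (p x)) ` A \<in> S (m + k)" and \<iota>: "\<And>x. x \<in> A \<Longrightarrow> \<iota> x \<in> Rn m" "inj_on \<iota> A"
    and p: "\<And>x. x \<in> A \<Longrightarrow> p x \<in> Rn k"
  shows "\<exists>P. Dmap P \<and> (\<forall>x\<in>A. p x = P (\<iota> x))"
proof -
  let ?G = "(\<lambda>x. join m (\<iota> x) (p x)) ` A"
  let ?Q = "\<lambda>z w. join m (trunc m z) (trunc k w) \<in> ?G"
  have Q_iff: "?Q z w \<longleftrightarrow> (\<exists>x\<in>A. \<iota> x = trunc m z \<and> p x = trunc k w)" for z w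
  proof
    assume "?Q z w"
    then obtain x where "x \<in> A" "join m (trunc m z) (trunc k w) = join m (\<iota> x) (p x)" by blast
    then show "\<exists>x\<in>A. \<iota> x = trunc m z \<and> p x = trunc k w"
      using join_inject[OF trunc_in_Rn \<iota>(1)] by metis
  next
    assume "\<exists>x\<in>A. \<iota> x = trunc m z \<and> p x = trunc k w"
    then obtain x where x: "x \<in> A" "\<iota> x = trunc m z" "p x = trunc k w" by blast
    show "?Q z w" unfolding x(2,3)[symmetric] using x(1) by (rule imageI)
  qed
  define P where "P z = (if \<exists>x\<in>A. \<iota> x = trunc m z then p (THE x. x \<in> A \<and> \<iota> x = trunc m z) else (\<lambda>_. 0))" for z
  have P\<iota>: "P z = p x" if "x \<in> A" "\<iota> x = trunc m z" for z x
  proof -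
    have "(THE x. x \<in> A \<and> \<iota> x = trunc m z) = x"
      using that \<iota>(2) unfolding inj_on_def by (intro the_equality) auto
    then show ?thesis using that unfolding P_def by auto
  qed
  have P0: "P z = (\<lambda>_. 0)" if "\<not> (\<exists>x\<in>A. \<iota> x = trunc m z)" for z using that unfolding P_def by simp
  have ex: "(\<exists>w\<in>Rn k. ?Q z w) \<longleftrightarrow> (\<exists>x\<in>A. \<iota> x = trunc m z)" for z
    unfolding Q_iff using p trunc_Rn by metis
  have tD: "Dmap (\<lambda>x. join m (trunc m (T x)) (trunc k (U x)))" if "Dmap T" "Dmap U" for T U
    by (intro Dmap_join Dmap_trunc that)
  have QD: "Def (\<lambda>x. ?Q (T x) (U x))" if "Dmap T" "Dmap U" for T U
  proof (rule Def_mem[OF G])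
    fix i show "DefT (\<lambda>x. join m (trunc m (T x)) (trunc k (U x)) i)" using tD[OF that] by (simp add: Dmap_def)
  qed (rule join_Rn[OF trunc_in_Rn trunc_in_Rn])
  have DP: "DefT (\<lambda>z. P z i)" for i
  proof (rule DefT_unique[where P = "\<lambda>z t. (\<exists>w\<in>Rn k. ?Q z w \<and> w i = t) \<or> \<not> (\<exists>w\<in>Rn k. ?Q z w) \<and> t = 0"])
    have 1: "Def (\<lambda>x. ?Q (\<lambda>j. x (Suc (j + k))) (trunc k x))" by (intro QD) (auto simp: Dmap_def intro: DefT_var Dmap_trunc[OF Dmap_id, unfolded Dmap_def, rule_format])
    have 2: "DefT (\<lambda>x. trunc k x i)" by (intro defi)
    show "Def (\<lambda>x. (\<exists>w\<in>Rn k. ?Q (\<lambda>i. x (Suc i)) w \<and> w i = x 0) \<or> \<not> (\<exists>w\<in>Rn k. ?Q (\<lambda>i. x (Suc i)) w) \<and> x 0 = 0)"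
      by (intro Def_disj Def_conj Def_not Def_ex_Rn Def_eq DefT_var DefT_const 2) (use 1 in simp_all)
  next
    fix z t assume "(\<exists>w\<in>Rn k. ?Q z w \<and> w i = t) \<or> \<not> (\<exists>w\<in>Rn k. ?Q z w) \<and> t = 0"
    then show "t = P z i"
    proof
      assume "\<exists>w\<in>Rn k. ?Q z w \<and> w i = t"
      then obtain w where w: "w \<in> Rn k" "?Q z w" "w i = t" by blast
      then obtain x where "x \<in> A" "\<iota> x = trunc m z" "p x = trunc k w" using Q_iff by blast
      then show "t = P z i" using P\<iota> w trunc_Rn[OF w(1)] by simp
    next
      assume "\<not> (\<exists>w\<in>Rn k. ?Q z w) \<and> t = 0"
      then show "t = P z i" using P0 ex by simp
    qed
  next
    fix z
    show "(\<exists>w\<in>Rn k. ?Q z w \<and> w i = P z i) \<or> \<not> (\<exists>w\<in>Rn k. ?Q z w) \<and> P z i = 0"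
    proof (cases "\<exists>x\<in>A. \<iota> x = trunc m z")
      case True
      then obtain x where x: "x \<in> A" "\<iota> x = trunc m z" by blast
      have "?Q z (p x)" unfolding Q_iff using x trunc_Rn[OF p[OF x(1)]] by metis
      then show ?thesis using P\<iota>[OF x] p[OF x(1)] by auto
    next
      case False then show ?thesis using P0 ex by simp
    qed
  qed
  have "p x = P (\<iota> x)" if "x \<in> A" for x
    using P\<iota>[OF that, of "\<iota> x"] trunc_Rn[OF \<iota>(1)[OF that]] by simp
  then show ?thesis using DP by (intro exI[of _ P]) (simp add: Dmap_def)
qed

section \<open>Complex-valued definable functions and the circle\<close>

definition CDef :: "((nat \<Rightarrow> real) \<Rightarrow> complex) \<Rightarrow> bool" where
  "CDef F \<longleftrightarrow> DefT (\<lambda>z. Re (F z)) \<and> DefT (\<lambda>z. Im (F z))"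

lemma CDef_const: "CDef (\<lambda>z. c)" by (simp add: CDef_def DefT_const)

lemma CDef_var: "CDef (\<lambda>z. Complex (z i) (z j))" by (simp add: CDef_def DefT_var)

lemma CDef_mult: "CDef F \<Longrightarrow> CDef G \<Longrightarrow> CDef (\<lambda>z. F z * G z)"
  unfolding CDef_def by (auto intro!: defi)

lemma CDef_cnj: "CDef F \<Longrightarrow> CDef (\<lambda>z. cnj (F z))"
  unfolding CDef_def by (auto intro!: DefT_minus)

lemma CDef_power: "CDef F \<Longrightarrow> CDef (\<lambda>z. F z ^ k)"
  by (induction k) (auto intro: CDef_mult CDef_const)

lemma CDef_of_real: "DefT f \<Longrightarrow> CDef (\<lambda>z. of_real (f z))"
  by (simp add: CDef_def DefT_const)

lemma Def_CDef_eq: "CDef F \<Longrightarrow> CDef G \<Longrightarrow> Def (\<lambda>z. F z = G z)"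
  unfolding CDef_def complex_eq_iff by (intro Def_conj Def_eq) auto

lemma DefT_norm2: "CDef F \<Longrightarrow> DefT (\<lambda>z. (cmod (F z))\<^sup>2)"
proof -
  assume F: "CDef F"
  have "DefT (\<lambda>z. Re (F z) * Re (F z) + Im (F z) * Im (F z))"
    using F unfolding CDef_def by (intro DefT_add DefT_mult) auto
  then show ?thesis by (simp only: cmod_power2 power2_eq_square[of "Re _"] power2_eq_square[of "Im _"])
qed

definition cpair :: "complex \<Rightarrow> nat \<Rightarrow> real" where
  "cpair h = (\<lambda>i. if i = 0 then Re h else if i = 1 then Im h else 0)"

lemma cpair_Rn: "cpair h \<in> Rn 2" by (simp add: cpair_def Rn_def)

lemma cpair_inject: "cpair h = cpair h' \<longleftrightarrow> h = h'"
proof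
  assume a: "cpair h = cpair h'"
  show "h = h'" using fun_cong[OF a, of 0] fun_cong[OF a, of 1] by (simp add: cpair_def complex_eq_iff)
qed simp

lemma Dmap_cpair: "CDef F \<Longrightarrow> Dmap (\<lambda>z. cpair (F z))"
  unfolding Dmap_def
proof
  fix i assume "CDef F"
  then show "DefT (\<lambda>z. cpair (F z) i)"
    by (cases "i = 0"; cases "i = 1") (simp_all add: cpair_def CDef_def DefT_const)
qed

lemma abs_eq_iff_mult: "\<bar>a\<bar> = \<bar>b\<bar> \<longleftrightarrow> a * a = b * (b::real)"
  using power2_eq_iff[of "\<bar>a\<bar>" "\<bar>b\<bar>"] by (auto simp: power2_eq_square abs_eq_iff square_eq_iff)

text \<open>The squaring map of the circle onto itself is two-to-one, so the Euler characteristic equals its double.\<close>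

lemma euler_char_circle:
  assumes "r > 0" shows "cpair ` {h. cmod h = r} \<in> S 2" "euler_char S 2 (cpair ` {h. cmod h = r}) = 0"
proof -
  let ?c = "\<lambda>z::nat \<Rightarrow> real. Complex (z 0) (z 1)"
  have c: "?c (cpair h) = h" for h by (simp add: cpair_def)
  have pc: "cpair (?c z) = z" if "z \<in> Rn 2" for z
    by (rule Rn_eqI[OF cpair_Rn that]) (auto simp: cpair_def numeral_2_eq_2 less_Suc_eq)
  let ?B = "cpair ` {h. cmod h = r}"
  have B_eq: "{z \<in> Rn 2. (cmod (?c z))\<^sup>2 = r\<^sup>2} = ?B"
  proof (intro equalityI subsetI)
    fix z assume z: "z \<in> {z \<in> Rn 2. (cmod (?c z))\<^sup>2 = r\<^sup>2}"
    then have "cmod (?c z) = r" using assms by (simp only: mem_Collect_eq) (rule power2_eq_imp_eq, auto)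
    then have "cpair (?c z) \<in> ?B" by blast
    then show "z \<in> ?B" using pc z by simp
  qed (auto simp: cpair_Rn c[unfolded One_nat_def])
  have "{z \<in> Rn 2. (cmod (?c z))\<^sup>2 = r\<^sup>2} \<in> S 2" by (intro Def_set Def_eq DefT_norm2 CDef_var DefT_const)
  then show B: "?B \<in> S 2" unfolding B_eq .
  \<comment> \<open>Division by \<open>r\<close> returns the square to the circle of radius
    \<open>r\<close>.\<close>
  let ?q = "\<lambda>z. cpair (of_real (1 / r) * (?c z * ?c z))"
  have q: "?q (cpair h) = cpair (h * h / of_real r)" for h unfolding c by simp
  have "euler_char S 2 ?B = 2 * euler_char S 2 ?B"
  proof (rule euler_char_map[OF B _ B])
    show "Dmap ?q" by (intro Dmap_cpair CDef_mult CDef_const CDef_var)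
    fix z assume "z \<in> ?B"
    then obtain h where h: "cmod h = r" "z = cpair h" by blast
    have "cmod (h * h / of_real r) = r" unfolding norm_mult norm_divide h(1) using assms by simp
    then show "?q z \<in> ?B" unfolding h(2) q by blast
  next
    fix y assume "y \<in> ?B"
    then obtain w where w: "cmod w = r" "y = cpair w" by blast
    define h where "h = csqrt (of_real r * w)"
    have hh: "h * h = of_real r * w" using power2_csqrt[of "of_real r * w"] unfolding h_def power2_eq_square .
    have "cmod h * cmod h = r * r" using arg_cong[OF hh, of cmod] w(1) assms unfolding norm_mult by simp
    then have "\<bar>cmod h\<bar> = \<bar>r\<bar>" by (rule abs_eq_iff_mult[THEN iffD2])
    then have hr: "cmod h = r" using assms by simp
    have "h \<noteq> 0" using hr assms by auto
    have "{z \<in> ?B. ?q z = y} = {cpair h} \<union> {cpair (- h)}"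
    proof (intro equalityI subsetI)
      fix z assume "z \<in> {z \<in> ?B. ?q z = y}"
      then obtain g where g: "cmod g = r" "z = cpair g" "?q (cpair g) = y" by blast
      then have "g * g / of_real r = w" unfolding q w(2) cpair_inject by simp
      then have "g * g = h * h" using hh assms by (simp add: field_simps)
      then have "g = h \<or> g = - h" unfolding square_eq_iff .
      then show "z \<in> {cpair h} \<union> {cpair (- h)}" using g(2) by blast
    next
      fix z assume "z \<in> {cpair h} \<union> {cpair (- h)}"
      then obtain g where g: "z = cpair g" "g = h \<or> g = - h" by blast
      have "g * g / of_real r = w" using g(2) hh assms by (auto simp: field_simps)
      then have "?q z = y" unfolding g(1) q w(2) by simp
      moreover have "cmod g = r" using g(2) hr by auto
      ultimately show "z \<in> {z \<in> ?B. ?q z = y}" using g(1) by blast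
    qed
    moreover have "{cpair h} \<inter> {cpair (- h)} = {}" using \<open>h \<noteq> 0\<close> by (simp add: cpair_inject)
    ultimately show "euler_char S 2 {z \<in> ?B. ?q z = y} = 2"
      using euler_char_Un[OF single_definable[OF cpair_Rn] single_definable[OF cpair_Rn]] by (simp add: euler_char_single[OF cpair_Rn])
  qed
  then show "euler_char S 2 ?B = 0" by simp
qed

end

section \<open>Homomorphisms to the circle\<close>

text \<open>Real and imaginary parts alternate, in agreement with \<open>vector_chart\<close> and
  \<open>hom_chart circle_chart\<close>; \<open>ent\<close> undoes this layout.\<close>

definition tup :: "nat \<Rightarrow> (nat \<Rightarrow> complex) \<Rightarrow> nat \<Rightarrow> real" where
  "tup r f = (\<lambda>i. if i < 2 * r then (if even i then Re else Im) (f (i div 2)) else 0)"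

definition ent :: "(nat \<Rightarrow> real) \<Rightarrow> nat \<Rightarrow> complex" where
  "ent z j = Complex (z (2 * j)) (z (Suc (2 * j)))"

lemma tup_Rn: "tup r f \<in> Rn (2 * r)" by (simp add: tup_def Rn_def)

lemma ent_tup: "j < r \<Longrightarrow> ent (tup r f) j = f j"
  by (simp add: ent_def tup_def complex_eq_iff)

lemma tup_ent: assumes "z \<in> Rn (2 * r)" shows "tup r (ent z) = z"
proof (rule Rn_eqI[OF tup_Rn assms])
  fix i assume i: "i < 2 * r"
  show "tup r (ent z) i = z i"
  proof (cases "even i")
    case True
    then have "2 * (i div 2) = i" by simp
    then show ?thesis using i True by (simp add: tup_def ent_def)
  next
    case False
    then have "Suc (2 * (i div 2)) = i" by presburger
    then show ?thesis using i False by (simp add: tup_def ent_def)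
  qed
qed

lemma tup_eq_iff: "tup r f = tup r g \<longleftrightarrow> (\<forall>j<r. f j = g j)"
proof
  assume a: "tup r f = tup r g"
  show "\<forall>j<r. f j = g j" using ent_tup[of _ r f] ent_tup[of _ r g] a by simp
next
  assume a: "\<forall>j<r. f j = g j"
  show "tup r f = tup r g"
  proof
    fix i show "tup r f i = tup r g i"
    proof (cases "i < 2 * r")
      case True
      then have "i div 2 < r" by auto
      then show ?thesis using a by (simp add: tup_def)
    qed (simp add: tup_def)
  qed
qed

text \<open>One family for all isotropy groups that occur: \<open>N > 0\<close> gives the roots of
  unity of order dividing \<open>N\<close>, and \<open>N = 0\<close> the whole circle, because
  \<open>z ^ 0 = 1\<close>.\<close>

definition circ :: "nat \<Rightarrow> complex monoid" where
  "circ N = circle_group\<lparr>carrier := {z \<in> sphere 0 1. z ^ N = 1}\<rparr>"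

lemma circ_simps:
  "carrier (circ N) = {z. cmod z = 1 \<and> z ^ N = 1}" "x \<otimes>\<^bsub>circ N\<^esub> y = x * y" "\<one>\<^bsub>circ N\<^esub> = 1"
  by (auto simp: circ_def circle_group_def)

lemma circ_0: "circ 0 = circle_group" by (simp add: circ_def circle_group_def sphere_def)

lemma circ_group: "comm_group (circ N)"
proof (rule comm_groupI)
  fix x assume "x \<in> carrier (circ N)"
  then have "inverse x \<in> carrier (circ N)" "inverse x \<otimes>\<^bsub>circ N\<^esub> x = \<one>\<^bsub>circ N\<^esub>"
    by (auto simp: circ_simps norm_inverse power_inverse intro!: left_inverse)
  then show "\<exists>y\<in>carrier (circ N). y \<otimes>\<^bsub>circ N\<^esub> x = \<one>\<^bsub>circ N\<^esub>" by blast
qed (auto simp: circ_simps norm_mult power_mult_distrib)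

lemma conj_act_trivial:
  assumes "\<phi> \<in> Hom \<Gamma> (circ N)" "h \<in> carrier (circ N)" shows "conj_act \<Gamma> (circ N) h \<phi> = \<phi>"
proof
  interpret comm_group "circ N" by (rule circ_group)
  fix \<gamma>
  have h: "inv\<^bsub>circ N\<^esub> h \<in> carrier (circ N)" using assms(2) by blast
  show "conj_act \<Gamma> (circ N) h \<phi> \<gamma> = \<phi> \<gamma>"
  proof (cases "\<gamma> \<in> carrier \<Gamma>")
    case True
    then have "\<phi> \<gamma> \<in> carrier (circ N)" using assms(1) by (auto simp: Hom_def hom_def)
    then have "h \<otimes>\<^bsub>circ N\<^esub> \<phi> \<gamma> \<otimes>\<^bsub>circ N\<^esub> inv\<^bsub>circ N\<^esub> h = \<phi> \<gamma>"
      using assms(2) h by (metis m_comm inv_solve_right m_closed)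
    then show ?thesis using True by (simp add: conj_act_def)
  next
    case False
    then show ?thesis using assms(1) by (simp add: conj_act_def Hom_def extensional_def)
  qed
qed

text \<open>Inverses are replaced by conjugates, which agree with them on the circle but are
  polynomial in real coordinates; relators thus become definable equations.\<close>

primrec circle_value :: "('g \<Rightarrow> complex) \<Rightarrow> ('g \<times> bool) list \<Rightarrow> complex" where
  "circle_value \<xi> [] = 1"
| "circle_value \<xi> (l # w) = (if snd l then \<xi> (fst l) else cnj (\<xi> (fst l))) * circle_value \<xi> w"

lemma circle_value_append: "circle_value \<xi> (v @ w) = circle_value \<xi> v * circle_value \<xi> w"
  by (induction v) (auto simp: mult.assoc)

lemma circle_value_cong:
  assumes "w \<in> lists (B \<times> UNIV)" "\<And>g. g \<in> B \<Longrightarrow> \<xi> g = \<xi>' g" shows "circle_value \<xi> w = circle_value \<xi>' w"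
  using assms(1) by (induction w) (auto simp: assms(2))

lemma circle_value_closed:
  assumes "w \<in> lists (B \<times> UNIV)" "\<And>g. g \<in> B \<Longrightarrow> \<xi> g \<in> carrier (circ N)"
  shows "circle_value \<xi> w \<in> carrier (circ N)"
  using assms(1)
proof induction
  case (Cons l w)
  have "\<xi> (fst l) \<in> carrier (circ N)" using Cons assms(2) by auto
  then show ?case using Cons
    by (auto simp: circ_simps norm_mult power_mult_distrib simp flip: complex_cnj_power)
qed (simp add: circ_simps)

lemma mult_cnj_1: "cmod z = 1 \<Longrightarrow> z * cnj z = 1"
  by (metis complex_norm_square of_real_1 power_one)

text \<open>Each elementary move preserves the value: cancellation because \<open>\<xi>\<close> has
  modulus 1, insertion of a relator because \<open>\<xi>\<close> kills it.\<close>

lemma word_eq_sound: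
  assumes "word_eq B R v w" "\<And>g. g \<in> B \<Longrightarrow> cmod (\<xi> g) = 1" "\<And>r. r \<in> R \<Longrightarrow> circle_value \<xi> r = 1"
  shows "circle_value \<xi> v = circle_value \<xi> w"
  using assms(1)
proof induction
  case (cancel u v x b)
  have "\<xi> x * cnj (\<xi> x) = 1" by (rule mult_cnj_1) (use cancel assms(2) in auto)
  then have "circle_value \<xi> [(x, b), (x, \<not> b)] = 1" by (cases b) (auto simp: mult.commute)
  then show ?case unfolding circle_value_append by simp
next
  case (relator u v r)
  then show ?case using assms(3) by (simp add: circle_value_append)
qed simp_all

definition word_inv :: "('g \<times> bool) list \<Rightarrow> ('g \<times> bool) list" where
  "word_inv w = rev (map (\<lambda>l. (fst l, \<not> snd l)) w)"

lemma word_inv_lists: "w \<in> lists (B \<times> UNIV) \<Longrightarrow> word_inv w \<in> lists (B \<times> UNIV)"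
  by (auto simp: word_inv_def in_lists_conv_set)

lemma circle_value_inv: "circle_value \<xi> (word_inv w) = cnj (circle_value \<xi> w)"
  by (induction w) (auto simp: word_inv_def circle_value_append)

section \<open>Words and circle-valued homomorphisms of a presented group\<close>

context group
begin

lemma word_value_closed: "w \<in> lists (B \<times> UNIV) \<Longrightarrow> B \<subseteq> carrier G \<Longrightarrow> word_value G w \<in> carrier G"
  by (induction w rule: lists.induct) auto

lemma word_value_append:
  assumes "v \<in> lists (B \<times> UNIV)" "w \<in> lists (B \<times> UNIV)" "B \<subseteq> carrier G"
  shows "word_value G (v @ w) = word_value G v \<otimes> word_value G w"
  using assms(1)
proof induction
  case Nil show ?case using word_value_closed[OF assms(2,3)] by simp
next
  case (Cons l v)
  have "fst l \<in> carrier G" using Cons.hyps assms(3) by auto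
  then show ?case using Cons word_value_closed[OF assms(2,3)] word_value_closed[OF Cons.hyps(2) assms(3)]
    by (simp add: m_assoc)
qed

lemma word_value_inv:
  assumes "w \<in> lists (B \<times> UNIV)" "B \<subseteq> carrier G" shows "word_value G (word_inv w) = inv (word_value G w)"
  using assms(1)
proof induction
  case Nil show ?case by (simp add: word_inv_def)
next
  case (Cons l w)
  have l: "fst l \<in> carrier G" "fst l \<in> B" using Cons.hyps assms(2) by auto
  have ll: "[(fst l, \<not> snd l)] \<in> lists (B \<times> UNIV)" using l by simp
  have "word_value G (word_inv (l # w)) = word_value G (word_inv w) \<otimes> word_value G [(fst l, \<not> snd l)]"
    using word_value_append[OF word_inv_lists[OF Cons.hyps(2)] ll assms(2)] by (simp add: word_inv_def)
  then show ?case using Cons.IH l word_value_closed[OF Cons.hyps(2) assms(2)] by (simp add: inv_mult_group)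
qed

lemma generate_word:
  assumes "B \<subseteq> carrier G" "g \<in> generate G B" shows "\<exists>w\<in>lists (B \<times> UNIV). word_value G w = g"
  using assms(2)
proof induction
  case one show ?case by (rule bexI[of _ "[]"]) auto
next
  case (incl h) then show ?case using assms(1) by (intro bexI[of _ "[(h, True)]"]) auto
next
  case (inv h) then show ?case using assms(1) by (intro bexI[of _ "[(h, False)]"]) auto
next
  case (eng g h)
  then obtain v w where "v \<in> lists (B \<times> UNIV)" "word_value G v = g" "w \<in> lists (B \<times> UNIV)" "word_value G w = h"
    by blast
  then show ?case using word_value_append[OF _ _ assms(1)] by (intro bexI[of _ "v @ w"]) auto
qed

lemma Hom_word:
  assumes "\<phi> \<in> Hom G (circ N)" "w \<in> lists (B \<times> UNIV)" "B \<subseteq> carrier G"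
  shows "\<phi> (word_value G w) = circle_value \<phi> w"
proof -
  have hm: "\<phi> \<in> hom G (circ N)" using assms(1) by (simp add: Hom_def)
  interpret gh: group_hom G "circ N" \<phi>
    using circ_group[of N] hm by (simp add: group_hom_def group_hom_axioms_def comm_group_def is_group)
  have inv: "\<phi> (inv x) = cnj (\<phi> x)" if x: "x \<in> carrier G" for x
  proof -
    have "\<phi> (inv x) * \<phi> x = \<phi> (inv x \<otimes> x)" using gh.hom_mult[of "inv x" x] x by (simp add: circ_simps(2))
    also have "\<dots> = \<phi> \<one>" by (simp only: l_inv[OF x])
    also have "\<dots> = 1" by (simp only: gh.hom_one circ_simps(3))
    finally have "\<phi> (inv x) * \<phi> x = 1" .
    moreover have "cmod (\<phi> x) = 1" using gh.hom_closed[OF x] by (simp add: circ_simps)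
    ultimately show ?thesis using mult_cnj_1 by (metis mult.assoc mult.left_neutral mult.right_neutral)
  qed
  show ?thesis using assms(2)
  proof induction
    case Nil show ?case using gh.hom_one by (simp add: circ_simps)
  next
    case (Cons l w)
    have l: "fst l \<in> carrier G" using Cons.hyps assms(3) by auto
    have w: "word_value G w \<in> carrier G" by (rule word_value_closed[OF Cons.hyps(2) assms(3)])
    show ?case using Cons.IH l w inv[OF l] gh.hom_mult[OF _ w] by (simp add: circ_simps)
  qed
qed

lemma Hom_eqI:
  assumes "\<phi> \<in> Hom G (circ N)" "\<psi> \<in> Hom G (circ N)" "B \<subseteq> carrier G" "generate G B = carrier G"
    "\<And>g. g \<in> B \<Longrightarrow> \<phi> g = \<psi> g"
  shows "\<phi> = \<psi>"
proof
  fix g show "\<phi> g = \<psi> g"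
  proof (cases "g \<in> carrier G")
    case True
    then obtain w where w: "w \<in> lists (B \<times> UNIV)" "word_value G w = g"
      using generate_word[OF assms(3)] assms(4) by blast
    show ?thesis using Hom_word[OF assms(1) w(1) assms(3)] Hom_word[OF assms(2) w(1) assms(3)] w(2)
        circle_value_cong[OF w(1) assms(5)] by simp
  next
    case False
    then show ?thesis using assms(1,2) by (simp add: Hom_def extensional_def)
  qed
qed

text \<open>Von Dyck's theorem for the circle: an element is written as a word \<open>W g\<close>,
  and the quotient of two words for the same element is a consequence of the relators, so the value
  does not depend on the word.\<close>

lemma Hom_extend:
  assumes B: "B \<subseteq> carrier G" "generate G B = carrier G"
    and pres: "\<forall>w\<in>lists (B \<times> UNIV). word_value G w = \<one> \<longrightarrow> word_eq B R w []"
    and \<xi>: "\<And>g. g \<in> B \<Longrightarrow> \<xi> g \<in> carrier (circ N)" "\<And>r. r \<in> R \<Longrightarrow> circle_value \<xi> r = 1"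
  shows "\<exists>\<phi>\<in>Hom G (circ N). \<forall>g\<in>B. \<phi> g = \<xi> g"
proof -
  define W where "W g = (SOME w. w \<in> lists (B \<times> UNIV) \<and> word_value G w = g)" for g
  have W: "W g \<in> lists (B \<times> UNIV)" "word_value G (W g) = g" if "g \<in> carrier G" for g
  proof -
    have "\<exists>w. w \<in> lists (B \<times> UNIV) \<and> word_value G w = g" using generate_word[OF B(1)] B(2) that by blast
    from someI_ex[OF this] show "W g \<in> lists (B \<times> UNIV)" "word_value G (W g) = g" by (simp_all add: W_def)
  qed
  have \<xi>1: "cmod (\<xi> g) = 1" if "g \<in> B" for g using \<xi>(1)[OF that] by (simp add: circ_simps)
  have eq: "circle_value \<xi> v = circle_value \<xi> w"
    if vw: "v \<in> lists (B \<times> UNIV)" "w \<in> lists (B \<times> UNIV)" "word_value G v = word_value G w" for v w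
  proof -
    have l: "v @ word_inv w \<in> lists (B \<times> UNIV)" using vw(1) word_inv_lists[OF vw(2)] by simp
    have "word_value G (v @ word_inv w) = \<one>"
      using word_value_append[OF vw(1) word_inv_lists[OF vw(2)] B(1)] word_value_inv[OF vw(2) B(1)] vw(3)
        word_value_closed[OF vw(2) B(1)] by simp
    then have "word_eq B R (v @ word_inv w) []" using pres l by blast
    from word_eq_sound[OF this \<xi>1 \<xi>(2)] have "circle_value \<xi> v * cnj (circle_value \<xi> w) = 1"
      by (simp add: circle_value_append circle_value_inv)
    moreover have "circle_value \<xi> w * cnj (circle_value \<xi> w) = 1"
      using circle_value_closed[OF vw(2) \<xi>(1)] by (intro mult_cnj_1) (simp add: circ_simps)
    ultimately show ?thesis by (metis mult.assoc mult.commute mult.right_neutral)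
  qed
  define \<phi> where "\<phi> = restrict (\<lambda>g. circle_value \<xi> (W g)) (carrier G)"
  have \<phi>: "\<phi> g = circle_value \<xi> (W g)" if "g \<in> carrier G" for g using that by (simp add: \<phi>_def)
  have "\<phi> (g \<otimes> h) = \<phi> g * \<phi> h" if gh: "g \<in> carrier G" "h \<in> carrier G" for g h
  proof -
    have "circle_value \<xi> (W (g \<otimes> h)) = circle_value \<xi> (W g @ W h)"
      by (rule eq) (use W gh word_value_append[OF _ _ B(1)] in auto)
    then show ?thesis using gh \<phi> by (simp add: circle_value_append)
  qed
  moreover have "\<phi> g \<in> carrier (circ N)" if "g \<in> carrier G" for g
    using circle_value_closed[OF W(1)[OF that] \<xi>(1)] \<phi>[OF that] by simp
  ultimately have "\<phi> \<in> Hom G (circ N)"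
    unfolding Hom_def hom_def by (auto simp: circ_simps(2) \<phi>_def)
  moreover have "\<phi> g = \<xi> g" if g: "g \<in> B" for g
  proof -
    have gc: "g \<in> carrier G" using B(1) g by blast
    have "circle_value \<xi> (W g) = circle_value \<xi> [(g, True)]" by (rule eq) (use W gc g in auto)
    then show ?thesis using \<phi>[OF gc] by simp
  qed
  ultimately show ?thesis by blast
qed

end

section \<open>Charts on spaces of homomorphisms\<close>

lemma hom_chart_circle: "hom_chart circle_chart gs = (2 * length gs, \<lambda>\<phi>. tup (length gs) (\<lambda>j. \<phi> (gs ! j)))"
proof -
  have "snd (hom_chart circle_chart gs) \<phi> i = tup (length gs) (\<lambda>j. \<phi> (gs ! j)) i" for \<phi> i
    by (simp add: hom_chart_def circle_chart_def tup_def mult.commute even_iff_mod_2_eq_zero)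
  then have "snd (hom_chart circle_chart gs) = (\<lambda>\<phi>. tup (length gs) (\<lambda>j. \<phi> (gs ! j)))" by blast
  moreover have "fst (hom_chart circle_chart gs) = 2 * length gs" by (simp add: hom_chart_def circle_chart_def)
  ultimately show ?thesis by (simp add: prod_eq_iff)
qed

text \<open>The chart topology is pulled back along the chart, hence is the one of the image. The
  form as a quotient map is chosen for composition with orbit maps.\<close>

lemma chart_quotient: "quotient_map (chart_topology c A) (top_of_set (snd c ` A)) (snd c)"
proof -
  have o: "openin (chart_topology c A) {x \<in> A. snd c x \<in> U} \<longleftrightarrow> openin (top_of_set (snd c ` A)) U"
    if U: "U \<subseteq> snd c ` A" for U
  proof
    assume "openin (chart_topology c A) {x \<in> A. snd c x \<in> U}"
    then obtain V where V: "open V" "{x \<in> A. snd c x \<in> U} = snd c -` V \<inter> A"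
      unfolding chart_topology_def openin_pullback_topology by auto
    have "U = snd c ` A \<inter> V" using V(2) U by blast
    then show "openin (top_of_set (snd c ` A)) U" using V(1) unfolding openin_open by blast
  next
    assume "openin (top_of_set (snd c ` A)) U"
    then obtain V where V: "open V" "U = snd c ` A \<inter> V" unfolding openin_open by blast
    have "{x \<in> A. snd c x \<in> U} = snd c -` V \<inter> A" using V(2) by blast
    then show "openin (chart_topology c A) {x \<in> A. snd c x \<in> U}"
      unfolding chart_topology_def openin_pullback_topology using V(1) by (metis open_openin)
  qed
  have t: "topspace (chart_topology c A) = A" by (simp add: chart_topology_def topspace_pullback_topology)
  show ?thesis unfolding quotient_map_def t using o by simp
qed

text \<open>Composition with \<open>\<kappa>\<close> and with its inverse exchanges the two sets of
  homomorphisms while the chart coordinates stay the same.\<close>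

lemma hom_chart_iso:
  assumes \<kappa>: "\<kappa> \<in> iso H K" and c: "fst c' = fst c" "\<And>x. x \<in> carrier H \<Longrightarrow> snd c' x = snd c (\<kappa> x)"
    and gs: "set gs \<subseteq> carrier \<Gamma>" and G: "group H" "group \<Gamma>"
  shows "snd (hom_chart c' gs) ` Hom \<Gamma> H = snd (hom_chart c gs) ` Hom \<Gamma> K"
proof -
  have eq: "snd (hom_chart c' gs) \<psi> = snd (hom_chart c gs) \<phi>"
    if h: "\<And>g. g \<in> carrier \<Gamma> \<Longrightarrow> \<psi> g \<in> carrier H \<and> \<phi> g = \<kappa> (\<psi> g)" for \<psi> \<phi>
  proof
    fix i show "snd (hom_chart c' gs) \<psi> i = snd (hom_chart c gs) \<phi> i"
    proof (cases "i < length gs * fst c")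
      case True
      then have "i div fst c < length gs" by (simp add: less_mult_imp_div_less)
      then have g: "gs ! (i div fst c) \<in> carrier \<Gamma>" using gs by auto
      show ?thesis using True c(2) h[OF g] by (simp add: hom_chart_def c(1))
    qed (simp add: hom_chart_def c(1))
  qed
  interpret \<Gamma>: group \<Gamma> by fact
  have comp: "restrict (\<theta> \<circ> \<psi>) (carrier \<Gamma>) \<in> Hom \<Gamma> K'" if h: "\<psi> \<in> Hom \<Gamma> H'" "\<theta> \<in> hom H' K'"
    for \<theta> :: "'x \<Rightarrow> 'y" and \<psi> and H' K'
    using h by (auto simp: Hom_def hom_def Pi_iff)
  have \<kappa>': "inv_into (carrier H) \<kappa> \<in> hom K H" "\<kappa> \<in> hom H K" "bij_betw \<kappa> (carrier H) (carrier K)"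
    using group.iso_set_sym[OF G(1) \<kappa>] \<kappa> by (auto simp: iso_def)
  show ?thesis
  proof (intro equalityI image_subsetI)
    fix \<psi> assume p: "\<psi> \<in> Hom \<Gamma> H"
    have "snd (hom_chart c' gs) \<psi> = snd (hom_chart c gs) (restrict (\<kappa> \<circ> \<psi>) (carrier \<Gamma>))"
      by (rule eq) (use p in \<open>auto simp: Hom_def hom_def\<close>)
    then show "snd (hom_chart c' gs) \<psi> \<in> snd (hom_chart c gs) ` Hom \<Gamma> K" using comp[OF p \<kappa>'(2)] by blast
  next
    fix \<phi> assume p: "\<phi> \<in> Hom \<Gamma> K"
    have "inv_into (carrier H) \<kappa> y \<in> carrier H \<and> y = \<kappa> (inv_into (carrier H) \<kappa> y)" if "y \<in> carrier K" for y
      using that \<kappa>'(3) by (metis bij_betw_imp_surj_on f_inv_into_f inv_into_into)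
    then have "snd (hom_chart c' gs) (restrict (inv_into (carrier H) \<kappa> \<circ> \<phi>) (carrier \<Gamma>)) = snd (hom_chart c gs) \<phi>"
      by (intro eq) (use p in \<open>auto simp: Hom_def hom_def\<close>)
    then show "snd (hom_chart c gs) \<phi> \<in> snd (hom_chart c' gs) ` Hom \<Gamma> H"
      using comp[OF p \<kappa>'(1)] by (metis imageI)
  qed
qed

lemma cyclic_iso:
  assumes "N > 0"
  shows "(\<lambda>k. cis (2 * pi * of_int k / of_nat N)) \<in> iso (integer_mod_group N) (circ N)"
proof -
  let ?k = "\<lambda>k::int. cis (2 * pi * of_int k / of_nat N)"
  have car: "carrier (integer_mod_group N) = {0..<int N}" using assms by (simp add: carrier_integer_mod_group)
  have add: "?k (x + y) = ?k x * ?k y" for x y by (simp add: cis_mult ring_distribs add_divide_distrib)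
  have mod: "?k (x mod int N) = ?k x" for x
  proof -
    have "x = x mod int N + int N * (x div int N)" by simp
    then have "?k x = ?k (x mod int N) * ?k (int N * (x div int N))" using add by metis
    moreover have "?k (int N * (x div int N)) = 1"
      using cis_multiple_2pi[of "of_int (x div int N)"] assms by (simp add: mult.assoc)
    ultimately show ?thesis by simp
  qed
  have b: "bij_betw (\<lambda>k. cis (2 * pi * real k / real N)) {..<N} {z. z ^ N = 1}"
    using Complex.bij_betw_roots_unity[of N] assms by simp
  have n: "bij_betw nat {0..<int N} {..<N}"
    by (rule bij_betwI[where g = int]) auto
  have "bij_betw ((\<lambda>k. cis (2 * pi * real k / real N)) \<circ> nat) {0..<int N} {z. z ^ N = 1}"
    by (rule bij_betw_trans[OF n b])
  moreover have "((\<lambda>k. cis (2 * pi * real k / real N)) \<circ> nat) k = ?k k" if "k \<in> {0..<int N}" for k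
    using that by simp
  ultimately have bij: "bij_betw ?k {0..<int N} {z. z ^ N = 1}" using bij_betw_cong by (metis (no_types, lifting))
  moreover have "{z::complex. z ^ N = 1} = carrier (circ N)"
    using assms by (auto simp: circ_simps dest: power_eq_1_iff)
  ultimately have bij: "bij_betw ?k (carrier (integer_mod_group N)) (carrier (circ N))" unfolding car by simp
  have "?k \<in> hom (integer_mod_group N) (circ N)"
    unfolding hom_def using bij_betwE[OF bij] mod add
    by (simp add: circ_simps(2) mult_integer_mod_group)
  then show ?thesis using bij by (simp add: iso_def)
qed

text \<open>\<open>cyclic_chart\<close> is the circle chart transported along
  \<open>cyclic_iso\<close>, so the two descriptions agree for every generating list.\<close>

lemma chi_Hom_cyclic:
  assumes "N > 0" "group \<Gamma>"
  shows "chi_Hom S \<Gamma> (integer_mod_group N) (cyclic_chart N) = chi_Hom S \<Gamma> (circ N) circle_chart"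
proof -
  have "chi S (hom_chart (cyclic_chart N) gs) (Hom \<Gamma> (integer_mod_group N)) =
      chi S (hom_chart circle_chart gs) (Hom \<Gamma> (circ N))" if "generating_list \<Gamma> gs" for gs
  proof -
    have "snd (hom_chart (cyclic_chart N) gs) ` Hom \<Gamma> (integer_mod_group N) =
        snd (hom_chart circle_chart gs) ` Hom \<Gamma> (circ N)"
      by (rule hom_chart_iso[OF cyclic_iso[OF assms(1)]])
        (use that assms in \<open>auto simp: cyclic_chart_def circle_chart_def generating_list_def group_integer_mod_group\<close>)
    then show ?thesis by (simp add: chi_def hom_chart_def cyclic_chart_def circle_chart_def)
  qed
  then have "(\<lambda>e. \<exists>gs. generating_list \<Gamma> gs \<and>
        e = chi S (hom_chart (cyclic_chart N) gs) (Hom \<Gamma> (integer_mod_group N))) =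
      (\<lambda>e. \<exists>gs. generating_list \<Gamma> gs \<and> e = chi S (hom_chart circle_chart gs) (Hom \<Gamma> (circ N)))"
    by (intro ext ex_cong1 conj_cong HOL.refl) (simp only:)
  then show ?thesis unfolding chi_Hom_def by (rule arg_cong)
qed

context o_minimal_structure
begin

lemma CDef_ent: "CDef (\<lambda>z. ent z j)" unfolding ent_def by (rule CDef_var)

lemma Dmap_tup: assumes "\<And>j. j < r \<Longrightarrow> CDef (F j)" shows "Dmap (\<lambda>z. tup r (\<lambda>j. F j z))"
  unfolding Dmap_def
proof
  fix i show "DefT (\<lambda>z. tup r (\<lambda>j. F j z) i)"
  proof (cases "i < 2 * r")
    case True
    then have "i div 2 < r" by auto
    from assms[OF this] show ?thesis using True by (cases "even i") (simp_all add: tup_def CDef_def)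
  qed (simp add: tup_def DefT_const)
qed

lemma CDef_circle_value: assumes "\<And>g. CDef (F g)" shows "CDef (\<lambda>z. circle_value (\<lambda>g. F g z) w)"
proof (induction w)
  case (Cons l w)
  then show ?case using assms by (cases "snd l") (auto intro!: CDef_mult CDef_cnj)
qed (simp add: CDef_const)

text \<open>Two orbit maps have the same fibres, namely the orbits, and both become definable maps
  of the chart coordinates; \<open>euler_char_equiv\<close> then gives uniqueness of the described
  number.\<close>

lemma chi_orbits_eqI:
  assumes om: "orbit_model S c A G act k Y p" and A: "definable S c A"
  shows "chi_orbits S c A G act = euler_char S k Y"
  unfolding chi_orbits_def
proof (rule the_equality)
  show "\<exists>k' Y' p'. orbit_model S c A G act k' Y' p' \<and> euler_char S k Y = euler_char S k' Y'" using om by blast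
next
  fix e assume "\<exists>k Y p. orbit_model S c A G act k Y p \<and> e = euler_char S k Y"
  then obtain k' Y' p' where om': "orbit_model S c A G act k' Y' p'" and e: "e = euler_char S k' Y'" by blast
  have B: "snd c ` A \<in> S (fst c)" and inj: "inj_on (snd c) A" using A by (auto simp: definable_def)
  have t: "topspace (chart_topology c A) = A" by (simp add: chart_topology_def topspace_pullback_topology)
  have *: "\<exists>P. Dmap P \<and> (\<forall>x\<in>A. p x = P (snd c x)) \<and> P ` (snd c ` A) = Y \<and> Y \<subseteq> Rn k"
    if om: "orbit_model S c A G act k Y p" for k Y p
  proof -
    have Y: "p ` A = Y" "Y \<subseteq> Rn k" using om t definable_subset
      by (auto simp: orbit_model_def quotient_map_def)
    have G: "(\<lambda>x. join (fst c) (snd c x) (p x)) ` A \<in> S (fst c + k)" using om by (simp add: orbit_model_def)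
    have "snd c x \<in> Rn (fst c)" "p x \<in> Rn k" if "x \<in> A" for x
      using that B definable_subset Y by blast+
    from graph_Dmap[OF G this(1) inj this(2)] obtain P where P: "Dmap P" "\<forall>x\<in>A. p x = P (snd c x)" by blast
    then have "P ` (snd c ` A) = Y" using Y(1) by force
    then show ?thesis using P Y by blast
  qed
  obtain P where P: "Dmap P" "\<forall>x\<in>A. p x = P (snd c x)" "P ` (snd c ` A) = Y" "Y \<subseteq> Rn k"
    using *[OF om] by blast
  obtain Q where Q: "Dmap Q" "\<forall>x\<in>A. p' x = Q (snd c x)" "Q ` (snd c ` A) = Y'" "Y' \<subseteq> Rn k'"
    using *[OF om'] by blast
  have "\<forall>x\<in>A. \<forall>y\<in>A. p x = p y \<longleftrightarrow> p' x = p' y" using om om' by (simp add: orbit_model_def)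
  then have "euler_char S k' (Q ` (snd c ` A)) = euler_char S k (P ` (snd c ` A))"
    by (intro euler_char_equiv[OF B Q(1) _ P(1)]) (use P Q in auto)
  then show "e = euler_char S k Y" using e P Q by simp
qed

text \<open>In terms of a finite generating set of the presentation the homomorphisms are the tuples
  that satisfy the relators. The entries of any other generating list are words in these generators,
  so its chart differs by a definable injection.\<close>

lemma Hom_charts:
  assumes "group \<Gamma>" "finitely_presented \<Gamma>"
  shows "\<exists>c. (\<exists>gs. generating_list \<Gamma> gs) \<and> (\<forall>gs. generating_list \<Gamma> gs \<longrightarrow>
    definable S (hom_chart circle_chart gs) (Hom \<Gamma> (circ N)) \<and> chi S (hom_chart circle_chart gs) (Hom \<Gamma> (circ N)) = c)"
proof -
  interpret \<Gamma>: group \<Gamma> by fact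
  obtain B R where B: "finite B" "B \<subseteq> carrier \<Gamma>" "generate \<Gamma> B = carrier \<Gamma>" and R: "finite R" "R \<subseteq> lists (B \<times> UNIV)"
    "\<forall>r\<in>R. word_value \<Gamma> r = \<one>\<^bsub>\<Gamma>\<^esub>" "\<forall>w\<in>lists (B \<times> UNIV). word_value \<Gamma> w = \<one>\<^bsub>\<Gamma>\<^esub> \<longrightarrow> word_eq B R w []"
    using assms(2) unfolding finitely_presented_def by blast
  obtain bs where bs: "set bs = B" "distinct bs" using finite_distinct_list[OF B(1)] by blast
  define r where "r = length bs"
  define idx where "idx g = (SOME j. j < r \<and> bs ! j = g)" for g
  have idx: "idx g < r" "bs ! idx g = g" if "g \<in> B" for g
    using someI_ex[of "\<lambda>j. j < r \<and> bs ! j = g"] that bs(1) by (auto simp: idx_def r_def in_set_conv_nth)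
  have bsB: "bs ! j \<in> B" if "j < r" for j using that bs(1) by (auto simp: r_def)
  have idx': "idx (bs ! j) = j" if "j < r" for j
    using idx[OF bsB[OF that]] that bs(2) by (auto simp: r_def nth_eq_iff_index_eq)
  define ch where "ch \<phi> = tup r (\<lambda>j. \<phi> (bs ! j))" for \<phi> :: "_ \<Rightarrow> complex"
  define \<xi> where "\<xi> z g = ent z (idx g)" for z g
  have \<xi>_ch: "\<xi> (ch \<phi>) g = \<phi> g" if "g \<in> B" for \<phi> g using idx[OF that] by (simp add: \<xi>_def ch_def ent_tup)
  define H where "H = Hom \<Gamma> (circ N)"
  \<comment> \<open>The modulus is prescribed separately, because the equation
    \<open>ent z j ^ N = 1\<close> is vacuous for \<open>N = 0\<close>. That nothing else is needed
    is \<open>Hom_extend\<close>.\<close>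
  define Z where "Z = {z \<in> Rn (2 * r). (\<forall>j<r. (cmod (ent z j))\<^sup>2 = 1 \<and> ent z j ^ N = 1) \<and> (\<forall>w\<in>R. circle_value (\<xi> z) w = 1)}"
  have CX: "CDef (\<lambda>z. circle_value (\<xi> z) w)" for w
    unfolding \<xi>_def by (rule CDef_circle_value[OF CDef_ent])
  have Z: "Z \<in> S (2 * r)"
    unfolding Z_def
    by (rule Def_set) (intro Def_conj Def_ball_less Def_finite_ball[OF R(1)] Def_eq Def_CDef_eq DefT_norm2 CDef_power CX
      CDef_ent CDef_const DefT_const)
  have ZH: "ch ` H = Z"
  proof (intro equalityI subsetI)
    fix z assume "z \<in> ch ` H"
    then obtain \<phi> where \<phi>: "\<phi> \<in> Hom \<Gamma> (circ N)" "z = ch \<phi>" by (auto simp: H_def)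
    have "\<phi> (bs ! j) \<in> carrier (circ N)" if "j < r" for j
      using \<phi>(1) bsB[OF that] B(2) by (auto simp: Hom_def hom_def)
    then have "(cmod (ent z j))\<^sup>2 = 1 \<and> ent z j ^ N = 1" if "j < r" for j
      using that by (simp add: \<phi>(2) ch_def ent_tup circ_simps)
    moreover have "circle_value (\<xi> z) w = 1" if "w \<in> R" for w
    proof -
      have w: "w \<in> lists (B \<times> UNIV)" using that R(2) by blast
      have "circle_value (\<xi> z) w = \<phi> (word_value \<Gamma> w)"
        unfolding \<Gamma>.Hom_word[OF \<phi>(1) w B(2)] by (rule circle_value_cong[OF w]) (simp add: \<phi>(2) \<xi>_ch)
      also have "\<dots> = \<phi> (word_value \<Gamma> [])" using R(3) that by simp
      also have "\<dots> = 1" using \<Gamma>.Hom_word[OF \<phi>(1) _ B(2), of "[]"] by simp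
      finally show ?thesis .
    qed
    ultimately show "z \<in> Z" unfolding Z_def using tup_Rn[of r] \<phi>(2) by (simp add: ch_def)
  next
    fix z assume z: "z \<in> Z"
    have "\<xi> z g \<in> carrier (circ N)" if "g \<in> B" for g
      using z idx(1)[OF that] by (auto simp: Z_def \<xi>_def circ_simps abs_square_eq_1)
    moreover have "circle_value (\<xi> z) w = 1" if "w \<in> R" for w using z that by (simp add: Z_def)
    ultimately have "\<exists>\<phi>\<in>Hom \<Gamma> (circ N). \<forall>g\<in>B. \<phi> g = \<xi> z g"
      by (rule \<Gamma>.Hom_extend[OF B(2,3) R(4), where \<xi> = "\<xi> z"])
    then obtain \<phi> where \<phi>: "\<phi> \<in> Hom \<Gamma> (circ N)" "\<forall>g\<in>B. \<phi> g = \<xi> z g" by (elim bexE)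
    have "ch \<phi> = tup r (ent z)"
      unfolding ch_def tup_eq_iff using \<phi>(2) bsB idx' by (simp add: \<xi>_def)
    also have "\<dots> = z" using z by (intro tup_ent) (simp add: Z_def)
    finally show "z \<in> ch ` H" using \<phi>(1) by (auto simp: H_def)
  qed
  have "definable S (hom_chart circle_chart gs) (Hom \<Gamma> (circ N)) \<and>
      chi S (hom_chart circle_chart gs) (Hom \<Gamma> (circ N)) = euler_char S (2 * r) Z"
    if gs: "generating_list \<Gamma> gs" for gs
  proof -
    have gc: "set gs \<subseteq> carrier \<Gamma>" "generate \<Gamma> (set gs) = carrier \<Gamma>" using gs by (auto simp: generating_list_def)
    have "\<exists>w\<in>lists (B \<times> UNIV). word_value \<Gamma> w = gs ! j" if "j < length gs" for j
      using that gc(1) B \<Gamma>.generate_word[OF B(2)] by (metis nth_mem subsetD)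
    then obtain W where W: "\<And>j. j < length gs \<Longrightarrow> W j \<in> lists (B \<times> UNIV) \<and> word_value \<Gamma> (W j) = gs ! j" by metis
    \<comment> \<open>Each entry of the list is a fixed word in the generators, so the change of
      chart is polynomial in real coordinates.\<close>
    define M where "M z = tup (length gs) (\<lambda>j. circle_value (\<xi> z) (W j))" for z
    let ?t = "\<lambda>\<phi>. tup (length gs) (\<lambda>j. \<phi> (gs ! j))"
    have M: "?t \<phi> = M (ch \<phi>)" if \<phi>: "\<phi> \<in> H" for \<phi>
      unfolding M_def tup_eq_iff
    proof (intro allI impI)
      fix j assume j: "j < length gs"
      note Wj = W[OF j, THEN conjunct1] W[OF j, THEN conjunct2]
      have "\<phi> (gs ! j) = circle_value \<phi> (W j)"
        using \<Gamma>.Hom_word[OF \<phi>[unfolded H_def] Wj(1) B(2)] Wj(2) by simp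
      also have "\<dots> = circle_value (\<xi> (ch \<phi>)) (W j)" by (rule circle_value_cong[OF Wj(1)]) (simp add: \<xi>_ch)
      finally show "\<phi> (gs ! j) = circle_value (\<xi> (ch \<phi>)) (W j)" .
    qed
    have inj: "inj_on ?t H"
    proof (rule inj_onI)
      fix \<phi> \<psi> assume h: "\<phi> \<in> H" "\<psi> \<in> H" "?t \<phi> = ?t \<psi>"
      then have "\<phi> g = \<psi> g" if "g \<in> set gs" for g using that by (auto simp: tup_eq_iff in_set_conv_nth)
      then show "\<phi> = \<psi>" using \<Gamma>.Hom_eqI[OF _ _ gc] h by (auto simp: H_def)
    qed
    have MZ: "?t ` H = M ` Z" unfolding ZH[THEN HOL.sym] image_image using M by simp
    have MD: "Dmap M" unfolding M_def by (rule Dmap_tup) (rule CX)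
    have MR: "M z \<in> Rn (2 * length gs)" for z unfolding M_def by (rule tup_Rn)
    have "inj_on M Z"
    proof (rule inj_onI)
      fix y z assume yz: "y \<in> Z" "z \<in> Z" "M y = M z"
      then obtain \<phi> \<psi> where \<phi>: "\<phi> \<in> H" "y = ch \<phi>" "\<psi> \<in> H" "z = ch \<psi>" unfolding ZH[THEN HOL.sym] by blast
      then show "y = z" using yz(3) M inj by (metis (no_types, lifting) inj_onD)
    qed
    then have "euler_char S (2 * length gs) (M ` Z) = euler_char S (2 * r) Z"
      by (intro euler_char_inj[OF Z MD]) (simp_all add: MR)
    moreover have "M ` Z \<in> S (2 * length gs)" by (rule image_definable[OF Z MD MR])
    ultimately show ?thesis using inj unfolding definable_def chi_def hom_chart_circle H_def[THEN HOL.sym]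
      by (simp add: MZ)
  qed
  moreover have "generating_list \<Gamma> bs" using bs B by (simp add: generating_list_def)
  ultimately show ?thesis by blast
qed

text \<open>Conjugation acts trivially, so the orbits are points and the chart itself is an orbit
  model.\<close>

lemma chi_Hom_orbits_circ:
  assumes "group \<Gamma>" "finitely_presented \<Gamma>"
  shows "chi_Hom_orbits S \<Gamma> (circ N) circle_chart = chi_Hom S \<Gamma> (circ N) circle_chart"
proof -
  let ?H = "Hom \<Gamma> (circ N)"
  have "chi_orbits S (hom_chart circle_chart gs) ?H (circ N) (conj_act \<Gamma> (circ N)) = chi S (hom_chart circle_chart gs) ?H"
    if gs: "generating_list \<Gamma> gs" for gs
  proof -
    let ?c = "hom_chart circle_chart gs"
    have D: "definable S ?c ?H" using Hom_charts[OF assms, of N] gs by blast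
    have B: "snd ?c ` ?H \<in> S (fst ?c)" and inj: "inj_on (snd ?c) ?H" using D by (auto simp: definable_def)
    have "(\<lambda>z. join (fst ?c) z z) ` (snd ?c ` ?H) \<in> S (fst ?c + fst ?c)"
      by (rule image_definable[OF B Dmap_join[OF Dmap_id Dmap_id]]) (use B definable_subset join_Rn in blast)
    then have J: "(\<lambda>x. join (fst ?c) (snd ?c x) (snd ?c x)) ` ?H \<in> S (fst ?c + fst ?c)" by (simp add: image_image)
    have ex: "\<exists>g. g \<in> carrier (circ N)" by (auto simp: circ_simps intro: exI[of _ 1])
    have "orbit_model S ?c ?H (circ N) (conj_act \<Gamma> (circ N)) (fst ?c) (snd ?c ` ?H) (snd ?c)"
      unfolding orbit_model_def
    proof (intro conjI ballI B J chart_quotient)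
      fix \<phi> \<psi> assume h: "\<phi> \<in> ?H" "\<psi> \<in> ?H"
      have "(\<exists>g\<in>carrier (circ N). conj_act \<Gamma> (circ N) g \<phi> = \<psi>) \<longleftrightarrow> \<phi> = \<psi>"
        using ex conj_act_trivial[OF h(1)] by metis
      then show "snd ?c \<phi> = snd ?c \<psi> \<longleftrightarrow> (\<exists>g\<in>carrier (circ N). conj_act \<Gamma> (circ N) g \<phi> = \<psi>)"
        using inj h by (metis inj_onD)
    qed
    from chi_orbits_eqI[OF this D] show ?thesis by (simp add: chi_def)
  qed
  then have "(\<lambda>e. \<exists>gs. generating_list \<Gamma> gs \<and>
        e = chi_orbits S (hom_chart circle_chart gs) ?H (circ N) (conj_act \<Gamma> (circ N))) =
      (\<lambda>e. \<exists>gs. generating_list \<Gamma> gs \<and> e = chi S (hom_chart circle_chart gs) ?H)"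
    by (intro ext ex_cong1 conj_cong HOL.refl) (simp only:)
  then show ?thesis unfolding chi_Hom_orbits_def chi_Hom_def by (rule arg_cong)
qed

end

section \<open>Diagonal circle actions\<close>

text \<open>Integer powers without division: a negative exponent is taken on the conjugate. The
  result is polynomial in real coordinates, multiplicative, defined at 0, and equal to
  \<open>powi\<close> on the circle.\<close>

definition pw :: "complex \<Rightarrow> int \<Rightarrow> complex" where
  "pw x k = (if k \<ge> 0 then x ^ nat k else cnj x ^ nat (- k))"

lemma pw_mult: "pw (x * y) k = pw x k * pw y k" by (simp add: pw_def power_mult_distrib)

lemma pw_eq_0: "pw x k = 0 \<longleftrightarrow> x = 0 \<and> k \<noteq> 0" by (auto simp: pw_def)

lemma norm_powi_1: "cmod w = 1 \<Longrightarrow> cmod (w powi k) = 1" by (simp add: norm_power_int)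

lemma pw_unit: assumes "cmod w = 1" shows "pw w k = w powi k"
proof -
  have "cnj w = inverse w" using mult_cnj_1[OF assms] by (metis inverse_unique)
  then show ?thesis by (simp add: pw_def power_int_def power_inverse)
qed

lemma cnj_unit: assumes "cmod w = 1" shows "pw (w powi m) k = w powi (m * k)"
  using pw_unit[OF norm_powi_1[OF assms]] by (simp add: power_int_mult)

definition act :: "nat \<Rightarrow> (nat \<Rightarrow> int) \<Rightarrow> complex \<Rightarrow> (nat \<Rightarrow> real) \<Rightarrow> nat \<Rightarrow> real" where
  "act n b w z = tup n (\<lambda>i. w powi b i * ent z i)"

lemma ent_act: "i < n \<Longrightarrow> ent (act n b w z) i = w powi b i * ent z i" by (simp add: act_def ent_tup)

lemma act_Rn: "act n b w z \<in> Rn (2 * n)" by (simp add: act_def tup_Rn)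

lemma ent_eqI: assumes "z \<in> Rn (2 * n)" "z' \<in> Rn (2 * n)" "\<And>i. i < n \<Longrightarrow> ent z i = ent z' i" shows "z = z'"
  using tup_ent[OF assms(1)] tup_ent[OF assms(2)] tup_eq_iff[of n "ent z" "ent z'"] assms(3) by metis

lemma act_commute: "act n b w (act n a v z) = act n a v (act n b w z)"
  unfolding act_def tup_eq_iff by (simp add: ent_tup)

text \<open>The coordinates of \<open>Inv n a\<close> are invariant polynomials separating the orbits of the weight vector \<open>a\<close>.\<close>

definition inv_ent :: "(nat \<Rightarrow> int) \<Rightarrow> (nat \<Rightarrow> real) \<Rightarrow> nat \<Rightarrow> nat \<Rightarrow> complex" where
  "inv_ent a z i j =
     (if i = j then if a i = 0 then ent z i else of_real ((cmod (ent z i))\<^sup>2)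
      else pw (ent z i) (a j div gcd (a i) (a j)) * pw (ent z j) (- (a i div gcd (a i) (a j))))"

text \<open>The matrix of entries is stored row by row, entry \<open>i\<close>, \<open>j\<close> at
  position \<open>i * n + j\<close>.\<close>

definition Inv :: "nat \<Rightarrow> (nat \<Rightarrow> int) \<Rightarrow> (nat \<Rightarrow> real) \<Rightarrow> nat \<Rightarrow> real" where
  "Inv n a z = tup (n * n) (\<lambda>m. inv_ent a z (m div n) (m mod n))"

lemma Inv_Rn: "Inv n a z \<in> Rn (2 * (n * n))" by (simp add: Inv_def tup_Rn)

lemma pair_index: "i < n \<Longrightarrow> j < n \<Longrightarrow> i * n + j < n * (n::nat)"
proof -
  assume "i < n" "j < n"
  then have "i * n + j < Suc i * n" "Suc i * n \<le> n * n" by (simp, intro mult_right_mono) auto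
  then show ?thesis by linarith
qed

lemma ent_Inv: assumes "i < n" "j < n" shows "ent (Inv n a z) (i * n + j) = inv_ent a z i j"
  unfolding Inv_def using assms by (subst ent_tup[OF pair_index]) auto

lemma Inv_eq_iff: "Inv n a z = Inv n a z' \<longleftrightarrow> (\<forall>i<n. \<forall>j<n. inv_ent a z i j = inv_ent a z' i j)"
proof
  assume "Inv n a z = Inv n a z'"
  then show "\<forall>i<n. \<forall>j<n. inv_ent a z i j = inv_ent a z' i j" using ent_Inv by metis
next
  assume h: "\<forall>i<n. \<forall>j<n. inv_ent a z i j = inv_ent a z' i j"
  have "m div n < n \<and> m mod n < n" if "m < n * n" for m
  proof -
    have "n > 0" using that by (cases n) auto
    then show ?thesis using that by (simp add: less_mult_imp_div_less)
  qed
  then show "Inv n a z = Inv n a z'" unfolding Inv_def tup_eq_iff using h by blast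
qed

lemma gcd_cross: "(x::int) * (y div gcd x y) = y * (x div gcd x y)"
  by (metis div_mult_swap dvd_div_mult gcd_dvd1 gcd_dvd2 mult.commute)

text \<open>The two exponents of an off-diagonal entry contribute opposite characters: by
  \<open>gcd_cross\<close>, \<open>a i\<close> times the first quotient equals \<open>a j\<close>
  times the second.\<close>

lemma Inv_act: assumes w: "cmod w = 1" shows "Inv n a (act n a w z) = Inv n a z"
  unfolding Inv_eq_iff
proof (intro allI impI)
  fix i j assume ij: "i < n" "j < n"
  let ?g = "gcd (a i) (a j)"
  have w0: "w \<noteq> 0" using w by auto
  have "w powi (a i * (a j div ?g)) * w powi (a j * (- (a i div ?g))) = 1"
    using gcd_cross[of "a i" "a j"] w0 by (simp flip: power_int_add)
  moreover have "pw (w powi a i * ent z i) (a j div ?g) * pw (w powi a j * ent z j) (- (a i div ?g)) =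
      (w powi (a i * (a j div ?g)) * w powi (a j * (- (a i div ?g)))) *
      (pw (ent z i) (a j div ?g) * pw (ent z j) (- (a i div ?g)))"
    unfolding pw_mult cnj_unit[OF w] by (simp only: mult_ac)
  ultimately show "inv_ent a (act n a w z) i j = inv_ent a z i j"
    unfolding inv_ent_def ent_act[OF ij(1)] ent_act[OF ij(2)] by (simp add: norm_mult norm_powi_1[OF w])
qed

section \<open>Separation of orbits and isotropy groups\<close>

lemma bezout_finite: "finite J \<Longrightarrow> \<exists>s. (\<Sum>i\<in>J. s i * a i) = Gcd (a ` J)" for a :: "nat \<Rightarrow> int"
proof (induction J rule: finite_induct)
  case (insert k J)
  then obtain s where s: "(\<Sum>i\<in>J. s i * a i) = Gcd (a ` J)" by blast
  obtain u v where uv: "u * a k + v * Gcd (a ` J) = gcd (a k) (Gcd (a ` J))" using bezout_int by blast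
  let ?s = "\<lambda>i. if i = k then u else v * s i"
  have "(\<Sum>i\<in>J. ?s i * a i) = (\<Sum>i\<in>J. v * (s i * a i))" using insert.hyps by (intro sum.cong) auto
  then have "(\<Sum>i\<in>J. ?s i * a i) = v * (\<Sum>i\<in>J. s i * a i)" by (simp only: sum_distrib_left)
  then have "(\<Sum>i\<in>insert k J. ?s i * a i) = u * a k + v * Gcd (a ` J)" using insert.hyps s by simp
  then show ?case using uv by (intro exI[of _ ?s]) simp
qed simp

lemma powi_prod: "(\<Prod>i\<in>J. u i) powi k = (\<Prod>i\<in>J. u i powi k)" for u :: "nat \<Rightarrow> complex"
  by (induction J rule: infinite_finite_induct) (simp_all add: power_int_mult_distrib)

lemma powi_sum: "finite J \<Longrightarrow> x \<noteq> 0 \<Longrightarrow> x powi (\<Sum>i\<in>J. k i) = (\<Prod>i\<in>J. x powi k i)" for x :: complex and k :: "nat \<Rightarrow> int"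
  by (induction J rule: finite_induct) (simp_all add: power_int_add)

lemma unit_root: assumes "cmod v = 1" "(g::int) \<noteq> 0" shows "\<exists>w. cmod w = 1 \<and> w powi g = v"
proof -
  let ?w = "cis (Arg v / of_int g)"
  have "?w powi g = cis (Arg v)" using assms(2) by (simp add: cis_power_int)
  also have "\<dots> = v" using assms(1) by (metis rcis_cmod_Arg rcis_def mult_1 of_real_1)
  finally show ?thesis by (intro exI[of _ ?w]) simp
qed

text \<open>For Bezout coefficients \<open>s\<close> a solution must satisfy
  \<open>w powi ?g = v\<close>, where \<open>v\<close> is the product of the
  \<open>u i powi s i\<close>; any root of this equation works, because the pairwise relations
  recover each \<open>u k\<close> from \<open>v\<close>.\<close>

lemma solve_weights:
  fixes a :: "nat \<Rightarrow> int"
  assumes J: "finite J" "\<And>i. i \<in> J \<Longrightarrow> a i \<noteq> 0" and u: "\<And>i. i \<in> J \<Longrightarrow> cmod (u i) = 1"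
    and rel: "\<And>i j. i \<in> J \<Longrightarrow> j \<in> J \<Longrightarrow> u i powi (a j div gcd (a i) (a j)) = u j powi (a i div gcd (a i) (a j))"
  shows "\<exists>w. cmod w = 1 \<and> (\<forall>i\<in>J. w powi a i = u i)"
proof (cases "J = {}")
  case True then show ?thesis by (auto intro: exI[of _ 1])
next
  case False
  let ?g = "Gcd (a ` J)"
  have g0: "?g \<noteq> 0" using False J by auto
  obtain s where s: "(\<Sum>i\<in>J. s i * a i) = ?g" using bezout_finite[OF J(1)] by blast
  define v where "v = (\<Prod>i\<in>J. u i powi s i)"
  have "cmod v = 1" unfolding v_def prod_norm[THEN HOL.sym] by (rule prod.neutral) (simp add: u norm_powi_1)
  from unit_root[OF this g0] obtain w where w: "cmod w = 1" "w powi ?g = v" by blast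
  have "w powi a k = u k" if k: "k \<in> J" for k
  proof -
    have dv: "?g dvd a i" if "i \<in> J" for i using that by simp
    have u0: "u k \<noteq> 0" using u[OF k] by auto
    \<comment> \<open>The relation for a pair has exponents divided by the gcd of the pair; a
      further power by the quotient of that gcd by \<open>?g\<close> gives exponents divided by the
      total gcd.\<close>
    have sw: "u i powi (a k div ?g) = u k powi (a i div ?g)" if i: "i \<in> J" for i
    proof -
      let ?h = "gcd (a i) (a k)"
      have h: "?g dvd ?h" "?h dvd a i" "?h dvd a k" "?h \<noteq> 0" using dv[OF i] dv[OF k] J(2)[OF k] by auto
      have e: "x div ?g = (x div ?h) * (?h div ?g)" if "?h dvd x" for x
        using that h(1) by (metis div_mult_swap dvd_div_mult_self)
      show ?thesis unfolding e[OF h(2)] e[OF h(3)] power_int_mult rel[OF i k] ..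
    qed
    have "w powi a k = (w powi ?g) powi (a k div ?g)" using dv[OF k] by (simp flip: power_int_mult)
    also have "\<dots> = (\<Prod>i\<in>J. (u i powi s i) powi (a k div ?g))" unfolding w(2) v_def powi_prod ..
    also have "\<dots> = (\<Prod>i\<in>J. u k powi (s i * (a i div ?g)))"
    proof (rule prod.cong[OF HOL.refl])
      fix i assume i: "i \<in> J"
      have "(u i powi s i) powi (a k div ?g) = (u i powi (a k div ?g)) powi s i"
        by (simp add: mult.commute flip: power_int_mult)
      then show "(u i powi s i) powi (a k div ?g) = u k powi (s i * (a i div ?g))"
        unfolding sw[OF i] by (simp add: mult.commute flip: power_int_mult)
    qed
    also have "\<dots> = u k powi (\<Sum>i\<in>J. s i * (a i div ?g))" by (rule powi_sum[OF J(1) u0, THEN HOL.sym])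
    also have "(\<Sum>i\<in>J. s i * (a i div ?g)) = 1"
    proof -
      have "?g * (\<Sum>i\<in>J. s i * (a i div ?g)) = (\<Sum>i\<in>J. s i * a i)"
        unfolding sum_distrib_left by (rule sum.cong[OF HOL.refl]) (use dv in \<open>simp add: mult.left_commute\<close>)
      then show ?thesis using s g0 by simp
    qed
    finally show ?thesis by simp
  qed
  then show ?thesis using w(1) by blast
qed

text \<open>Diagonal entries fix weight-zero coordinates and all moduli, so on the support the
  ratios \<open>u i\<close> lie on the circle; off-diagonal entries give exactly the relations of
  \<open>solve_weights\<close>. Without division by the gcd these would hold only up to roots of
  unity.\<close>

lemma Inv_separates:
  assumes z: "z \<in> Rn (2 * n)" "z' \<in> Rn (2 * n)" and eq: "Inv n a z = Inv n a z'"
  shows "\<exists>w. cmod w = 1 \<and> act n a w z = z'"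
proof -
  have e: "inv_ent a z i j = inv_ent a z' i j" if "i < n" "j < n" for i j using eq that by (simp add: Inv_eq_iff)
  have e0: "ent z i = ent z' i" if "i < n" "a i = 0" for i using e[OF that(1,1)] that(2) by (simp add: inv_ent_def)
  have en: "cmod (ent z i) = cmod (ent z' i)" if i: "i < n" for i
  proof (cases "a i = 0")
    case False
    then have "(cmod (ent z i))\<^sup>2 = (cmod (ent z' i))\<^sup>2"
      using e[OF i i] unfolding inv_ent_def by (simp only: if_True if_False simp_thms of_real_eq_iff)
    then show ?thesis by simp
  qed (simp add: e0[OF i])
  define J where "J = {i. i < n \<and> a i \<noteq> 0 \<and> ent z i \<noteq> 0}"
  define u where "u i = ent z' i / ent z i" for i
  have J: "i < n" "a i \<noteq> 0" "ent z i \<noteq> 0" if "i \<in> J" for i using that by (auto simp: J_def)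
  have u: "cmod (u i) = 1" if "i \<in> J" for i using J(3)[OF that] unfolding u_def norm_divide en[OF J(1)[OF that], THEN HOL.sym] by simp
  have uz: "ent z' i = u i * ent z i" if "i \<in> J" for i using J(3)[OF that] by (simp add: u_def)
  have rel: "u i powi (a j div gcd (a i) (a j)) = u j powi (a i div gcd (a i) (a j))" if ij: "i \<in> J" "j \<in> J" for i j
  proof (cases "i = j")
    case False
    let ?k = "a j div gcd (a i) (a j)" and ?l = "a i div gcd (a i) (a j)"
    have "pw (ent z i) ?k * pw (ent z j) (- ?l) = pw (ent z' i) ?k * pw (ent z' j) (- ?l)"
      using e[OF J(1)[OF ij(1)] J(1)[OF ij(2)]] False by (simp add: inv_ent_def)
    also have "\<dots> = (pw (u i) ?k * pw (u j) (- ?l)) * (pw (ent z i) ?k * pw (ent z j) (- ?l))"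
      unfolding uz[OF ij(1)] uz[OF ij(2)] pw_mult by (simp only: mult_ac)
    finally have "pw (u i) ?k * pw (u j) (- ?l) = 1" using J(3)[OF ij(1)] J(3)[OF ij(2)] by (simp add: pw_eq_0)
    then have "u i powi ?k * inverse (u j powi ?l) = 1"
      unfolding pw_unit[OF u[OF ij(1)]] pw_unit[OF u[OF ij(2)]] power_int_minus .
    moreover have "u j powi ?l \<noteq> 0" using norm_powi_1[OF u[OF ij(2)], of ?l] norm_zero zero_neq_one by metis
    ultimately show ?thesis by (simp add: field_simps)
  qed simp
  have "finite J" by (simp add: J_def)
  from solve_weights[where J = J and a = a and u = u, OF this J(2) u rel] obtain w where w: "cmod w = 1" "\<forall>i\<in>J. w powi a i = u i" by blast
  have "act n a w z = z'"
  proof (rule ent_eqI[OF act_Rn z(2)])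
    fix i assume i: "i < n"
    show "ent (act n a w z) i = ent z' i"
    proof (cases "i \<in> J")
      case True then show ?thesis using w(2) uz i by (simp add: ent_act)
    next
      case False
      then consider "a i = 0" | "ent z i = 0" using i by (auto simp: J_def)
      then show ?thesis using e0[OF i] en[OF i] i by cases (simp_all add: ent_act)
    qed
  qed
  then show ?thesis using w(1) by blast
qed

lemma Inv_eq_iff_orbit:
  assumes "z \<in> Rn (2 * n)" "z' \<in> Rn (2 * n)"
  shows "Inv n a z = Inv n a z' \<longleftrightarrow> (\<exists>w. cmod w = 1 \<and> act n a w z = z')"
  using Inv_separates[OF assms] Inv_act by metis

text \<open>The equations \<open>w powi a i = 1\<close> over the support combine, by Bezout, into
  one equation for the gcd of the weights. If all these weights vanish, the gcd is 0 and the
  condition \<open>w ^ 0 = 1\<close> is vacuous, as it should be.\<close>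

lemma fixed_iff:
  assumes z: "z \<in> Rn (2 * n)" and w: "cmod w = 1"
  shows "act n a w z = z \<longleftrightarrow> w ^ nat (Gcd (a ` {i. i < n \<and> ent z i \<noteq> 0})) = 1"
proof -
  let ?J = "{i. i < n \<and> ent z i \<noteq> 0}"
  let ?g = "Gcd (a ` ?J)"
  have w0: "w \<noteq> 0" using w by auto
  have "act n a w z = z \<longleftrightarrow> (\<forall>i<n. w powi a i * ent z i = ent z i)"
    using ent_eqI[OF act_Rn z] ent_act by metis
  also have "\<dots> \<longleftrightarrow> (\<forall>i\<in>?J. w powi a i = 1)" by auto
  also have "\<dots> \<longleftrightarrow> w powi ?g = 1"
  proof
    assume h: "\<forall>i\<in>?J. w powi a i = 1"
    obtain s where s: "(\<Sum>i\<in>?J. s i * a i) = ?g" using bezout_finite[of ?J a] by auto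
    have "w powi ?g = (\<Prod>i\<in>?J. w powi (s i * a i))" unfolding s[THEN HOL.sym] by (rule powi_sum[OF _ w0]) simp
    also have "\<dots> = 1"
    proof (rule prod.neutral, rule ballI)
      fix i assume "i \<in> ?J"
      then have "(w powi a i) powi s i = 1" using h by simp
      then show "w powi (s i * a i) = 1" by (simp add: mult.commute power_int_mult)
    qed
    finally show "w powi ?g = 1" .
  next
    assume h: "w powi ?g = 1"
    show "\<forall>i\<in>?J. w powi a i = 1"
    proof
      fix i assume "i \<in> ?J"
      then have "?g dvd a i" by simp
      then have "w powi a i = (w powi ?g) powi (a i div ?g)" by (simp flip: power_int_mult)
      then show "w powi a i = 1" using h by simp
    qed
  qed
  finally show ?thesis by (simp add: power_int_def)
qed

section \<open>Continuity and properness of the invariant map\<close>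

lemma continuous_ent: "continuous_on UNIV (\<lambda>z. ent z j)"
  unfolding ent_def Complex_eq by (intro continuous_intros continuous_on_product_coordinates)

lemma continuous_pw: "continuous_on UNIV F \<Longrightarrow> continuous_on UNIV (\<lambda>z::nat \<Rightarrow> real. pw (F z) k)"
  unfolding pw_def by (cases "k \<ge> 0") (auto intro!: continuous_intros)

lemma continuous_Inv: "continuous_on UNIV (Inv n a)"
proof (rule continuous_on_coordinatewise_then_product)
  fix i
  have c: "continuous_on UNIV (\<lambda>z. inv_ent a z k l)" for k l
    unfolding inv_ent_def by (cases "k = l"; cases "a k = 0") (auto intro!: continuous_intros continuous_ent continuous_pw)
  show "continuous_on UNIV (\<lambda>z. Inv n a z i)"
    unfolding Inv_def tup_def by (cases "i < 2 * (n * n)"; cases "even i") (auto intro!: continuous_intros c)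
qed

text \<open>The diagonal invariant of the index controls the coordinate: directly for weight 0, and
  otherwise through the estimate of a number \<open>t\<close> by \<open>1 + t * t\<close>.\<close>

lemma Inv_bound:
  assumes z: "z \<in> Rn (2 * n)"
  shows "\<bar>z m\<bar> \<le> (if m < 2 * n then 1 + \<bar>Inv n a z (2 * ((m div 2) * n + m div 2))\<bar> + \<bar>Inv n a z (Suc (2 * ((m div 2) * n + m div 2)))\<bar> else 0)"
proof (cases "m < 2 * n")
  case True
  let ?i = "m div 2"
  have i: "?i < n" using True by auto
  let ?y = "Inv n a z" and ?q = "?i * n + ?i"
  have y: "inv_ent a z ?i ?i = Complex (?y (2 * ?q)) (?y (Suc (2 * ?q)))" using ent_Inv[OF i i, of a z] by (simp add: ent_def)
  have m: "z m = Re (ent z ?i) \<or> z m = Im (ent z ?i)"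
    by (cases "even m") (auto simp: ent_def elim!: oddE evenE)
  have "\<bar>z m\<bar> \<le> cmod (ent z ?i)" using m abs_Re_le_cmod abs_Im_le_cmod by metis
  also have "\<dots> \<le> 1 + \<bar>?y (2 * ?q)\<bar> + \<bar>?y (Suc (2 * ?q))\<bar>"
  proof (cases "a ?i = 0")
    case True
    then have "ent z ?i = Complex (?y (2 * ?q)) (?y (Suc (2 * ?q)))" using y by (simp add: inv_ent_def)
    then show ?thesis using cmod_le[of "ent z ?i"] by simp
  next
    case False
    then have "(cmod (ent z ?i))\<^sup>2 = ?y (2 * ?q)" using y unfolding inv_ent_def by (metis Re_complex_of_real complex.sel(1))
    moreover have "cmod (ent z ?i) \<le> 1 + (cmod (ent z ?i))\<^sup>2"
      using sum_squares_bound[of 1 "cmod (ent z ?i)"] norm_ge_zero[of "ent z ?i"] by (simp, linarith)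
    ultimately show ?thesis by linarith
  qed
  finally show ?thesis using True by simp
qed (use z in \<open>simp add: Rn_def\<close>)

text \<open>Tychonoff's theorem; in the application \<open>K\<close> vanishes beyond the dimension,
  so that limits stay in \<open>Rn (2 * n)\<close>.\<close>

lemma compact_box: "compact {z::nat \<Rightarrow> real. \<forall>m. \<bar>z m\<bar> \<le> K m}"
proof -
  have "compactin (product_topology (\<lambda>i. euclidean) UNIV) (PiE UNIV (\<lambda>m. {- K m..K m}))"
    unfolding compactin_PiE by (simp add: compactin_euclidean_iff)
  moreover have "PiE UNIV (\<lambda>m. {- K m..K m}) = {z. \<forall>m. \<bar>z m\<bar> \<le> K m}" by (auto simp: abs_le_iff PiE_UNIV_domain Pi_iff minus_le_iff)
  ultimately show ?thesis by (simp add: euclidean_product_topology compactin_euclidean_iff)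
qed

lemma coordinate_limit: "X \<longlonglongrightarrow> (x :: nat \<Rightarrow> real) \<Longrightarrow> (\<lambda>k. X k m) \<longlonglongrightarrow> x m"
  using continuous_on_tendsto_compose[OF continuous_on_product_coordinates[of m], of X x] by simp

text \<open>Compactness of the orbits: \<open>Inv\<close> is proper, because it controls the moduli of the coordinates.\<close>

lemma Inv_quotient:
  assumes A: "A \<subseteq> Rn (2 * n)" and inv: "\<And>w z. cmod w = 1 \<Longrightarrow> z \<in> A \<Longrightarrow> act n a w z \<in> A"
  shows "quotient_map (top_of_set A) (top_of_set (Inv n a ` A)) (Inv n a)"
  unfolding quotient_map_closedin
proof (intro conjI allI impI)
  show "Inv n a ` topspace (top_of_set A) = topspace (top_of_set (Inv n a ` A))" by simp
  fix U assume U: "U \<subseteq> topspace (top_of_set (Inv n a ` A))"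
  let ?C = "{x \<in> topspace (top_of_set A). Inv n a x \<in> U}"
  show "closedin (top_of_set A) ?C = closedin (top_of_set (Inv n a ` A)) U"
  proof
    assume "closedin (top_of_set (Inv n a ` A)) U"
    then obtain V where V: "closed V" "U = Inv n a ` A \<inter> V" unfolding closedin_closed by blast
    have "closed (Inv n a -` V)" by (rule closed_vimage[OF V(1) continuous_Inv])
    moreover have "?C = A \<inter> Inv n a -` V" using V(2) by auto
    ultimately show "closedin (top_of_set A) ?C" unfolding closedin_closed by blast
  next
    assume C: "closedin (top_of_set A) ?C"
    then obtain V where V: "closed V" "?C = A \<inter> V" unfolding closedin_closed by blast
    \<comment> \<open>Closedness is tested with sequences: preimages of a convergent sequence of
      invariants stay in a box, where a subsequence converges.\<close>
    have "y \<in> U" if y: "y \<in> Inv n a ` A" "y \<in> closure U" for y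
    proof -
      obtain Y where Y: "\<And>k. Y k \<in> U" "y \<in> Inv n a ` A" "Y \<longlonglongrightarrow> y" using y unfolding closure_sequential by blast
      have "Y k \<in> Inv n a ` A" for k using Y(1)[of k] U by (simp add: subsetD)
      then have "\<exists>x. x \<in> A \<and> Inv n a x = Y k" for k by (metis imageE)
      then obtain X where X: "\<And>k. X k \<in> A" "\<And>k. Inv n a (X k) = Y k" by metis
      have "\<exists>M. \<forall>k. \<bar>Y k m\<bar> \<le> M" for m
        using convergent_imp_Bseq[OF convergentI[OF coordinate_limit[OF Y(3), of m]]] by (auto simp: Bseq_def)
      then obtain M where M: "\<And>m k. \<bar>Y k m\<bar> \<le> M m" by metis
      define K where "K m = (if m < 2 * n then 1 + M (2 * ((m div 2) * n + m div 2)) + M (Suc (2 * ((m div 2) * n + m div 2))) else 0)" for m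
      have "\<bar>X k m\<bar> \<le> K m" for k m
        using Inv_bound[of "X k" n m a] A X(1)[of k] M[of k "2 * ((m div 2) * n + m div 2)"]
          M[of k "Suc (2 * ((m div 2) * n + m div 2))"] unfolding X(2) K_def by (cases "m < 2 * n") auto
      then have all: "\<forall>k. X k \<in> {z. \<forall>m. \<bar>z m\<bar> \<le> K m}" by blast
      have c: "seq_compact {z. \<forall>m. \<bar>z m\<bar> \<le> K m}" by (rule compact_imp_seq_compact[OF compact_box])
      obtain x r where x: "x \<in> {z. \<forall>m. \<bar>z m\<bar> \<le> K m}" "strict_mono (r :: nat \<Rightarrow> nat)" "(X \<circ> r) \<longlonglongrightarrow> x"
        by (rule seq_compactE[OF c all])
      have xR: "x \<in> Rn (2 * n)"
        unfolding Rn_def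
      proof (intro CollectI allI impI)
        fix m assume "2 * n \<le> m"
        moreover have "\<bar>x m\<bar> \<le> K m" using x(1) by blast
        ultimately show "x m = 0" by (simp add: K_def)
      qed
      have "(\<lambda>k. Inv n a ((X \<circ> r) k)) \<longlonglongrightarrow> Inv n a x"
        using continuous_on_tendsto_compose[OF continuous_Inv x(3)] by simp
      moreover have "(\<lambda>k. Inv n a ((X \<circ> r) k)) = Y \<circ> r" by (auto simp: X(2))
      moreover have "(Y \<circ> r) \<longlonglongrightarrow> y" by (rule LIMSEQ_subseq_LIMSEQ[OF Y(3) x(2)])
      ultimately have ix: "Inv n a x = y" using LIMSEQ_unique by metis
      obtain x0 where x0: "x0 \<in> A" "Inv n a x0 = y" using Y(2) by blast
      have "Inv n a x0 = Inv n a x" by (simp only: x0(2) ix)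
      \<comment> \<open>\<open>A\<close> is not assumed closed; the limit \<open>x\<close> lies in
        it because it is on the orbit of the point \<open>x0\<close> of the invariant set
        \<open>A\<close>.\<close>
      from Inv_separates[OF subsetD[OF A x0(1)] xR this] obtain w where "cmod w = 1" "act n a w x0 = x" by blast
      then have xA: "x \<in> A" using inv[OF _ x0(1)] by blast
      have "\<forall>k. (X \<circ> r) k \<in> ?C" using X Y(1) by simp
      then have "\<And>k. (X \<circ> r) k \<in> V" using V(2) by blast
      from closed_sequentially[OF V(1) this x(3)] have "x \<in> ?C" using xA V(2) by blast
      then show "y \<in> U" using ix by simp
    qed
    then have "U = Inv n a ` A \<inter> closure U" using U closure_subset[of U] by auto
    then show "closedin (top_of_set (Inv n a ` A)) U" unfolding closedin_closed using closed_closure by blast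
  qed
qed

context o_minimal_structure
begin

lemma CDef_pw: "CDef F \<Longrightarrow> CDef (\<lambda>z. pw (F z) k)"
  unfolding pw_def by (cases "k \<ge> 0") (auto intro: CDef_power CDef_cnj)

lemma Dmap_Inv: "Dmap (Inv n a)"
proof -
  have "CDef (\<lambda>z. inv_ent a z k l)" for k l
    unfolding inv_ent_def
    by (cases "k = l"; cases "a k = 0") (auto intro!: CDef_ent CDef_mult CDef_pw CDef_of_real DefT_norm2 simp flip: of_real_power)
  then show ?thesis unfolding Inv_def by (rule Dmap_tup)
qed

lemma Dmap_act: "Dmap (act n b w)"
  unfolding act_def by (rule Dmap_tup) (intro CDef_mult CDef_const CDef_ent)

text \<open>A second circle acts on the quotient, and the coordinate \<open>h\<close> below winds around the origin along it.\<close>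

lemma euler_char_Inv_zero:
  assumes B: "B \<in> S (2 * n)" and ij: "i < n" "j < n" and nz: "\<And>z. z \<in> B \<Longrightarrow> ent z i \<noteq> 0 \<and> ent z j \<noteq> 0"
    and b: "b i * a j - b j * a i \<noteq> 0" and inv: "\<And>w z. cmod w = 1 \<Longrightarrow> z \<in> B \<Longrightarrow> act n b w z \<in> B"
  shows "euler_char S (2 * (n * n)) (Inv n a ` B) = 0"
proof -
  let ?m = "2 * (n * n)"
  have BR: "z \<in> Rn (2 * n)" if "z \<in> B" for z using that B definable_subset by blast
  \<comment> \<open>Under a weight vector \<open>c\<close> this monomial has weight
    \<open>c i * a j - c j * a i\<close>. That is 0 for \<open>c = a\<close>, so \<open>h\<close>
    descends to the quotient, and nonzero for \<open>c = b\<close>.\<close>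
  define h where "h z = pw (ent z i) (a j) * pw (ent z j) (- a i)" for z
  \<comment> \<open>Appending \<open>h\<close> changes the image only by a definable bijection, but
    makes \<open>h\<close> a projection to coordinates of the image.\<close>
  define T where "T z = join ?m (Inv n a z) (cpair (h z))" for z
  have hD: "CDef h" unfolding h_def by (intro CDef_mult CDef_pw CDef_ent)
  have TD: "Dmap T" unfolding T_def by (rule Dmap_join[OF Dmap_Inv Dmap_cpair[OF hD]])
  have TR: "T z \<in> Rn (?m + 2)" for z unfolding T_def by (rule join_Rn[OF Inv_Rn cpair_Rn])
  have h_act: "h (act n c w z) = w powi (c i * a j - c j * a i) * h z" if w: "cmod w = 1" for c w z
  proof -
    have w0: "w \<noteq> 0" using w by auto
    have "h (act n c w z) = (w powi (c i * a j) * w powi (c j * (- a i))) * h z"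
      unfolding h_def ent_act[OF ij(1)] ent_act[OF ij(2)] pw_mult cnj_unit[OF w] by (simp only: mult_ac)
    then show ?thesis using w0 by (simp flip: power_int_add)
  qed
  have h_Inv: "h z = h z'" if z: "z \<in> B" "z' \<in> B" "Inv n a z = Inv n a z'" for z z'
  proof -
    obtain w where w: "cmod w = 1" "act n a w z = z'" using Inv_separates[OF BR[OF z(1)] BR[OF z(2)] z(3)] by blast
    show ?thesis using h_act[OF w(1), of a z] w(2) by (simp add: mult.commute)
  qed
  have T_iff: "T z = T z' \<longleftrightarrow> Inv n a z = Inv n a z'" if "z \<in> B" "z' \<in> B" for z z'
    using h_Inv[OF that] join_inject[OF Inv_Rn Inv_Rn] unfolding T_def by metis
  have h0: "cmod (h z) > 0" if "z \<in> B" for z using nz[OF that] by (simp add: h_def pw_eq_0)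
  define C where "C = T ` B"
  have C: "C \<in> S (?m + 2)" unfolding C_def by (rule image_definable[OF B TD TR])
  define hc where "hc t = Complex (t ?m) (t (Suc ?m))" for t :: "nat \<Rightarrow> real"
  have hc: "hc (T z) = h z" for z by (simp add: hc_def T_def join_def cpair_def)
  have hcD: "CDef hc" unfolding hc_def by (rule CDef_var)
  \<comment> \<open>The squared modulus stands for the modulus because it is polynomial.\<close>
  define P where "P t = (\<lambda>k::nat. if k = 0 then (cmod (hc t))\<^sup>2 else 0)" for t
  have PD: "Dmap P"
    unfolding Dmap_def
  proof
    fix k show "DefT (\<lambda>z. P z k)" unfolding P_def by (cases "k = 0") (simp_all add: DefT_norm2[OF hcD] DefT_const)
  qed
  have PR: "P t \<in> Rn 1" for t by (simp add: P_def Rn_def)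
  let ?D = "\<lambda>v. {z \<in> B. h z = v}"
  have D: "?D v \<in> S (2 * n)" for v by (rule definable_Collect[OF B Def_CDef_eq[OF hD CDef_const]])
  \<comment> \<open>A root of \<open>v' / v\<close> on the second circle rotates one level set of
    \<open>h\<close> onto the other; since the two actions commute, this induces a bijection of the
    orbits.\<close>
  have fib: "euler_char S (?m + 2) (T ` ?D v) = euler_char S (?m + 2) (T ` ?D v')"
    if v: "cmod v = cmod v'" "cmod v' > 0" for v v'
  proof -
    have "cmod (v' / v) = 1" using v by (simp add: norm_divide)
    from unit_root[OF this b] obtain w where w: "cmod w = 1" "w powi (b i * a j - b j * a i) = v' / v" by blast
    have w': "cmod (inverse w) = 1" using w by (simp add: norm_inverse)
    have v0: "v \<noteq> 0" "v' \<noteq> 0" using v by auto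
    have w0: "w \<noteq> 0" using w(1) by auto
    have aa: "act n b (inverse w) (act n b w z) = z" "act n b w (act n b (inverse w) z) = z" if "z \<in> B" for z
      by (rule ent_eqI[OF act_Rn BR[OF that]], simp add: ent_act power_int_inverse w0)+
    have "act n b w ` ?D v = ?D v'"
    proof (intro equalityI subsetI)
      fix z assume "z \<in> act n b w ` ?D v"
      then show "z \<in> ?D v'" using inv[OF w(1)] h_act[OF w(1)] w(2) v0 by auto
    next
      fix z assume z: "z \<in> ?D v'"
      have "h (act n b (inverse w) z) = inverse (v' / v) * v'"
        using h_act[OF w', of b z] z w(2) by (simp add: power_int_inverse)
      then have "act n b (inverse w) z \<in> ?D v" using inv[OF w'] z v0 by simp
      then show "z \<in> act n b w ` ?D v" using aa(2)[of z] z by force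
    qed
    then have "T ` ?D v' = (\<lambda>z. T (act n b w z)) ` ?D v" by (metis image_image)
    moreover have "euler_char S (?m + 2) ((\<lambda>z. T (act n b w z)) ` ?D v) = euler_char S (?m + 2) (T ` ?D v)"
    proof (rule euler_char_equiv[OF D Dmap_comp[OF TD Dmap_act] TR TD TR])
      fix z z' assume z: "z \<in> ?D v" "z' \<in> ?D v"
      then have zB: "z \<in> B" "z' \<in> B" "act n b w z \<in> B" "act n b w z' \<in> B" using inv[OF w(1)] by auto
      have "Inv n a (act n b w z) = Inv n a (act n b w z') \<longleftrightarrow> Inv n a z = Inv n a z'"
        unfolding Inv_eq_iff_orbit[OF BR[OF zB(3)] BR[OF zB(4)]] Inv_eq_iff_orbit[OF BR[OF zB(1)] BR[OF zB(2)]]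
        using aa(1)[OF zB(1)] aa(1)[OF zB(2)] act_commute by metis
      then show "T (act n b w z) = T (act n b w z') \<longleftrightarrow> T z = T z'"
        unfolding T_iff[OF zB(1,2)] T_iff[OF zB(3,4)] .
    qed
    ultimately show ?thesis by simp
  qed
  have PC: "P ` C \<in> S 1" by (rule image_definable[OF C PD PR])
  have "euler_char S (?m + 2) {t \<in> C. P t = y} = 0" if y: "y \<in> P ` C" for y
  proof -
    obtain z0 where z0: "z0 \<in> B" "y = P (T z0)" using y by (auto simp: C_def)
    define r where "r = cmod (h z0)"
    have r: "r > 0" unfolding r_def by (rule h0[OF z0(1)])
    let ?F = "{t \<in> C. P t = y}"
    have P_iff: "P t = y \<longleftrightarrow> cmod (hc t) = r" for t
    proof
      assume "P t = y"
      then have "P t 0 = P (T z0) 0" by (simp only: z0(2))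
      then have "(cmod (hc t))\<^sup>2 = r\<^sup>2" by (simp only: P_def hc r_def if_True simp_thms)
      then show "cmod (hc t) = r" using r by simp
    next
      assume "cmod (hc t) = r"
      then have "cmod (hc t) = cmod (hc (T z0))" by (simp only: r_def hc)
      then show "P t = y" by (simp only: z0(2) P_def)
    qed
    have "Def (\<lambda>t. P t \<in> {y})"
      by (rule Def_mem[OF single_definable]) (use PD PR z0 in \<open>auto simp: Dmap_def\<close>)
    then have F: "?F \<in> S (?m + 2)" using definable_Collect[OF C] by simp
    have "euler_char S (?m + 2) ?F = euler_char S (?m + 2) (T ` ?D (of_real r)) * euler_char S 2 (cpair ` {h. cmod h = r})"
    proof (rule euler_char_map[OF F Dmap_cpair[OF hcD] euler_char_circle(1)[OF r]])
      show "cpair (hc t) \<in> cpair ` {h. cmod h = r}" if "t \<in> ?F" for t using that P_iff by auto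
      fix q assume "q \<in> cpair ` {h. cmod h = r}"
      then obtain v where v: "cmod v = r" "q = cpair v" by auto
      have "{t \<in> ?F. cpair (hc t) = q} = T ` ?D v"
        using v by (auto simp: C_def cpair_inject P_iff hc)
      then show "euler_char S (?m + 2) {t \<in> ?F. cpair (hc t) = q} = euler_char S (?m + 2) (T ` ?D (of_real r))"
        using fib[of v "of_real r"] v(1) r by simp
    qed
    then show ?thesis using euler_char_circle(2)[OF r] by simp
  qed
  from euler_char_map[OF C PD PC _ this] have "euler_char S (?m + 2) C = 0" by simp
  moreover have "euler_char S ?m (Inv n a ` B) = euler_char S (?m + 2) (T ` B)"
    by (rule euler_char_equiv[OF B Dmap_Inv Inv_Rn TD TR]) (simp add: T_iff)
  ultimately show ?thesis by (simp add: C_def)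
qed

end

section \<open>The \<open>\<Gamma>\<close>-Euler characteristic\<close>

text \<open>Makes \<open>N\<close> recoverable from the group: there are \<open>N\<close> roots of
  unity, and the infinite circle has \<open>card\<close> equal to 0 by convention, in accordance
  with \<open>N = 0\<close>.\<close>

lemma card_circ: "card (carrier (circ N)) = N"
proof (cases "N = 0")
  case False
  have "carrier (circ N) = {z. z ^ N = 1}" using False by (auto simp: circ_simps dest: power_eq_1_iff)
  then show ?thesis using False card_roots_unity_eq[of N] by simp
next
  case True
  have "infinite (carrier (circ N))"
  proof
    assume f: "finite (carrier (circ N))"
    let ?k = "Suc (card (carrier (circ N)))"
    have "{z. z ^ ?k = 1} \<subseteq> carrier (circ N)" using True by (auto simp: circ_simps simp del: power_Suc dest: power_eq_1_iff)
    then have "card {z::complex. z ^ ?k = 1} \<le> card (carrier (circ N))" by (rule card_mono[OF f])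
    then show False using card_roots_unity_eq[of ?k] by simp
  qed
  then show ?thesis using True by simp
qed

lemma circ_iso_eq: assumes "top_group_iso c (circ N) (circ M)" shows "N = M"
proof -
  obtain f where "f \<in> iso (circ N) (circ M)" using assms unfolding top_group_iso_def by blast
  then have "bij_betw f (carrier (circ N)) (carrier (circ M))" by (simp add: iso_def)
  from bij_betw_same_card[OF this] show ?thesis by (simp add: card_circ)
qed

lemma top_group_iso_self: "top_group_iso c H H"
  unfolding top_group_iso_def using iso_set_refl[of H] homeomorphic_map_id by (metis eq_id_iff)

section \<open>The representation in weight coordinates\<close>

locale definable_circle_space = o_minimal_structure S + unitary_circle_rep sc herm \<rho>
  for S and sc :: "complex \<Rightarrow> 'v::ab_group_add \<Rightarrow> 'v" and herm \<rho> +
  fixes n e a X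
  assumes wb: "weight_basis sc \<rho> n e a" and defX: "definable S (vector_chart sc n e) X"
    and invX: "circle_invariant \<rho> X"
begin

definition \<iota> :: "'v \<Rightarrow> nat \<Rightarrow> real" where "\<iota> x = tup n (coord sc n e x)"

lemma chart: "vector_chart sc n e = (2 * n, \<iota>)"
  by (simp add: vector_chart_def \<iota>_def[abs_def] tup_def)

lemma ent_\<iota>: "i < n \<Longrightarrow> ent (\<iota> x) i = coord sc n e x i" by (simp add: \<iota>_def ent_tup)

lemma \<iota>_Rn: "\<iota> x \<in> Rn (2 * n)" by (simp add: \<iota>_def tup_Rn)

lemma basis: "inj_on e {..<n}" "independent (e ` {..<n})" "v \<in> span (e ` {..<n})"
  "cmod z = 1 \<Longrightarrow> i < n \<Longrightarrow> \<rho> z (e i) = sc (z powi a i) (e i)"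
  using wb by (auto simp: weight_basis_def)

lemma coord_expand: "(\<Sum>i<n. sc (coord sc n e x i) (e i)) = x"
proof -
  have "(\<Sum>b\<in>e ` {..<n}. sc (representation (e ` {..<n}) x b) b) = x"
    by (rule sum_representation_eq[OF basis(2,3)]) auto
  then show ?thesis unfolding sum.reindex[OF basis(1)] by (simp add: coord_def)
qed

lemma coord_scale: "coord sc n e (sc w x) i = w * coord sc n e x i"
  unfolding coord_def representation_scale[OF basis(2,3)] ..

lemma coord_sum: assumes "i < n" shows "coord sc n e (\<Sum>j<n. sc (c j) (e j)) i = c i"
proof -
  have "coord sc n e (\<Sum>j<n. sc (c j) (e j)) i = (\<Sum>j<n. coord sc n e (sc (c j) (e j)) i)"
    unfolding coord_def by (subst representation_sum[OF basis(2) basis(3)]) simp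
  also have "\<dots> = (\<Sum>j<n. if j = i then c i else 0)"
  proof (rule sum.cong[OF HOL.refl])
    fix j assume j: "j \<in> {..<n}"
    have "coord sc n e (e j) i = (if e i = e j then 1 else 0)"
      unfolding coord_def using representation_basis[OF basis(2), of "e j"] j by simp
    moreover have "e i = e j \<longleftrightarrow> i = j" using basis(1) j assms by (auto dest: inj_onD)
    ultimately show "coord sc n e (sc (c j) (e j)) i = (if j = i then c i else 0)" by (auto simp: coord_scale)
  qed
  also have "\<dots> = c i" using assms by simp
  finally show ?thesis .
qed

lemma \<iota>_inj: assumes "\<iota> x = \<iota> y" shows "x = y"
proof -
  have "coord sc n e x i = coord sc n e y i" if "i < n" for i using assms that by (metis ent_\<iota>)
  then have "(\<Sum>i<n. sc (coord sc n e x i) (e i)) = (\<Sum>i<n. sc (coord sc n e y i) (e i))" by (intro sum.cong) auto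
  then show ?thesis by (simp only: coord_expand)
qed

lemma \<iota>_scale: "\<iota> (sc w x) = act n (\<lambda>_. 1) w (\<iota> x)"
  by (rule ent_eqI[OF \<iota>_Rn act_Rn]) (simp add: ent_\<iota> ent_act coord_scale)

lemma \<iota>_rho: assumes w: "cmod w = 1" shows "\<iota> (\<rho> w x) = act n a w (\<iota> x)"
proof (rule ent_eqI[OF \<iota>_Rn act_Rn])
  fix i assume i: "i < n"
  have ws: "w \<in> sphere 0 1" using w by simp
  interpret L: Vector_Spaces.linear sc sc "\<rho> w" by (rule rho_linear[OF ws])
  have "\<rho> w x = \<rho> w (\<Sum>i<n. sc (coord sc n e x i) (e i))" by (simp only: coord_expand)
  also have "\<dots> = (\<Sum>i<n. sc (coord sc n e x i) (\<rho> w (e i)))" by (simp only: L.sum L.scale)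
  also have "\<dots> = (\<Sum>i<n. sc (w powi a i * coord sc n e x i) (e i))"
    by (rule sum.cong) (simp_all add: basis(4)[OF w] mult.commute)
  finally show "ent (\<iota> (\<rho> w x)) i = ent (act n a w (\<iota> x)) i"
    using i by (simp add: ent_\<iota> ent_act coord_sum)
qed

text \<open>Off \<open>I\<close> the coordinates of a point of the stratum vanish, so the sum over
  \<open>I\<close> is a sum over the whole basis and the action becomes diagonal, whatever the
  values of \<open>\<epsilon>\<close> outside \<open>I\<close>.\<close>

lemma \<iota>_weighted:
  assumes I: "I \<subseteq> {..<n}" and x: "x \<in> stratum sc n e I"
  shows "\<iota> (weighted_act sc n e I \<epsilon> w x) = act n \<epsilon> w (\<iota> x)"
proof (rule ent_eqI[OF \<iota>_Rn act_Rn])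
  fix i assume i: "i < n"
  have "weighted_act sc n e I \<epsilon> w x = (\<Sum>j<n. sc (w powi \<epsilon> j * coord sc n e x j) (e j))"
    unfolding weighted_act_def by (rule sum.mono_neutral_left) (use I x in \<open>auto simp: stratum_def\<close>)
  then show "ent (\<iota> (weighted_act sc n e I \<epsilon> w x)) i = ent (act n \<epsilon> w (\<iota> x)) i"
    using i by (simp add: ent_\<iota> ent_act coord_sum)
qed

lemma \<iota>X: "\<iota> ` X \<in> S (2 * n)" using defX by (simp add: definable_def chart)

lemma act_X: assumes "cmod w = 1" "x \<in> X" shows "act n a w (\<iota> x) \<in> \<iota> ` X"
  using invX assms \<iota>_rho[OF assms(1)] by (metis circle_invariant_def imageI mem_sphere_0)

definition supp :: "(nat \<Rightarrow> real) \<Rightarrow> nat set" where "supp z = {i. i < n \<and> ent z i \<noteq> 0}"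

text \<open>Order of the isotropy group on the stratum of \<open>I\<close>, with 0 standing for the
  whole circle; it is the parameter of \<open>circ\<close>.\<close>

definition isoN :: "nat set \<Rightarrow> nat" where "isoN I = nat (Gcd (a ` I))"

definition BI :: "nat set \<Rightarrow> (nat \<Rightarrow> real) set" where "BI I = {z \<in> \<iota> ` X. \<forall>i<n. (ent z i \<noteq> 0) = (i \<in> I)}"

lemma BI_S: "BI I \<in> S (2 * n)"
  unfolding BI_def
  by (rule definable_Collect[OF \<iota>X]) (intro Def_ball_less Def_iff Def_not Def_CDef_eq CDef_ent CDef_const Def_const)

lemma BI_stratum: assumes "I \<subseteq> {..<n}" shows "BI I = \<iota> ` (X \<inter> stratum sc n e I)"
proof -
  have "(\<forall>i<n. (ent (\<iota> x) i \<noteq> 0) = (i \<in> I)) \<longleftrightarrow> x \<in> stratum sc n e I" for x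
    using assms by (auto simp: stratum_def ent_\<iota>)
  then show ?thesis unfolding BI_def by blast
qed

lemma BI_iff: assumes "I \<subseteq> {..<n}" shows "z \<in> BI I \<longleftrightarrow> z \<in> \<iota> ` X \<and> supp z = I"
  using assms by (auto simp: BI_def supp_def)

lemma supp_act: "cmod w = 1 \<Longrightarrow> supp (act n a w z) = supp z"
proof -
  assume "cmod w = 1"
  then have nz: "w powi k \<noteq> 0" for k using norm_powi_1[of w k] norm_zero zero_neq_one by metis
  have "ent (act n a w z) i \<noteq> 0 \<longleftrightarrow> ent z i \<noteq> 0" if "i < n" for i
    unfolding ent_act[OF that] mult_eq_0_iff using nz[of "a i"] by simp
  then show ?thesis unfolding supp_def by (intro Collect_cong conj_cong HOL.refl)
qed

lemma isotropy_eq: "isotropy circle_group \<rho> x = circ (isoN (supp (\<iota> x)))"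
proof -
  have "\<rho> g x = x \<longleftrightarrow> g ^ isoN (supp (\<iota> x)) = 1" if g: "cmod g = 1" for g
  proof -
    have "\<rho> g x = x \<longleftrightarrow> \<iota> (\<rho> g x) = \<iota> x" using \<iota>_inj by metis
    then show ?thesis unfolding \<iota>_rho[OF g] fixed_iff[OF \<iota>_Rn g] isoN_def supp_def .
  qed
  then have "{g \<in> carrier circle_group. \<rho> g x = x} = {z \<in> sphere 0 1. z ^ isoN (supp (\<iota> x)) = 1}"
    by (auto simp: circle_group_def)
  then show ?thesis by (simp only: isotropy_def circ_def)
qed

lemma orbit_iff: "(\<exists>g\<in>carrier circle_group. \<rho> g x = y) \<longleftrightarrow> Inv n a (\<iota> x) = Inv n a (\<iota> y)"
proof -
  have "(\<exists>g\<in>carrier circle_group. \<rho> g x = y) \<longleftrightarrow> (\<exists>g. cmod g = 1 \<and> \<iota> (\<rho> g x) = \<iota> y)"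
  proof -
    have "(\<exists>g\<in>carrier circle_group. \<rho> g x = y) \<longleftrightarrow> (\<exists>g. cmod g = 1 \<and> \<rho> g x = y)"
      by (simp add: circle_group_def Bex_def)
    then show ?thesis using \<iota>_inj by metis
  qed
  also have "\<dots> \<longleftrightarrow> (\<exists>g. cmod g = 1 \<and> act n a g (\<iota> x) = \<iota> y)" using \<iota>_rho by metis
  finally show ?thesis unfolding Inv_eq_iff_orbit[OF \<iota>_Rn \<iota>_Rn] .
qed

text \<open>The invariants in chart coordinates realize the orbit space: their fibres are the orbits
  by \<open>orbit_iff\<close>, and properness gives the quotient topology through
  \<open>Inv_quotient\<close>.\<close>

lemma Inv_model:
  assumes A: "\<iota> ` A \<in> S (2 * n)" and inv: "\<And>w x. cmod w = 1 \<Longrightarrow> x \<in> A \<Longrightarrow> act n a w (\<iota> x) \<in> \<iota> ` A"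
  shows "orbit_model S (vector_chart sc n e) A circle_group \<rho> (2 * (n * n)) (Inv n a ` \<iota> ` A) (Inv n a \<circ> \<iota>)"
  unfolding orbit_model_def
proof (intro conjI ballI)
  show "Inv n a ` \<iota> ` A \<in> S (2 * (n * n))" by (rule image_definable[OF A Dmap_Inv Inv_Rn])
  have "(\<lambda>z. join (2 * n) z (Inv n a z)) ` \<iota> ` A \<in> S (2 * n + 2 * (n * n))"
    by (rule image_definable[OF A Dmap_join[OF Dmap_id Dmap_Inv]]) (use \<iota>_Rn Inv_Rn join_Rn in blast)
  then show "(\<lambda>x. join (fst (vector_chart sc n e)) (snd (vector_chart sc n e) x) ((Inv n a \<circ> \<iota>) x)) ` A
      \<in> S (fst (vector_chart sc n e) + 2 * (n * n))" by (simp add: chart image_image)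
  have "quotient_map (chart_topology (vector_chart sc n e) A) (top_of_set (\<iota> ` A)) \<iota>"
    using chart_quotient[of "vector_chart sc n e" A] by (simp add: chart)
  moreover have "quotient_map (top_of_set (\<iota> ` A)) (top_of_set (Inv n a ` \<iota> ` A)) (Inv n a)"
    by (rule Inv_quotient) (use \<iota>_Rn inv in auto)
  ultimately show "quotient_map (chart_topology (vector_chart sc n e) A) (top_of_set (Inv n a ` \<iota> ` A)) (Inv n a \<circ> \<iota>)"
    by (rule quotient_map_compose)
  show "((Inv n a \<circ> \<iota>) x = (Inv n a \<circ> \<iota>) y) = (\<exists>g\<in>carrier circle_group. \<rho> g x = y)" for x y
    by (simp add: orbit_iff)
qed

lemma chi_orbits_stratum:
  assumes I: "I \<subseteq> {..<n}"
  shows "chi_orbits S (vector_chart sc n e) (X \<inter> stratum sc n e I) circle_group \<rho> =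
    euler_char S (2 * (n * n)) (Inv n a ` BI I)"
  unfolding BI_stratum[OF I]
proof (rule chi_orbits_eqI[OF Inv_model])
  show A: "\<iota> ` (X \<inter> stratum sc n e I) \<in> S (2 * n)" using BI_S BI_stratum[OF I] by metis
  show "definable S (vector_chart sc n e) (X \<inter> stratum sc n e I)"
    unfolding definable_def chart using A \<iota>_inj by (auto intro: inj_onI)
  fix w x assume w: "cmod w = 1" and x: "x \<in> X \<inter> stratum sc n e I"
  then have "\<iota> x \<in> BI I" unfolding BI_stratum[OF I] by blast
  then have "act n a w (\<iota> x) \<in> BI I" using act_X[OF w] x supp_act[OF w] BI_iff[OF I] by blast
  then show "act n a w (\<iota> x) \<in> \<iota> ` (X \<inter> stratum sc n e I)" by (simp only: BI_stratum[OF I])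
qed

section \<open>The sum over a partition and its independence of choices\<close>

lemma Inv_supp:
  assumes "z \<in> \<iota> ` X" "z' \<in> \<iota> ` X" "Inv n a z = Inv n a z'" shows "supp z = supp z'"
  using assms \<iota>_Rn Inv_separates[of z n z' a] supp_act by (metis imageE)

text \<open>The condition inside the description in \<open>chi_Gamma\<close>, named so that its many
  parameters can be handled together.\<close>

definition groupoid_sum :: "('g, 'b) monoid_scheme \<Rightarrow> int \<Rightarrow> nat \<Rightarrow> (nat \<Rightarrow> real) set \<Rightarrow> ('v \<Rightarrow> nat \<Rightarrow> real) \<Rightarrow>
    (nat \<Rightarrow> real) set set \<Rightarrow> ((nat \<Rightarrow> real) set \<Rightarrow> 'v) \<Rightarrow> bool" where
  "groupoid_sum \<Gamma> c k Y p P r \<longleftrightarrow> orbit_model S (vector_chart sc n e) X circle_group \<rho> k Y p \<and>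
        finite P \<and> partition_on Y P \<and> P \<subseteq> S k \<and>
        (\<forall>C\<in>P. \<forall>x\<in>X. \<forall>y\<in>X. p x \<in> C \<longrightarrow> p y \<in> C \<longrightarrow>
           top_group_iso circle_chart (isotropy circle_group \<rho> x) (isotropy circle_group \<rho> y)) \<and>
        (\<forall>C\<in>P. r C \<in> X \<and> p (r C) \<in> C) \<and>
        c = (\<Sum>C\<in>P. euler_char S k C * chi_Hom_orbits S \<Gamma> (isotropy circle_group \<rho> (r C)) circle_chart)"

text \<open>An admissible partition is refined by the supports \<open>I\<close>. On a nonempty piece
  the isotropy groups of block and stratum agree, so after exchanging the sums over \<open>C\<close>
  and \<open>I\<close> the blocks within each stratum reassemble to the whole stratum.\<close>

lemma groupoid_sum_unique:
  assumes \<Gamma>: "group \<Gamma>" "finitely_presented \<Gamma>" and gs: "groupoid_sum \<Gamma> c k Y p P r"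
  shows "c = (\<Sum>I\<in>Pow {..<n}. euler_char S (2 * (n * n)) (Inv n a ` BI I) * chi_Hom S \<Gamma> (circ (isoN I)) circle_chart)"
proof -
  let ?c = "vector_chart sc n e" and ?m = "2 * (n * n)"
  have om: "orbit_model S ?c X circle_group \<rho> k Y p" and P: "finite P" "partition_on Y P" "P \<subseteq> S k"
    and iso: "\<And>C x y. C \<in> P \<Longrightarrow> x \<in> X \<Longrightarrow> y \<in> X \<Longrightarrow> p x \<in> C \<Longrightarrow> p y \<in> C \<Longrightarrow>
      top_group_iso circle_chart (isotropy circle_group \<rho> x) (isotropy circle_group \<rho> y)"
    and r: "\<And>C. C \<in> P \<Longrightarrow> r C \<in> X \<and> p (r C) \<in> C"
    and c: "c = (\<Sum>C\<in>P. euler_char S k C * chi_Hom_orbits S \<Gamma> (isotropy circle_group \<rho> (r C)) circle_chart)"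
    using gs unfolding groupoid_sum_def by auto
  have YS: "Y \<in> S k" and pG: "(\<lambda>x. join (2 * n) (\<iota> x) (p x)) ` X \<in> S (2 * n + k)"
    and pq: "quotient_map (chart_topology ?c X) (top_of_set Y) p"
    and po: "\<And>x y. x \<in> X \<Longrightarrow> y \<in> X \<Longrightarrow> p x = p y \<longleftrightarrow> Inv n a (\<iota> x) = Inv n a (\<iota> y)"
    using om unfolding orbit_model_def by (auto simp: chart orbit_iff)
  have YR: "Y \<subseteq> Rn k" by (rule definable_subset[OF YS])
  have "topspace (chart_topology ?c X) = X" by (simp add: chart_topology_def topspace_pullback_topology)
  then have pX: "p ` X = Y" using pq by (auto simp: quotient_map_def)
  have "inj_on \<iota> X" using \<iota>_inj by (auto intro: inj_onI)
  then obtain Q where Q: "Dmap Q" "\<forall>x\<in>X. p x = Q (\<iota> x)"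
    using graph_Dmap[OF pG \<iota>_Rn _] pX YR by blast
  \<comment> \<open>\<open>Q\<close> is known to take values in \<open>Rn k\<close> only on the
    chart image; truncation makes this global and keeps the values of \<open>p\<close>.\<close>
  define q where "q z = trunc k (Q z)" for z
  have qD: "Dmap q" unfolding q_def by (rule Dmap_trunc[OF Q(1)])
  have qR: "q z \<in> Rn k" for z by (simp add: q_def)
  have q: "q (\<iota> x) = p x" if "x \<in> X" for x
  proof -
    have "p x \<in> Rn k" using that pX YR by blast
    then show ?thesis using Q(2) that by (simp add: q_def trunc_Rn)
  qed
  have qI: "q z = q z' \<longleftrightarrow> Inv n a z = Inv n a z'" if "z \<in> \<iota> ` X" "z' \<in> \<iota> ` X" for z z'
    using that q po by auto
  \<comment> \<open>The common refinement is kept in the chart of \<open>X\<close>, from where it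
    can be mapped both to the given orbit model and to the model by invariants.\<close>
  define D where "D C I = {z \<in> BI I. q z \<in> C}" for C I
  have BX: "z \<in> \<iota> ` X" if "z \<in> BI I" for z I using that by (simp add: BI_def)
  have DS: "D C I \<in> S (2 * n)" if "C \<in> P" for C I
  proof -
    have "C \<in> S k" using that P(3) by blast
    then have "Def (\<lambda>z. q z \<in> C)" by (rule Def_mem) (use qD qR in \<open>auto simp: Dmap_def\<close>)
    then show ?thesis unfolding D_def by (rule definable_Collect[OF BI_S])
  qed
  have termC: "euler_char S k C * chi_Hom_orbits S \<Gamma> (isotropy circle_group \<rho> (r C)) circle_chart =
      (\<Sum>I\<in>Pow {..<n}. euler_char S ?m (Inv n a ` D C I) * chi_Hom S \<Gamma> (circ (isoN I)) circle_chart)"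
    if C: "C \<in> P" for C
  proof -
    let ?N = "isoN (supp (\<iota> (r C)))"
    have CY: "C \<subseteq> Y" using P(2) C by (auto simp: partition_on_def)
    have U: "(\<Union>I\<in>Pow {..<n}. q ` D C I) = C"
    proof (intro equalityI subsetI)
      fix y assume y: "y \<in> C"
      then obtain x where x: "x \<in> X" "y = p x" using CY pX by blast
      have sub: "supp (\<iota> x) \<subseteq> {..<n}" by (auto simp: supp_def)
      have "\<iota> x \<in> D C (supp (\<iota> x))" unfolding D_def using BI_iff[OF sub] x y q by simp
      then show "y \<in> (\<Union>I\<in>Pow {..<n}. q ` D C I)" using sub x q by (metis PowI UN_I imageI)
    qed (auto simp: D_def)
    have "euler_char S k (\<Union>I\<in>Pow {..<n}. q ` D C I) = (\<Sum>I\<in>Pow {..<n}. euler_char S k (q ` D C I))"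
    proof (rule euler_char_UN)
      show "q ` D C I \<in> S k" for I by (rule image_definable[OF DS[OF C] qD qR])
      fix I J assume IJ: "I \<in> Pow {..<n}" "J \<in> Pow {..<n}" "I \<noteq> J"
      show "q ` D C I \<inter> q ` D C J = {}"
      proof (rule ccontr)
        assume "q ` D C I \<inter> q ` D C J \<noteq> {}"
        then obtain z z' where z: "z \<in> BI I" "z' \<in> BI J" "q z = q z'" unfolding D_def by auto
        then have "supp z = supp z'" using Inv_supp[OF BX BX] qI[OF BX BX] by blast
        then show False using z BI_iff IJ by auto
      qed
    qed simp
    then have "euler_char S k C = (\<Sum>I\<in>Pow {..<n}. euler_char S ?m (Inv n a ` D C I))"
      unfolding U
    proof (rule HOL.trans)
      have "euler_char S k (q ` D C I) = euler_char S ?m (Inv n a ` D C I)" for I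
        by (rule euler_char_equiv[OF DS[OF C] qD qR Dmap_Inv Inv_Rn], rule qI) (auto simp: D_def BX)
      then show "(\<Sum>I\<in>Pow {..<n}. euler_char S k (q ` D C I)) = (\<Sum>I\<in>Pow {..<n}. euler_char S ?m (Inv n a ` D C I))"
        by simp
    qed
    moreover have "chi_Hom_orbits S \<Gamma> (isotropy circle_group \<rho> (r C)) circle_chart = chi_Hom S \<Gamma> (circ ?N) circle_chart"
      unfolding isotropy_eq by (rule chi_Hom_orbits_circ[OF \<Gamma>])
    \<comment> \<open>Within a block the isotropy groups are only isomorphic;
      \<open>circ_iso_eq\<close> turns this into equality of their orders. An empty piece
      contributes 0 on both sides.\<close>
    moreover have "euler_char S ?m (Inv n a ` D C I) * chi_Hom S \<Gamma> (circ ?N) circle_chart =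
        euler_char S ?m (Inv n a ` D C I) * chi_Hom S \<Gamma> (circ (isoN I)) circle_chart" if I: "I \<in> Pow {..<n}" for I
    proof (cases "D C I = {}")
      case True then show ?thesis by (simp add: euler_char_empty)
    next
      case False
      then obtain x where x: "x \<in> X" "\<iota> x \<in> BI I" "p x \<in> C" unfolding D_def using BX q by fastforce
      have "top_group_iso circle_chart (circ ?N) (circ (isoN (supp (\<iota> x))))"
        using iso[OF C _ x(1) _ x(3)] r[OF C] unfolding isotropy_eq by blast
      then have "?N = isoN I" using circ_iso_eq BI_iff x(2) I by (metis PowD)
      then show ?thesis by simp
    qed
    ultimately show ?thesis by (simp only: sum_distrib_right) (rule sum.cong[OF HOL.refl])
  qed
  have merge: "(\<Sum>C\<in>P. euler_char S ?m (Inv n a ` D C I)) = euler_char S ?m (Inv n a ` BI I)" for I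
  proof -
    have "(\<Union>C\<in>P. Inv n a ` D C I) = Inv n a ` BI I"
    proof (intro equalityI subsetI)
      fix y assume "y \<in> Inv n a ` BI I"
      then obtain z where z: "z \<in> BI I" "y = Inv n a z" by blast
      obtain x where x: "x \<in> X" "z = \<iota> x" using BX[OF z(1)] by blast
      have "p x \<in> \<Union>P" using P(2) pX x(1) by (auto simp: partition_on_def)
      then obtain C where C: "C \<in> P" "p x \<in> C" by blast
      have "q z \<in> C" unfolding x(2) q[OF x(1)] by (rule C(2))
      then have "z \<in> D C I" unfolding D_def using z(1) by simp
      then show "y \<in> (\<Union>C\<in>P. Inv n a ` D C I)" unfolding z(2) using C(1) by blast
    qed (auto simp: D_def)
    moreover have "euler_char S ?m (\<Union>C\<in>P. Inv n a ` D C I) = (\<Sum>C\<in>P. euler_char S ?m (Inv n a ` D C I))"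
    proof (rule euler_char_UN[OF P(1)])
      show "Inv n a ` D C I \<in> S ?m" if "C \<in> P" for C by (rule image_definable[OF DS[OF that] Dmap_Inv Inv_Rn])
      fix C C' assume C: "C \<in> P" "C' \<in> P" "C \<noteq> C'"
      then have dj: "C \<inter> C' = {}" using P(2) by (auto simp: partition_on_def disjoint_def)
      show "Inv n a ` D C I \<inter> Inv n a ` D C' I = {}"
      proof (rule ccontr)
        assume "Inv n a ` D C I \<inter> Inv n a ` D C' I \<noteq> {}"
        then obtain z z' where z: "z \<in> D C I" "z' \<in> D C' I" "Inv n a z = Inv n a z'" by auto
        then have "q z = q z'" using qI BX by (auto simp: D_def)
        then show False using z dj by (auto simp: D_def)
      qed
    qed
    ultimately show ?thesis by simp
  qed
  have "c = (\<Sum>C\<in>P. \<Sum>I\<in>Pow {..<n}. euler_char S ?m (Inv n a ` D C I) * chi_Hom S \<Gamma> (circ (isoN I)) circle_chart)"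
    unfolding c by (rule sum.cong[OF HOL.refl termC])
  also have "\<dots> = (\<Sum>I\<in>Pow {..<n}. \<Sum>C\<in>P. euler_char S ?m (Inv n a ` D C I) * chi_Hom S \<Gamma> (circ (isoN I)) circle_chart)"
    by (rule sum.swap)
  finally show ?thesis by (simp only: sum_distrib_right[THEN HOL.sym] merge)
qed

text \<open>The blocks are the images of the strata: the support is constant on orbits, hence they
  are disjoint. Empty images are removed because a partition has no empty block.\<close>

lemma groupoid_sum_exists: "\<exists>c k Y p P r. groupoid_sum \<Gamma> c k Y p P r"
proof -
  let ?p = "Inv n a \<circ> \<iota>"
  define P where "P = (\<lambda>I. Inv n a ` BI I) ` Pow {..<n} - {{}}"
  define r where "r C = (SOME x. x \<in> X \<and> ?p x \<in> C)" for C
  have BX: "z \<in> \<iota> ` X" if "z \<in> BI I" for z I using that by (simp add: BI_def)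
  have sub: "supp z \<subseteq> {..<n}" for z by (auto simp: supp_def)
  have key: "supp (\<iota> x) = I" if h: "x \<in> X" "?p x \<in> Inv n a ` BI I" "I \<subseteq> {..<n}" for x I
  proof -
    obtain z where z: "z \<in> BI I" "Inv n a (\<iota> x) = Inv n a z" using h(2) by auto
    have "supp (\<iota> x) = supp z" by (rule Inv_supp[OF _ BX[OF z(1)] z(2)]) (use h(1) in blast)
    then show ?thesis using z(1) BI_iff[OF h(3)] by blast
  qed
  have om: "orbit_model S (vector_chart sc n e) X circle_group \<rho> (2 * (n * n)) (Inv n a ` \<iota> ` X) ?p"
    by (rule Inv_model[OF \<iota>X act_X])
  have PE: "\<exists>I. I \<subseteq> {..<n} \<and> C = Inv n a ` BI I" if "C \<in> P" for C using that by (auto simp: P_def)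
  have r: "r C \<in> X \<and> ?p (r C) \<in> C" if C: "C \<in> P" for C
  proof -
    obtain I where I: "I \<subseteq> {..<n}" "C = Inv n a ` BI I" using PE[OF C] by blast
    have "C \<noteq> {}" using C by (simp add: P_def)
    then obtain z where "z \<in> BI I" using I by blast
    then obtain x where "x \<in> X" "\<iota> x \<in> BI I" using BX by blast
    then have "\<exists>x. x \<in> X \<and> ?p x \<in> C" using I(2) by auto
    from someI_ex[OF this] show ?thesis by (simp only: r_def)
  qed
  have "partition_on (Inv n a ` \<iota> ` X) P"
    unfolding partition_on_def disjoint_def
  proof (intro conjI ballI impI)
    show "\<Union>P = Inv n a ` \<iota> ` X"
    proof (intro equalityI subsetI)
      fix y assume "y \<in> Inv n a ` \<iota> ` X"
      then obtain x where x: "x \<in> X" "y = Inv n a (\<iota> x)" by blast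
      have "\<iota> x \<in> BI (supp (\<iota> x))" using BI_iff[OF sub] x(1) by blast
      then show "y \<in> \<Union>P" using x(2) sub by (auto simp: P_def)
    qed (use BX in \<open>auto simp: P_def\<close>)
    fix C C' assume C: "C \<in> P" "C' \<in> P" "C \<noteq> C'"
    obtain I J where IJ: "I \<subseteq> {..<n}" "C = Inv n a ` BI I" "J \<subseteq> {..<n}" "C' = Inv n a ` BI J"
      using PE[OF C(1)] PE[OF C(2)] by blast
    show "C \<inter> C' = {}"
    proof (rule ccontr)
      assume "C \<inter> C' \<noteq> {}"
      then obtain y where y: "y \<in> C" "y \<in> C'" by blast
      then obtain z where z: "z \<in> BI I" "y = Inv n a z" using IJ(2) by blast
      obtain x where x: "x \<in> X" "z = \<iota> x" using BX[OF z(1)] by blast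
      have "supp (\<iota> x) = I" "supp (\<iota> x) = J" using key[OF x(1) _ IJ(1)] key[OF x(1) _ IJ(3)] y IJ z x by auto
      then show False using C(3) IJ by blast
    qed
  qed (simp add: P_def)
  moreover have "top_group_iso circle_chart (isotropy circle_group \<rho> x) (isotropy circle_group \<rho> y)"
    if h: "C \<in> P" "x \<in> X" "y \<in> X" "?p x \<in> C" "?p y \<in> C" for C x y
  proof -
    obtain I where I: "I \<subseteq> {..<n}" "C = Inv n a ` BI I" using PE[OF h(1)] by blast
    have "supp (\<iota> x) = supp (\<iota> y)" using key[OF h(2) _ I(1)] key[OF h(3) _ I(1)] h(4,5) I(2) by blast
    then show ?thesis unfolding isotropy_eq by (simp add: top_group_iso_self)
  qed
  moreover have "P \<subseteq> S (2 * (n * n))" using image_definable[OF BI_S Dmap_Inv Inv_Rn] by (auto simp: P_def)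
  moreover have "finite P" by (simp add: P_def)
  ultimately have "groupoid_sum \<Gamma> (\<Sum>C\<in>P. euler_char S (2 * (n * n)) C * chi_Hom_orbits S \<Gamma> (isotropy circle_group \<rho> (r C)) circle_chart)
      (2 * (n * n)) (Inv n a ` \<iota> ` X) ?p P r"
    unfolding groupoid_sum_def using om r by blast
  then show ?thesis by blast
qed

lemma chi_Gamma_eq:
  assumes \<Gamma>: "group \<Gamma>" "finitely_presented \<Gamma>"
  shows "chi_Gamma S \<Gamma> circle_group circle_chart \<rho> (vector_chart sc n e) X =
    (\<Sum>I\<in>Pow {..<n}. euler_char S (2 * (n * n)) (Inv n a ` BI I) * chi_Hom S \<Gamma> (circ (isoN I)) circle_chart)"
    (is "_ = ?R")
proof -
  have "chi_Gamma S \<Gamma> circle_group circle_chart \<rho> (vector_chart sc n e) X =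
      (THE c. \<exists>k Y p P r. groupoid_sum \<Gamma> c k Y p P r)"
    unfolding chi_Gamma_def groupoid_sum_def ..
  also have "\<dots> = ?R"
  proof (rule the_equality)
    obtain c k Y p P r where g: "groupoid_sum \<Gamma> c k Y p P r" using groupoid_sum_exists[of \<Gamma>] by (elim exE)
    from g[unfolded groupoid_sum_unique[OF \<Gamma> g]] show "\<exists>k Y p P r. groupoid_sum \<Gamma> ?R k Y p P r" by (intro exI)
  next
    fix c assume "\<exists>k Y p P r. groupoid_sum \<Gamma> c k Y p P r"
    then show "c = ?R" by (elim exE) (rule groupoid_sum_unique[OF \<Gamma>])
  qed
  finally show ?thesis .
qed

text \<open>A point is fixed if its isotropy group is the whole circle, that is if the order code is
  0, and a gcd vanishes exactly when all its arguments do. The origin, with empty support, is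
  included.\<close>

lemma fixed_points_iff: "x \<in> fixed_points \<rho> \<longleftrightarrow> a ` supp (\<iota> x) \<subseteq> {0}"
proof -
  have "x \<in> fixed_points \<rho> \<longleftrightarrow> {g \<in> carrier circle_group. \<rho> g x = x} = carrier (circ 0)"
    by (auto simp: fixed_points_def circ_0 circle_group_def)
  also have "{g \<in> carrier circle_group. \<rho> g x = x} = carrier (circ (isoN (supp (\<iota> x))))"
    using arg_cong[OF isotropy_eq[of x], of carrier] by (simp add: isotropy_def)
  also have "carrier (circ (isoN (supp (\<iota> x)))) = carrier (circ 0) \<longleftrightarrow> isoN (supp (\<iota> x)) = 0"
    using card_circ by metis
  also have "\<dots> \<longleftrightarrow> Gcd (a ` supp (\<iota> x)) = 0"
  proof -
    have "Gcd (a ` supp (\<iota> x)) \<ge> 0" by simp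
    then show ?thesis unfolding isoN_def by linarith
  qed
  also have "\<dots> \<longleftrightarrow> a ` supp (\<iota> x) \<subseteq> {0}" by (rule Gcd_0_iff)
  finally show ?thesis .
qed

text \<open>The orbits of fixed points are single points, so \<open>Inv\<close> is injective on
  their union and preserves its Euler characteristic; additivity glues the strata.\<close>

lemma fixed_sum:
  "(\<Sum>I | I \<subseteq> {..<n} \<and> a ` I \<subseteq> {0}. euler_char S (2 * (n * n)) (Inv n a ` BI I)) =
    chi S (vector_chart sc n e) (X \<inter> fixed_points \<rho>)"
proof -
  let ?F = "{I. I \<subseteq> {..<n} \<and> a ` I \<subseteq> {0}}" and ?m = "2 * (n * n)"
  have fin: "finite ?F" by (rule finite_subset[of _ "Pow {..<n}"]) auto
  have BX: "z \<in> \<iota> ` X" if "z \<in> BI I" for z I using that by (simp add: BI_def)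
  have U: "(\<Union>I\<in>?F. BI I) = \<iota> ` (X \<inter> fixed_points \<rho>)"
  proof (intro equalityI subsetI)
    fix z assume "z \<in> (\<Union>I\<in>?F. BI I)"
    then obtain I where I: "I \<subseteq> {..<n}" "a ` I \<subseteq> {0}" "z \<in> BI I" by blast
    then show "z \<in> \<iota> ` (X \<inter> fixed_points \<rho>)" using BI_iff[OF I(1)] fixed_points_iff by auto
  next
    fix z assume "z \<in> \<iota> ` (X \<inter> fixed_points \<rho>)"
    then obtain x where x: "x \<in> X" "a ` supp (\<iota> x) \<subseteq> {0}" "z = \<iota> x" using fixed_points_iff by blast
    have sub: "supp (\<iota> x) \<subseteq> {..<n}" by (auto simp: supp_def)
    show "z \<in> (\<Union>I\<in>?F. BI I)" using BI_iff[OF sub] x sub by blast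
  qed
  have US: "(\<Union>I\<in>?F. BI I) \<in> S (2 * n)" by (rule definable_Union) (use fin BI_S in auto)
  have "euler_char S ?m (\<Union>I\<in>?F. Inv n a ` BI I) = (\<Sum>I\<in>?F. euler_char S ?m (Inv n a ` BI I))"
  proof (rule euler_char_UN[OF fin])
    show "Inv n a ` BI I \<in> S ?m" for I by (rule image_definable[OF BI_S Dmap_Inv Inv_Rn])
    fix I J assume IJ: "I \<in> ?F" "J \<in> ?F" "I \<noteq> J"
    show "Inv n a ` BI I \<inter> Inv n a ` BI J = {}"
    proof (rule ccontr)
      assume "Inv n a ` BI I \<inter> Inv n a ` BI J \<noteq> {}"
      then obtain z z' where z: "z \<in> BI I" "z' \<in> BI J" "Inv n a z = Inv n a z'" by auto
      then have "supp z = supp z'" using Inv_supp[OF BX BX] by blast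
      then show False using z BI_iff IJ by auto
    qed
  qed
  moreover have "euler_char S ?m (Inv n a ` (\<Union>I\<in>?F. BI I)) = euler_char S (2 * n) (\<Union>I\<in>?F. BI I)"
  proof (rule euler_char_inj[OF US Dmap_Inv Inv_Rn], rule inj_onI)
    fix z z' assume z: "z \<in> (\<Union>I\<in>?F. BI I)" "z' \<in> (\<Union>I\<in>?F. BI I)" "Inv n a z = Inv n a z'"
    obtain x x' where x: "z = \<iota> x" "x \<in> fixed_points \<rho>" "z' = \<iota> x'" using z(1,2) unfolding U by blast
    have "Inv n a (\<iota> x) = Inv n a (\<iota> x')" using z(3) x by simp
    then obtain g where g: "g \<in> carrier circle_group" "\<rho> g x = x'" using orbit_iff by blast
    have "\<rho> g x = x" using x(2) g(1) by (simp add: fixed_points_def circle_group_def)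
    then show "z = z'" using g x by simp
  qed
  ultimately show ?thesis unfolding chi_def chart fst_conv snd_conv U[THEN HOL.sym] image_UN by (simp only:)
qed

lemma BI_zero:
  assumes I: "I \<subseteq> {..<n}" and ij: "i \<in> I" "j \<in> I" and b: "b i * a j - b j * a i \<noteq> 0"
    and inv: "\<And>w z. cmod w = 1 \<Longrightarrow> z \<in> BI I \<Longrightarrow> act n b w z \<in> BI I"
  shows "euler_char S (2 * (n * n)) (Inv n a ` BI I) = 0"
  by (rule euler_char_Inv_zero[where i = i and j = j and b = b, OF BI_S _ _ _ b inv])
    (use I ij in \<open>auto simp: BI_def\<close>)

text \<open>Supports fall into those of weight zero, singletons of nonzero weight, and the rest. For
  each of the rest that meets \<open>X\<close>, the invariance assumptions supply a circle whose
  weights are not proportional to \<open>a\<close> on the support, so \<open>BI_zero\<close>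
  applies.\<close>

lemma chi_Gamma_formula:
  assumes \<Gamma>: "group \<Gamma>" "finitely_presented \<Gamma>"
    and scal: "\<And>I. \<lbrakk>I \<subseteq> {..<n}; card I \<ge> 2; a ` I \<noteq> {0}; stratum sc n e I \<inter> X \<noteq> {}; card (a ` I) > 1\<rbrakk>
           \<Longrightarrow> circle_invariant sc (X \<inter> stratum sc n e I)"
    and weig: "\<And>I. \<lbrakk>I \<subseteq> {..<n}; card I \<ge> 2; a ` I \<noteq> {0}; stratum sc n e I \<inter> X \<noteq> {}; is_singleton (a ` I)\<rbrakk>
           \<Longrightarrow> \<exists>\<epsilon> :: nat \<Rightarrow> int. \<epsilon> ` I = {1, - 1} \<and>
                 circle_invariant (weighted_act sc n e I \<epsilon>) (X \<inter> stratum sc n e I)"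
  shows "chi_Gamma S \<Gamma> circle_group circle_chart \<rho> (vector_chart sc n e) X =
           chi_Hom S \<Gamma> circle_group circle_chart
             * chi S (vector_chart sc n e) (X \<inter> fixed_points \<rho>)
           + (\<Sum>i\<in>{i \<in> {..<n}. a i \<noteq> 0}.
                chi_orbits S (vector_chart sc n e) (X \<inter> stratum sc n e {i}) circle_group \<rho>
                * chi_Hom S \<Gamma> (integer_mod_group (nat \<bar>a i\<bar>)) (cyclic_chart (nat \<bar>a i\<bar>)))"
proof -
  define t where "t I = euler_char S (2 * (n * n)) (Inv n a ` BI I) * chi_Hom S \<Gamma> (circ (isoN I)) circle_chart" for I
  let ?F = "{I. I \<subseteq> {..<n} \<and> a ` I \<subseteq> {0}}"
  let ?E = "{i \<in> {..<n}. a i \<noteq> 0}"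
  have zero: "t I = 0" if I: "I \<in> Pow {..<n} - ?F" "I \<notin> (\<lambda>i. {i}) ` ?E" for I
  proof -
    have I1: "I \<subseteq> {..<n}" "\<not> a ` I \<subseteq> {0}" using I(1) by auto
    have fI: "finite I" using I1(1) finite_subset by blast
    have "card I \<ge> 2"
    proof (rule ccontr)
      assume "\<not> card I \<ge> 2"
      moreover have "card I \<noteq> 0" using I1(2) fI by auto
      ultimately have "card I = 1" by linarith
      then obtain i where "I = {i}" by (rule card_1_singletonE)
      then show False using I(2) I1 by auto
    qed
    moreover have "a ` I \<noteq> {0}" using I1(2) by auto
    ultimately have c: "I \<subseteq> {..<n}" "card I \<ge> 2" "a ` I \<noteq> {0}" using I1(1) by auto
    have "euler_char S (2 * (n * n)) (Inv n a ` BI I) = 0"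
    proof (cases "stratum sc n e I \<inter> X = {}")
      case True
      then have "BI I = {}" unfolding BI_stratum[OF c(1)] by blast
      then show ?thesis by (simp add: euler_char_empty)
    next
      case ne: False
      show ?thesis
      proof (cases "card (a ` I) > 1")
        case True
        have "\<exists>i\<in>I. \<exists>j\<in>I. a i \<noteq> a j"
        proof (rule ccontr)
          assume "\<not> ?thesis"
          then have "a ` I \<subseteq> {a (SOME i. i \<in> I)}" using someI[of "\<lambda>i. i \<in> I"] by blast
          from card_mono[OF _ this] True show False by simp
        qed
        then obtain i j where ij: "i \<in> I" "j \<in> I" "a i \<noteq> a j" by blast
        have ci: "circle_invariant sc (X \<inter> stratum sc n e I)" by (rule scal[OF c ne True])
        \<comment> \<open>Scalar multiplication has all weights equal to 1, and the determinant
          required by \<open>BI_zero\<close> is \<open>a j - a i\<close>.\<close>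
        show ?thesis
        proof (rule BI_zero[OF c(1) ij(1,2), where b = "\<lambda>_. 1"])
          fix w z assume w: "cmod w = 1" and "z \<in> BI I"
          then obtain x where x: "x \<in> X \<inter> stratum sc n e I" "z = \<iota> x" unfolding BI_stratum[OF c(1)] by blast
          have "sc w x \<in> X \<inter> stratum sc n e I" using ci w x(1) by (simp add: circle_invariant_def)
          then show "act n (\<lambda>_. 1) w z \<in> BI I" unfolding BI_stratum[OF c(1)] x(2) \<iota>_scale[THEN HOL.sym] by (rule imageI)
        qed (use ij(3) in simp)
      next
        case False
        have "I \<noteq> {}" using I1(2) by blast
        then have "card (a ` I) \<noteq> 0" using fI by simp
        then have "card (a ` I) = 1" using False by linarith
        then have sing: "is_singleton (a ` I)" by (simp add: is_singleton_altdef)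
        obtain \<epsilon> :: "nat \<Rightarrow> int" where eps: "\<epsilon> ` I = {1, - 1}"
          "circle_invariant (weighted_act sc n e I \<epsilon>) (X \<inter> stratum sc n e I)" using weig[OF c ne sing] by blast
        obtain i j where ij: "i \<in> I" "\<epsilon> i = 1" "j \<in> I" "\<epsilon> j = - 1" using eps(1) by (metis imageE insertCI)
        obtain \<alpha> where \<alpha>: "a ` I = {\<alpha>}" using sing by (auto simp: is_singleton_def)
        have a: "a i = \<alpha>" "a j = \<alpha>" "\<alpha> \<noteq> 0" using \<alpha> ij c(3) by auto
        \<comment> \<open>On \<open>I\<close> the weights \<open>a\<close> have the common value
          \<open>\<alpha>\<close>; opposite signs at \<open>i\<close> and \<open>j\<close> make the
          determinant \<open>2 * \<alpha>\<close>, which is nonzero.\<close>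
        show ?thesis
        proof (rule BI_zero[OF c(1) ij(1,3), where b = \<epsilon>])
          fix w z assume w: "cmod w = 1" and "z \<in> BI I"
          then obtain x where x: "x \<in> X \<inter> stratum sc n e I" "z = \<iota> x" unfolding BI_stratum[OF c(1)] by blast
          have "weighted_act sc n e I \<epsilon> w x \<in> X \<inter> stratum sc n e I" using eps(2) w x(1) by (simp add: circle_invariant_def)
          moreover have "act n \<epsilon> w z = \<iota> (weighted_act sc n e I \<epsilon> w x)" using \<iota>_weighted[OF c(1)] x by simp
          ultimately show "act n \<epsilon> w z \<in> BI I" unfolding BI_stratum[OF c(1)] by simp
        qed (use ij a in simp)
      qed
    qed
    then show ?thesis by (simp add: t_def)
  qed
  have "chi_Gamma S \<Gamma> circle_group circle_chart \<rho> (vector_chart sc n e) X = sum t (Pow {..<n})"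
    unfolding t_def by (rule chi_Gamma_eq[OF \<Gamma>])
  also have "\<dots> = sum t (Pow {..<n} - ?F) + sum t ?F" by (rule sum.subset_diff) auto
  also have "sum t (Pow {..<n} - ?F) = sum t ((\<lambda>i. {i}) ` ?E)"
    by (rule sum.mono_neutral_right) (use zero in auto)
  also have "\<dots> = (\<Sum>i\<in>?E. t {i})" by (subst sum.reindex) (auto simp: inj_on_def)
  also have "\<dots> = (\<Sum>i\<in>?E. chi_orbits S (vector_chart sc n e) (X \<inter> stratum sc n e {i}) circle_group \<rho>
                * chi_Hom S \<Gamma> (integer_mod_group (nat \<bar>a i\<bar>)) (cyclic_chart (nat \<bar>a i\<bar>)))"
  proof (rule sum.cong[OF HOL.refl])
    fix i assume i: "i \<in> ?E"
    have N: "isoN {i} = nat \<bar>a i\<bar>" by (simp add: isoN_def)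
    have "nat \<bar>a i\<bar> > 0" using i by simp
    from chi_Hom_cyclic[OF this \<Gamma>(1)]
    show "t {i} = chi_orbits S (vector_chart sc n e) (X \<inter> stratum sc n e {i}) circle_group \<rho>
                * chi_Hom S \<Gamma> (integer_mod_group (nat \<bar>a i\<bar>)) (cyclic_chart (nat \<bar>a i\<bar>))"
      unfolding t_def N using chi_orbits_stratum[of "{i}"] i by simp
  qed
  also have "sum t ?F = (\<Sum>I\<in>?F. euler_char S (2 * (n * n)) (Inv n a ` BI I) * chi_Hom S \<Gamma> (circ 0) circle_chart)"
  proof (rule sum.cong[OF HOL.refl])
    fix I assume "I \<in> ?F"
    \<comment> \<open>The order code is 0 for all these supports, so the factor for the whole circle
      is common to the terms.\<close>
    then have "Gcd (a ` I) = 0" by (simp add: Gcd_0_iff)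
    then show "t I = euler_char S (2 * (n * n)) (Inv n a ` BI I) * chi_Hom S \<Gamma> (circ 0) circle_chart"
      by (simp only: t_def isoN_def nat_0)
  qed
  also have "\<dots> = chi S (vector_chart sc n e) (X \<inter> fixed_points \<rho>) * chi_Hom S \<Gamma> circle_group circle_chart"
    unfolding sum_distrib_right[THEN HOL.sym] fixed_sum circ_0 ..
  finally show ?thesis by (simp add: mult.commute)
qed

end

theorem corollary4p6:
  fixes S :: "nat \<Rightarrow> (nat \<Rightarrow> real) set set"
    and sc :: "complex \<Rightarrow> 'v::ab_group_add \<Rightarrow> 'v"
    and herm :: "'v \<Rightarrow> 'v \<Rightarrow> complex"
    and \<rho> :: "complex \<Rightarrow> 'v \<Rightarrow> 'v"
    and n :: nat
    and e :: "nat \<Rightarrow> 'v"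
    and a :: "nat \<Rightarrow> int"
    and \<Gamma> :: "('g, 'b) monoid_scheme"
    and X :: "'v set"
  assumes "o_minimal_structure S"
    and "unitary_circle_rep sc herm \<rho>"
    and "weight_basis sc \<rho> n e a"
    and "group \<Gamma>" and "finitely_presented \<Gamma>"
    and "definable S (vector_chart sc n e) X"
    and "circle_invariant \<rho> X"
    and "\<And>I. \<lbrakk>I \<subseteq> {..<n}; card I \<ge> 2; a ` I \<noteq> {0}; stratum sc n e I \<inter> X \<noteq> {}; card (a ` I) > 1\<rbrakk>
           \<Longrightarrow> circle_invariant sc (X \<inter> stratum sc n e I)"
    and "\<And>I. \<lbrakk>I \<subseteq> {..<n}; card I \<ge> 2; a ` I \<noteq> {0}; stratum sc n e I \<inter> X \<noteq> {}; is_singleton (a ` I)\<rbrakk>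
           \<Longrightarrow> \<exists>\<epsilon> :: nat \<Rightarrow> int. \<epsilon> ` I = {1, - 1} \<and>
                 circle_invariant (weighted_act sc n e I \<epsilon>) (X \<inter> stratum sc n e I)"
  shows "chi_Gamma S \<Gamma> circle_group circle_chart \<rho> (vector_chart sc n e) X =
           chi_Hom S \<Gamma> circle_group circle_chart
             * chi S (vector_chart sc n e) (X \<inter> fixed_points \<rho>)
           + (\<Sum>i\<in>{i \<in> {..<n}. a i \<noteq> 0}.
                chi_orbits S (vector_chart sc n e) (X \<inter> stratum sc n e {i}) circle_group \<rho>
                * chi_Hom S \<Gamma> (integer_mod_group (nat \<bar>a i\<bar>)) (cyclic_chart (nat \<bar>a i\<bar>)))"
proof -
  interpret definable_circle_space S sc herm \<rho> n e a X
    using assms(1,2,3,6,7) by (simp add: definable_circle_space_def definable_circle_space_axioms_def)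
  show ?thesis
    by (rule chi_Gamma_formula[OF assms(4,5)]) ((rule assms(8); assumption), (rule assms(9); assumption))
qed

end
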